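(* Let $\mathscr{T}$ and $\mathscr{S}$ be rigidly-compactly generated tt-categories and let $f^*:\mathscr{T}\to\mathscr{S}$ be a faithful geometric functor. Then the induced map $\varphi=\mathrm{Spc}(f^* ):\mathrm{Spc}(\mathscr{S}^c)\to\mathrm{Spc}(\mathscr{T}^c)$ is a strong spectral quotient map.
   Context: A tt-category is a triangulated category with a compatible (closed) symmetric monoidal structure $(\otimes,\mathbb{1})$. It is rigidly-compactly generated if it has all small coproducts, is compactly generated as a triangulated category, and its compact objects coincide with its dualizable objects. $\mathscr{T}^c$ denotes the subcategory of compact objects. A geometric functor is a coproduct-preserving tensor-triangulated functor between rigidly-compactly generated tt-categories; it restricts to a tt-functor $\mathscr{T}^c\to\mathscr{S}^c$ and hence induces a spectral map $\mathrm{Spc}(\mathscr{S}^c)\to\mathrm{Spc}(\mathscr{T}^c)$, $\mathscr{Q}\mapsto (f^* )^{-1}(\mathscr{Q})\cap\mathscr{T}^c$, on Balmer spectra. Here $\mathrm{Spc}(\mathscr{K})$ is the spectral space of prime thick tensor-ideals of $\mathscr{K}$ with basis of closed sets $\mathrm{supp}(a)=\{\mathscr{P}: a\notin\mathscr{P}\}$, $a\in\mathscr{K}$. A surjective spectral map $\varphi:X\to Y$ of spectral spaces is a spectral quotient map if a subset $C\subseteq Y$ is quasi-compact open whenever $\varphi^{-1}(C)$ is quasi-compact open. A Thomason subset of a spectral space is a union of closed subsets each of which has quasi-compact complement; the complement of a Thomason subset is a spectral space in the subspace topology. A spectral map $\varphi:X\to Y$ is a strong spectral quotient map if the corestriction $\varphi^{-1}(U)\to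 U$ is a spectral quotient map for every $U\subseteq Y$ which is the complement of a Thomason subset. *)

theory Defs
  imports "HOL-Analysis.Abstract_Topological_Spaces" "HOL-Algebra.Free_Abelian_Groups"
begin

section \<open>Size\<close>

text \<open>
  "Set" versus "class" is expressed relative to a universe \<open>U\<close>: a set of any type counts as small
  if its cardinality is strictly below that of \<open>U\<close>.  The conditions on \<open>U\<close> say that \<open>|U|\<close> is an
  uncountable strongly inaccessible cardinal, i.e. that the usual operations of set theory preserve
  smallness.  Every small set is in bijection with a subset of \<open>U\<close>, so small families may be
  indexed by subsets of \<open>U\<close>.
\<close>

definition small :: "'u set \<Rightarrow> 'a set \<Rightarrow> bool" where
  "small U A \<longleftrightarrow> |A| <o |U|"

definition universe :: "'u set \<Rightarrow> bool" where
  "universe U \<longleftrightarrow>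
     small U (UNIV :: nat set) \<and>
     (\<forall>A \<subseteq> U. small U A \<longrightarrow> small U (Pow A)) \<and>
     (\<forall>I A. I \<subseteq> U \<and> small U I \<and> (\<forall>i\<in>I. A i \<subseteq> U \<and> small U (A i)) \<longrightarrow> small U (\<Union>i\<in>I. A i))"

section \<open>Categories\<close>

record ('o, 'm) cat =
  Obj :: "'o set"
  Arr :: "'m set"
  Dom :: "'m \<Rightarrow> 'o"
  Cod :: "'m \<Rightarrow> 'o"
  Idt :: "'o \<Rightarrow> 'm"
  Cmp :: "'m \<Rightarrow> 'm \<Rightarrow> 'm"  (infixl \<open>\<cdot>\<index>\<close> 70)

definition Hom :: "('o, 'm, 'x) cat_scheme \<Rightarrow> 'o \<Rightarrow> 'o \<Rightarrow> 'm set" where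
  "Hom C a b = {f \<in> Arr C. Dom C f = a \<and> Cod C f = b}"

locale category =
  fixes C :: "('o, 'm, 'x) cat_scheme" (structure)
  assumes Dom_Obj: "f \<in> Arr C \<Longrightarrow> Dom C f \<in> Obj C"
    and Cod_Obj: "f \<in> Arr C \<Longrightarrow> Cod C f \<in> Obj C"
    and Idt_Hom: "a \<in> Obj C \<Longrightarrow> Idt C a \<in> Hom C a a"
    and Cmp_Hom: "\<lbrakk>f \<in> Hom C a b; g \<in> Hom C b c\<rbrakk> \<Longrightarrow> g \<cdot> f \<in> Hom C a c"
    and Idt_left: "f \<in> Hom C a b \<Longrightarrow> Idt C b \<cdot> f = f"
    and Idt_right: "f \<in> Hom C a b \<Longrightarrow> f \<cdot> Idt C a = f"
    and Cmp_assoc: "\<lbrakk>f \<in> Hom C a b; g \<in> Hom C b c; h \<in> Hom C c d\<rbrakk> \<Longrightarrow> (h \<cdot> g) \<cdot> f = h \<cdot> (g \<cdot> f)"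

definition inverse_arrows :: "('o, 'm, 'x) cat_scheme \<Rightarrow> 'm \<Rightarrow> 'm \<Rightarrow> bool" where
  "inverse_arrows C f g \<longleftrightarrow> f \<in> Arr C \<and> g \<in> Hom C (Cod C f) (Dom C f) \<and>
     g \<cdot>\<^bsub>C\<^esub> f = Idt C (Dom C f) \<and> f \<cdot>\<^bsub>C\<^esub> g = Idt C (Cod C f)"

definition is_iso :: "('o, 'm, 'x) cat_scheme \<Rightarrow> 'm \<Rightarrow> bool" where
  "is_iso C f \<longleftrightarrow> (\<exists>g. inverse_arrows C f g)"

definition inv_arr :: "('o, 'm, 'x) cat_scheme \<Rightarrow> 'm \<Rightarrow> 'm" where
  "inv_arr C f = (THE g. inverse_arrows C f g)"

definition zero_object :: "('o, 'm, 'x) cat_scheme \<Rightarrow> 'o \<Rightarrow> bool" where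
  "zero_object C z \<longleftrightarrow> z \<in> Obj C \<and>
     (\<forall>a\<in>Obj C. (\<exists>!f. f \<in> Hom C a z) \<and> (\<exists>!f. f \<in> Hom C z a))"

definition is_coproduct ::
  "('o, 'm, 'x) cat_scheme \<Rightarrow> 'i set \<Rightarrow> ('i \<Rightarrow> 'o) \<Rightarrow> 'o \<Rightarrow> ('i \<Rightarrow> 'm) \<Rightarrow> bool" where
  "is_coproduct C I x X inc \<longleftrightarrow>
     X \<in> Obj C \<and> (\<forall>i\<in>I. x i \<in> Obj C \<and> inc i \<in> Hom C (x i) X) \<and>
     (\<forall>Y\<in>Obj C. \<forall>f. (\<forall>i\<in>I. f i \<in> Hom C (x i) Y) \<longrightarrow>
        (\<exists>!h. h \<in> Hom C X Y \<and> (\<forall>i\<in>I. h \<cdot>\<^bsub>C\<^esub> inc i = f i)))"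

definition is_direct_sum :: "('o, 'm, 'x) cat_scheme \<Rightarrow> 'o \<Rightarrow> 'o \<Rightarrow> 'o \<Rightarrow> bool" where
  "is_direct_sum C a b X \<longleftrightarrow>
     (\<exists>inc. is_coproduct C (UNIV :: bool set) (\<lambda>i. if i then a else b) X inc)"

definition has_small_coproducts :: "'u set \<Rightarrow> ('o, 'm, 'x) cat_scheme \<Rightarrow> bool" where
  "has_small_coproducts U C \<longleftrightarrow>
     (\<forall>I x. I \<subseteq> U \<and> small U I \<and> (\<forall>i\<in>I. x i \<in> Obj C) \<longrightarrow> (\<exists>X inc. is_coproduct C I x X inc))"

section \<open>Additive and triangulated categories\<close>

record ('o, 'm) addcat = "('o, 'm) cat" +
  Add :: "'m \<Rightarrow> 'm \<Rightarrow> 'm"  (infixl \<open>\<boxplus>\<index>\<close> 65)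
  Zer :: "'o \<Rightarrow> 'o \<Rightarrow> 'm"

text \<open>The groups of \<open>HOL-Algebra\<close> are written multiplicatively.\<close>

definition hom_group :: "('o, 'm, 'x) addcat_scheme \<Rightarrow> 'o \<Rightarrow> 'o \<Rightarrow> 'm monoid" where
  "hom_group C a b = \<lparr>carrier = Hom C a b, monoid.mult = Add C, one = Zer C a b\<rparr>"

definition Neg :: "('o, 'm, 'x) addcat_scheme \<Rightarrow> 'm \<Rightarrow> 'm" where
  "Neg C f = m_inv (hom_group C (Dom C f) (Cod C f)) f"

locale additive_category = category C
  for C :: "('o, 'm, 'x) addcat_scheme" (structure) +
  assumes hom_comm_group: "\<lbrakk>a \<in> Obj C; b \<in> Obj C\<rbrakk> \<Longrightarrow> comm_group (hom_group C a b)"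
    and Cmp_Add_left: "\<lbrakk>f \<in> Hom C a b; g \<in> Hom C b c; g' \<in> Hom C b c\<rbrakk>
                        \<Longrightarrow> (g \<boxplus> g') \<cdot> f = (g \<cdot> f) \<boxplus> (g' \<cdot> f)"
    and Cmp_Add_right: "\<lbrakk>f \<in> Hom C a b; f' \<in> Hom C a b; g \<in> Hom C b c\<rbrakk>
                        \<Longrightarrow> g \<cdot> (f \<boxplus> f') = (g \<cdot> f) \<boxplus> (g \<cdot> f')"
    and ex_zero_object: "\<exists>z. zero_object C z"
    and ex_direct_sum: "\<lbrakk>a \<in> Obj C; b \<in> Obj C\<rbrakk> \<Longrightarrow> \<exists>X. is_direct_sum C a b X"

text \<open>
  \<open>Sh\<close> and \<open>Shm\<close> are the suspension on objects and on arrows.  A triple \<open>(f, g, h) \<in> Tri\<close> stands for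
  the distinguished triangle with \<open>f : a \<rightarrow> b\<close>, \<open>g : b \<rightarrow> c\<close>, \<open>h : c \<rightarrow> Sh a\<close>; the objects are
  recovered as \<open>a = Dom f\<close>, \<open>b = Dom g\<close>, \<open>c = Dom h\<close>.
\<close>

record ('o, 'm) tricat = "('o, 'm) addcat" +
  Sh :: "'o \<Rightarrow> 'o"
  Shm :: "'m \<Rightarrow> 'm"
  Tri :: "('m \<times> 'm \<times> 'm) set"

definition candidate :: "('o, 'm, 'x) tricat_scheme \<Rightarrow> 'm \<Rightarrow> 'm \<Rightarrow> 'm \<Rightarrow> bool" where
  "candidate C f g h \<longleftrightarrow>
     f \<in> Hom C (Dom C f) (Dom C g) \<and> g \<in> Hom C (Dom C g) (Dom C h) \<and>
     h \<in> Hom C (Dom C h) (Sh C (Dom C f))"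

text \<open>The suspension is only required to be an equivalence, not an automorphism.\<close>

locale triangulated_category = additive_category C
  for C :: "('o, 'm, 'x) tricat_scheme" (structure) +
  assumes Sh_Obj: "a \<in> Obj C \<Longrightarrow> Sh C a \<in> Obj C"
    and Shm_Hom: "f \<in> Hom C a b \<Longrightarrow> Shm C f \<in> Hom C (Sh C a) (Sh C b)"
    and Shm_Idt: "a \<in> Obj C \<Longrightarrow> Shm C (Idt C a) = Idt C (Sh C a)"
    and Shm_Cmp: "\<lbrakk>f \<in> Hom C a b; g \<in> Hom C b c\<rbrakk> \<Longrightarrow> Shm C (g \<cdot> f) = Shm C g \<cdot> Shm C f"
    and Shm_Add: "\<lbrakk>f \<in> Hom C a b; g \<in> Hom C a b\<rbrakk> \<Longrightarrow> Shm C (f \<boxplus> g) = Shm C f \<boxplus> Shm C g"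
    and Shm_fully_faithful: "\<lbrakk>a \<in> Obj C; b \<in> Obj C\<rbrakk>
          \<Longrightarrow> bij_betw (Shm C) (Hom C a b) (Hom C (Sh C a) (Sh C b))"
    and Sh_ess_surj: "b \<in> Obj C \<Longrightarrow> \<exists>a\<in>Obj C. \<exists>f\<in>Hom C (Sh C a) b. is_iso C f"
    and Tri_candidate: "(f, g, h) \<in> Tri C \<Longrightarrow> candidate C f g h"
    and Tri_iso: "\<lbrakk>(f, g, h) \<in> Tri C; candidate C f' g' h';
          u \<in> Hom C (Dom C f) (Dom C f'); v \<in> Hom C (Dom C g) (Dom C g');
          w \<in> Hom C (Dom C h) (Dom C h'); is_iso C u; is_iso C v; is_iso C w;
          v \<cdot> f = f' \<cdot> u; w \<cdot> g = g' \<cdot> v; Shm C u \<cdot> h = h' \<cdot> w\<rbrakk> \<Longrightarrow> (f', g', h') \<in> Tri C"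
    and TR1_Idt: "\<lbrakk>a \<in> Obj C; zero_object C z\<rbrakk> \<Longrightarrow> (Idt C a, Zer C a z, Zer C z (Sh C a)) \<in> Tri C"
    and TR1_cone: "f \<in> Arr C \<Longrightarrow> \<exists>g h. (f, g, h) \<in> Tri C"
    and TR2: "candidate C f g h \<Longrightarrow> (f, g, h) \<in> Tri C \<longleftrightarrow> (g, h, Neg C (Shm C f)) \<in> Tri C"
    and TR3: "\<lbrakk>(f, g, h) \<in> Tri C; (f', g', h') \<in> Tri C;
          u \<in> Hom C (Dom C f) (Dom C f'); v \<in> Hom C (Dom C g) (Dom C g'); v \<cdot> f = f' \<cdot> u\<rbrakk>
          \<Longrightarrow> \<exists>w \<in> Hom C (Dom C h) (Dom C h'). w \<cdot> g = g' \<cdot> v \<and> Shm C u \<cdot> h = h' \<cdot> w"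
    and TR4: "\<lbrakk>f \<in> Hom C a b; g \<in> Hom C b c;
          (f, p1, d1) \<in> Tri C; (g \<cdot> f, p2, d2) \<in> Tri C; (g, p3, d3) \<in> Tri C\<rbrakk>
          \<Longrightarrow> \<exists>u v. (u, v, Shm C p1 \<cdot> d3) \<in> Tri C \<and>
                u \<in> Hom C (Dom C d1) (Dom C d2) \<and> v \<in> Hom C (Dom C d2) (Dom C d3) \<and>
                u \<cdot> p1 = p2 \<cdot> g \<and> d2 \<cdot> u = d1 \<and> v \<cdot> p2 = p3 \<and> d3 \<cdot> v = Shm C f \<cdot> d2"

section \<open>Tensor-triangulated categories\<close>

text \<open>
  Associator \<open>Asc x y z : (x \<boxtimes> y) \<boxtimes> z \<rightarrow> x \<boxtimes> (y \<boxtimes> z)\<close>, unitors \<open>Lun x : Unt \<boxtimes> x \<rightarrow> x\<close> and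
  \<open>Run x : x \<boxtimes> Unt \<rightarrow> x\<close>, symmetry \<open>Sym x y : x \<boxtimes> y \<rightarrow> y \<boxtimes> x\<close>, and the comparison
  \<open>Ssp x y : Sh x \<boxtimes> y \<rightarrow> Sh (x \<boxtimes> y)\<close> of the tensor product with the suspension.
\<close>

record ('o, 'm) ttcat = "('o, 'm) tricat" +
  Ten :: "'o \<Rightarrow> 'o \<Rightarrow> 'o"  (infixl \<open>\<boxtimes>\<index>\<close> 75)
  Tenm :: "'m \<Rightarrow> 'm \<Rightarrow> 'm"  (infixl \<open>\<boxdot>\<index>\<close> 75)
  Unt :: "'o"
  Asc :: "'o \<Rightarrow> 'o \<Rightarrow> 'o \<Rightarrow> 'm"
  Lun :: "'o \<Rightarrow> 'm"
  Run :: "'o \<Rightarrow> 'm"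
  Sym :: "'o \<Rightarrow> 'o \<Rightarrow> 'm"
  Ssp :: "'o \<Rightarrow> 'o \<Rightarrow> 'm"

locale symmetric_monoidal_category = category C
  for C :: "('o, 'm, 'x) ttcat_scheme" (structure) +
  assumes Unt_Obj: "Unt C \<in> Obj C"
    and Ten_Obj: "\<lbrakk>x \<in> Obj C; y \<in> Obj C\<rbrakk> \<Longrightarrow> x \<boxtimes> y \<in> Obj C"
    and Tenm_Hom: "\<lbrakk>f \<in> Hom C a b; g \<in> Hom C c d\<rbrakk> \<Longrightarrow> f \<boxdot> g \<in> Hom C (a \<boxtimes> c) (b \<boxtimes> d)"
    and Tenm_Idt: "\<lbrakk>x \<in> Obj C; y \<in> Obj C\<rbrakk> \<Longrightarrow> Idt C x \<boxdot> Idt C y = Idt C (x \<boxtimes> y)"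
    and Tenm_Cmp: "\<lbrakk>f \<in> Hom C a b; f' \<in> Hom C b c; g \<in> Hom C a' b'; g' \<in> Hom C b' c'\<rbrakk>
                    \<Longrightarrow> (f' \<cdot> f) \<boxdot> (g' \<cdot> g) = (f' \<boxdot> g') \<cdot> (f \<boxdot> g)"
    and Asc_Hom: "\<lbrakk>x \<in> Obj C; y \<in> Obj C; z \<in> Obj C\<rbrakk>
                    \<Longrightarrow> Asc C x y z \<in> Hom C ((x \<boxtimes> y) \<boxtimes> z) (x \<boxtimes> (y \<boxtimes> z))"
    and Asc_iso: "\<lbrakk>x \<in> Obj C; y \<in> Obj C; z \<in> Obj C\<rbrakk> \<Longrightarrow> is_iso C (Asc C x y z)"
    and Asc_natural: "\<lbrakk>f \<in> Hom C x x'; g \<in> Hom C y y'; h \<in> Hom C z z'\<rbrakk>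
                    \<Longrightarrow> Asc C x' y' z' \<cdot> ((f \<boxdot> g) \<boxdot> h) = (f \<boxdot> (g \<boxdot> h)) \<cdot> Asc C x y z"
    and Lun_Hom: "x \<in> Obj C \<Longrightarrow> Lun C x \<in> Hom C (Unt C \<boxtimes> x) x"
    and Lun_iso: "x \<in> Obj C \<Longrightarrow> is_iso C (Lun C x)"
    and Lun_natural: "f \<in> Hom C x y \<Longrightarrow> Lun C y \<cdot> (Idt C (Unt C) \<boxdot> f) = f \<cdot> Lun C x"
    and Run_Hom: "x \<in> Obj C \<Longrightarrow> Run C x \<in> Hom C (x \<boxtimes> Unt C) x"
    and Run_iso: "x \<in> Obj C \<Longrightarrow> is_iso C (Run C x)"
    and Run_natural: "f \<in> Hom C x y \<Longrightarrow> Run C y \<cdot> (f \<boxdot> Idt C (Unt C)) = f \<cdot> Run C x"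
    and Sym_Hom: "\<lbrakk>x \<in> Obj C; y \<in> Obj C\<rbrakk> \<Longrightarrow> Sym C x y \<in> Hom C (x \<boxtimes> y) (y \<boxtimes> x)"
    and Sym_natural: "\<lbrakk>f \<in> Hom C x x'; g \<in> Hom C y y'\<rbrakk>
                    \<Longrightarrow> Sym C x' y' \<cdot> (f \<boxdot> g) = (g \<boxdot> f) \<cdot> Sym C x y"
    and Sym_Sym: "\<lbrakk>x \<in> Obj C; y \<in> Obj C\<rbrakk> \<Longrightarrow> Sym C y x \<cdot> Sym C x y = Idt C (x \<boxtimes> y)"
    and pentagon: "\<lbrakk>w \<in> Obj C; x \<in> Obj C; y \<in> Obj C; z \<in> Obj C\<rbrakk>
                    \<Longrightarrow> Asc C w x (y \<boxtimes> z) \<cdot> Asc C (w \<boxtimes> x) y z =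
                        (Idt C w \<boxdot> Asc C x y z) \<cdot> Asc C w (x \<boxtimes> y) z \<cdot> (Asc C w x y \<boxdot> Idt C z)"
    and triangle: "\<lbrakk>x \<in> Obj C; y \<in> Obj C\<rbrakk>
                    \<Longrightarrow> (Idt C x \<boxdot> Lun C y) \<cdot> Asc C x (Unt C) y = Run C x \<boxdot> Idt C y"
    and hexagon: "\<lbrakk>x \<in> Obj C; y \<in> Obj C; z \<in> Obj C\<rbrakk>
                    \<Longrightarrow> Asc C y z x \<cdot> Sym C x (y \<boxtimes> z) \<cdot> Asc C x y z =
                        (Idt C y \<boxdot> Sym C x z) \<cdot> Asc C y x z \<cdot> (Sym C x y \<boxdot> Idt C z)"

text \<open>
  Closedness is stated through universal arrows: \<open>h\<close> with \<open>ev : h \<boxtimes> x \<rightarrow> y\<close> is the internal hom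
  from \<open>x\<close> to \<open>y\<close>.
\<close>

locale closed_symmetric_monoidal_category = symmetric_monoidal_category +
  assumes closed: "\<lbrakk>x \<in> Obj C; y \<in> Obj C\<rbrakk>
      \<Longrightarrow> \<exists>h\<in>Obj C. \<exists>ev\<in>Hom C (h \<boxtimes> x) y.
            \<forall>w\<in>Obj C. \<forall>f\<in>Hom C (w \<boxtimes> x) y. \<exists>!g. g \<in> Hom C w h \<and> ev \<cdot> (g \<boxdot> Idt C x) = f"

text \<open>
  Compatibility of the tensor product with the triangulation: \<open>- \<boxtimes> w\<close> is exact (by symmetry, so
  is \<open>w \<boxtimes> -\<close>), the comparison with the suspension is coherent, and the symmetry on
  \<open>Sh Unt \<boxtimes> Sh Unt\<close> is the graded-commutativity sign.
\<close>

locale tt_category =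
  triangulated_category C + closed_symmetric_monoidal_category C
  for C :: "('o, 'm, 'x) ttcat_scheme" (structure) +
  assumes Tenm_Add: "\<lbrakk>f \<in> Hom C a b; f' \<in> Hom C a b; g \<in> Hom C c d\<rbrakk>
                    \<Longrightarrow> (f \<boxplus> f') \<boxdot> g = (f \<boxdot> g) \<boxplus> (f' \<boxdot> g)"
    and Ssp_Hom: "\<lbrakk>x \<in> Obj C; y \<in> Obj C\<rbrakk> \<Longrightarrow> Ssp C x y \<in> Hom C (Sh C x \<boxtimes> y) (Sh C (x \<boxtimes> y))"
    and Ssp_iso: "\<lbrakk>x \<in> Obj C; y \<in> Obj C\<rbrakk> \<Longrightarrow> is_iso C (Ssp C x y)"
    and Ssp_natural: "\<lbrakk>f \<in> Hom C x x'; g \<in> Hom C y y'\<rbrakk>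
                    \<Longrightarrow> Ssp C x' y' \<cdot> (Shm C f \<boxdot> g) = Shm C (f \<boxdot> g) \<cdot> Ssp C x y"
    and Ssp_Run: "x \<in> Obj C \<Longrightarrow> Shm C (Run C x) \<cdot> Ssp C x (Unt C) = Run C (Sh C x)"
    and Ssp_Asc: "\<lbrakk>x \<in> Obj C; y \<in> Obj C; z \<in> Obj C\<rbrakk>
                    \<Longrightarrow> Ssp C x (y \<boxtimes> z) \<cdot> Asc C (Sh C x) y z =
                        Shm C (Asc C x y z) \<cdot> Ssp C (x \<boxtimes> y) z \<cdot> (Ssp C x y \<boxdot> Idt C z)"
    and Ten_exact: "\<lbrakk>(f, g, h) \<in> Tri C; w \<in> Obj C\<rbrakk>
                    \<Longrightarrow> (f \<boxdot> Idt C w, g \<boxdot> Idt C w, Ssp C (Dom C f) w \<cdot> (h \<boxdot> Idt C w)) \<in> Tri C"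
    and Sym_sign: "Sym C (Sh C (Unt C)) (Sh C (Unt C)) = Neg C (Idt C (Sh C (Unt C) \<boxtimes> Sh C (Unt C)))"

definition dualizable :: "('o, 'm, 'x) ttcat_scheme \<Rightarrow> 'o \<Rightarrow> bool" where
  "dualizable C x \<longleftrightarrow> x \<in> Obj C \<and>
     (\<exists>y\<in>Obj C. \<exists>coev\<in>Hom C (Unt C) (x \<boxtimes>\<^bsub>C\<^esub> y). \<exists>ev\<in>Hom C (y \<boxtimes>\<^bsub>C\<^esub> x) (Unt C).
        Run C x \<cdot>\<^bsub>C\<^esub> (Idt C x \<boxdot>\<^bsub>C\<^esub> ev) \<cdot>\<^bsub>C\<^esub> Asc C x y x \<cdot>\<^bsub>C\<^esub> (coev \<boxdot>\<^bsub>C\<^esub> Idt C x) = Lun C x \<and>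
        Lun C y \<cdot>\<^bsub>C\<^esub> (ev \<boxdot>\<^bsub>C\<^esub> Idt C y) \<cdot>\<^bsub>C\<^esub> inv_arr C (Asc C y x y) \<cdot>\<^bsub>C\<^esub> (Idt C y \<boxdot>\<^bsub>C\<^esub> coev) = Run C y)"

text \<open>
  \<open>c\<close> is compact if the canonical map from the direct sum of the groups \<open>Hom c (x i)\<close> to
  \<open>Hom c X\<close>, with \<open>X\<close> a coproduct of the \<open>x i\<close>, is an isomorphism; \<open>gfinprod\<close> is the
  (additive) sum of a finitely supported family.
\<close>

definition compact_object :: "'u set \<Rightarrow> ('o, 'm, 'x) addcat_scheme \<Rightarrow> 'o \<Rightarrow> bool" where
  "compact_object U C c \<longleftrightarrow> c \<in> Obj C \<and>
     (\<forall>I x X inc. I \<subseteq> U \<and> small U I \<and> is_coproduct C I x X inc \<longrightarrow>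
        (\<lambda>u. gfinprod (hom_group C c X) (\<lambda>i. inc i \<cdot>\<^bsub>C\<^esub> u i) I)
          \<in> iso (sum_group I (\<lambda>i. hom_group C c (x i))) (hom_group C c X))"

definition compacts :: "'u set \<Rightarrow> ('o, 'm, 'x) addcat_scheme \<Rightarrow> 'o set" where
  "compacts U C = {c. compact_object U C c}"

text \<open>
  No closure of the generating set under suspension is required; adding all suspensions and
  desuspensions of its members keeps it small, so this does not affect the notion.
\<close>

definition compactly_generated :: "'u set \<Rightarrow> ('o, 'm, 'x) addcat_scheme \<Rightarrow> bool" where
  "compactly_generated U C \<longleftrightarrow>
     (\<exists>G \<subseteq> compacts U C. small U G \<and>
        (\<forall>x\<in>Obj C. (\<forall>g\<in>G. Hom C g x = {Zer C g x}) \<longrightarrow> zero_object C x))"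

locale rigidly_compactly_generated = tt_category C
  for U :: "'u set" and C :: "('o, 'm, 'x) ttcat_scheme" (structure) +
  assumes universe: "universe U"
    and locally_small: "\<lbrakk>a \<in> Obj C; b \<in> Obj C\<rbrakk> \<Longrightarrow> small U (Hom C a b)"
    and small_coproducts: "has_small_coproducts U C"
    and compactly_generated: "compactly_generated U C"
    and compact_iff_dualizable: "compact_object U C x \<longleftrightarrow> dualizable C x"

section \<open>Geometric functors\<close>

text \<open>
  \<open>Fsh x : F (Sh x) \<rightarrow> Sh (F x)\<close>, \<open>Ften x y : F x \<boxtimes> F y \<rightarrow> F (x \<boxtimes> y)\<close> and
  \<open>Funt : Unt \<rightarrow> F Unt\<close> are the structure isomorphisms of the functor.
\<close>

record ('o, 'm, 'p, 'n) ttfun =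
  Fob :: "'o \<Rightarrow> 'p"
  Far :: "'m \<Rightarrow> 'n"
  Fsh :: "'o \<Rightarrow> 'n"
  Ften :: "'o \<Rightarrow> 'o \<Rightarrow> 'n"
  Funt :: "'n"

locale exact_functor =
  T: triangulated_category T + S: triangulated_category S
  for T :: "('o, 'm, 'x) tricat_scheme" and S :: "('p, 'n, 'y) tricat_scheme"
    and F :: "('o, 'm, 'p, 'n, 'z) ttfun_scheme" +
  assumes Fob_Obj: "a \<in> Obj T \<Longrightarrow> Fob F a \<in> Obj S"
    and Far_Hom: "f \<in> Hom T a b \<Longrightarrow> Far F f \<in> Hom S (Fob F a) (Fob F b)"
    and Far_Idt: "a \<in> Obj T \<Longrightarrow> Far F (Idt T a) = Idt S (Fob F a)"
    and Far_Cmp: "\<lbrakk>f \<in> Hom T a b; g \<in> Hom T b c\<rbrakk> \<Longrightarrow> Far F (g \<cdot>\<^bsub>T\<^esub> f) = Far F g \<cdot>\<^bsub>S\<^esub> Far F f"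
    and Far_Add: "\<lbrakk>f \<in> Hom T a b; g \<in> Hom T a b\<rbrakk> \<Longrightarrow> Far F (f \<boxplus>\<^bsub>T\<^esub> g) = Far F f \<boxplus>\<^bsub>S\<^esub> Far F g"
    and Fsh_Hom: "a \<in> Obj T \<Longrightarrow> Fsh F a \<in> Hom S (Fob F (Sh T a)) (Sh S (Fob F a))"
    and Fsh_iso: "a \<in> Obj T \<Longrightarrow> is_iso S (Fsh F a)"
    and Fsh_natural: "f \<in> Hom T a b
          \<Longrightarrow> Fsh F b \<cdot>\<^bsub>S\<^esub> Far F (Shm T f) = Shm S (Far F f) \<cdot>\<^bsub>S\<^esub> Fsh F a"
    and Far_Tri: "(f, g, h) \<in> Tri T
          \<Longrightarrow> (Far F f, Far F g, Fsh F (Dom T f) \<cdot>\<^bsub>S\<^esub> Far F h) \<in> Tri S"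

locale tt_functor =
  T: tt_category T + S: tt_category S + exact_functor T S F
  for T :: "('o, 'm, 'x) ttcat_scheme" and S :: "('p, 'n, 'y) ttcat_scheme"
    and F :: "('o, 'm, 'p, 'n, 'z) ttfun_scheme" +
  assumes Ften_Hom: "\<lbrakk>x \<in> Obj T; y \<in> Obj T\<rbrakk>
          \<Longrightarrow> Ften F x y \<in> Hom S (Fob F x \<boxtimes>\<^bsub>S\<^esub> Fob F y) (Fob F (x \<boxtimes>\<^bsub>T\<^esub> y))"
    and Ften_iso: "\<lbrakk>x \<in> Obj T; y \<in> Obj T\<rbrakk> \<Longrightarrow> is_iso S (Ften F x y)"
    and Ften_natural: "\<lbrakk>f \<in> Hom T x x'; g \<in> Hom T y y'\<rbrakk>
          \<Longrightarrow> Ften F x' y' \<cdot>\<^bsub>S\<^esub> (Far F f \<boxdot>\<^bsub>S\<^esub> Far F g) = Far F (f \<boxdot>\<^bsub>T\<^esub> g) \<cdot>\<^bsub>S\<^esub> Ften F x y"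
    and Funt_Hom: "Funt F \<in> Hom S (Unt S) (Fob F (Unt T))"
    and Funt_iso: "is_iso S (Funt F)"
    and Ften_Asc: "\<lbrakk>x \<in> Obj T; y \<in> Obj T; z \<in> Obj T\<rbrakk>
          \<Longrightarrow> Far F (Asc T x y z) \<cdot>\<^bsub>S\<^esub> Ften F (x \<boxtimes>\<^bsub>T\<^esub> y) z \<cdot>\<^bsub>S\<^esub> (Ften F x y \<boxdot>\<^bsub>S\<^esub> Idt S (Fob F z)) =
              Ften F x (y \<boxtimes>\<^bsub>T\<^esub> z) \<cdot>\<^bsub>S\<^esub> (Idt S (Fob F x) \<boxdot>\<^bsub>S\<^esub> Ften F y z)
                \<cdot>\<^bsub>S\<^esub> Asc S (Fob F x) (Fob F y) (Fob F z)"
    and Ften_Lun: "x \<in> Obj T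
          \<Longrightarrow> Far F (Lun T x) \<cdot>\<^bsub>S\<^esub> Ften F (Unt T) x \<cdot>\<^bsub>S\<^esub> (Funt F \<boxdot>\<^bsub>S\<^esub> Idt S (Fob F x)) = Lun S (Fob F x)"
    and Ften_Run: "x \<in> Obj T
          \<Longrightarrow> Far F (Run T x) \<cdot>\<^bsub>S\<^esub> Ften F x (Unt T) \<cdot>\<^bsub>S\<^esub> (Idt S (Fob F x) \<boxdot>\<^bsub>S\<^esub> Funt F) = Run S (Fob F x)"
    and Ften_Sym: "\<lbrakk>x \<in> Obj T; y \<in> Obj T\<rbrakk>
          \<Longrightarrow> Far F (Sym T x y) \<cdot>\<^bsub>S\<^esub> Ften F x y = Ften F y x \<cdot>\<^bsub>S\<^esub> Sym S (Fob F x) (Fob F y)"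

locale geometric_functor =
  T: rigidly_compactly_generated U T + S: rigidly_compactly_generated U S + tt_functor T S F
  for U :: "'u set" and T :: "('o, 'm, 'x) ttcat_scheme" and S :: "('p, 'n, 'y) ttcat_scheme"
    and F :: "('o, 'm, 'p, 'n, 'z) ttfun_scheme" +
  assumes preserves_coproducts: "\<lbrakk>I \<subseteq> U; small U I; is_coproduct T I x X inc\<rbrakk>
          \<Longrightarrow> is_coproduct S I (\<lambda>i. Fob F (x i)) (Fob F X) (\<lambda>i. Far F (inc i))"

definition faithful ::
  "('o, 'm, 'x) cat_scheme \<Rightarrow> ('o, 'm, 'p, 'n, 'z) ttfun_scheme \<Rightarrow> bool" where
  "faithful T F \<longleftrightarrow> (\<forall>a\<in>Obj T. \<forall>b\<in>Obj T. inj_on (Far F) (Hom T a b))"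

section \<open>The Balmer spectrum\<close>

text \<open>\<open>K\<close> is the set of objects of a full tensor-triangulated subcategory of \<open>C\<close>.\<close>

definition thick_subcategory :: "('o, 'm, 'x) tricat_scheme \<Rightarrow> 'o set \<Rightarrow> 'o set \<Rightarrow> bool" where
  "thick_subcategory C K P \<longleftrightarrow> P \<subseteq> K \<and> P \<noteq> {} \<and>
     (\<forall>a\<in>K. Sh C a \<in> P \<longleftrightarrow> a \<in> P) \<and>
     (\<forall>f g h. (f, g, h) \<in> Tri C \<and> {Dom C f, Dom C g, Dom C h} \<subseteq> K \<longrightarrow>
        (Dom C f \<in> P \<and> Dom C g \<in> P \<longrightarrow> Dom C h \<in> P) \<and>
        (Dom C g \<in> P \<and> Dom C h \<in> P \<longrightarrow> Dom C f \<in> P) \<and>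
        (Dom C f \<in> P \<and> Dom C h \<in> P \<longrightarrow> Dom C g \<in> P)) \<and>
     (\<forall>a\<in>K. \<forall>b\<in>K. \<forall>X\<in>P. is_direct_sum C a b X \<longrightarrow> a \<in> P \<and> b \<in> P)"

definition thick_tensor_ideal :: "('o, 'm, 'x) ttcat_scheme \<Rightarrow> 'o set \<Rightarrow> 'o set \<Rightarrow> bool" where
  "thick_tensor_ideal C K P \<longleftrightarrow> thick_subcategory C K P \<and> (\<forall>a\<in>K. \<forall>b\<in>P. a \<boxtimes>\<^bsub>C\<^esub> b \<in> P)"

definition prime_ideal :: "('o, 'm, 'x) ttcat_scheme \<Rightarrow> 'o set \<Rightarrow> 'o set \<Rightarrow> bool" where
  "prime_ideal C K P \<longleftrightarrow> thick_tensor_ideal C K P \<and> P \<noteq> K \<and>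
     (\<forall>a\<in>K. \<forall>b\<in>K. a \<boxtimes>\<^bsub>C\<^esub> b \<in> P \<longrightarrow> a \<in> P \<or> b \<in> P)"

definition primes :: "('o, 'm, 'x) ttcat_scheme \<Rightarrow> 'o set \<Rightarrow> 'o set set" where
  "primes C K = {P. prime_ideal C K P}"

definition supp :: "('o, 'm, 'x) ttcat_scheme \<Rightarrow> 'o set \<Rightarrow> 'o \<Rightarrow> 'o set set" where
  "supp C K a = {P \<in> primes C K. a \<notin> P}"

text \<open>
  The complements of the supports cover the space (take the support of a zero object) and are stable
  under finite intersections (take direct sums), so they form a basis of the topology generated by
  them.
\<close>

definition Spc :: "('o, 'm, 'x) ttcat_scheme \<Rightarrow> 'o set \<Rightarrow> 'o set topology" where
  "Spc C K = topology_generated_by {primes C K - supp C K a | a. a \<in> K}"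

definition Spc_map :: "('o, 'm, 'p, 'n, 'z) ttfun_scheme \<Rightarrow> 'o set \<Rightarrow> 'p set \<Rightarrow> 'o set" where
  "Spc_map F K Q = {a \<in> K. Fob F a \<in> Q}"

section \<open>Spectral spaces and spectral quotient maps\<close>

definition qc_open :: "'a topology \<Rightarrow> 'a set \<Rightarrow> bool" where
  "qc_open X V \<longleftrightarrow> openin X V \<and> compactin X V"

definition irreducible_closed :: "'a topology \<Rightarrow> 'a set \<Rightarrow> bool" where
  "irreducible_closed X Z \<longleftrightarrow> closedin X Z \<and> Z \<noteq> {} \<and>
     (\<forall>A B. closedin X A \<and> closedin X B \<and> Z = A \<union> B \<longrightarrow> Z = A \<or> Z = B)"

definition spectral_space :: "'a topology \<Rightarrow> bool" where
  "spectral_space X \<longleftrightarrow>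
     compact_space X \<and>
     (\<forall>V x. openin X V \<and> x \<in> V \<longrightarrow> (\<exists>B. qc_open X B \<and> x \<in> B \<and> B \<subseteq> V)) \<and>
     (\<forall>V W. qc_open X V \<and> qc_open X W \<longrightarrow> qc_open X (V \<inter> W)) \<and>
     (\<forall>Z. irreducible_closed X Z \<longrightarrow> (\<exists>!x. x \<in> topspace X \<and> X closure_of {x} = Z))"

definition preimage_in :: "'a topology \<Rightarrow> ('a \<Rightarrow> 'b) \<Rightarrow> 'b set \<Rightarrow> 'a set" where
  "preimage_in X \<phi> V = {x \<in> topspace X. \<phi> x \<in> V}"

definition spectral_map :: "'a topology \<Rightarrow> 'b topology \<Rightarrow> ('a \<Rightarrow> 'b) \<Rightarrow> bool" where
  "spectral_map X Y \<phi> \<longleftrightarrow> spectral_space X \<and> spectral_space Y \<and> continuous_map X Y \<phi> \<and>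
     (\<forall>V. qc_open Y V \<longrightarrow> qc_open X (preimage_in X \<phi> V))"

definition spectral_quotient_map :: "'a topology \<Rightarrow> 'b topology \<Rightarrow> ('a \<Rightarrow> 'b) \<Rightarrow> bool" where
  "spectral_quotient_map X Y \<phi> \<longleftrightarrow> spectral_map X Y \<phi> \<and> \<phi> ` topspace X = topspace Y \<and>
     (\<forall>V \<subseteq> topspace Y. qc_open X (preimage_in X \<phi> V) \<longrightarrow> qc_open Y V)"

definition thomason :: "'a topology \<Rightarrow> 'a set \<Rightarrow> bool" where
  "thomason X V \<longleftrightarrow>
     (\<exists>\<Z>. (\<forall>Z\<in>\<Z>. closedin X Z \<and> compactin X (topspace X - Z)) \<and> V = \<Union>\<Z>)"

definition strong_spectral_quotient_map :: "'a topology \<Rightarrow> 'b topology \<Rightarrow> ('a \<Rightarrow> 'b) \<Rightarrow> bool" where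
  "strong_spectral_quotient_map X Y \<phi> \<longleftrightarrow> spectral_map X Y \<phi> \<and>
     (\<forall>V \<subseteq> topspace Y. thomason Y (topspace Y - V) \<longrightarrow>
        spectral_quotient_map (subtopology X (preimage_in X \<phi> V)) (subtopology Y V) \<phi>)"

end

theory Submission
  imports Defs
begin

text \<open>
  An arrow factors through a second one as soon as its composite with the fiber of the second
  vanishes, and a faithful functor detects vanishing.  By rigidity it still does so modulo any thick
  tensor ideal of compact objects, whence the map \<open>\<phi>\<close> on spectra is surjective.

  Let the preimage of \<open>C\<close> be the basic open set of \<open>b\<close>.  Since spectra are compact in the
  constructible topology, \<open>C\<close> is open as soon as \<open>P \<subseteq> R\<close> and \<open>P \<in> C\<close> imply \<open>R \<in> C\<close>.  In a
  counterexample take \<open>R\<close> minimal; then some \<open>a \<notin> R\<close> is such that inside \<open>supp a\<close> the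
  complement of \<open>C\<close> is the locus where one object \<open>d\<close> vanishes.  Hence modulo \<open>P\<close> the image of
  \<open>a\<close> has disconnected support and splits into two summands.  Being the solvability of a
  factorization problem, this splitting descends to \<open>a\<close>, and as \<open>P\<close> is prime one of the two
  summands is zero, i.e. \<open>a \<in> R\<close>.
\<close>

section \<open>Categories, additive categories and triangulated categories\<close>

text \<open>Verdier quotients are never formed: vanishing and invertibility modulo an ideal are the
  predicates \<open>null\<close> and \<open>biso\<close> on arrows. Faithfulness passes to the
  quotients because an object of the ideal generated by the image of P is annihilated by the image
  of one arrow \<theta> out of the unit of the source category that is invertible modulo P
  (\<open>killed\<close>). If m becomes zero, then \<theta> applied to m is sent to zero, hence is
  zero, and \<theta> can be cancelled.

  The obstacle is the descent of the splitting: a faithful functor may fail to be full, so the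
  idempotent found on the image of a has no evident preimage. It is traded for the equation q
  \<cdot> \<sigma> \<cdot> \<kappa> = \<kappa> in an unknown q, where \<sigma> and \<kappa> come
  from a coevaluation and an evaluation in the source category and act on a. Solvability of such an
  equation is the vanishing of a single arrow.

  Complements of Thomason subsets are treated without localizing: they are the sets of primes
  containing a given set A of objects, and A is carried along as a parameter.\<close>

context category
begin

lemma in_Hom [simp]: "f \<in> Hom C a b \<longleftrightarrow> f \<in> Arr C \<and> Dom C f = a \<and> Cod C f = b"
  by (auto simp: Hom_def)

lemma Obj_Dom [simp]: "f \<in> Arr C \<Longrightarrow> Dom C f \<in> Obj C"
  by (rule Dom_Obj)

lemma Obj_Cod [simp]: "f \<in> Arr C \<Longrightarrow> Cod C f \<in> Obj C"
  by (rule Cod_Obj)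

lemma Idt_simps [simp]:
  assumes "a \<in> Obj C"
  shows "Idt C a \<in> Arr C" "Dom C (Idt C a) = a" "Cod C (Idt C a) = a"
  using Idt_Hom[OF assms] by simp_all

lemma Cmp_simps [simp]:
  assumes "f \<in> Arr C" "g \<in> Arr C" "Cod C f = Dom C g"
  shows "g \<cdot> f \<in> Arr C" "Dom C (g \<cdot> f) = Dom C f" "Cod C (g \<cdot> f) = Cod C g"
  using Cmp_Hom[of f "Dom C f" "Cod C f" g "Cod C g"] assms by simp_all

lemma Idt_Cmp [simp]: "f \<in> Arr C \<Longrightarrow> Cod C f = b \<Longrightarrow> Idt C b \<cdot> f = f"
  by (rule Idt_left) simp

lemma Cmp_Idt [simp]: "f \<in> Arr C \<Longrightarrow> Dom C f = a \<Longrightarrow> f \<cdot> Idt C a = f"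
  by (rule Idt_right) simp

lemma Cmp_Cmp [simp]:
  "\<lbrakk>f \<in> Arr C; g \<in> Arr C; h \<in> Arr C; Cod C f = Dom C g; Cod C g = Dom C h\<rbrakk>
    \<Longrightarrow> (h \<cdot> g) \<cdot> f = h \<cdot> (g \<cdot> f)"
  by (rule Cmp_assoc) simp_all

lemma Cmp_eq_Cmp:
  assumes "g \<cdot> f = h" "x \<in> Arr C" "f \<in> Arr C" "g \<in> Arr C" "Cod C x = Dom C f" "Cod C f = Dom C g"
  shows "g \<cdot> (f \<cdot> x) = h \<cdot> x"
  using Cmp_Cmp[of x f g] assms by simp

definition inverses :: "'m \<Rightarrow> 'm \<Rightarrow> bool" where
  "inverses f g \<longleftrightarrow> f \<in> Arr C \<and> g \<in> Arr C \<and> Dom C g = Cod C f \<and> Cod C g = Dom C f \<and>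
     g \<cdot> f = Idt C (Dom C f) \<and> f \<cdot> g = Idt C (Cod C f)"

lemma is_iso_iff: "is_iso C f \<longleftrightarrow> (\<exists>g. inverses f g)"
  by (auto simp: is_iso_def inverse_arrows_def inverses_def)

lemma inverses_sym: "inverses f g \<Longrightarrow> inverses g f"
  by (auto simp: inverses_def)

lemma inverses_simps:
  assumes "inverses f g"
  shows "f \<in> Arr C" "g \<in> Arr C" "Dom C g = Cod C f" "Cod C g = Dom C f"
     "g \<cdot> f = Idt C (Dom C f)" "f \<cdot> g = Idt C (Cod C f)"
     "\<And>x. x \<in> Arr C \<Longrightarrow> Cod C x = Dom C f \<Longrightarrow> g \<cdot> (f \<cdot> x) = x"
     "\<And>x. x \<in> Arr C \<Longrightarrow> Cod C x = Cod C f \<Longrightarrow> f \<cdot> (g \<cdot> x) = x"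
  using assms by (auto simp: inverses_def Cmp_eq_Cmp)

lemma inverses_unique: "inverses f g \<Longrightarrow> inverses f g' \<Longrightarrow> g = g'"
  using inverses_simps[of f g] inverses_simps[of f g'] by (metis Cmp_Idt Idt_Cmp Cmp_Cmp)

lemma inv_arr_eq: "inverses f g \<Longrightarrow> inv_arr C f = g"
  unfolding inv_arr_def
  by (rule the_equality)
     (auto intro: inverses_unique simp: inverse_arrows_def inverses_def)

lemma inverses_inv_arr: "is_iso C f \<Longrightarrow> inverses f (inv_arr C f)"
  using inv_arr_eq is_iso_iff by metis

lemmas inv_simps = inverses_simps(2-8)[OF inverses_inv_arr]

lemma inverses_Idt: "a \<in> Obj C \<Longrightarrow> inverses (Idt C a) (Idt C a)"
  by (simp add: inverses_def)

lemma inverses_Cmp: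
  assumes "inverses f f'" "inverses g g'" "Cod C f = Dom C g"
  shows "inverses (g \<cdot> f) (f' \<cdot> g')"
  using inverses_simps[OF assms(1)] inverses_simps[OF assms(2)] assms(3)
  by (simp add: inverses_def)

lemma is_iso_Idt: "a \<in> Obj C \<Longrightarrow> is_iso C (Idt C a)"
  using inverses_Idt is_iso_iff by blast

lemma is_iso_Cmp: "is_iso C f \<Longrightarrow> is_iso C g \<Longrightarrow> Cod C f = Dom C g \<Longrightarrow> is_iso C (g \<cdot> f)"
  using inverses_Cmp is_iso_iff by metis

lemma is_iso_inv: "is_iso C f \<Longrightarrow> is_iso C (inv_arr C f)"
  using inverses_inv_arr inverses_sym is_iso_iff by metis

lemma is_iso_Arr: "is_iso C f \<Longrightarrow> f \<in> Arr C"
  by (simp add: is_iso_def inverse_arrows_def)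

definition is_retract :: "'o \<Rightarrow> 'o \<Rightarrow> bool" where
  "is_retract a b \<longleftrightarrow> (\<exists>i\<in>Arr C. \<exists>p\<in>Arr C. Dom C i = a \<and> Cod C i = b \<and> Dom C p = b \<and> Cod C p = a \<and>
     p \<cdot> i = Idt C a)"

definition isomorphic :: "'o \<Rightarrow> 'o \<Rightarrow> bool" where
  "isomorphic a b \<longleftrightarrow> (\<exists>f. is_iso C f \<and> Dom C f = a \<and> Cod C f = b)"

lemma isomorphicI: "is_iso C f \<Longrightarrow> isomorphic (Dom C f) (Cod C f)"
  by (auto simp: isomorphic_def)

lemma isomorphic_sym: "isomorphic a b \<Longrightarrow> isomorphic b a"
  unfolding isomorphic_def using is_iso_inv inv_simps by metis

lemma isomorphic_trans: "isomorphic a b \<Longrightarrow> isomorphic b c \<Longrightarrow> isomorphic a c"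
  unfolding isomorphic_def by (metis is_iso_Cmp Cmp_simps(2,3) is_iso_Arr)

lemma isomorphic_retract: "isomorphic a b \<Longrightarrow> is_retract a b"
  unfolding isomorphic_def is_iso_iff is_retract_def using inverses_simps by metis

lemma is_retract_trans:
  assumes "is_retract a b" "is_retract b c"
  shows "is_retract a c"
proof -
  from assms(1) obtain i p where 1: "i \<in> Arr C" "p \<in> Arr C" "Dom C i = a" "Cod C i = b"
      "Dom C p = b" "Cod C p = a" "p \<cdot> i = Idt C a"
    unfolding is_retract_def by blast
  from assms(2) obtain i' p' where 2: "i' \<in> Arr C" "p' \<in> Arr C" "Dom C i' = b" "Cod C i' = c"
      "Dom C p' = c" "Cod C p' = b" "p' \<cdot> i' = Idt C b"
    unfolding is_retract_def by blast
  have "(p \<cdot> p') \<cdot> (i' \<cdot> i) = Idt C a"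
    using 1 2 by (simp add: Cmp_eq_Cmp)
  then show ?thesis
    unfolding is_retract_def using 1 2 by (intro bexI[of _ "i' \<cdot> i"] bexI[of _ "p \<cdot> p'"]) simp_all
qed

end

section \<open>Zero arrows, differences and retracts in additive categories\<close>

context additive_category
begin

lemma group_hom_group: "a \<in> Obj C \<Longrightarrow> b \<in> Obj C \<Longrightarrow> group (hom_group C a b)"
  using hom_comm_group comm_group.axioms(2) by blast

lemma hom_group_simps [simp]:
  "carrier (hom_group C a b) = Hom C a b" "monoid.mult (hom_group C a b) = Add C"
  "one (hom_group C a b) = Zer C a b"
  by (simp_all add: hom_group_def)

lemma Zer_simps [simp]:
  assumes "a \<in> Obj C" "b \<in> Obj C"
  shows "Zer C a b \<in> Arr C" "Dom C (Zer C a b) = a" "Cod C (Zer C a b) = b"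
proof -
  interpret group "hom_group C a b" using assms by (rule group_hom_group)
  show "Zer C a b \<in> Arr C" "Dom C (Zer C a b) = a" "Cod C (Zer C a b) = b"
    using one_closed by simp_all
qed

lemma Add_simps [simp]:
  assumes "f \<in> Arr C" "g \<in> Arr C" "Dom C g = Dom C f" "Cod C g = Cod C f"
  shows "f \<boxplus> g \<in> Arr C" "Dom C (f \<boxplus> g) = Dom C f" "Cod C (f \<boxplus> g) = Cod C f"
proof -
  interpret group "hom_group C (Dom C f) (Cod C f)" using assms by (simp add: group_hom_group)
  show "f \<boxplus> g \<in> Arr C" "Dom C (f \<boxplus> g) = Dom C f" "Cod C (f \<boxplus> g) = Cod C f"
    using m_closed[of f g] assms by simp_all
qed

lemma Neg_simps [simp]:
  assumes "f \<in> Arr C"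
  shows "Neg C f \<in> Arr C" "Dom C (Neg C f) = Dom C f" "Cod C (Neg C f) = Cod C f"
    "f \<boxplus> Neg C f = Zer C (Dom C f) (Cod C f)" "Neg C f \<boxplus> f = Zer C (Dom C f) (Cod C f)"
proof -
  interpret group "hom_group C (Dom C f) (Cod C f)" using assms by (simp add: group_hom_group)
  show "Neg C f \<in> Arr C" "Dom C (Neg C f) = Dom C f" "Cod C (Neg C f) = Cod C f"
    "f \<boxplus> Neg C f = Zer C (Dom C f) (Cod C f)" "Neg C f \<boxplus> f = Zer C (Dom C f) (Cod C f)"
    using inv_closed[of f] r_inv[of f] l_inv[of f] assms by (simp_all add: Neg_def)
qed

lemma Add_Zer [simp]:
  assumes "f \<in> Arr C" "Dom C f = a" "Cod C f = b"
  shows "f \<boxplus> Zer C a b = f" "Zer C a b \<boxplus> f = f"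
proof -
  interpret group "hom_group C a b" using assms by (auto intro: group_hom_group)
  show "f \<boxplus> Zer C a b = f" "Zer C a b \<boxplus> f = f"
    using r_one[of f] l_one[of f] assms by simp_all
qed

lemma Add_assoc:
  assumes "f \<in> Arr C" "g \<in> Arr C" "h \<in> Arr C" "Dom C g = Dom C f" "Cod C g = Cod C f"
    "Dom C h = Dom C f" "Cod C h = Cod C f"
  shows "(f \<boxplus> g) \<boxplus> h = f \<boxplus> (g \<boxplus> h)"
proof -
  interpret group "hom_group C (Dom C f) (Cod C f)" using assms by (simp add: group_hom_group)
  show ?thesis using m_assoc[of f g h] assms by simp
qed

lemma Add_cancel:
  assumes "f \<in> Arr C" "k \<in> Arr C" "Dom C k = Dom C f" "Cod C k = Cod C f" "f \<boxplus> k = f"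
  shows "k = Zer C (Dom C f) (Cod C f)"
proof -
  interpret group "hom_group C (Dom C f) (Cod C f)" using assms by (simp add: group_hom_group)
  show ?thesis using l_cancel_one[of f k] assms by simp
qed

text \<open>Equalities of arrows are proved below by naming the difference k and showing that it
  vanishes; this keeps signs out of the calculations.\<close>

lemma ex_difference:
  assumes "f \<in> Arr C" "g \<in> Arr C" "Dom C g = Dom C f" "Cod C g = Cod C f"
  shows "\<exists>k\<in>Arr C. Dom C k = Dom C f \<and> Cod C k = Cod C f \<and> f = g \<boxplus> k"
proof -
  have "g \<boxplus> (Neg C g \<boxplus> f) = f"
    using assms by (simp flip: Add_assoc)
  then show ?thesis using assms by (intro bexI[of _ "Neg C g \<boxplus> f"]) simp_all
qed

lemma Cmp_Add [simp]:
  "\<lbrakk>f \<in> Arr C; g \<in> Arr C; h \<in> Arr C; Dom C g = Dom C f; Cod C g = Cod C f; Cod C f = Dom C h\<rbrakk>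
   \<Longrightarrow> h \<cdot> (f \<boxplus> g) = (h \<cdot> f) \<boxplus> (h \<cdot> g)"
  by (rule Cmp_Add_right) auto

lemma Add_Cmp [simp]:
  "\<lbrakk>f \<in> Arr C; g \<in> Arr C; h \<in> Arr C; Dom C g = Dom C f; Cod C g = Cod C f; Cod C h = Dom C f\<rbrakk>
   \<Longrightarrow> (f \<boxplus> g) \<cdot> h = (f \<cdot> h) \<boxplus> (g \<cdot> h)"
  by (rule Cmp_Add_left) auto

lemma Cmp_Zer [simp]:
  assumes "f \<in> Arr C" "Dom C f = b" "a \<in> Obj C"
  shows "f \<cdot> Zer C a b = Zer C a (Cod C f)"
proof -
  have b: "b \<in> Obj C" using assms by auto
  have "(f \<cdot> Zer C a b) \<boxplus> (f \<cdot> Zer C a b) = f \<cdot> (Zer C a b \<boxplus> Zer C a b)"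
    using assms b by (subst Cmp_Add) auto
  also have "\<dots> = f \<cdot> Zer C a b" using assms b by simp
  finally show ?thesis
    using Add_cancel[of "f \<cdot> Zer C a b" "f \<cdot> Zer C a b"] assms b by simp
qed

lemma Zer_Cmp [simp]:
  assumes "f \<in> Arr C" "Cod C f = a" "b \<in> Obj C"
  shows "Zer C a b \<cdot> f = Zer C (Dom C f) b"
proof -
  have a: "a \<in> Obj C" using assms by auto
  have "(Zer C a b \<cdot> f) \<boxplus> (Zer C a b \<cdot> f) = (Zer C a b \<boxplus> Zer C a b) \<cdot> f"
    using assms a by (subst Add_Cmp) auto
  also have "\<dots> = Zer C a b \<cdot> f" using assms a by simp
  finally show ?thesis
    using Add_cancel[of "Zer C a b \<cdot> f" "Zer C a b \<cdot> f"] assms a by simp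
qed

definition zero_arr :: "'m \<Rightarrow> bool" where
  "zero_arr f \<longleftrightarrow> f = Zer C (Dom C f) (Cod C f)"

lemma zero_arrD: "zero_arr f \<Longrightarrow> Dom C f = a \<Longrightarrow> Cod C f = b \<Longrightarrow> f = Zer C a b"
  by (simp add: zero_arr_def)

lemma zero_arr_Zer [simp]: "a \<in> Obj C \<Longrightarrow> b \<in> Obj C \<Longrightarrow> zero_arr (Zer C a b)"
  by (simp add: zero_arr_def)

lemma zero_arr_Cmp_left: "zero_arr f \<Longrightarrow> f \<in> Arr C \<Longrightarrow> g \<in> Arr C \<Longrightarrow> Cod C f = Dom C g \<Longrightarrow> zero_arr (g \<cdot> f)"
  unfolding zero_arr_def by (metis Cmp_Zer Cmp_simps(2) Cmp_simps(3) Obj_Dom)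

lemma zero_arr_Cmp_right: "zero_arr g \<Longrightarrow> f \<in> Arr C \<Longrightarrow> g \<in> Arr C \<Longrightarrow> Cod C f = Dom C g \<Longrightarrow> zero_arr (g \<cdot> f)"
  unfolding zero_arr_def by (metis Zer_Cmp Cmp_simps(2) Cmp_simps(3) Obj_Cod)

lemma zero_arr_mono_split:
  assumes "zero_arr (i \<cdot> f)" "p \<cdot> i = Idt C (Dom C i)" "f \<in> Arr C" "i \<in> Arr C" "p \<in> Arr C"
    "Cod C f = Dom C i" "Cod C i = Dom C p"
  shows "zero_arr f"
proof -
  have "zero_arr (p \<cdot> (i \<cdot> f))"
    by (rule zero_arr_Cmp_left) (use assms in auto)
  then show ?thesis using assms by (simp add: Cmp_eq_Cmp[OF assms(2)])
qed

lemma zero_arr_epi_split: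
  assumes "zero_arr (f \<cdot> p)" "p \<cdot> i = Idt C (Cod C p)" "f \<in> Arr C" "i \<in> Arr C" "p \<in> Arr C"
    "Cod C p = Dom C f" "Cod C i = Dom C p"
  shows "zero_arr f"
proof -
  have "zero_arr ((f \<cdot> p) \<cdot> i)"
    by (rule zero_arr_Cmp_right) (use assms in auto)
  then show ?thesis using assms by simp
qed

lemma zero_arr_iso_left:
  assumes "is_iso C i" "f \<in> Arr C" "Cod C f = Dom C i"
  shows "zero_arr (i \<cdot> f) \<longleftrightarrow> zero_arr f"
  using zero_arr_mono_split[of i f "inv_arr C i"] zero_arr_Cmp_left[of f i] inv_simps[OF assms(1)]
    assms is_iso_Arr[OF assms(1)] by auto

lemma zero_arr_iso_right:
  assumes "is_iso C i" "f \<in> Arr C" "Cod C i = Dom C f"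
  shows "zero_arr (f \<cdot> i) \<longleftrightarrow> zero_arr f"
  using zero_arr_epi_split[of f i "inv_arr C i"] zero_arr_Cmp_right[of f i] inv_simps[OF assms(1)]
    assms is_iso_Arr[OF assms(1)] by auto

lemma eq_if_zero_difference:
  assumes "f = g \<boxplus> k" "zero_arr k" "g \<in> Arr C" "k \<in> Arr C" "Dom C k = Dom C g" "Cod C k = Cod C g"
  shows "f = g"
  using assms unfolding zero_arr_def by (metis Add_Zer(1))

lemma zero_arr_difference:
  assumes "h \<cdot> f = h \<cdot> g" "f = g \<boxplus> k" "f \<in> Arr C" "g \<in> Arr C" "k \<in> Arr C" "h \<in> Arr C"
    "Dom C k = Dom C g" "Cod C k = Cod C g" "Cod C g = Dom C h"
  shows "zero_arr (h \<cdot> k)"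
  using Add_cancel[of "h \<cdot> g" "h \<cdot> k"] assms by (simp add: zero_arr_def)

lemma zero_arr_difference':
  assumes "f \<cdot> h = g \<cdot> h" "f = g \<boxplus> k" "f \<in> Arr C" "g \<in> Arr C" "k \<in> Arr C" "h \<in> Arr C"
    "Dom C k = Dom C g" "Cod C k = Cod C g" "Dom C g = Cod C h"
  shows "zero_arr (k \<cdot> h)"
  using Add_cancel[of "g \<cdot> h" "k \<cdot> h"] assms by (simp add: zero_arr_def)

lemma zero_object_iff: "zero_object C z \<longleftrightarrow> z \<in> Obj C \<and> zero_arr (Idt C z)"
proof
  assume z: "zero_object C z"
  then have zo: "z \<in> Obj C" by (simp add: zero_object_def)
  have "\<exists>!f. f \<in> Hom C z z" using z by (simp add: zero_object_def)
  then have "Idt C z = Zer C z z"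
    using zo by (metis Idt_simps Zer_simps in_Hom)
  then show "z \<in> Obj C \<and> zero_arr (Idt C z)" using zo by (simp add: zero_arr_def)
next
  assume z: "z \<in> Obj C \<and> zero_arr (Idt C z)"
  then have id: "Idt C z = Zer C z z" by (intro zero_arrD) simp_all
  have "\<exists>!f. f \<in> Hom C a z" "\<exists>!f. f \<in> Hom C z a" if a: "a \<in> Obj C" for a
  proof -
    show "\<exists>!f. f \<in> Hom C a z"
    proof (rule ex1I[of _ "Zer C a z"])
      fix f assume "f \<in> Hom C a z"
      then show "f = Zer C a z" using Idt_Cmp[of f z] z id by simp
    qed (use a z in simp)
    show "\<exists>!f. f \<in> Hom C z a"
    proof (rule ex1I[of _ "Zer C z a"])
      fix f assume "f \<in> Hom C z a"
      then show "f = Zer C z a" using Cmp_Idt[of f z] z id by simp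
    qed (use a z in simp)
  qed
  then show "zero_object C z" using z by (simp add: zero_object_def)
qed

lemma zero_object_arr:
  assumes "zero_object C z" "f \<in> Arr C"
  shows "Dom C f = z \<Longrightarrow> zero_arr f" "Cod C f = z \<Longrightarrow> zero_arr f"
proof -
  have z: "z \<in> Obj C" "zero_arr (Idt C z)" using assms(1) zero_object_iff by auto
  show "zero_arr f" if "Dom C f = z"
    using zero_arr_Cmp_left[of "Idt C z" f] z assms that by simp
  show "zero_arr f" if "Cod C f = z"
    using zero_arr_Cmp_right[of "Idt C z" f] z assms that by simp
qed

lemma direct_sum_retracts:
  assumes X: "is_direct_sum C a b X"
  shows "is_retract a X" "is_retract b X"
proof -
  obtain inc where inc: "is_coproduct C (UNIV :: bool set) (\<lambda>i. if i then a else b) X inc"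
    using X by (auto simp: is_direct_sum_def)
  have o: "X \<in> Obj C" "a \<in> Obj C" "b \<in> Obj C"
    "inc True \<in> Hom C a X" "inc False \<in> Hom C b X"
    using inc unfolding is_coproduct_def by (metis UNIV_I)+
  have ex: "\<exists>h. h \<in> Hom C X Y \<and> h \<cdot> inc True = f \<and> h \<cdot> inc False = g"
    if "Y \<in> Obj C" "f \<in> Hom C a Y" "g \<in> Hom C b Y" for Y f g
  proof -
    have "\<forall>Y\<in>Obj C. \<forall>f. (\<forall>i\<in>UNIV. f i \<in> Hom C (if i then a else b) Y) \<longrightarrow>
        (\<exists>!h. h \<in> Hom C X Y \<and> (\<forall>i\<in>UNIV. h \<cdot> inc i = f i))"
      using inc unfolding is_coproduct_def by (elim conjE)
    moreover have "\<forall>i\<in>UNIV. (if i then f else g) \<in> Hom C (if i then a else b) Y"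
      using that by simp
    ultimately have "\<exists>!h. h \<in> Hom C X Y \<and> (\<forall>i\<in>UNIV. h \<cdot> inc i = (if i then f else g))"
      using \<open>Y \<in> Obj C\<close> by (elim ballE[of _ _ Y] allE[of _ "\<lambda>i. if i then f else g"] impE) simp_all
    then obtain h where "h \<in> Hom C X Y" "\<forall>i. h \<cdot> inc i = (if i then f else g)"
      by blast
    then show ?thesis by (metis (full_types))
  qed
  obtain p where p: "p \<in> Hom C X a" "p \<cdot> inc True = Idt C a"
    using ex[of a "Idt C a" "Zer C b a"] o by auto
  obtain q where q: "q \<in> Hom C X b" "q \<cdot> inc False = Idt C b"
    using ex[of b "Zer C a b" "Idt C b"] o by auto
  show "is_retract a X"
    unfolding is_retract_def by (rule bexI[of _ "inc True"], rule bexI[of _ p]) (use p o in simp_all)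
  show "is_retract b X"
    unfolding is_retract_def by (rule bexI[of _ "inc False"], rule bexI[of _ q]) (use q o in simp_all)
qed

end

section \<open>Exact triangles: weak kernels and cokernels, fibers, split triangles\<close>

context triangulated_category
begin

lemma Sh_simps [simp]:
  "a \<in> Obj C \<Longrightarrow> Sh C a \<in> Obj C"
  "f \<in> Arr C \<Longrightarrow> Shm C f \<in> Arr C"
  "f \<in> Arr C \<Longrightarrow> Dom C (Shm C f) = Sh C (Dom C f)"
  "f \<in> Arr C \<Longrightarrow> Cod C (Shm C f) = Sh C (Cod C f)"
  using Sh_Obj Shm_Hom[of f "Dom C f" "Cod C f"] by simp_all

lemma Shm_Zer [simp]:
  assumes "a \<in> Obj C" "b \<in> Obj C"
  shows "Shm C (Zer C a b) = Zer C (Sh C a) (Sh C b)"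
proof -
  have "Shm C (Zer C a b) \<boxplus> Shm C (Zer C a b) = Shm C (Zer C a b)"
    using Shm_Add[of "Zer C a b" a b "Zer C a b"] assms by simp
  then show ?thesis using Add_cancel[of "Shm C (Zer C a b)" "Shm C (Zer C a b)"] assms by simp
qed

lemma Shm_eq_iff:
  assumes "f \<in> Arr C" "g \<in> Arr C" "Dom C f = Dom C g" "Cod C f = Cod C g"
  shows "Shm C f = Shm C g \<longleftrightarrow> f = g"
proof -
  have "inj_on (Shm C) (Hom C (Dom C g) (Cod C g))"
    using Shm_fully_faithful[of "Dom C g" "Cod C g"] assms by (simp add: bij_betw_def)
  then show ?thesis using assms by (auto dest: inj_onD)
qed

lemma Shm_full:
  assumes "a \<in> Obj C" "b \<in> Obj C" "f \<in> Arr C" "Dom C f = Sh C a" "Cod C f = Sh C b"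
  obtains g where "g \<in> Arr C" "Dom C g = a" "Cod C g = b" "Shm C g = f"
proof -
  have "f \<in> Shm C ` Hom C a b"
    using Shm_fully_faithful[OF assms(1,2)] assms by (simp add: bij_betw_def)
  then show ?thesis using that by auto
qed

lemma zero_arr_Shm [simp]: "f \<in> Arr C \<Longrightarrow> zero_arr (Shm C f) \<longleftrightarrow> zero_arr f"
  unfolding zero_arr_def using Shm_eq_iff[of f "Zer C (Dom C f) (Cod C f)"] by simp

lemma zero_object_Sh: "zero_object C z \<Longrightarrow> zero_object C (Sh C z)"
  unfolding zero_object_iff using zero_arr_Shm[of "Idt C z"] by (simp add: Shm_Idt)

lemma Cmp_Neg:
  assumes "f \<in> Arr C" "g \<in> Arr C" "Cod C f = Dom C g"
  shows "g \<cdot> Neg C f = Neg C (g \<cdot> f)" "Neg C g \<cdot> f = Neg C (g \<cdot> f)"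
proof -
  interpret group "hom_group C (Dom C f) (Cod C g)" using assms by (simp add: group_hom_group)
  have "(g \<cdot> Neg C f) \<boxplus> (g \<cdot> f) = Zer C (Dom C f) (Cod C g)"
    using assms by (subst Cmp_Add[symmetric]) auto
  then show "g \<cdot> Neg C f = Neg C (g \<cdot> f)"
    using inv_equality[of "g \<cdot> Neg C f" "g \<cdot> f"] assms by (simp add: Neg_def[of C "g \<cdot> f"])
  have "(Neg C g \<cdot> f) \<boxplus> (g \<cdot> f) = Zer C (Dom C f) (Cod C g)"
    using assms by (subst Add_Cmp[symmetric]) auto
  then show "Neg C g \<cdot> f = Neg C (g \<cdot> f)"
    using inv_equality[of "Neg C g \<cdot> f" "g \<cdot> f"] assms by (simp add: Neg_def[of C "g \<cdot> f"])
qed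

lemma Neg_Neg [simp]:
  assumes "f \<in> Arr C"
  shows "Neg C (Neg C f) = f"
proof -
  interpret group "hom_group C (Dom C f) (Cod C f)" using assms by (simp add: group_hom_group)
  show ?thesis using inv_inv[of f] assms Neg_simps(2,3)[of f] by (simp add: Neg_def[of C "Neg C f"]) (simp add: Neg_def)
qed

lemma zero_arr_Neg [simp]:
  assumes "f \<in> Arr C"
  shows "zero_arr (Neg C f) \<longleftrightarrow> zero_arr f"
proof -
  have *: "Neg C (Zer C a b) = Zer C a b" if "a \<in> Obj C" "b \<in> Obj C" for a b
    using Neg_simps(4)[of "Zer C a b"] Add_Zer(2)[of "Neg C (Zer C a b)" a b] that by simp
  show ?thesis
    unfolding zero_arr_def using assms *[of "Dom C f" "Cod C f"] Neg_Neg[OF assms]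
    by (metis Neg_simps(2,3) Obj_Cod Obj_Dom)
qed

lemma Tri_simps:
  assumes "(f, g, h) \<in> Tri C"
  shows "f \<in> Arr C" "g \<in> Arr C" "h \<in> Arr C" "Cod C f = Dom C g" "Cod C g = Dom C h"
    "Cod C h = Sh C (Dom C f)"
  using Tri_candidate[OF assms] by (simp_all add: candidate_def)

lemma Tri_rotate: "(f, g, h) \<in> Tri C \<Longrightarrow> (g, h, Neg C (Shm C f)) \<in> Tri C"
  using TR2 Tri_candidate by blast

text \<open>Comparison with the contractible triangle on the source of \<open>f\<close>: TR3 extends
  the pair formed by the identity and \<open>f\<close>, and the resulting square writes
  \<open>g \<cdot> f\<close> as an arrow through a zero object.\<close>

lemma Tri_Cmp_zero:
  assumes "(f, g, h) \<in> Tri C"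
  shows "zero_arr (g \<cdot> f)"
proof -
  note [simp] = Tri_simps[OF assms]
  obtain z where z: "zero_object C z" using ex_zero_object by blast
  have zo: "z \<in> Obj C" using z by (simp add: zero_object_def)
  let ?a = "Dom C f"
  have "(Idt C ?a, Zer C ?a z, Zer C z (Sh C ?a)) \<in> Tri C"
    using TR1_Idt z by simp
  from TR3[OF this assms, of "Idt C ?a" f]
  obtain w where "w \<in> Hom C z (Dom C h)" "w \<cdot> Zer C ?a z = g \<cdot> f"
    using zo by auto
  then show ?thesis using zo by (metis Zer_simps Cmp_Zer Obj_Dom \<open>g \<in> Arr C\<close> \<open>f \<in> Arr C\<close> zero_arr_Zer in_Hom Obj_Cod)
qed

text \<open>The first arrow of a triangle is a weak kernel of the second. TR3 produces a filler only
  in the third place, so both triangles are rotated; the filler then lives between suspensions and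
  is brought back by full faithfulness of the suspension.\<close>

lemma Tri_lift:
  assumes tri: "(f, g, h) \<in> Tri C" and m: "m \<in> Arr C" "Cod C m = Dom C g" and zm: "zero_arr (g \<cdot> m)"
  obtains k where "k \<in> Arr C" "Dom C k = Dom C m" "Cod C k = Dom C f" "f \<cdot> k = m"
proof -
  note [simp] = Tri_simps[OF tri] m
  obtain z where z: "zero_object C z" using ex_zero_object by blast
  have [simp]: "z \<in> Obj C" using z by (simp add: zero_object_def)
  let ?x = "Dom C m"
  have "(Idt C ?x, Zer C ?x z, Zer C z (Sh C ?x)) \<in> Tri C"
    using TR1_Idt z by simp
  from Tri_rotate[OF this]
  have t: "(Zer C ?x z, Zer C z (Sh C ?x), Neg C (Idt C (Sh C ?x))) \<in> Tri C"
    by (simp add: Shm_Idt)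
  have gm: "g \<cdot> m = Zer C ?x (Dom C h)"
    by (rule zero_arrD[OF zm]) simp_all
  have "\<exists>w \<in> Hom C (Dom C (Neg C (Idt C (Sh C ?x)))) (Dom C (Neg C (Shm C f))).
      w \<cdot> Zer C z (Sh C ?x) = h \<cdot> Zer C z (Dom C h) \<and>
      Shm C m \<cdot> Neg C (Idt C (Sh C ?x)) = Neg C (Shm C f) \<cdot> w"
    by (rule TR3[OF t Tri_rotate[OF tri]]) (simp_all add: gm)
  then obtain w where w': "w \<in> Hom C (Dom C (Neg C (Idt C (Sh C ?x)))) (Dom C (Neg C (Shm C f)))"
      and sq: "Shm C m \<cdot> Neg C (Idt C (Sh C ?x)) = Neg C (Shm C f) \<cdot> w"
    by blast
  have w: "w \<in> Arr C" "Dom C w = Sh C ?x" "Cod C w = Sh C (Dom C f)"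
    using w' by simp_all
  \<comment> \<open>Each of the two rotations contributes a sign, and the signs cancel.\<close>
  have "Neg C (Shm C m) = Neg C (Shm C f \<cdot> w)"
    using sq w by (simp add: Cmp_Neg)
  then have "Neg C (Neg C (Shm C m)) = Neg C (Neg C (Shm C f \<cdot> w))"
    by (rule arg_cong)
  then have e: "Shm C m = Shm C f \<cdot> w"
    using w by simp
  obtain k where k: "k \<in> Arr C" "Dom C k = ?x" "Cod C k = Dom C f" "Shm C k = w"
    using Shm_full[of ?x "Dom C f" w] w by auto
  have "Shm C (f \<cdot> k) = Shm C m"
    using e k Shm_Cmp[of k ?x "Dom C f" f "Cod C f"] by simp
  then have "f \<cdot> k = m" using Shm_eq_iff[of "f \<cdot> k" m] k by simp
  then show ?thesis using that k by blast
qed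

text \<open>The second arrow is a weak cokernel of the first: TR3 is applied to an arrow into the
  triangle \<open>z\<close>, \<open>?y\<close>, \<open>?y\<close>, a contractible triangle rotated
  backwards.\<close>

lemma Tri_factor:
  assumes tri: "(f, g, h) \<in> Tri C" and m: "m \<in> Arr C" "Dom C m = Dom C g" and zm: "zero_arr (m \<cdot> f)"
  obtains k where "k \<in> Arr C" "Dom C k = Dom C h" "Cod C k = Cod C m" "k \<cdot> g = m"
proof -
  note [simp] = Tri_simps[OF tri] m
  obtain z where z: "zero_object C z" using ex_zero_object by blast
  have [simp]: "z \<in> Obj C" using z by (simp add: zero_object_def)
  let ?y = "Cod C m"
  \<comment> \<open>The zero object has the form \<open>Sh C z\<close> so that TR2 recognizes this
    triangle as the rotation of one that starts at \<open>z\<close>.\<close>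
  have "(Idt C ?y, Zer C ?y (Sh C z), Zer C (Sh C z) (Sh C ?y)) \<in> Tri C"
    using TR1_Idt[OF _ zero_object_Sh[OF z]] by simp
  moreover have "Neg C (Shm C (Zer C z ?y)) = Zer C (Sh C z) (Sh C ?y)"
    using zero_arr_Neg[of "Zer C (Sh C z) (Sh C ?y)"] by (simp add: zero_arr_def)
  ultimately have t: "(Zer C z ?y, Idt C ?y, Zer C ?y (Sh C z)) \<in> Tri C"
    using TR2[of "Zer C z ?y" "Idt C ?y" "Zer C ?y (Sh C z)"] by (simp add: candidate_def)
  have mf: "m \<cdot> f = Zer C (Dom C f) ?y"
    by (rule zero_arrD[OF zm]) simp_all
  have "\<exists>w \<in> Hom C (Dom C h) (Dom C (Zer C ?y (Sh C z))).
      w \<cdot> g = Idt C ?y \<cdot> m \<and> Shm C (Zer C (Dom C f) z) \<cdot> h = Zer C ?y (Sh C z) \<cdot> w"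
    by (rule TR3[OF tri t]) (simp_all add: mf)
  then obtain w where "w \<in> Arr C" "Dom C w = Dom C h" "Cod C w = ?y" "w \<cdot> g = m"
    by (elim bexE conjE) (rule that; simp)
  then show ?thesis using that by blast
qed

lemma is_iso_Shm: "is_iso C f \<Longrightarrow> is_iso C (Shm C f)"
proof -
  assume "is_iso C f"
  then obtain g where g: "inverses f g" using is_iso_iff by blast
  note [simp] = inverses_simps[OF g]
  have "inverses (Shm C f) (Shm C g)"
    using Shm_Cmp[of f "Dom C f" "Cod C f" g "Dom C f"] Shm_Cmp[of g "Cod C f" "Dom C f" f "Cod C f"]
    by (simp add: inverses_def Shm_Idt)
  then show ?thesis using is_iso_iff by blast
qed

lemma ex_desuspension:
  assumes "b \<in> Obj C"
  obtains a i where "a \<in> Obj C" "is_iso C i" "Dom C i = Sh C a" "Cod C i = b"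
  using Sh_ess_surj[OF assms] by auto

lemma ex_cone:
  assumes "f \<in> Arr C"
  obtains g h where "(f, g, h) \<in> Tri C"
  using TR1_cone[OF assms] by auto

text \<open>The cone of \<open>f\<close> is desuspended to obtain the fiber. As the suspension is
  merely an equivalence, this works up to the isomorphism \<open>i\<close>, which is then absorbed
  into the triangle.\<close>

lemma ex_fiber:
  assumes "f \<in> Arr C"
  obtains k h where "(k, f, h) \<in> Tri C"
proof -
  obtain g h where tri: "(f, g, h) \<in> Tri C" using ex_cone[OF assms] .
  note [simp] = Tri_simps[OF tri]
  obtain w i where i: "w \<in> Obj C" "is_iso C i" "Dom C i = Sh C w" "Cod C i = Dom C h"
    using ex_desuspension[of "Dom C h"] by auto
  note [simp] = i inv_simps[OF i(2)] is_iso_Arr[OF i(2)]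
  \<comment> \<open>The sign anticipates the one that TR2 puts on \<open>Shm C k\<close>.\<close>
  obtain k where k: "k \<in> Arr C" "Dom C k = w" "Cod C k = Dom C f" "Shm C k = Neg C (h \<cdot> i)"
    using Shm_full[of w "Dom C f" "Neg C (h \<cdot> i)"] by auto
  have "(f, inv_arr C i \<cdot> g, Neg C (Shm C k)) \<in> Tri C"
    by (rule Tri_iso[OF tri, of _ _ _ "Idt C (Dom C f)" "Idt C (Dom C g)" "inv_arr C i"])
      (use k in \<open>auto simp: candidate_def is_iso_Idt is_iso_inv Shm_Idt\<close>)
  then have "(k, f, inv_arr C i \<cdot> g) \<in> Tri C"
    using TR2[of k f "inv_arr C i \<cdot> g"] k by (simp add: candidate_def)
  then show ?thesis using that by blast
qed

text \<open>The suspension of \<open>i\<close> is a split monomorphism and annihilates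
  \<open>h\<close>, so \<open>h\<close> vanishes; then the identity of the cone lifts along
  \<open>g\<close>.\<close>

lemma Tri_split_section:
  assumes tri: "(i, g, h) \<in> Tri C" and p: "p \<in> Arr C" "Dom C p = Cod C i" "p \<cdot> i = Idt C (Dom C i)"
    and pc: "Cod C p = Dom C i"
  obtains s where "s \<in> Arr C" "Dom C s = Dom C h" "Cod C s = Dom C g" "g \<cdot> s = Idt C (Dom C h)"
proof -
  note [simp] = Tri_simps[OF tri] p pc
  let ?a = "Dom C i"
  have "zero_arr (Neg C (Shm C i) \<cdot> h)"
    using Tri_Cmp_zero[OF Tri_rotate[OF tri]] Tri_Cmp_zero[OF Tri_rotate[OF Tri_rotate[OF tri]]] by simp
  then have "zero_arr (Shm C i \<cdot> h)" by (simp add: Cmp_Neg)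
  moreover have "Shm C p \<cdot> Shm C i = Idt C (Sh C ?a)"
    using Shm_Cmp[of i ?a "Dom C g" p ?a] by (simp add: Shm_Idt)
  ultimately have "zero_arr h"
    using zero_arr_mono_split[of "Shm C i" h "Shm C p"] by simp
  then have "zero_arr (h \<cdot> Idt C (Dom C h))" by simp
  from Tri_lift[OF Tri_rotate[OF tri] _ _ this]
  obtain s0 where "s0 \<in> Arr C" "Dom C s0 = Dom C h" "Cod C s0 = Dom C g" "g \<cdot> s0 = Idt C (Dom C h)"
    by auto
  then show ?thesis by (rule that)
qed

text \<open>Retracts are what the arguments produce, while thickness is defined by direct sums; the
  cone of the inclusion supplies the complementary summand.\<close>

lemma Tri_split_complement:
  assumes tri: "(i, g, h) \<in> Tri C" and p: "p \<in> Arr C" "Dom C p = Cod C i" "p \<cdot> i = Idt C (Dom C i)"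
    and pc: "Cod C p = Dom C i"
  shows "is_direct_sum C (Dom C i) (Dom C h) (Cod C i)"
proof -
  note [simp] = Tri_simps[OF tri] p pc
  let ?a = "Dom C i" and ?X = "Dom C g" and ?b = "Dom C h"
  obtain s0 where s0: "s0 \<in> Arr C" "Dom C s0 = ?b" "Cod C s0 = ?X" "g \<cdot> s0 = Idt C ?b"
    using Tri_split_section[OF tri p pc] by blast
  note [simp] = s0
  have gi: "g \<cdot> i = Zer C ?a ?b"
    using Tri_Cmp_zero[OF tri] by (simp add: zero_arr_def)
  \<comment> \<open>The component along \<open>i\<close> is subtracted from \<open>s0\<close>: the
    corrected section is still split by \<open>g\<close> and is now annihilated by
    \<open>p\<close>.\<close>
  obtain s where s: "s \<in> Arr C" "Dom C s = ?b" "Cod C s = ?X" "s0 = (i \<cdot> (p \<cdot> s0)) \<boxplus> s"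
    using ex_difference[of s0 "i \<cdot> (p \<cdot> s0)"] by auto
  note [simp] = s(1-3)
  have gs: "g \<cdot> s = Idt C ?b"
  proof -
    have "g \<cdot> ((i \<cdot> (p \<cdot> s0)) \<boxplus> s) = (g \<cdot> (i \<cdot> (p \<cdot> s0))) \<boxplus> (g \<cdot> s)"
      by (subst Cmp_Add) auto
    also have "\<dots> = g \<cdot> s" by (simp add: Cmp_eq_Cmp[OF gi])
    finally show ?thesis using s(4) s0(4) by metis
  qed
  have ps: "p \<cdot> s = Zer C ?b ?a"
  proof -
    have "p \<cdot> ((i \<cdot> (p \<cdot> s0)) \<boxplus> s) = (p \<cdot> (i \<cdot> (p \<cdot> s0))) \<boxplus> (p \<cdot> s)"
      by (subst Cmp_Add) auto
    also have "\<dots> = (p \<cdot> s0) \<boxplus> (p \<cdot> s)" by (simp add: Cmp_eq_Cmp[OF p(3)])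
    finally have "(p \<cdot> s0) \<boxplus> (p \<cdot> s) = p \<cdot> s0" using s(4) by metis
    then show ?thesis using Add_cancel[of "p \<cdot> s0" "p \<cdot> s"] by simp
  qed
  have id: "Idt C ?X = (i \<cdot> p) \<boxplus> (s \<cdot> g)"
  proof -
    \<comment> \<open>The defect \<open>k\<close> is annihilated by \<open>g\<close>, so it factors
      through \<open>i\<close>; it is annihilated by \<open>p\<close> as well, so that factor is
      zero.\<close>
    obtain k where k: "k \<in> Arr C" "Dom C k = ?X" "Cod C k = ?X" "Idt C ?X = ((i \<cdot> p) \<boxplus> (s \<cdot> g)) \<boxplus> k"
      using ex_difference[of "Idt C ?X" "(i \<cdot> p) \<boxplus> (s \<cdot> g)"] by auto
    note [simp] = k(1-3)
    have "g \<cdot> (((i \<cdot> p) \<boxplus> (s \<cdot> g)) \<boxplus> k) = g \<boxplus> (g \<cdot> k)"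
      by (simp add: Cmp_eq_Cmp[OF gi] Cmp_eq_Cmp[OF gs])
    moreover have "g \<cdot> (((i \<cdot> p) \<boxplus> (s \<cdot> g)) \<boxplus> k) = g" using k(4) by (metis Cmp_Idt Tri_simps(2)[OF tri])
    ultimately have "zero_arr (g \<cdot> k)" using Add_cancel[of g "g \<cdot> k"] by (simp add: zero_arr_def)
    from Tri_lift[OF tri _ _ this] obtain t where t: "t \<in> Arr C" "Dom C t = ?X" "Cod C t = ?a" "i \<cdot> t = k"
      by auto
    have "p \<cdot> (((i \<cdot> p) \<boxplus> (s \<cdot> g)) \<boxplus> k) = p \<boxplus> (p \<cdot> k)"
      by (simp add: Cmp_eq_Cmp[OF p(3)] Cmp_eq_Cmp[OF ps])
    moreover have "p \<cdot> (((i \<cdot> p) \<boxplus> (s \<cdot> g)) \<boxplus> k) = p" using k(4) p by (metis Cmp_Idt Tri_simps(4)[OF tri])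
    ultimately have pk: "p \<cdot> k = Zer C ?X ?a" using Add_cancel[of p "p \<cdot> k"] by simp
    have "p \<cdot> k = t" using t Cmp_eq_Cmp[OF p(3), of t] by simp
    then have "k = Zer C ?X ?X" using pk t by auto
    then show ?thesis using k(4) by simp
  qed
  let ?inc = "\<lambda>c. if c then i else s"
  have "is_coproduct C (UNIV :: bool set) (\<lambda>c. if c then ?a else ?b) ?X ?inc"
    unfolding is_coproduct_def
  proof (intro conjI ballI allI impI)
    fix Y f assume Y: "Y \<in> Obj C" and f: "\<forall>c\<in>UNIV. f c \<in> Hom C (if c then ?a else ?b) Y"
    have [simp]: "f True \<in> Arr C" "Dom C (f True) = ?a" "Cod C (f True) = Y"
      "f False \<in> Arr C" "Dom C (f False) = ?b" "Cod C (f False) = Y"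
      using bspec[OF f, of True] bspec[OF f, of False] by simp_all
    show "\<exists>!k. k \<in> Hom C ?X Y \<and> (\<forall>c\<in>UNIV. k \<cdot> ?inc c = f c)"
    proof (rule ex1I[of _ "(f True \<cdot> p) \<boxplus> (f False \<cdot> g)"])
      show "(f True \<cdot> p) \<boxplus> (f False \<cdot> g) \<in> Hom C ?X Y \<and>
          (\<forall>c\<in>UNIV. ((f True \<cdot> p) \<boxplus> (f False \<cdot> g)) \<cdot> ?inc c = f c)"
        using gi gs ps Y by (auto simp: all_bool_eq)
    next
      fix k assume k: "k \<in> Hom C ?X Y \<and> (\<forall>c\<in>UNIV. k \<cdot> ?inc c = f c)"
      then have "k \<cdot> i = f True" "k \<cdot> s = f False" by (metis UNIV_I)+
      moreover have "k = k \<cdot> ((i \<cdot> p) \<boxplus> (s \<cdot> g))" using k id by (metis Cmp_Idt in_Hom)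
      ultimately show "k = (f True \<cdot> p) \<boxplus> (f False \<cdot> g)"
        using k by (simp flip: Cmp_Cmp)
    qed
  qed simp_all
  then show ?thesis unfolding is_direct_sum_def by auto
qed

end

section \<open>Symmetric monoidal and tensor-triangulated categories\<close>

context category
begin

text \<open>Isomorphism in the category of arrows. Vanishing, factoring through an ideal and
  splitting are invariant under it, so tensor factors can be permuted and reassociated without
  tracking coherence isomorphisms.\<close>

definition arr_iso :: "'m \<Rightarrow> 'm \<Rightarrow> bool" where
  "arr_iso f g \<longleftrightarrow> f \<in> Arr C \<and> g \<in> Arr C \<and>
     (\<exists>i j. is_iso C i \<and> is_iso C j \<and> Dom C i = Dom C f \<and> Cod C i = Dom C g \<and>
            Dom C j = Cod C f \<and> Cod C j = Cod C g \<and> g \<cdot> i = j \<cdot> f)"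

lemma arr_isoI:
  "\<lbrakk>g \<cdot> i = j \<cdot> f; is_iso C i; is_iso C j; f \<in> Arr C; g \<in> Arr C; Dom C i = Dom C f;
    Cod C i = Dom C g; Dom C j = Cod C f; Cod C j = Cod C g\<rbrakk> \<Longrightarrow> arr_iso f g"
  unfolding arr_iso_def by blast

lemma arr_isoE:
  assumes "arr_iso f g"
  obtains i j where "is_iso C i" "is_iso C j" "Dom C i = Dom C f" "Cod C i = Dom C g"
    "Dom C j = Cod C f" "Cod C j = Cod C g" "g \<cdot> i = j \<cdot> f" "f \<in> Arr C" "g \<in> Arr C"
    "i \<in> Arr C" "j \<in> Arr C"
  using assms is_iso_Arr unfolding arr_iso_def by blast

lemma arr_iso_refl: "f \<in> Arr C \<Longrightarrow> arr_iso f f"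
  by (rule arr_isoI[of _ "Idt C (Dom C f)" "Idt C (Cod C f)"]) (auto simp: is_iso_Idt)

lemma arr_iso_sym: "arr_iso f g \<Longrightarrow> arr_iso g f"
proof (elim arr_isoE)
  fix i j assume a: "is_iso C i" "is_iso C j" "Dom C i = Dom C f" "Cod C i = Dom C g"
    "Dom C j = Cod C f" "Cod C j = Cod C g" "g \<cdot> i = j \<cdot> f" "f \<in> Arr C" "g \<in> Arr C"
    "i \<in> Arr C" "j \<in> Arr C"
  note [simp] = a(3-6,8-11) inv_simps[OF a(1)] inv_simps[OF a(2)]
  have "inv_arr C j \<cdot> g = inv_arr C j \<cdot> ((g \<cdot> i) \<cdot> inv_arr C i)" by simp
  also have "\<dots> = f \<cdot> inv_arr C i" unfolding a(7) by simp
  finally have "f \<cdot> inv_arr C i = inv_arr C j \<cdot> g" ..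
  then show "arr_iso g f"
    by (rule arr_isoI) (use a is_iso_inv in simp_all)
qed

lemma arr_iso_trans [trans]: "arr_iso f g \<Longrightarrow> arr_iso g h \<Longrightarrow> arr_iso f h"
proof (elim arr_isoE)
  fix i j k l assume a: "is_iso C i" "is_iso C j" "Dom C i = Dom C f" "Cod C i = Dom C g"
    "Dom C j = Cod C f" "Cod C j = Cod C g" "g \<cdot> i = j \<cdot> f" "f \<in> Arr C" "g \<in> Arr C"
    "i \<in> Arr C" "j \<in> Arr C"
    and b: "is_iso C k" "is_iso C l" "Dom C k = Dom C g" "Cod C k = Dom C h"
    "Dom C l = Cod C g" "Cod C l = Cod C h" "h \<cdot> k = l \<cdot> g" "h \<in> Arr C"
    "k \<in> Arr C" "l \<in> Arr C"
  have "h \<cdot> (k \<cdot> i) = (l \<cdot> j) \<cdot> f"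
    using a b Cmp_eq_Cmp[OF b(7), of i] by simp
  then show "arr_iso f h"
    by (rule arr_isoI) (use a b is_iso_Cmp in simp_all)
qed

lemma arr_iso_Cmp_iso_right:
  assumes "f \<in> Arr C" "is_iso C i" "Cod C i = Dom C f"
  shows "arr_iso (f \<cdot> i) f"
  by (rule arr_isoI[of _ i "Idt C (Cod C f)"]) (use assms is_iso_Arr in \<open>auto simp: is_iso_Idt\<close>)

definition split_mono :: "'m \<Rightarrow> bool" where
  "split_mono f \<longleftrightarrow> f \<in> Arr C \<and> (\<exists>p\<in>Arr C. Dom C p = Cod C f \<and> Cod C p = Dom C f \<and> p \<cdot> f = Idt C (Dom C f))"

definition split_epi :: "'m \<Rightarrow> bool" where
  "split_epi f \<longleftrightarrow> f \<in> Arr C \<and> (\<exists>s\<in>Arr C. Dom C s = Cod C f \<and> Cod C s = Dom C f \<and> f \<cdot> s = Idt C (Cod C f))"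

lemma split_mono_arr_iso:
  assumes "arr_iso f g" "split_mono f"
  shows "split_mono g"
proof -
  from assms(1) obtain i j where a: "is_iso C i" "is_iso C j" "Dom C i = Dom C f" "Cod C i = Dom C g"
    "Dom C j = Cod C f" "Cod C j = Cod C g" "g \<cdot> i = j \<cdot> f" "f \<in> Arr C" "g \<in> Arr C"
    "i \<in> Arr C" "j \<in> Arr C" by (rule arr_isoE)
  from assms(2) obtain p where p: "p \<in> Arr C" "Dom C p = Cod C f" "Cod C p = Dom C f" "p \<cdot> f = Idt C (Dom C f)"
    unfolding split_mono_def by blast
  note [simp] = a(3-6,8-11) inv_simps[OF a(1)] inv_simps[OF a(2)] p
  have "g = (g \<cdot> i) \<cdot> inv_arr C i" by simp
  also have "\<dots> = j \<cdot> (f \<cdot> inv_arr C i)" unfolding a(7) by simp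
  finally have "(i \<cdot> (p \<cdot> inv_arr C j)) \<cdot> g = (i \<cdot> (p \<cdot> inv_arr C j)) \<cdot> (j \<cdot> (f \<cdot> inv_arr C i))"
    by (rule arg_cong)
  also have "\<dots> = Idt C (Dom C g)" by (simp add: Cmp_eq_Cmp[OF p(4)])
  finally show ?thesis
    unfolding split_mono_def by (intro conjI bexI[of _ "i \<cdot> (p \<cdot> inv_arr C j)"]) simp_all
qed

lemma coproduct_simps:
  assumes "is_coproduct C I x X inc"
  shows "X \<in> Obj C" "i \<in> I \<Longrightarrow> x i \<in> Obj C" "i \<in> I \<Longrightarrow> inc i \<in> Arr C"
    "i \<in> I \<Longrightarrow> Dom C (inc i) = x i" "i \<in> I \<Longrightarrow> Cod C (inc i) = X"
  using assms unfolding is_coproduct_def by auto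

lemma coproduct_desc:
  assumes "is_coproduct C I x X inc" "Y \<in> Obj C"
    "\<And>i. i \<in> I \<Longrightarrow> f i \<in> Arr C \<and> Dom C (f i) = x i \<and> Cod C (f i) = Y"
  obtains h where "h \<in> Arr C" "Dom C h = X" "Cod C h = Y" "\<And>i. i \<in> I \<Longrightarrow> h \<cdot> inc i = f i"
proof -
  have "\<forall>i\<in>I. f i \<in> Hom C (x i) Y" using assms(3) by simp
  then have "\<exists>!h. h \<in> Hom C X Y \<and> (\<forall>i\<in>I. h \<cdot> inc i = f i)"
    using assms(1,2) unfolding is_coproduct_def by blast
  then show ?thesis using that by auto
qed

lemma coproduct_eqI:
  assumes "is_coproduct C I x X inc" "h \<in> Arr C" "h' \<in> Arr C" "Dom C h = X" "Dom C h' = X"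
    "Cod C h = Cod C h'" "\<And>i. i \<in> I \<Longrightarrow> h \<cdot> inc i = h' \<cdot> inc i"
  shows "h = h'"
proof -
  have "\<forall>i\<in>I. h' \<cdot> inc i \<in> Hom C (x i) (Cod C h')" "Cod C h' \<in> Obj C"
    using assms coproduct_simps[OF assms(1)] by auto
  note H = this
  have "\<exists>!k. k \<in> Hom C X (Cod C h') \<and> (\<forall>i\<in>I. k \<cdot> inc i = h' \<cdot> inc i)"
    by (rule bspec[OF conjunct2[OF conjunct2[OF assms(1)[unfolded is_coproduct_def]]], THEN spec, THEN mp])
      (fact H)+
  moreover have "h \<in> Hom C X (Cod C h') \<and> (\<forall>i\<in>I. h \<cdot> inc i = h' \<cdot> inc i)"
    "h' \<in> Hom C X (Cod C h') \<and> (\<forall>i\<in>I. h' \<cdot> inc i = h' \<cdot> inc i)"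
    using assms(2-7) by simp_all
  ultimately show ?thesis by blast
qed

end

section \<open>Tensor products of arrows and the action of arrows from and to the unit\<close>

context symmetric_monoidal_category
begin

lemma Unt_simps [simp]: "Unt C \<in> Obj C"
  by (rule Unt_Obj)

lemma Ten_simps [simp]:
  "x \<in> Obj C \<Longrightarrow> y \<in> Obj C \<Longrightarrow> x \<boxtimes> y \<in> Obj C"
  "f \<in> Arr C \<Longrightarrow> g \<in> Arr C \<Longrightarrow> f \<boxdot> g \<in> Arr C"
  "f \<in> Arr C \<Longrightarrow> g \<in> Arr C \<Longrightarrow> Dom C (f \<boxdot> g) = Dom C f \<boxtimes> Dom C g"
  "f \<in> Arr C \<Longrightarrow> g \<in> Arr C \<Longrightarrow> Cod C (f \<boxdot> g) = Cod C f \<boxtimes> Cod C g"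
  using Ten_Obj Tenm_Hom[of f "Dom C f" "Cod C f" g "Dom C g" "Cod C g"] by simp_all

lemma structure_simps [simp]:
  assumes "x \<in> Obj C"
  shows "Lun C x \<in> Arr C" "Dom C (Lun C x) = Unt C \<boxtimes> x" "Cod C (Lun C x) = x"
    "Run C x \<in> Arr C" "Dom C (Run C x) = x \<boxtimes> Unt C" "Cod C (Run C x) = x"
    "is_iso C (Lun C x)" "is_iso C (Run C x)"
    "y \<in> Obj C \<Longrightarrow> Sym C x y \<in> Arr C" "y \<in> Obj C \<Longrightarrow> Dom C (Sym C x y) = x \<boxtimes> y"
    "y \<in> Obj C \<Longrightarrow> Cod C (Sym C x y) = y \<boxtimes> x"
    "y \<in> Obj C \<Longrightarrow> z \<in> Obj C \<Longrightarrow> Asc C x y z \<in> Arr C"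
    "y \<in> Obj C \<Longrightarrow> z \<in> Obj C \<Longrightarrow> Dom C (Asc C x y z) = (x \<boxtimes> y) \<boxtimes> z"
    "y \<in> Obj C \<Longrightarrow> z \<in> Obj C \<Longrightarrow> Cod C (Asc C x y z) = x \<boxtimes> (y \<boxtimes> z)"
    "y \<in> Obj C \<Longrightarrow> z \<in> Obj C \<Longrightarrow> is_iso C (Asc C x y z)"
  using assms Lun_Hom[of x] Run_Hom[of x] Sym_Hom[of x y] Asc_Hom[of x y z]
  by (simp_all add: Lun_iso Run_iso Asc_iso)

lemma is_iso_Sym [simp]: "x \<in> Obj C \<Longrightarrow> y \<in> Obj C \<Longrightarrow> is_iso C (Sym C x y)"
  unfolding is_iso_iff inverses_def using Sym_Sym[of x y] Sym_Sym[of y x]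
  by (intro exI[of _ "Sym C y x"]) simp

lemma Tenm_Idt_Idt [simp]: "x \<in> Obj C \<Longrightarrow> y \<in> Obj C \<Longrightarrow> Idt C x \<boxdot> Idt C y = Idt C (x \<boxtimes> y)"
  by (rule Tenm_Idt)

lemma Tenm_Tenm:
  "\<lbrakk>f \<in> Arr C; f' \<in> Arr C; g \<in> Arr C; g' \<in> Arr C; Cod C f = Dom C f'; Cod C g = Dom C g'\<rbrakk>
    \<Longrightarrow> (f' \<boxdot> g') \<cdot> (f \<boxdot> g) = (f' \<cdot> f) \<boxdot> (g' \<cdot> g)"
  by (rule Tenm_Cmp[symmetric]) auto

lemma Ten_left_Cmp:
  "\<lbrakk>f \<in> Arr C; g \<in> Arr C; Cod C f = Dom C g; w \<in> Obj C\<rbrakk>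
    \<Longrightarrow> Idt C w \<boxdot> (g \<cdot> f) = (Idt C w \<boxdot> g) \<cdot> (Idt C w \<boxdot> f)"
  by (simp add: Tenm_Tenm)

lemma Ten_right_Cmp:
  "\<lbrakk>f \<in> Arr C; g \<in> Arr C; Cod C f = Dom C g; w \<in> Obj C\<rbrakk>
    \<Longrightarrow> (g \<cdot> f) \<boxdot> Idt C w = (g \<boxdot> Idt C w) \<cdot> (f \<boxdot> Idt C w)"
  by (simp add: Tenm_Tenm)

lemma inverses_Tenm:
  assumes "inverses f f'" "inverses g g'"
  shows "inverses (f \<boxdot> g) (f' \<boxdot> g')"
  using inverses_simps[OF assms(1)] inverses_simps[OF assms(2)]
  by (simp add: inverses_def Tenm_Tenm)

lemma is_iso_Tenm [simp]: "is_iso C f \<Longrightarrow> is_iso C g \<Longrightarrow> is_iso C (f \<boxdot> g)"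
  using inverses_Tenm is_iso_iff by metis

lemma is_iso_Idt' [simp]: "a \<in> Obj C \<Longrightarrow> is_iso C (Idt C a)"
  by (rule is_iso_Idt)

lemma arr_iso_Tenm:
  assumes "arr_iso f f'" "arr_iso g g'"
  shows "arr_iso (f \<boxdot> g) (f' \<boxdot> g')"
proof -
  from assms(1) obtain i j where a: "is_iso C i" "is_iso C j" "Dom C i = Dom C f" "Cod C i = Dom C f'"
    "Dom C j = Cod C f" "Cod C j = Cod C f'" "f' \<cdot> i = j \<cdot> f" "f \<in> Arr C" "f' \<in> Arr C"
    "i \<in> Arr C" "j \<in> Arr C" by (rule arr_isoE)
  from assms(2) obtain k l where b: "is_iso C k" "is_iso C l" "Dom C k = Dom C g" "Cod C k = Dom C g'"
    "Dom C l = Cod C g" "Cod C l = Cod C g'" "g' \<cdot> k = l \<cdot> g" "g \<in> Arr C" "g' \<in> Arr C"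
    "k \<in> Arr C" "l \<in> Arr C" by (rule arr_isoE)
  show ?thesis
    by (rule arr_isoI[of _ "i \<boxdot> k" "j \<boxdot> l"]) (use a b in \<open>auto simp: Tenm_Tenm\<close>)
qed

lemma arr_iso_Sym: "f \<in> Arr C \<Longrightarrow> g \<in> Arr C \<Longrightarrow> arr_iso (f \<boxdot> g) (g \<boxdot> f)"
  by (rule arr_isoI[of _ "Sym C (Dom C f) (Dom C g)" "Sym C (Cod C f) (Cod C g)"])
    (auto simp: Sym_natural[of f "Dom C f" "Cod C f" g "Dom C g" "Cod C g"])

lemma arr_iso_Asc: "f \<in> Arr C \<Longrightarrow> g \<in> Arr C \<Longrightarrow> h \<in> Arr C \<Longrightarrow> arr_iso ((f \<boxdot> g) \<boxdot> h) (f \<boxdot> (g \<boxdot> h))"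
  by (rule arr_isoI[of _ "Asc C (Dom C f) (Dom C g) (Dom C h)" "Asc C (Cod C f) (Cod C g) (Cod C h)"])
    (auto simp: Asc_natural[of f "Dom C f" "Cod C f" g "Dom C g" "Cod C g" h "Dom C h" "Cod C h"])

lemma arr_iso_Lun: "f \<in> Arr C \<Longrightarrow> arr_iso (Idt C (Unt C) \<boxdot> f) f"
  by (rule arr_isoI[of _ "Lun C (Dom C f)" "Lun C (Cod C f)"])
    (auto simp: Lun_natural[of f "Dom C f" "Cod C f"])

lemma arr_iso_Ten_right:
  "\<theta> \<in> Arr C \<Longrightarrow> y \<in> Obj C \<Longrightarrow> z \<in> Obj C \<Longrightarrow> arr_iso ((\<theta> \<boxdot> Idt C y) \<boxdot> Idt C z) (\<theta> \<boxdot> Idt C (y \<boxtimes> z))"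
  using arr_iso_Asc[of \<theta> "Idt C y" "Idt C z"] by simp

lemma arr_iso_Ten_left:
  assumes "\<theta> \<in> Arr C" "y \<in> Obj C" "z \<in> Obj C"
  shows "arr_iso ((\<theta> \<boxdot> Idt C y) \<boxdot> Idt C z) (\<theta> \<boxdot> Idt C (z \<boxtimes> y))"
proof -
  have "arr_iso (\<theta> \<boxdot> Idt C (y \<boxtimes> z)) (\<theta> \<boxdot> Idt C (z \<boxtimes> y))"
    by (rule arr_isoI[of _ "Idt C (Dom C \<theta>) \<boxdot> Sym C y z" "Idt C (Cod C \<theta>) \<boxdot> Sym C y z"])
      (use assms in \<open>auto simp: Tenm_Tenm\<close>)
  then show ?thesis using arr_iso_Ten_right[OF assms] arr_iso_trans by blast
qed

lemma arr_iso_Ten_mid: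
  assumes "\<theta> \<in> Arr C" "y \<in> Obj C" "z \<in> Obj C"
  shows "arr_iso ((\<theta> \<boxdot> Idt C y) \<boxdot> Idt C z) ((\<theta> \<boxdot> Idt C z) \<boxdot> Idt C y)"
  using arr_iso_Ten_left[of \<theta> y z] arr_iso_sym[OF arr_iso_Ten_right[of \<theta> z y]] assms arr_iso_trans
  by blast

text \<open>An arrow from the unit to v acts on every object \<open>y\<close> as an arrow from
  \<open>y\<close> to v \<open>\<boxtimes>\<close> \<open>y\<close>, naturally in \<open>y\<close>;
  dually an arrow to the unit acts by \<open>coact\<close>. In this way one arrow is applied to all
  objects at once.\<close>

definition act :: "'m \<Rightarrow> 'o \<Rightarrow> 'm" where
  "act \<theta> y = (\<theta> \<boxdot> Idt C y) \<cdot> inv_arr C (Lun C y)"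

definition coact :: "'m \<Rightarrow> 'o \<Rightarrow> 'm" where
  "coact \<kappa> y = Lun C y \<cdot> (\<kappa> \<boxdot> Idt C y)"

lemma Lun_inv_simps [simp]:
  assumes "y \<in> Obj C"
  shows "inv_arr C (Lun C y) \<in> Arr C" "Dom C (inv_arr C (Lun C y)) = y"
    "Cod C (inv_arr C (Lun C y)) = Unt C \<boxtimes> y"
    "is_iso C (inv_arr C (Lun C y))"
    "inv_arr C (Lun C y) \<cdot> Lun C y = Idt C (Unt C \<boxtimes> y)" "Lun C y \<cdot> inv_arr C (Lun C y) = Idt C y"
    "x \<in> Arr C \<Longrightarrow> Cod C x = Unt C \<boxtimes> y \<Longrightarrow> inv_arr C (Lun C y) \<cdot> (Lun C y \<cdot> x) = x"
    "x \<in> Arr C \<Longrightarrow> Cod C x = y \<Longrightarrow> Lun C y \<cdot> (inv_arr C (Lun C y) \<cdot> x) = x"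
  using inv_simps[of "Lun C y"] assms by (auto simp: is_iso_inv)

lemma act_simps [simp]:
  assumes "\<theta> \<in> Arr C" "Dom C \<theta> = Unt C" "y \<in> Obj C"
  shows "act \<theta> y \<in> Arr C" "Dom C (act \<theta> y) = y" "Cod C (act \<theta> y) = Cod C \<theta> \<boxtimes> y"
  using assms by (simp_all add: act_def)

lemma coact_simps [simp]:
  assumes "\<kappa> \<in> Arr C" "Cod C \<kappa> = Unt C" "y \<in> Obj C"
  shows "coact \<kappa> y \<in> Arr C" "Dom C (coact \<kappa> y) = Dom C \<kappa> \<boxtimes> y" "Cod C (coact \<kappa> y) = y"
  using assms by (simp_all add: coact_def)

lemma arr_iso_act:
  "\<theta> \<in> Arr C \<Longrightarrow> Dom C \<theta> = Unt C \<Longrightarrow> y \<in> Obj C \<Longrightarrow> arr_iso (act \<theta> y) (\<theta> \<boxdot> Idt C y)"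
  unfolding act_def by (rule arr_iso_Cmp_iso_right) simp_all

lemma Lun_inv_natural:
  assumes "m \<in> Arr C" "Dom C m = y" "Cod C m = z"
  shows "inv_arr C (Lun C z) \<cdot> m = (Idt C (Unt C) \<boxdot> m) \<cdot> inv_arr C (Lun C y)"
proof -
  have o: "y \<in> Obj C" "z \<in> Obj C" using assms by auto
  have "inv_arr C (Lun C z) \<cdot> (Lun C z \<cdot> ((Idt C (Unt C) \<boxdot> m) \<cdot> inv_arr C (Lun C y))) =
      inv_arr C (Lun C z) \<cdot> ((m \<cdot> Lun C y) \<cdot> inv_arr C (Lun C y))"
    using assms o by (simp add: Cmp_eq_Cmp[OF Lun_natural[of m y z]])
  then show ?thesis using assms o by simp
qed

lemma act_natural:
  assumes "m \<in> Arr C" "Dom C m = y" "Cod C m = z" "\<theta> \<in> Arr C" "Dom C \<theta> = Unt C" "Cod C \<theta> = v"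
  shows "act \<theta> z \<cdot> m = (Idt C v \<boxdot> m) \<cdot> act \<theta> y"
proof -
  have o: "y \<in> Obj C" "z \<in> Obj C" "v \<in> Obj C" using assms by auto
  have eq: "(\<theta> \<boxdot> Idt C z) \<cdot> (Idt C (Unt C) \<boxdot> m) = (Idt C v \<boxdot> m) \<cdot> (\<theta> \<boxdot> Idt C y)"
    using assms o by (simp add: Tenm_Tenm)
  show ?thesis
    using assms o by (simp add: act_def Lun_inv_natural[of m y z] Cmp_eq_Cmp[OF eq])
qed

lemma coact_natural:
  assumes "m \<in> Arr C" "Dom C m = y" "Cod C m = z" "\<kappa> \<in> Arr C" "Cod C \<kappa> = Unt C" "Dom C \<kappa> = u"
  shows "m \<cdot> coact \<kappa> y = coact \<kappa> z \<cdot> (Idt C u \<boxdot> m)"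
proof -
  have o: "y \<in> Obj C" "z \<in> Obj C" "u \<in> Obj C" using assms by auto
  have "(\<kappa> \<boxdot> Idt C z) \<cdot> (Idt C u \<boxdot> m) = (Idt C (Unt C) \<boxdot> m) \<cdot> (\<kappa> \<boxdot> Idt C y)"
    using assms o by (simp add: Tenm_Tenm)
  then show ?thesis
    using assms o Cmp_eq_Cmp[OF Lun_natural[of m y z], of "\<kappa> \<boxdot> Idt C y"] by (simp add: coact_def)
qed

end

context additive_category
begin

lemma zero_arr_arr_iso: "arr_iso f g \<Longrightarrow> zero_arr f \<longleftrightarrow> zero_arr g"
  by (elim arr_isoE) (metis zero_arr_iso_left zero_arr_iso_right)

lemma zero_arr_Cmp_split_epi: "zero_arr (f \<cdot> p) \<Longrightarrow> split_epi p \<Longrightarrow> f \<in> Arr C \<Longrightarrow> Cod C p = Dom C f \<Longrightarrow> zero_arr f"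
  unfolding split_epi_def using zero_arr_epi_split by metis

end

section \<open>Exactness of the tensor product and suspensions of the unit\<close>

context tt_category
begin

lemma Tenm_Zer_left: "a \<in> Obj C \<Longrightarrow> b \<in> Obj C \<Longrightarrow> g \<in> Arr C \<Longrightarrow>
    Zer C a b \<boxdot> g = Zer C (a \<boxtimes> Dom C g) (b \<boxtimes> Cod C g)"
  using Tenm_Add[of "Zer C a b" a b "Zer C a b" g "Dom C g" "Cod C g"]
    Add_cancel[of "Zer C a b \<boxdot> g" "Zer C a b \<boxdot> g"] by simp

lemma zero_arr_Tenm_left: "zero_arr f \<Longrightarrow> f \<in> Arr C \<Longrightarrow> g \<in> Arr C \<Longrightarrow> zero_arr (f \<boxdot> g)"
  using Tenm_Zer_left[of "Dom C f" "Cod C f" g] by (metis zero_arr_def Obj_Cod Obj_Dom Ten_simps(1) zero_arr_Zer)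

lemma zero_arr_Tenm_right: "zero_arr g \<Longrightarrow> f \<in> Arr C \<Longrightarrow> g \<in> Arr C \<Longrightarrow> zero_arr (f \<boxdot> g)"
  using zero_arr_Tenm_left zero_arr_arr_iso arr_iso_Sym by blast

lemma Tri_Ten_right:
  assumes "(f, g, h) \<in> Tri C" "w \<in> Obj C"
  obtains h' where "(f \<boxdot> Idt C w, g \<boxdot> Idt C w, h') \<in> Tri C" "Dom C h' = Dom C h \<boxtimes> w"
  using Ten_exact[OF assms] Tri_simps[OF Ten_exact[OF assms]] Tri_simps[OF assms(1)] assms(2) that
  by simp

lemma Tri_Ten_left:
  assumes tri: "(f, g, h) \<in> Tri C" and w: "w \<in> Obj C"
  obtains h' where "(Idt C w \<boxdot> f, Idt C w \<boxdot> g, h') \<in> Tri C" "Dom C h' = w \<boxtimes> Dom C h"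
proof -
  obtain h1 where h1: "(f \<boxdot> Idt C w, g \<boxdot> Idt C w, h1) \<in> Tri C" "Dom C h1 = Dom C h \<boxtimes> w"
    using Tri_Ten_right[OF assms] .
  note [simp] = Tri_simps[OF tri] w Tri_simps(3)[OF h1(1)]
  have c1: "Cod C h1 = Sh C (Dom C f \<boxtimes> w)" using Tri_simps(6)[OF h1(1)] by simp
  let ?s = "Shm C (Sym C (Dom C f) w)" and ?h' = "Shm C (Sym C (Dom C f) w) \<cdot> (h1 \<cdot> Sym C w (Dom C h))"
  have h'[simp]: "?h' \<in> Arr C" "Dom C ?h' = w \<boxtimes> Dom C h" "Cod C ?h' = Sh C (w \<boxtimes> Dom C f)"
    using h1(2) c1 by simp_all
  have "(Idt C w \<boxdot> f, Idt C w \<boxdot> g, ?h') \<in> Tri C"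
  proof (rule Tri_iso[OF h1(1), of _ _ _ "Sym C (Dom C f) w" "Sym C (Dom C g) w" "Sym C (Dom C h) w"])
    show "candidate C (Idt C w \<boxdot> f) (Idt C w \<boxdot> g) ?h'" using h' by (simp add: candidate_def)
    show "Sym C (Dom C g) w \<cdot> (f \<boxdot> Idt C w) = (Idt C w \<boxdot> f) \<cdot> Sym C (Dom C f) w"
      by (rule Sym_natural) simp_all
    show "Sym C (Dom C h) w \<cdot> (g \<boxdot> Idt C w) = (Idt C w \<boxdot> g) \<cdot> Sym C (Dom C g) w"
      by (rule Sym_natural) simp_all
    show "?s \<cdot> h1 = ?h' \<cdot> Sym C (Dom C h) w"
      using h1(2) c1 by (simp add: Sym_Sym)
  qed (use h1(2) h' in simp_all)
  then show ?thesis using that h'(2) by blast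
qed

text \<open>The triangle tensored with \<open>y\<close>, with the unit factor removed in the middle
  term; it describes which arrows into \<open>y\<close> are annihilated by the action of \<theta>
  and which arrows out of \<open>y\<close> vanish on \<kappa>.\<close>

lemma Tri_act:
  assumes tri: "(\<kappa>, \<theta>, h) \<in> Tri C" and d: "Dom C \<theta> = Unt C" and y: "y \<in> Obj C"
  obtains h' where "(coact \<kappa> y, act \<theta> y, h') \<in> Tri C" "Dom C h' = Cod C \<theta> \<boxtimes> y"
proof -
  obtain h1 where h1: "(\<kappa> \<boxdot> Idt C y, \<theta> \<boxdot> Idt C y, h1) \<in> Tri C" "Dom C h1 = Dom C h \<boxtimes> y"
    using Tri_Ten_right[OF tri y] .
  note [simp] = Tri_simps[OF tri] y d Tri_simps(3)[OF h1(1)]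
  have c1: "Cod C h1 = Sh C (Dom C \<kappa> \<boxtimes> y)" using Tri_simps(6)[OF h1(1)] by simp
  have [simp]: "Cod C \<kappa> = Unt C" using d Tri_simps(4)[OF tri] by simp
  have "(coact \<kappa> y, act \<theta> y, h1) \<in> Tri C"
    by (rule Tri_iso[OF h1(1), of _ _ _ "Idt C (Dom C \<kappa> \<boxtimes> y)" "Lun C y" "Idt C (Dom C h \<boxtimes> y)"])
      (simp_all add: candidate_def h1(2) c1 Shm_Idt act_def coact_def)
  then show ?thesis using that h1(2) by simp
qed

lemma isomorphic_Ten:
  assumes "isomorphic a a'" "isomorphic b b'"
  shows "isomorphic (a \<boxtimes> b) (a' \<boxtimes> b')"
  using assms unfolding isomorphic_def by (metis is_iso_Tenm Ten_simps(3,4) is_iso_Arr)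

lemma isomorphic_refl: "a \<in> Obj C \<Longrightarrow> isomorphic a a"
  using isomorphicI[of "Idt C a"] by simp

lemma isomorphic_Sym: "x \<in> Obj C \<Longrightarrow> y \<in> Obj C \<Longrightarrow> isomorphic (x \<boxtimes> y) (y \<boxtimes> x)"
  using isomorphicI[of "Sym C x y"] by simp

lemma isomorphic_Asc: "x \<in> Obj C \<Longrightarrow> y \<in> Obj C \<Longrightarrow> z \<in> Obj C \<Longrightarrow>
    isomorphic ((x \<boxtimes> y) \<boxtimes> z) (x \<boxtimes> (y \<boxtimes> z))"
  using isomorphicI[of "Asc C x y z"] by simp

lemma isomorphic_Lun: "x \<in> Obj C \<Longrightarrow> isomorphic (Unt C \<boxtimes> x) x"
  using isomorphicI[of "Lun C x"] by simp

lemma isomorphic_Sh: "isomorphic a b \<Longrightarrow> isomorphic (Sh C a) (Sh C b)"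
  unfolding isomorphic_def by (metis is_iso_Shm Sh_simps(3,4) is_iso_Arr)

lemma isomorphic_Ten_Sh:
  assumes [simp]: "x \<in> Obj C" "y \<in> Obj C"
  shows "isomorphic (Sh C x \<boxtimes> y) (Sh C (x \<boxtimes> y))"
  using isomorphicI[OF Ssp_iso[of x y]] Ssp_Hom[of x y] by simp

lemma isomorphic_Sh_Unt: "y \<in> Obj C \<Longrightarrow> isomorphic (Sh C (Unt C) \<boxtimes> y) (Sh C y)"
  using isomorphic_trans[OF isomorphic_Ten_Sh isomorphic_Sh[OF isomorphic_Lun]] by simp

lemma isomorphic_Ten_Sh':
  assumes "x \<in> Obj C" "y \<in> Obj C"
  shows "isomorphic (x \<boxtimes> Sh C y) (Sh C x \<boxtimes> y)"
proof -
  have "isomorphic (x \<boxtimes> Sh C y) (Sh C y \<boxtimes> x)" using assms by (simp add: isomorphic_Sym)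
  moreover have "isomorphic (Sh C y \<boxtimes> x) (Sh C (y \<boxtimes> x))" using assms by (simp add: isomorphic_Ten_Sh)
  moreover have "isomorphic (Sh C (y \<boxtimes> x)) (Sh C (x \<boxtimes> y))"
    using assms by (simp add: isomorphic_Sym isomorphic_Sh)
  moreover have "isomorphic (Sh C (x \<boxtimes> y)) (Sh C x \<boxtimes> y)"
    using assms by (simp add: isomorphic_Ten_Sh isomorphic_sym)
  ultimately show ?thesis using isomorphic_trans by blast
qed

lemma ex_desuspended_unit:
  obtains s where "s \<in> Obj C" "isomorphic (Sh C s) (Unt C)"
  using ex_desuspension[of "Unt C"] isomorphicI by (metis Unt_simps)

text \<open>Desuspension is itself a tensor operation, so a class of objects stable under tensoring
  and isomorphism is stable under it.\<close>

lemma isomorphic_desuspended_unit: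
  assumes s: "s \<in> Obj C" "isomorphic (Sh C s) (Unt C)" and "y \<in> Obj C"
  shows "isomorphic (s \<boxtimes> Sh C y) y"
  using isomorphic_trans[OF isomorphic_Ten_Sh'[OF s(1) assms(3)]
      isomorphic_trans[OF isomorphic_Ten[OF s(2) isomorphic_refl] isomorphic_Lun]] assms(3) by simp

end

section \<open>Compact objects\<close>

context additive_category
begin

lemma Cmp_finprod:
  assumes "finite S" "\<And>i. i \<in> S \<Longrightarrow> f i \<in> Hom C a b" "p \<in> Hom C b c" "a \<in> Obj C"
  shows "p \<cdot> finprod (hom_group C a b) f S = finprod (hom_group C a c) (\<lambda>i. p \<cdot> f i) S"
proof -
  have o: "b \<in> Obj C" "c \<in> Obj C" using assms(3) by auto
  interpret A: comm_group "hom_group C a b" using o assms(4) by (simp add: hom_comm_group)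
  interpret B: comm_group "hom_group C a c" using o assms(4) by (simp add: hom_comm_group)
  show ?thesis
    using assms(1,2)
  proof (induction S)
    case empty
    then show ?case using o assms(3,4) by simp
  next
    case (insert i S)
    have "f \<in> S \<rightarrow> carrier (hom_group C a b)" "f i \<in> carrier (hom_group C a b)"
      "(\<lambda>i. p \<cdot> f i) \<in> S \<rightarrow> carrier (hom_group C a c)" "p \<cdot> f i \<in> carrier (hom_group C a c)"
      using insert.prems assms(3) by auto
    moreover from this have "finprod (hom_group C a b) f S \<in> carrier (hom_group C a b)"
      by (intro A.finprod_closed)
    ultimately show ?case using insert assms(3) by simp
  qed
qed

lemma finprod_Cmp:
  assumes "finite S" "\<And>i. i \<in> S \<Longrightarrow> f i \<in> Hom C b c" "p \<in> Hom C a b" "c \<in> Obj C"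
  shows "finprod (hom_group C b c) f S \<cdot> p = finprod (hom_group C a c) (\<lambda>i. f i \<cdot> p) S"
proof -
  have o: "b \<in> Obj C" "a \<in> Obj C" using assms(3) by auto
  interpret A: comm_group "hom_group C b c" using o assms(4) by (simp add: hom_comm_group)
  interpret B: comm_group "hom_group C a c" using o assms(4) by (simp add: hom_comm_group)
  show ?thesis
    using assms(1,2)
  proof (induction S)
    case empty
    then show ?case using o assms(3,4) by simp
  next
    case (insert i S)
    have "f \<in> S \<rightarrow> carrier (hom_group C b c)" "f i \<in> carrier (hom_group C b c)"
      "(\<lambda>i. f i \<cdot> p) \<in> S \<rightarrow> carrier (hom_group C a c)" "f i \<cdot> p \<in> carrier (hom_group C a c)"
      using insert.prems assms(3) by auto
    moreover from this have "finprod (hom_group C b c) f S \<in> carrier (hom_group C b c)"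
      by (intro A.finprod_closed)
    ultimately show ?case using insert assms(3) by simp
  qed
qed

text \<open>That an arrow u lands in the finite part J of a coproduct is expressed by
  \<open>E \<cdot> u\<close> being zero, where \<open>E\<close> erases the summands in J. No
  sub-coproduct or quotient has to be chosen.\<close>

definition cut :: "'i set \<Rightarrow> ('i \<Rightarrow> 'o) \<Rightarrow> 'o \<Rightarrow> ('i \<Rightarrow> 'm) \<Rightarrow> 'i set \<Rightarrow> 'm \<Rightarrow> bool" where
  "cut I x X inc J E \<longleftrightarrow> E \<in> Hom C X X \<and>
     (\<forall>i\<in>I. E \<cdot> inc i = (if i \<in> J then Zer C (x i) X else inc i))"

lemma cutD:
  assumes "cut I x X inc J E"
  shows "E \<in> Arr C" "Dom C E = X" "Cod C E = X" "i \<in> I \<Longrightarrow> i \<in> J \<Longrightarrow> E \<cdot> inc i = Zer C (x i) X"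
    "i \<in> I \<Longrightarrow> i \<notin> J \<Longrightarrow> E \<cdot> inc i = inc i"
  using assms unfolding cut_def by auto

lemma ex_cut:
  assumes "is_coproduct C I x X inc"
  obtains E where "cut I x X inc J E"
proof -
  obtain E where "E \<in> Arr C" "Dom C E = X" "Cod C E = X"
    "\<And>i. i \<in> I \<Longrightarrow> E \<cdot> inc i = (if i \<in> J then Zer C (x i) X else inc i)"
    by (rule coproduct_desc[OF assms coproduct_simps(1)[OF assms], of "\<lambda>i. if i \<in> J then Zer C (x i) X else inc i"])
      (use coproduct_simps[OF assms] in auto)
  then have "cut I x X inc J E" by (simp add: cut_def)
  then show ?thesis by (rule that)
qed

lemma cut_Cmp:
  assumes X: "is_coproduct C I x X inc" and E: "cut I x X inc J E" "cut I x X inc J' E'"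
  shows "cut I x X inc (J \<union> J') (E' \<cdot> E)"
proof -
  note [simp] = cutD[OF E(1)] cutD[OF E(2)] coproduct_simps[OF X]
  have "(E' \<cdot> E) \<cdot> inc i = (if i \<in> J \<union> J' then Zer C (x i) X else inc i)" if "i \<in> I" for i
    using that by (cases "i \<in> J"; cases "i \<in> J'") simp_all
  then show ?thesis unfolding cut_def by simp
qed

lemma cut_unique:
  assumes X: "is_coproduct C I x X inc" and E: "cut I x X inc J E" "cut I x X inc J E'"
  shows "E = E'"
  by (rule coproduct_eqI[OF X]) (use E in \<open>auto simp: cut_def\<close>)

lemma ex_projection:
  assumes X: "is_coproduct C I x X inc"
  obtains p where "\<And>i. i \<in> I \<Longrightarrow> p i \<in> Hom C X (x i)"
    "\<And>i j. i \<in> I \<Longrightarrow> j \<in> I \<Longrightarrow> p i \<cdot> inc j = (if i = j then Idt C (x i) else Zer C (x j) (x i))"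
proof -
  have "\<exists>p. p \<in> Hom C X (x i) \<and> (\<forall>j\<in>I. p \<cdot> inc j = (if i = j then Idt C (x i) else Zer C (x j) (x i)))"
    if i: "i \<in> I" for i
  proof -
    obtain h where "h \<in> Arr C" "Dom C h = X" "Cod C h = x i"
      "\<And>j. j \<in> I \<Longrightarrow> h \<cdot> inc j = (if i = j then Idt C (x i) else Zer C (x j) (x i))"
      by (rule coproduct_desc[OF X coproduct_simps(2)[OF X i],
            of "\<lambda>j. if i = j then Idt C (x i) else Zer C (x j) (x i)"])
        (use coproduct_simps[OF X] i in auto)
    then show ?thesis by auto
  qed
  then have "\<forall>i\<in>I. \<exists>p. p \<in> Hom C X (x i) \<and> (\<forall>j\<in>I. p \<cdot> inc j = (if i = j then Idt C (x i) else Zer C (x j) (x i)))"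
    by blast
  from bchoice[OF this] obtain p where "\<forall>i\<in>I. p i \<in> Hom C X (x i) \<and>
      (\<forall>j\<in>I. p i \<cdot> inc j = (if i = j then Idt C (x i) else Zer C (x j) (x i)))" by blast
  then show ?thesis using that by blast
qed

definition factors_finitely :: "'i set \<Rightarrow> ('i \<Rightarrow> 'o) \<Rightarrow> 'o \<Rightarrow> ('i \<Rightarrow> 'm) \<Rightarrow> 'm \<Rightarrow> bool" where
  "factors_finitely I x X inc u \<longleftrightarrow> (\<exists>J E. finite J \<and> J \<subseteq> I \<and> cut I x X inc J E \<and> zero_arr (E \<cdot> u))"

text \<open>The canonical map is always an injective homomorphism, since the projections
  \<open>p\<close> recover the components; the content lies in surjectivity.\<close>

lemma sum_map_iso_iff:
  assumes X: "is_coproduct C I x X inc" and c: "c \<in> Obj C"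
  shows "(\<lambda>u. gfinprod (hom_group C c X) (\<lambda>i. inc i \<cdot> u i) I)
          \<in> iso (sum_group I (\<lambda>i. hom_group C c (x i))) (hom_group C c X) \<longleftrightarrow>
         (\<forall>u\<in>Hom C c X. factors_finitely I x X inc u)"
proof -
  note [simp] = coproduct_simps[OF X]
  let ?S = "sum_group I (\<lambda>i. hom_group C c (x i))" and ?H = "hom_group C c X"
  let ?\<Phi> = "\<lambda>u. gfinprod (hom_group C c X) (\<lambda>i. inc i \<cdot> u i) I"
  interpret H: comm_group ?H using c by (simp add: hom_comm_group)
  have grp: "\<And>i. i \<in> I \<Longrightarrow> group (hom_group C c (x i))"
    using c by (simp add: group_hom_group)
  have carr: "carrier ?S = {v \<in> \<Pi>\<^sub>E i\<in>I. Hom C c (x i). finite {i \<in> I. v i \<noteq> Zer C c (x i)}}"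
    using carrier_sum_group[OF grp] by simp
  obtain p where p: "\<And>i. i \<in> I \<Longrightarrow> p i \<in> Hom C X (x i)"
    "\<And>i j. i \<in> I \<Longrightarrow> j \<in> I \<Longrightarrow> p i \<cdot> inc j = (if i = j then Idt C (x i) else Zer C (x j) (x i))"
    using ex_projection[OF X] by blast
  have red: "?\<Phi> v = finprod ?H (\<lambda>i. inc i \<cdot> v i) J"
    if v: "v \<in> (\<Pi>\<^sub>E i\<in>I. Hom C c (x i))" and J: "finite J" "J \<subseteq> I" "{i \<in> I. v i \<noteq> Zer C c (x i)} \<subseteq> J" for v J
  proof -
    have m: "(\<lambda>i. inc i \<cdot> v i) \<in> I \<rightarrow> carrier ?H" using v by (auto simp: PiE_iff)
    have "?\<Phi> v = gfinprod ?H (\<lambda>i. inc i \<cdot> v i) J"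
    proof (rule H.gfinprod_mono_neutral_cong_right)
      fix i assume "i \<in> I - J"
      then show "inc i \<cdot> v i = \<one>\<^bsub>?H\<^esub>" using J(3) c by (auto simp: subset_iff)
    qed (use m J in auto)
    also have "\<dots> = finprod ?H (\<lambda>i. inc i \<cdot> v i) J"
      by (rule H.gfinprod_eq_finprod) (use m J in auto)
    finally show ?thesis .
  qed
  have hom: "?\<Phi> \<in> hom ?S ?H"
  proof (rule H.hom_group_sum[OF _ grp])
    fix i assume "i \<in> I"
    then show "(\<cdot>) (inc i) \<in> hom (hom_group C c (x i)) ?H"
      by (auto simp: hom_def)
  qed
  have inj: "inj_on ?\<Phi> (carrier ?S)"
  proof (rule inj_onI)
    fix v w assume v: "v \<in> carrier ?S" and w: "w \<in> carrier ?S" and eq: "?\<Phi> v = ?\<Phi> w"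
    have pr: "p i \<cdot> ?\<Phi> v = v i" if v: "v \<in> carrier ?S" and i: "i \<in> I" for v i
    proof -
      let ?J = "insert i {i \<in> I. v i \<noteq> Zer C c (x i)}"
      have vi: "v \<in> (\<Pi>\<^sub>E i\<in>I. Hom C c (x i))" "finite ?J" "?J \<subseteq> I" using v i by (auto simp: carr)
      interpret G: comm_group "hom_group C c (x i)" using c i by (simp add: hom_comm_group)
      have "p i \<cdot> ?\<Phi> v = p i \<cdot> finprod ?H (\<lambda>i. inc i \<cdot> v i) ?J"
        by (subst red[OF vi]) auto
      also have "\<dots> = finprod (hom_group C c (x i)) (\<lambda>j. p i \<cdot> (inc j \<cdot> v j)) ?J"
        by (rule Cmp_finprod) (use vi p i c in \<open>auto simp: PiE_iff\<close>)
      also have "\<dots> = finprod (hom_group C c (x i)) (\<lambda>j. if i = j then v i else \<one>\<^bsub>hom_group C c (x i)\<^esub>) ?J"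
      proof (rule G.finprod_cong')
        show "(\<lambda>j. if i = j then v i else \<one>\<^bsub>hom_group C c (x i)\<^esub>) \<in> ?J \<rightarrow> carrier (hom_group C c (x i))"
          using vi i c by (auto simp: PiE_iff)
        fix j assume j: "j \<in> ?J"
        then have jI: "j \<in> I" using i by auto
        have vj: "v j \<in> Arr C" "Dom C (v j) = c" "Cod C (v j) = x j" using vi(1) jI by (auto simp: PiE_iff)
        show "p i \<cdot> (inc j \<cdot> v j) = (if i = j then v i else \<one>\<^bsub>hom_group C c (x i)\<^esub>)"
          using Cmp_eq_Cmp[OF p(2)[OF i jI], of "v j"] p(1)[OF i] vj jI i c by simp
      qed simp
      also have "\<dots> = v i"
        by (rule G.finprod_singleton[of i ?J "\<lambda>_. v i"]) (use vi i c in \<open>auto simp: PiE_iff\<close>)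
      finally show ?thesis .
    qed
    show "v = w"
    proof (rule PiE_ext)
      show "v \<in> (\<Pi>\<^sub>E i\<in>I. Hom C c (x i))" "w \<in> (\<Pi>\<^sub>E i\<in>I. Hom C c (x i))" using v w by (auto simp: carr)
      fix i assume "i \<in> I"
      then show "v i = w i" using pr[OF v] pr[OF w] eq by metis
    qed
  qed
  show ?thesis
  proof
    assume "?\<Phi> \<in> iso ?S ?H"
    then have surj: "?\<Phi> ` carrier ?S = Hom C c X" by (auto simp: iso_def bij_betw_def)
    show "\<forall>u\<in>Hom C c X. factors_finitely I x X inc u"
    proof
      fix u assume "u \<in> Hom C c X"
      then obtain v where v: "v \<in> carrier ?S" "u = ?\<Phi> v" using surj by blast
      let ?J = "{i \<in> I. v i \<noteq> Zer C c (x i)}"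
      have vi: "v \<in> (\<Pi>\<^sub>E i\<in>I. Hom C c (x i))" "finite ?J" "?J \<subseteq> I" using v by (auto simp: carr)
      \<comment> \<open>Erasing the support of \<open>v\<close> erases every term of the finite sum
        \<open>u\<close>.\<close>
      obtain E where E: "cut I x X inc ?J E" using ex_cut[OF X] .
      note [simp] = cutD[OF E]
      have "E \<cdot> u = E \<cdot> finprod ?H (\<lambda>i. inc i \<cdot> v i) ?J"
        unfolding v(2) by (subst red[OF vi]) auto
      also have "\<dots> = finprod ?H (\<lambda>i. E \<cdot> (inc i \<cdot> v i)) ?J"
        by (rule Cmp_finprod) (use vi c in \<open>auto simp: PiE_iff\<close>)
      also have "\<dots> = \<one>\<^bsub>?H\<^esub>"
      proof (rule H.finprod_one_eqI)
        fix i assume i: "i \<in> ?J"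
        then have v: "v i \<in> Arr C" "Dom C (v i) = c" "Cod C (v i) = x i" using vi(1) by (auto simp: PiE_iff)
        show "E \<cdot> (inc i \<cdot> v i) = \<one>\<^bsub>?H\<^esub>"
          using Cmp_eq_Cmp[OF cutD(4)[OF E], of i "v i"] i v by simp
      qed
      finally have "zero_arr (E \<cdot> u)" using c by simp
      then show "factors_finitely I x X inc u"
        unfolding factors_finitely_def using E vi(2,3) by blast
    qed
  next
    assume fin: "\<forall>u\<in>Hom C c X. factors_finitely I x X inc u"
    have "Hom C c X \<subseteq> ?\<Phi> ` carrier ?S"
    proof
      fix u assume u: "u \<in> Hom C c X"
      then obtain J E where J: "finite J" "J \<subseteq> I" and E: "cut I x X inc J E" and zE: "zero_arr (E \<cdot> u)"
        using fin unfolding factors_finitely_def by blast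
      note [simp] = cutD[OF E]
      interpret XX: comm_group "hom_group C X X" by (simp add: hom_comm_group)
      have JI: "i \<in> J \<Longrightarrow> i \<in> I" for i using J by auto
      let ?N = "finprod (hom_group C X X) (\<lambda>i. inc i \<cdot> p i) J"
      have N: "?N \<in> carrier (hom_group C X X)"
        by (rule XX.finprod_closed) (use p J in auto)
      then have N': "?N \<in> Arr C" "Dom C ?N = X" "Cod C ?N = X" by simp_all
      \<comment> \<open>The identity of the coproduct is the sum of the projections onto the
        summands in \<open>J\<close> and the cut. An arrow annihilated by the cut is therefore the
        finite sum of its components.\<close>
      have id: "?N \<boxplus> E = Idt C X"
      proof (rule coproduct_eqI[OF X])
        fix k assume k: "k \<in> I"
        interpret K: comm_group "hom_group C (x k) X" using k by (simp add: hom_comm_group)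
        have eq: "inc i \<cdot> (p i \<cdot> inc k) = (if k = i then inc k else \<one>\<^bsub>hom_group C (x k) X\<^esub>)"
          if "i \<in> I" for i using that k p by simp
        have "?N \<cdot> inc k = finprod (hom_group C (x k) X) (\<lambda>i. (inc i \<cdot> p i) \<cdot> inc k) J"
          by (rule finprod_Cmp) (use p JI k J in auto)
        also have "\<dots> = finprod (hom_group C (x k) X) (\<lambda>i. if k = i then inc k else \<one>\<^bsub>hom_group C (x k) X\<^esub>) J"
          by (rule K.finprod_cong') (use p JI k J eq in auto)
        also have "\<dots> = (if k \<in> J then inc k else Zer C (x k) X)"
        proof (cases "k \<in> J")
          case True
          then show ?thesis using K.finprod_singleton[of k J "\<lambda>_. inc k"] J k by simp
        next
          case False
          then have "finprod (hom_group C (x k) X) (\<lambda>i. if k = i then inc k else \<one>\<^bsub>hom_group C (x k) X\<^esub>) J =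
              \<one>\<^bsub>hom_group C (x k) X\<^esub>"
            by (intro K.finprod_one_eqI) auto
          then show ?thesis using False by simp
        qed
        finally show "(?N \<boxplus> E) \<cdot> inc k = Idt C X \<cdot> inc k"
          using k N' cutD(4,5)[OF E] by simp
      qed (use N' in simp_all)
      have u': "u \<in> Arr C" "Dom C u = c" "Cod C u = X" using u by simp_all
      define v where "v = (\<lambda>i\<in>I. if i \<in> J then p i \<cdot> u else Zer C c (x i))"
      have v: "v \<in> (\<Pi>\<^sub>E i\<in>I. Hom C c (x i))" "{i \<in> I. v i \<noteq> Zer C c (x i)} \<subseteq> J"
        using p u' c by (auto simp: v_def)
      have "u = (?N \<boxplus> E) \<cdot> u" using u' id by simp
      also have "\<dots> = ?N \<cdot> u"
        using zero_arrD[OF zE, of c X] u' N' by simp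
      also have "\<dots> = finprod ?H (\<lambda>i. (inc i \<cdot> p i) \<cdot> u) J"
        by (rule finprod_Cmp) (use p JI u' J in auto)
      also have "\<dots> = finprod ?H (\<lambda>i. inc i \<cdot> v i) J"
        by (rule H.finprod_cong') (use p JI u' J in \<open>auto simp: v_def\<close>)
      also have "\<dots> = ?\<Phi> v" by (rule red[OF v(1) J v(2), symmetric])
      finally have "u = ?\<Phi> v" .
      moreover have "v \<in> carrier ?S" using v J finite_subset by (auto simp: carr)
      ultimately show "u \<in> ?\<Phi> ` carrier ?S" by blast
    qed
    then have "?\<Phi> ` carrier ?S = carrier ?H"
      using hom by (auto simp: hom_def)
    then show "?\<Phi> \<in> iso ?S ?H" using hom inj by (simp add: iso_def bij_betw_def)
  qed
qed

lemma compact_object_iff: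
  "compact_object U C c \<longleftrightarrow> c \<in> Obj C \<and>
     (\<forall>I x X inc. I \<subseteq> U \<and> small U I \<and> is_coproduct C I x X inc \<longrightarrow>
        (\<forall>u\<in>Hom C c X. factors_finitely I x X inc u))"
  unfolding compact_object_def
  by (intro conj_cong refl arg_cong[where f = All] ext imp_cong) (rule sum_map_iso_iff; blast)

end

text \<open>An abstract form of the compact part of a rigidly-compactly generated category, placed
  inside the ambient one. Duality appears as two splittings; in this form it is insensitive to
  unitors and associators.\<close>

locale rigid_tt_category = tt_category C
  for C :: "('o, 'm, 'x) ttcat_scheme" (structure) and K :: "'o set" +
  assumes K_Obj: "K \<subseteq> Obj C"
    and Unt_K: "Unt C \<in> K"
    and Ten_K: "a \<in> K \<Longrightarrow> b \<in> K \<Longrightarrow> a \<boxtimes> b \<in> K"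
    and Sh_K: "a \<in> Obj C \<Longrightarrow> Sh C a \<in> K \<longleftrightarrow> a \<in> K"
    and cone_K: "(f, g, h) \<in> Tri C \<Longrightarrow> Dom C f \<in> K \<Longrightarrow> Dom C g \<in> K \<Longrightarrow> Dom C h \<in> K"
    and zero_K: "zero_object C z \<Longrightarrow> z \<in> K"
    and sum_K: "is_direct_sum C a b X \<Longrightarrow> a \<in> K \<Longrightarrow> b \<in> K \<Longrightarrow> X \<in> K"
    and dual_K: "d \<in> K \<Longrightarrow> \<exists>y\<in>K. \<exists>coev ev. coev \<in> Hom C (Unt C) (d \<boxtimes> y) \<and>
      ev \<in> Hom C (y \<boxtimes> d) (Unt C) \<and> split_mono (coev \<boxdot> Idt C d) \<and> split_epi (Idt C d \<boxdot> ev)"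

section \<open>Closure of compact objects under cones, suspensions and sums\<close>

context triangulated_category
begin

lemma compact_objectE:
  assumes "compact_object U C c" "I \<subseteq> U" "small U I" "is_coproduct C I x X inc"
    "u \<in> Arr C" "Dom C u = c" "Cod C u = X"
  obtains J E where "finite J" "J \<subseteq> I" "cut I x X inc J E" "zero_arr (E \<cdot> u)"
proof -
  have "factors_finitely I x X inc u"
    using assms unfolding compact_object_iff by auto
  then show ?thesis using that unfolding factors_finitely_def by blast
qed

lemma compact_objectI:
  assumes "c \<in> Obj C"
    "\<And>I x X inc u. I \<subseteq> U \<Longrightarrow> small U I \<Longrightarrow> is_coproduct C I x X inc \<Longrightarrow>
      u \<in> Arr C \<Longrightarrow> Dom C u = c \<Longrightarrow> Cod C u = X \<Longrightarrow>
      \<exists>J E. finite J \<and> J \<subseteq> I \<and> cut I x X inc J E \<and> zero_arr (E \<cdot> u)"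
  shows "compact_object U C c"
  unfolding compact_object_iff factors_finitely_def using assms by auto

lemma compact_object_Obj: "compact_object U C c \<Longrightarrow> c \<in> Obj C"
  unfolding compact_object_iff by blast

text \<open>Two cuts in succession: after the first the composite with \<open>g\<close> vanishes, so
  what is left of \<open>u\<close> factors through the suspension of the source; the second
  annihilates that factor.\<close>

lemma compact_object_cone:
  assumes tri: "(f, g, h) \<in> Tri C" and b: "compact_object U C (Dom C g)"
    and a: "compact_object U C (Sh C (Dom C f))"
  shows "compact_object U C (Dom C h)"
proof (rule compact_objectI)
  note [simp] = Tri_simps[OF tri]
  show "Dom C h \<in> Obj C" by simp
  fix I x X inc u
  assume I: "I \<subseteq> U" "small U I" and X: "is_coproduct C I x X inc"
    and u[simp]: "u \<in> Arr C" "Dom C u = Dom C h" "Cod C u = X"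
  obtain J E where J: "finite J" "J \<subseteq> I" and E: "cut I x X inc J E" and zE: "zero_arr (E \<cdot> (u \<cdot> g))"
    using compact_objectE[OF b I X, of "u \<cdot> g"] by auto
  note [simp] = cutD(1-3)[OF E]
  have "zero_arr ((E \<cdot> u) \<cdot> g)" using zE by simp
  then obtain v where v[simp]: "v \<in> Arr C" "Dom C v = Sh C (Dom C f)" "Cod C v = X" and vh: "v \<cdot> h = E \<cdot> u"
    by (rule Tri_factor[OF Tri_rotate[OF tri], rotated 2]) auto
  obtain J' E' where J': "finite J'" "J' \<subseteq> I" and E': "cut I x X inc J' E'" and zE': "zero_arr (E' \<cdot> v)"
    using compact_objectE[OF a I X v] by auto
  note [simp] = cutD(1-3)[OF E']
  have "zero_arr ((E' \<cdot> v) \<cdot> h)" by (rule zero_arr_Cmp_right[OF zE']) auto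
  then have "zero_arr ((E' \<cdot> E) \<cdot> u)" by (simp add: vh)
  then show "\<exists>J E. finite J \<and> J \<subseteq> I \<and> cut I x X inc J E \<and> zero_arr (E \<cdot> u)"
    using cut_Cmp[OF X E E'] J J' by (meson Un_least finite_UnI)
qed

text \<open>An equivalence preserves coproducts: the target of a cocone is desuspended up to
  isomorphism, and the components are pulled back by fullness.\<close>

lemma coproduct_Sh:
  assumes X: "is_coproduct C I x X inc"
  shows "is_coproduct C I (\<lambda>i. Sh C (x i)) (Sh C X) (\<lambda>i. Shm C (inc i))"
  unfolding is_coproduct_def
proof (intro conjI ballI allI impI)
  note [simp] = coproduct_simps[OF X]
  show "Sh C X \<in> Obj C" by simp
  show "Sh C (x i) \<in> Obj C" "Shm C (inc i) \<in> Hom C (Sh C (x i)) (Sh C X)" if "i \<in> I" for i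
    using that by simp_all
  fix Y f assume Y: "Y \<in> Obj C" and f: "\<forall>i\<in>I. f i \<in> Hom C (Sh C (x i)) Y"
  obtain Y' s where Y'[simp]: "Y' \<in> Obj C" and s: "is_iso C s" and s'[simp]: "Dom C s = Sh C Y'" "Cod C s = Y"
    using ex_desuspension[OF Y] .
  note [simp] = inv_simps[OF s] is_iso_Arr[OF s]
  have "\<forall>i\<in>I. \<exists>g. g \<in> Hom C (x i) Y' \<and> Shm C g = inv_arr C s \<cdot> f i"
  proof
    fix i assume i: "i \<in> I"
    then have "f i \<in> Hom C (Sh C (x i)) Y" using f by blast
    then show "\<exists>g. g \<in> Hom C (x i) Y' \<and> Shm C g = inv_arr C s \<cdot> f i"
      using Shm_full[of "x i" Y' "inv_arr C s \<cdot> f i"] i by auto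
  qed
  from bchoice[OF this] obtain g where g: "\<And>i. i \<in> I \<Longrightarrow> g i \<in> Hom C (x i) Y'"
      and gf: "\<And>i. i \<in> I \<Longrightarrow> Shm C (g i) = inv_arr C s \<cdot> f i" by blast
  obtain h where h[simp]: "h \<in> Arr C" "Dom C h = X" "Cod C h = Y'" and hg: "\<And>i. i \<in> I \<Longrightarrow> h \<cdot> inc i = g i"
    using coproduct_desc[OF X, of Y' g] g by auto
  show "\<exists>!k. k \<in> Hom C (Sh C X) Y \<and> (\<forall>i\<in>I. k \<cdot> Shm C (inc i) = f i)"
  proof (rule ex1I[of _ "s \<cdot> Shm C h"])
    have "(s \<cdot> Shm C h) \<cdot> Shm C (inc i) = f i" if i: "i \<in> I" for i
    proof -
      have fi: "f i \<in> Arr C" "Dom C (f i) = Sh C (x i)" "Cod C (f i) = Y" using f i by auto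
      have "(s \<cdot> Shm C h) \<cdot> Shm C (inc i) = s \<cdot> Shm C (h \<cdot> inc i)"
        using i Shm_Cmp[of "inc i" "x i" X h Y'] by simp
      then show ?thesis using i hg gf fi by simp
    qed
    then show "s \<cdot> Shm C h \<in> Hom C (Sh C X) Y \<and> (\<forall>i\<in>I. (s \<cdot> Shm C h) \<cdot> Shm C (inc i) = f i)"
      by simp
  next
    fix k assume k: "k \<in> Hom C (Sh C X) Y \<and> (\<forall>i\<in>I. k \<cdot> Shm C (inc i) = f i)"
    then have k'[simp]: "k \<in> Arr C" "Dom C k = Sh C X" "Cod C k = Y" by simp_all
    obtain l where l[simp]: "l \<in> Arr C" "Dom C l = X" "Cod C l = Y'" and lk: "Shm C l = inv_arr C s \<cdot> k"
      using Shm_full[of X Y' "inv_arr C s \<cdot> k"] by auto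
    have "l = h"
    proof (rule coproduct_eqI[OF X])
      fix i assume i: "i \<in> I"
      have ki: "k \<cdot> Shm C (inc i) = f i" using k i by blast
      have "Shm C (l \<cdot> inc i) = Shm C (h \<cdot> inc i)"
        using i Shm_Cmp[of "inc i" "x i" X l Y'] lk ki hg gf by simp
      then show "l \<cdot> inc i = h \<cdot> inc i"
        using i Shm_eq_iff[of "l \<cdot> inc i" "h \<cdot> inc i"] by simp
    qed simp_all
    then show "k = s \<cdot> Shm C h" using lk by simp
  qed
qed

lemma compact_object_Sh_iff:
  assumes c: "c \<in> Obj C"
  shows "compact_object U C (Sh C c) \<longleftrightarrow> compact_object U C c"
proof
  assume cc: "compact_object U C (Sh C c)"
  show "compact_object U C c"
  proof (rule compact_objectI[OF c])
    fix I x X inc u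
    assume I: "I \<subseteq> U" "small U I" and X: "is_coproduct C I x X inc"
      and u[simp]: "u \<in> Arr C" "Dom C u = c" "Cod C u = X"
    note SX = coproduct_Sh[OF X]
    note [simp] = coproduct_simps[OF X]
    obtain J E where J: "finite J" "J \<subseteq> I"
        and E: "cut I (\<lambda>i. Sh C (x i)) (Sh C X) (\<lambda>i. Shm C (inc i)) J E" and zE: "zero_arr (E \<cdot> Shm C u)"
      using compact_objectE[OF cc I SX, of "Shm C u"] by auto
    obtain E' where E': "cut I x X inc J E'" using ex_cut[OF X] .
    note [simp] = cutD(1-3)[OF E']
    have "Shm C E' \<cdot> Shm C (inc i) = (if i \<in> J then Zer C (Sh C (x i)) (Sh C X) else Shm C (inc i))" if "i \<in> I" for i
      using that cutD(4,5)[OF E', of i] Shm_Cmp[of "inc i" "x i" X E' X] by auto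
    then have "cut I (\<lambda>i. Sh C (x i)) (Sh C X) (\<lambda>i. Shm C (inc i)) J (Shm C E')"
      unfolding cut_def by simp
    then have "E = Shm C E'" using cut_unique[OF SX E] by simp
    then have "zero_arr (Shm C (E' \<cdot> u))" using zE Shm_Cmp[of u c X E' X] by simp
    then have "zero_arr (E' \<cdot> u)" by simp
    then show "\<exists>J E. finite J \<and> J \<subseteq> I \<and> cut I x X inc J E \<and> zero_arr (E \<cdot> u)"
      using J E' by blast
  qed
next
  assume cc: "compact_object U C c"
  show "compact_object U C (Sh C c)"
  proof (rule compact_objectI)
    show "Sh C c \<in> Obj C" using c by simp
    fix I x X inc u
    assume I: "I \<subseteq> U" "small U I" and X: "is_coproduct C I x X inc"
      and u[simp]: "u \<in> Arr C" "Dom C u = Sh C c" "Cod C u = X"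
    note [simp] = coproduct_simps[OF X] c
    \<comment> \<open>Testing the suspension of \<open>c\<close> against a coproduct requires
      desuspending the whole coproduct diagram, objects up to isomorphism and inclusions by
      fullness. The result is again a coproduct, against which compactness of \<open>c\<close>
      applies.\<close>
    obtain X' \<psi> where X'[simp]: "X' \<in> Obj C" and \<psi>: "is_iso C \<psi>" "Dom C \<psi> = Sh C X'" "Cod C \<psi> = X"
      using ex_desuspension[of X] by auto
    have "\<forall>i\<in>I. \<exists>a. \<exists>\<phi>. a \<in> Obj C \<and> is_iso C \<phi> \<and> Dom C \<phi> = Sh C a \<and> Cod C \<phi> = x i"
      using ex_desuspension coproduct_simps(2)[OF X] by metis
    from bchoice[OF this] obtain x' where "\<forall>i\<in>I. \<exists>\<phi>. x' i \<in> Obj C \<and> is_iso C \<phi> \<and> Dom C \<phi> = Sh C (x' i) \<and> Cod C \<phi> = x i" ..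
    from bchoice[OF this] obtain \<phi> where \<phi>: "\<And>i. i \<in> I \<Longrightarrow> x' i \<in> Obj C" "\<And>i. i \<in> I \<Longrightarrow> is_iso C (\<phi> i)"
      "\<And>i. i \<in> I \<Longrightarrow> Dom C (\<phi> i) = Sh C (x' i)" "\<And>i. i \<in> I \<Longrightarrow> Cod C (\<phi> i) = x i" by blast
    note [simp] = \<psi>(2,3) \<phi>(1,3,4) inv_simps[OF \<psi>(1)] is_iso_Arr[OF \<psi>(1)]
      inv_simps[OF \<phi>(2)] is_iso_Arr[OF \<phi>(2)]
    have "\<forall>i\<in>I. \<exists>g. g \<in> Hom C (x' i) X' \<and> Shm C g = inv_arr C \<psi> \<cdot> (inc i \<cdot> \<phi> i)"
    proof
      fix i assume i: "i \<in> I"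
      then show "\<exists>g. g \<in> Hom C (x' i) X' \<and> Shm C g = inv_arr C \<psi> \<cdot> (inc i \<cdot> \<phi> i)"
        using Shm_full[of "x' i" X' "inv_arr C \<psi> \<cdot> (inc i \<cdot> \<phi> i)"] by auto
    qed
    from bchoice[OF this] obtain inc' where inc'0: "\<And>i. i \<in> I \<Longrightarrow> inc' i \<in> Hom C (x' i) X'"
      and inc'_eq: "\<And>i. i \<in> I \<Longrightarrow> Shm C (inc' i) = inv_arr C \<psi> \<cdot> (inc i \<cdot> \<phi> i)" by blast
    have inc'[simp]: "i \<in> I \<Longrightarrow> inc' i \<in> Arr C" "i \<in> I \<Longrightarrow> Dom C (inc' i) = x' i" "i \<in> I \<Longrightarrow> Cod C (inc' i) = X'" for i
      using inc'0 by simp_all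
    have CX': "is_coproduct C I x' X' inc'"
      unfolding is_coproduct_def
    proof (intro conjI ballI allI impI)
      fix Y f assume Y[simp]: "Y \<in> Obj C" and "\<forall>i\<in>I. f i \<in> Hom C (x' i) Y"
      then have f[simp]: "i \<in> I \<Longrightarrow> f i \<in> Arr C" "i \<in> I \<Longrightarrow> Dom C (f i) = x' i" "i \<in> I \<Longrightarrow> Cod C (f i) = Y" for i
        by auto
      obtain h where h[simp]: "h \<in> Arr C" "Dom C h = X" "Cod C h = Sh C Y"
        and hf: "\<And>i. i \<in> I \<Longrightarrow> h \<cdot> inc i = Shm C (f i) \<cdot> inv_arr C (\<phi> i)"
        using coproduct_desc[OF X, of "Sh C Y" "\<lambda>i. Shm C (f i) \<cdot> inv_arr C (\<phi> i)"] by auto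
      obtain k where k[simp]: "k \<in> Arr C" "Dom C k = X'" "Cod C k = Y" and kh: "Shm C k = h \<cdot> \<psi>"
        using Shm_full[of X' Y "h \<cdot> \<psi>"] by auto
      show "\<exists>!k. k \<in> Hom C X' Y \<and> (\<forall>i\<in>I. k \<cdot> inc' i = f i)"
      proof (rule ex1I[of _ k])
        have "k \<cdot> inc' i = f i" if i: "i \<in> I" for i
        proof -
          have "Shm C (k \<cdot> inc' i) = Shm C (f i)"
            using i Shm_Cmp[of "inc' i" "x' i" X' k Y] by (simp add: kh inc'_eq Cmp_eq_Cmp[OF hf])
          then show ?thesis using i Shm_eq_iff[of "k \<cdot> inc' i" "f i"] by simp
        qed
        then show "k \<in> Hom C X' Y \<and> (\<forall>i\<in>I. k \<cdot> inc' i = f i)" by simp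
      next
        fix l assume l: "l \<in> Hom C X' Y \<and> (\<forall>i\<in>I. l \<cdot> inc' i = f i)"
        then have l'[simp]: "l \<in> Arr C" "Dom C l = X'" "Cod C l = Y" by simp_all
        have lh: "Shm C l \<cdot> inv_arr C \<psi> = h"
        proof (rule coproduct_eqI[OF X])
          fix i assume i: "i \<in> I"
          have li: "l \<cdot> inc' i = f i" using l i by blast
          have "(Shm C l \<cdot> inv_arr C \<psi>) \<cdot> inc i = (Shm C l \<cdot> Shm C (inc' i)) \<cdot> inv_arr C (\<phi> i)"
            using i by (simp add: inc'_eq)
          also have "Shm C l \<cdot> Shm C (inc' i) = Shm C (l \<cdot> inc' i)"
            using i by (intro Shm_Cmp[symmetric]) auto
          finally show "(Shm C l \<cdot> inv_arr C \<psi>) \<cdot> inc i = h \<cdot> inc i"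
            using li hf i by simp
        qed simp_all
        have "Shm C l = (Shm C l \<cdot> inv_arr C \<psi>) \<cdot> \<psi>" by simp
        then have "Shm C l = Shm C k" unfolding lh kh .
        then show "l = k" using Shm_eq_iff[of l k] by simp
      qed
    qed simp_all
    obtain w where w[simp]: "w \<in> Arr C" "Dom C w = c" "Cod C w = X'" and wu: "Shm C w = inv_arr C \<psi> \<cdot> u"
      using Shm_full[of c X' "inv_arr C \<psi> \<cdot> u"] by auto
    obtain J E where J: "finite J" "J \<subseteq> I" and E: "cut I x' X' inc' J E" and zE: "zero_arr (E \<cdot> w)"
      using compact_objectE[OF cc I CX' w] by auto
    note [simp] = cutD(1-3)[OF E]
    let ?E = "\<psi> \<cdot> (Shm C E \<cdot> inv_arr C \<psi>)"
    have "cut I x X inc J ?E"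
      unfolding cut_def
    proof (intro conjI ballI)
      fix i assume i: "i \<in> I"
      have "?E \<cdot> inc i = \<psi> \<cdot> ((Shm C E \<cdot> Shm C (inc' i)) \<cdot> inv_arr C (\<phi> i))"
        using i by (simp add: inc'_eq)
      also have "Shm C E \<cdot> Shm C (inc' i) = Shm C (E \<cdot> inc' i)"
        using i by (intro Shm_Cmp[symmetric]) auto
      also have "E \<cdot> inc' i = (if i \<in> J then Zer C (x' i) X' else inc' i)"
        using cutD(4,5)[OF E] i by simp
      finally show "?E \<cdot> inc i = (if i \<in> J then Zer C (x i) X else inc i)"
        using i by (simp add: inc'_eq)
    qed simp
    moreover have "zero_arr (?E \<cdot> u)"
    proof -
      have "?E \<cdot> u = \<psi> \<cdot> Shm C (E \<cdot> w)"
        using Shm_Cmp[of w c X' E X'] by (simp add: wu)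
      then show ?thesis using zero_arr_Cmp_left[of "Shm C (E \<cdot> w)" \<psi>] zE by simp
    qed
    ultimately show "\<exists>J E. finite J \<and> J \<subseteq> I \<and> cut I x X inc J E \<and> zero_arr (E \<cdot> u)"
      using J by blast
  qed
qed

lemma compact_object_zero:
  assumes z: "zero_object C z"
  shows "compact_object U C z"
proof (rule compact_objectI)
  show "z \<in> Obj C" using z zero_object_iff by blast
  fix I x X inc u
  assume X: "is_coproduct C I x X inc" and u[simp]: "u \<in> Arr C" "Dom C u = z" "Cod C u = X"
  obtain E where E: "cut I x X inc {} E" using ex_cut[OF X] .
  note [simp] = cutD(1-3)[OF E]
  have "zero_arr (E \<cdot> u)" by (rule zero_object_arr(1)[OF z]) simp_all
  then show "\<exists>J E. finite J \<and> J \<subseteq> I \<and> cut I x X inc J E \<and> zero_arr (E \<cdot> u)"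
    using E by blast
qed

lemma direct_sum_zero_arr:
  assumes X: "is_coproduct C (UNIV :: bool set) (\<lambda>i. if i then a else b) X inc"
    and f: "f \<in> Arr C" "Dom C f = X" and z: "zero_arr (f \<cdot> inc True)" "zero_arr (f \<cdot> inc False)"
  shows "zero_arr f"
proof -
  note [simp] = coproduct_simps[OF X] f
  have "f = Zer C X (Cod C f)"
  proof (rule coproduct_eqI[OF X])
    fix i :: bool
    have "zero_arr (f \<cdot> inc i)" using z by (cases i) auto
    then show "f \<cdot> inc i = Zer C X (Cod C f) \<cdot> inc i"
      using zero_arrD[of "f \<cdot> inc i" "Dom C (inc i)" "Cod C f"] by simp
  qed simp_all
  then show ?thesis by (simp add: zero_arr_def)
qed

text \<open>One cut for each of the two summands; their composite erases the union of the two finite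
  index sets.\<close>

lemma compact_object_sum:
  assumes s: "is_direct_sum C a b Y" and a: "compact_object U C a" and b: "compact_object U C b"
  shows "compact_object U C Y"
proof -
  obtain inj where Y: "is_coproduct C (UNIV :: bool set) (\<lambda>i. if i then a else b) Y inj"
    using s unfolding is_direct_sum_def by blast
  have inj[simp]: "Y \<in> Obj C" "inj i \<in> Arr C" "Cod C (inj i) = Y" "Dom C (inj i) = (if i then a else b)" for i
    using coproduct_simps[OF Y] by auto
  show ?thesis
  proof (rule compact_objectI)
    fix I x X inc u
    assume I: "I \<subseteq> U" "small U I" and X: "is_coproduct C I x X inc"
      and u[simp]: "u \<in> Arr C" "Dom C u = Y" "Cod C u = X"
    obtain J E where J: "finite J" "J \<subseteq> I" and E: "cut I x X inc J E" and zE: "zero_arr (E \<cdot> (u \<cdot> inj True))"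
      using compact_objectE[OF a I X, of "u \<cdot> inj True"] by auto
    note [simp] = cutD(1-3)[OF E]
    obtain J' E' where J': "finite J'" "J' \<subseteq> I" and E': "cut I x X inc J' E'" and zE': "zero_arr (E' \<cdot> ((E \<cdot> u) \<cdot> inj False))"
      using compact_objectE[OF b I X, of "(E \<cdot> u) \<cdot> inj False"] by auto
    note [simp] = cutD(1-3)[OF E']
    have "zero_arr ((E' \<cdot> E) \<cdot> u)"
      by (rule direct_sum_zero_arr[OF Y]) (use zE zE' zero_arr_Cmp_left[OF zE, of E'] in simp_all)
    then show "\<exists>J E. finite J \<and> J \<subseteq> I \<and> cut I x X inc J E \<and> zero_arr (E \<cdot> u)"
      using cut_Cmp[OF X E E'] J J' by (meson Un_least finite_UnI)
  qed simp
qed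

end

section \<open>Coherence of the unit, and duality\<close>

context symmetric_monoidal_category
begin

lemma Ten_Unt_right_eqD:
  assumes "f \<boxdot> Idt C (Unt C) = g \<boxdot> Idt C (Unt C)" "f \<in> Arr C" "g \<in> Arr C" "Dom C f = Dom C g" "Cod C f = Cod C g"
  shows "f = g"
proof -
  have "f \<cdot> Run C (Dom C f) = g \<cdot> Run C (Dom C f)"
    using Run_natural[of f "Dom C f" "Cod C f"] Run_natural[of g "Dom C g" "Cod C g"] assms by simp
  then have "(f \<cdot> Run C (Dom C f)) \<cdot> inv_arr C (Run C (Dom C f)) = (g \<cdot> Run C (Dom C f)) \<cdot> inv_arr C (Run C (Dom C f))"
    by simp
  then show ?thesis using assms inv_simps[of "Run C (Dom C f)"] by simp
qed

lemma Ten_Unt_left_eqD: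
  assumes "Idt C (Unt C) \<boxdot> f = Idt C (Unt C) \<boxdot> g" "f \<in> Arr C" "g \<in> Arr C" "Dom C f = Dom C g" "Cod C f = Cod C g"
  shows "f = g"
proof -
  have "f \<cdot> Lun C (Dom C f) = g \<cdot> Lun C (Dom C f)"
    using Lun_natural[of f "Dom C f" "Cod C f"] Lun_natural[of g "Dom C g" "Cod C g"] assms by simp
  then have "(f \<cdot> Lun C (Dom C f)) \<cdot> inv_arr C (Lun C (Dom C f)) = (g \<cdot> Lun C (Dom C f)) \<cdot> inv_arr C (Lun C (Dom C f))"
    by simp
  then show ?thesis using assms inv_simps[of "Lun C (Dom C f)"] by simp
qed

lemma Cmp_iso_cancel_right:
  assumes "f \<cdot> i = g \<cdot> i" "is_iso C i" "f \<in> Arr C" "g \<in> Arr C" "Dom C f = Cod C i" "Dom C g = Cod C i"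
  shows "f = g"
proof -
  have "(f \<cdot> i) \<cdot> inv_arr C i = (g \<cdot> i) \<cdot> inv_arr C i" using assms(1) by simp
  then show ?thesis using assms(3-) inv_simps[OF assms(2)] is_iso_Arr[OF assms(2)] by simp
qed

lemma Cmp_iso_cancel_left:
  assumes "i \<cdot> f = i \<cdot> g" "is_iso C i" "f \<in> Arr C" "g \<in> Arr C" "Cod C f = Dom C i" "Cod C g = Dom C i"
  shows "f = g"
proof -
  have "inv_arr C i \<cdot> (i \<cdot> f) = inv_arr C i \<cdot> (i \<cdot> g)" using assms(1) by simp
  then show ?thesis using assms(3-) inv_simps[OF assms(2)] is_iso_Arr[OF assms(2)] by simp
qed

text \<open>A classical consequence of pentagon and triangle. Both sides are tensored with the unit
  on the left, where the triangle axiom applies; the pentagon with two unit factors then connects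
  them, and the isomorphism \<open>?W\<close> and the extra unit are cancelled.\<close>

lemma Lun_Ten:
  assumes [simp]: "x \<in> Obj C" "y \<in> Obj C"
  shows "Lun C (x \<boxtimes> y) \<cdot> Asc C (Unt C) x y = Lun C x \<boxdot> Idt C y"
proof -
  let ?i = "Unt C" and ?I = "Idt C (Unt C)"
  let ?W = "Asc C ?i (?i \<boxtimes> x) y \<cdot> (Asc C ?i ?i x \<boxdot> Idt C y)"
  have pent: "Asc C ?i ?i (x \<boxtimes> y) \<cdot> Asc C (?i \<boxtimes> ?i) x y = (?I \<boxdot> Asc C ?i x y) \<cdot> ?W"
    using pentagon[of ?i ?i x y] by simp
  have "(?I \<boxdot> (Lun C (x \<boxtimes> y) \<cdot> Asc C ?i x y)) \<cdot> ?W =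
      (?I \<boxdot> Lun C (x \<boxtimes> y)) \<cdot> ((?I \<boxdot> Asc C ?i x y) \<cdot> ?W)"
    by (simp add: Ten_left_Cmp)
  also have "\<dots> = (?I \<boxdot> Lun C (x \<boxtimes> y)) \<cdot> (Asc C ?i ?i (x \<boxtimes> y) \<cdot> Asc C (?i \<boxtimes> ?i) x y)"
    by (simp only: pent)
  also have "\<dots> = (Run C ?i \<boxdot> Idt C (x \<boxtimes> y)) \<cdot> Asc C (?i \<boxtimes> ?i) x y"
    by (rule Cmp_eq_Cmp[OF triangle]) simp_all
  also have "\<dots> = (Run C ?i \<boxdot> (Idt C x \<boxdot> Idt C y)) \<cdot> Asc C (?i \<boxtimes> ?i) x y"
    by simp
  also have "\<dots> = Asc C ?i x y \<cdot> ((Run C ?i \<boxdot> Idt C x) \<boxdot> Idt C y)"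
    by (rule Asc_natural[symmetric]) simp_all
  also have "\<dots> = Asc C ?i x y \<cdot> (((?I \<boxdot> Lun C x) \<cdot> Asc C ?i ?i x) \<boxdot> Idt C y)"
    by (simp only: triangle[OF Unt_simps assms(1)])
  also have "\<dots> = (Asc C ?i x y \<cdot> ((?I \<boxdot> Lun C x) \<boxdot> Idt C y)) \<cdot> (Asc C ?i ?i x \<boxdot> Idt C y)"
    by (simp add: Ten_right_Cmp)
  also have "Asc C ?i x y \<cdot> ((?I \<boxdot> Lun C x) \<boxdot> Idt C y) = (?I \<boxdot> (Lun C x \<boxdot> Idt C y)) \<cdot> Asc C ?i (?i \<boxtimes> x) y"
    by (rule Asc_natural) simp_all
  finally have "(?I \<boxdot> (Lun C (x \<boxtimes> y) \<cdot> Asc C ?i x y)) \<cdot> ?W = (?I \<boxdot> (Lun C x \<boxdot> Idt C y)) \<cdot> ?W"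
    by simp
  then have "?I \<boxdot> (Lun C (x \<boxtimes> y) \<cdot> Asc C ?i x y) = ?I \<boxdot> (Lun C x \<boxdot> Idt C y)"
    by (rule Cmp_iso_cancel_right) (simp_all add: is_iso_Cmp)
  then show ?thesis by (rule Ten_Unt_left_eqD) simp_all
qed

text \<open>Naturality of the left unitor along itself identifies the two ways of removing a unit
  from a double unit; then \<open>Lun_Ten\<close> and the triangle axiom describe the same
  arrow.\<close>

lemma Lun_Unt_eq_Run_Unt: "Lun C (Unt C) = Run C (Unt C)"
proof -
  let ?i = "Unt C"
  have "Lun C ?i \<cdot> (Idt C ?i \<boxdot> Lun C ?i) = Lun C ?i \<cdot> Lun C (?i \<boxtimes> ?i)"
    by (rule Lun_natural) simp
  then have "Idt C ?i \<boxdot> Lun C ?i = Lun C (?i \<boxtimes> ?i)"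
    by (rule Cmp_iso_cancel_left) simp_all
  then have "Lun C ?i \<boxdot> Idt C ?i = Run C ?i \<boxdot> Idt C ?i"
    using Lun_Ten[of ?i ?i] triangle[of ?i ?i] by simp
  then show ?thesis by (rule Ten_Unt_right_eqD) simp_all
qed

text \<open>Since dualizable objects are compact, this makes the unit compact, and compactness of
  all objects with duals is deduced from that of the unit.\<close>

lemma dualizable_Unt: "dualizable C (Unt C)"
proof -
  let ?i = "Unt C" and ?l = "Lun C (Unt C)"
  let ?k = "inv_arr C ?l"
  note [simp] = inv_simps[of "Asc C ?i ?i ?i"]
  have t: "(Idt C ?i \<boxdot> ?l) \<cdot> Asc C ?i ?i ?i = ?l \<boxdot> Idt C ?i"
    using triangle[of ?i ?i] Lun_Unt_eq_Run_Unt by simp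
  have 1: "Run C ?i \<cdot> (Idt C ?i \<boxdot> ?l) \<cdot> Asc C ?i ?i ?i \<cdot> (?k \<boxdot> Idt C ?i) = ?l"
    using Cmp_eq_Cmp[OF t, of "?k \<boxdot> Idt C ?i"] by (simp add: Tenm_Tenm Lun_Unt_eq_Run_Unt[symmetric])
  have "(?l \<boxdot> Idt C ?i) \<cdot> inv_arr C (Asc C ?i ?i ?i) = ((Idt C ?i \<boxdot> ?l) \<cdot> Asc C ?i ?i ?i) \<cdot> inv_arr C (Asc C ?i ?i ?i)"
    by (simp only: t)
  then have t2: "(?l \<boxdot> Idt C ?i) \<cdot> inv_arr C (Asc C ?i ?i ?i) = Idt C ?i \<boxdot> ?l" by simp
  have 2: "Lun C ?i \<cdot> (?l \<boxdot> Idt C ?i) \<cdot> inv_arr C (Asc C ?i ?i ?i) \<cdot> (Idt C ?i \<boxdot> ?k) = Run C ?i"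
    using Cmp_eq_Cmp[OF t2, of "Idt C ?i \<boxdot> ?k"] by (simp add: Tenm_Tenm Lun_Unt_eq_Run_Unt[symmetric])
  have "?k \<in> Hom C ?i (?i \<boxtimes> ?i)" "?l \<in> Hom C (?i \<boxtimes> ?i) ?i" by simp_all
  then show ?thesis unfolding dualizable_def using 1 2 Unt_simps by blast
qed

text \<open>A single zigzag, up to isomorphism and stripped of unitors: the form in which duality
  detects the vanishing of arrows out of \<open>x\<close>.\<close>

definition half_dual :: "'o \<Rightarrow> 'o \<Rightarrow> 'm \<Rightarrow> 'm \<Rightarrow> bool" where
  "half_dual x y coev ev \<longleftrightarrow> x \<in> Obj C \<and> y \<in> Obj C \<and> coev \<in> Hom C (Unt C) (x \<boxtimes> y) \<and>
     ev \<in> Hom C (y \<boxtimes> x) (Unt C) \<and>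
     is_iso C ((Idt C x \<boxdot> ev) \<cdot> (Asc C x y x \<cdot> (coev \<boxdot> Idt C x)))"

lemma half_dualD:
  assumes "half_dual x y coev ev"
  shows "x \<in> Obj C" "y \<in> Obj C" "coev \<in> Arr C" "Dom C coev = Unt C" "Cod C coev = x \<boxtimes> y"
    "ev \<in> Arr C" "Dom C ev = y \<boxtimes> x" "Cod C ev = Unt C"
    "is_iso C ((Idt C x \<boxdot> ev) \<cdot> (Asc C x y x \<cdot> (coev \<boxdot> Idt C x)))"
  using assms by (auto simp: half_dual_def)

lemma half_dual_split:
  assumes d: "half_dual x y coev ev"
  shows "split_mono (coev \<boxdot> Idt C x)" "split_epi (Idt C x \<boxdot> ev)"
proof -
  note [simp] = half_dualD[OF d]
  let ?k = "(Idt C x \<boxdot> ev) \<cdot> (Asc C x y x \<cdot> (coev \<boxdot> Idt C x))"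
  obtain j where j: "inverses ?k j" using half_dualD(9)[OF d] is_iso_iff by blast
  have [simp]: "j \<in> Arr C" "Dom C j = x \<boxtimes> Unt C" "Cod C j = Unt C \<boxtimes> x"
    using inverses_simps(2-4)[OF j] by simp_all
  have "(j \<cdot> ((Idt C x \<boxdot> ev) \<cdot> Asc C x y x)) \<cdot> (coev \<boxdot> Idt C x) = Idt C (Unt C \<boxtimes> x)"
    using inverses_simps(5)[OF j] by simp
  then show "split_mono (coev \<boxdot> Idt C x)"
    unfolding split_mono_def by (intro conjI bexI[of _ "j \<cdot> ((Idt C x \<boxdot> ev) \<cdot> Asc C x y x)"]) simp_all
  have "(Idt C x \<boxdot> ev) \<cdot> ((Asc C x y x \<cdot> (coev \<boxdot> Idt C x)) \<cdot> j) = Idt C (x \<boxtimes> Unt C)"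
    using inverses_simps(6)[OF j] by simp
  then show "split_epi (Idt C x \<boxdot> ev)"
    unfolding split_epi_def by (intro conjI bexI[of _ "(Asc C x y x \<cdot> (coev \<boxdot> Idt C x)) \<cdot> j"]) simp_all
qed

lemma dualizable_half_dual:
  assumes "dualizable C x"
  obtains y coev ev where "half_dual x y coev ev"
    "is_iso C ((ev \<boxdot> Idt C y) \<cdot> (inv_arr C (Asc C y x y) \<cdot> (Idt C y \<boxdot> coev)))"
proof -
  from assms obtain y coev ev where y: "x \<in> Obj C" "y \<in> Obj C" "coev \<in> Hom C (Unt C) (x \<boxtimes> y)"
     "ev \<in> Hom C (y \<boxtimes> x) (Unt C)"
     and 1: "Run C x \<cdot> (Idt C x \<boxdot> ev) \<cdot> Asc C x y x \<cdot> (coev \<boxdot> Idt C x) = Lun C x"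
     and 2: "Lun C y \<cdot> (ev \<boxdot> Idt C y) \<cdot> inv_arr C (Asc C y x y) \<cdot> (Idt C y \<boxdot> coev) = Run C y"
    unfolding dualizable_def by blast
  have [simp]: "coev \<in> Arr C" "Dom C coev = Unt C" "Cod C coev = x \<boxtimes> y"
    "ev \<in> Arr C" "Dom C ev = y \<boxtimes> x" "Cod C ev = Unt C" using y by simp_all
  note [simp] = y(1,2) inv_simps[of "Asc C y x y"] inv_simps[of "Run C x"] inv_simps[of "Lun C y"]
  let ?a = "(Idt C x \<boxdot> ev) \<cdot> (Asc C x y x \<cdot> (coev \<boxdot> Idt C x))"
  let ?b = "(ev \<boxdot> Idt C y) \<cdot> (inv_arr C (Asc C y x y) \<cdot> (Idt C y \<boxdot> coev))"
  have "?a = inv_arr C (Run C x) \<cdot> (Run C x \<cdot> ?a)" by simp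
  also have "Run C x \<cdot> ?a = Lun C x" using 1 by simp
  finally have a: "is_iso C ?a" by (simp add: is_iso_Cmp is_iso_inv)
  have "?b = inv_arr C (Lun C y) \<cdot> (Lun C y \<cdot> ?b)" by simp
  also have "Lun C y \<cdot> ?b = Run C y" using 2 by simp
  finally have b: "is_iso C ?b" by (simp add: is_iso_Cmp is_iso_inv)
  show ?thesis using that a b y unfolding half_dual_def by blast
qed

end

section \<open>Compactness from duality\<close>

context tt_category
begin

text \<open>The arrow assumed to vanish is the adjunct of \<open>m\<close>. Tensored with
  \<open>x\<close> and closed up by \<open>ev\<close>, it becomes \<open>m\<close> tensored with the
  unit, preceded by the invertible zigzag.\<close>

lemma half_dual_zero_arr:
  assumes d: "half_dual x y coev ev" and m[simp]: "m \<in> Arr C" "Dom C m = x"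
    and z: "zero_arr ((m \<boxdot> Idt C y) \<cdot> coev)"
  shows "zero_arr m"
proof -
  note [simp] = half_dualD(1-8)[OF d]
  let ?X = "Cod C m" and ?k = "(Idt C x \<boxdot> ev) \<cdot> (Asc C x y x \<cdot> (coev \<boxdot> Idt C x))"
  have z': "zero_arr (((m \<boxdot> Idt C y) \<cdot> coev) \<boxdot> Idt C x)"
    by (rule zero_arr_Tenm_left[OF z]) simp_all
  have e1: "(m \<boxdot> Idt C (Unt C)) \<cdot> (Idt C x \<boxdot> ev) = (Idt C ?X \<boxdot> ev) \<cdot> (m \<boxdot> Idt C (y \<boxtimes> x))"
    by (simp add: Tenm_Tenm)
  have e2: "(m \<boxdot> Idt C (y \<boxtimes> x)) \<cdot> Asc C x y x = Asc C ?X y x \<cdot> ((m \<boxdot> Idt C y) \<boxdot> Idt C x)"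
    using Asc_natural[of m x ?X "Idt C y" y y "Idt C x" x x] by simp
  have "(m \<boxdot> Idt C (Unt C)) \<cdot> ?k =
      (Idt C ?X \<boxdot> ev) \<cdot> (Asc C ?X y x \<cdot> (((m \<boxdot> Idt C y) \<cdot> coev) \<boxdot> Idt C x))"
    by (simp add: Cmp_eq_Cmp[OF e1] Cmp_eq_Cmp[OF e2] Ten_right_Cmp)
  moreover have "zero_arr \<dots>"
    by (intro zero_arr_Cmp_left z') simp_all
  ultimately have "zero_arr ((m \<boxdot> Idt C (Unt C)) \<cdot> ?k)" by simp
  then have "zero_arr (m \<boxdot> Idt C (Unt C))"
    using half_dualD(9)[OF d] by (subst (asm) zero_arr_iso_right) simp_all
  then have "zero_arr (Run C ?X \<cdot> (m \<boxdot> Idt C (Unt C)))"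
    by (rule zero_arr_Cmp_left) simp_all
  then show ?thesis
    using Run_natural[of m x ?X] by (simp add: zero_arr_iso_right)
qed

lemma half_dual_zero_arr':
  assumes d: "half_dual x y coev ev"
    and k: "is_iso C ((ev \<boxdot> Idt C y) \<cdot> (inv_arr C (Asc C y x y) \<cdot> (Idt C y \<boxdot> coev)))"
    and m[simp]: "m \<in> Arr C" "Dom C m = y"
    and z: "zero_arr ((Idt C x \<boxdot> m) \<cdot> coev)"
  shows "zero_arr m"
proof -
  note [simp] = half_dualD(1-8)[OF d]
  let ?X = "Cod C m" and ?k = "(ev \<boxdot> Idt C y) \<cdot> (inv_arr C (Asc C y x y) \<cdot> (Idt C y \<boxdot> coev))"
  note [simp] = inv_simps[of "Asc C y x y"] inv_simps[of "Asc C y x ?X"]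
  have z': "zero_arr (Idt C y \<boxdot> ((Idt C x \<boxdot> m) \<cdot> coev))"
    by (rule zero_arr_Tenm_right[OF z]) simp_all
  have e1: "(Idt C (Unt C) \<boxdot> m) \<cdot> (ev \<boxdot> Idt C y) = (ev \<boxdot> Idt C ?X) \<cdot> (Idt C (y \<boxtimes> x) \<boxdot> m)"
    by (simp add: Tenm_Tenm)
  have n: "Asc C y x ?X \<cdot> (Idt C (y \<boxtimes> x) \<boxdot> m) = (Idt C y \<boxdot> (Idt C x \<boxdot> m)) \<cdot> Asc C y x y"
    using Asc_natural[of "Idt C y" y y "Idt C x" x x m y ?X] by simp
  have "(Idt C (y \<boxtimes> x) \<boxdot> m) \<cdot> inv_arr C (Asc C y x y) =
      inv_arr C (Asc C y x ?X) \<cdot> ((Asc C y x ?X \<cdot> (Idt C (y \<boxtimes> x) \<boxdot> m)) \<cdot> inv_arr C (Asc C y x y))"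
    by simp
  also have "\<dots> = inv_arr C (Asc C y x ?X) \<cdot> (Idt C y \<boxdot> (Idt C x \<boxdot> m))"
    unfolding n by simp
  finally have e2: "(Idt C (y \<boxtimes> x) \<boxdot> m) \<cdot> inv_arr C (Asc C y x y) = inv_arr C (Asc C y x ?X) \<cdot> (Idt C y \<boxdot> (Idt C x \<boxdot> m))" .
  have "(Idt C (Unt C) \<boxdot> m) \<cdot> ?k =
      (ev \<boxdot> Idt C ?X) \<cdot> (inv_arr C (Asc C y x ?X) \<cdot> (Idt C y \<boxdot> ((Idt C x \<boxdot> m) \<cdot> coev)))"
    by (simp add: Cmp_eq_Cmp[OF e1] Cmp_eq_Cmp[OF e2] Ten_left_Cmp)
  moreover have "zero_arr \<dots>"
    by (intro zero_arr_Cmp_left z') simp_all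
  ultimately have "zero_arr ((Idt C (Unt C) \<boxdot> m) \<cdot> ?k)" by simp
  then have "zero_arr (Idt C (Unt C) \<boxdot> m)"
    using k by (subst (asm) zero_arr_iso_right) simp_all
  then show ?thesis
    using zero_arr_arr_iso[OF arr_iso_Lun[of m]] by simp
qed

text \<open>The same adjunction argument with a bystander \<open>c\<close>. The zigzag beside
  \<open>c\<close> is \<open>?Y\<close>; its invertibility is the extra work.\<close>

lemma half_dual_Ten_zero_arr:
  assumes d: "half_dual x y coev ev" and c[simp]: "c \<in> Obj C" and m[simp]: "m \<in> Arr C" "Dom C m = c \<boxtimes> x"
    and z: "zero_arr ((m \<boxdot> Idt C y) \<cdot> (inv_arr C (Asc C c x y) \<cdot> (Idt C c \<boxdot> coev)))"
  shows "zero_arr m"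
proof -
  note [simp] = half_dualD(1-8)[OF d] inv_simps[of "Asc C c x y"]
  let ?X = "Cod C m" and ?i = "Unt C" and ?k = "(Idt C x \<boxdot> ev) \<cdot> (Asc C x y x \<cdot> (coev \<boxdot> Idt C x))"
  let ?Z = "inv_arr C (Asc C c x y) \<cdot> (Idt C c \<boxdot> coev)"
  let ?Y = "(Idt C (c \<boxtimes> x) \<boxdot> ev) \<cdot> (Asc C (c \<boxtimes> x) y x \<cdot> (?Z \<boxdot> Idt C x))"
  have z': "zero_arr (((m \<boxdot> Idt C y) \<cdot> ?Z) \<boxdot> Idt C x)"
    by (rule zero_arr_Tenm_left[OF z]) simp_all
  have e1: "(m \<boxdot> Idt C ?i) \<cdot> (Idt C (c \<boxtimes> x) \<boxdot> ev) = (Idt C ?X \<boxdot> ev) \<cdot> (m \<boxdot> Idt C (y \<boxtimes> x))"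
    by (simp add: Tenm_Tenm)
  have e2: "(m \<boxdot> Idt C (y \<boxtimes> x)) \<cdot> Asc C (c \<boxtimes> x) y x = Asc C ?X y x \<cdot> ((m \<boxdot> Idt C y) \<boxdot> Idt C x)"
    using Asc_natural[of m "c \<boxtimes> x" ?X "Idt C y" y y "Idt C x" x x] by simp
  have "(m \<boxdot> Idt C ?i) \<cdot> ?Y =
      (Idt C ?X \<boxdot> ev) \<cdot> (Asc C ?X y x \<cdot> (((m \<boxdot> Idt C y) \<cdot> ?Z) \<boxdot> Idt C x))"
    by (simp add: Cmp_eq_Cmp[OF e1] Cmp_eq_Cmp[OF e2] Ten_right_Cmp)
  moreover have "zero_arr \<dots>"
    by (intro zero_arr_Cmp_left z') simp_all
  ultimately have zY: "zero_arr ((m \<boxdot> Idt C ?i) \<cdot> ?Y)" by simp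
  have pent: "Asc C c x (y \<boxtimes> x) \<cdot> Asc C (c \<boxtimes> x) y x =
      (Idt C c \<boxdot> Asc C x y x) \<cdot> (Asc C c (x \<boxtimes> y) x \<cdot> (Asc C c x y \<boxdot> Idt C x))"
    using pentagon[of c x y x] by simp
  have n1: "Asc C c x ?i \<cdot> (Idt C (c \<boxtimes> x) \<boxdot> ev) = (Idt C c \<boxdot> (Idt C x \<boxdot> ev)) \<cdot> Asc C c x (y \<boxtimes> x)"
    using Asc_natural[of "Idt C c" c c "Idt C x" x x ev "y \<boxtimes> x" ?i] by simp
  have n2: "Asc C c (x \<boxtimes> y) x \<cdot> ((Idt C c \<boxdot> coev) \<boxdot> Idt C x) = (Idt C c \<boxdot> (coev \<boxdot> Idt C x)) \<cdot> Asc C c ?i x"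
    using Asc_natural[of "Idt C c" c c coev ?i "x \<boxtimes> y" "Idt C x" x x] by simp
  have e3: "(Asc C c x y \<boxdot> Idt C x) \<cdot> (?Z \<boxdot> Idt C x) = (Idt C c \<boxdot> coev) \<boxdot> Idt C x"
    by (simp add: Tenm_Tenm)
  \<comment> \<open>Up to associators \<open>?Y\<close> is the identity of \<open>c\<close> tensored
    with the zigzag \<open>?k\<close>: the pentagon moves \<open>c\<close> out of the way.\<close>
  have "Asc C c x ?i \<cdot> ?Y = (Idt C c \<boxdot> (Idt C x \<boxdot> ev)) \<cdot> ((Idt C c \<boxdot> Asc C x y x) \<cdot>
      (Asc C c (x \<boxtimes> y) x \<cdot> ((Asc C c x y \<boxdot> Idt C x) \<cdot> (?Z \<boxdot> Idt C x))))"
    by (simp add: Cmp_eq_Cmp[OF n1] Cmp_eq_Cmp[OF pent])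
  also have "\<dots> = (Idt C c \<boxdot> ?k) \<cdot> Asc C c ?i x"
    unfolding e3 n2 by (simp add: Ten_left_Cmp)
  finally have AY: "Asc C c x ?i \<cdot> ?Y = (Idt C c \<boxdot> ?k) \<cdot> Asc C c ?i x" .
  have "is_iso C ((Idt C c \<boxdot> ?k) \<cdot> Asc C c ?i x)"
    by (rule is_iso_Cmp[OF _ is_iso_Tenm[OF _ half_dualD(9)[OF d]]]) simp_all
  then have iAY: "is_iso C (Asc C c x ?i \<cdot> ?Y)" unfolding AY .
  have "is_iso C (inv_arr C (Asc C c x ?i) \<cdot> (Asc C c x ?i \<cdot> ?Y))"
    by (rule is_iso_Cmp[OF iAY is_iso_inv]) (simp_all add: inv_simps[of "Asc C c x ?i"])
  then have "is_iso C ?Y" using inv_simps[of "Asc C c x ?i"] by simp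
  then have "zero_arr (m \<boxdot> Idt C ?i)"
    using zY by (subst (asm) zero_arr_iso_right) simp_all
  then have "zero_arr (Run C ?X \<cdot> (m \<boxdot> Idt C ?i))"
    by (rule zero_arr_Cmp_left) simp_all
  then show ?thesis
    using Run_natural[of m "c \<boxtimes> x" ?X] by (simp add: zero_arr_iso_right)
qed

text \<open>Tensoring with \<open>y\<close> is a left adjoint by closedness, hence preserves
  coproducts; the universal property is transported through the internal hom.\<close>

lemma coproduct_Ten:
  assumes X: "is_coproduct C I x X inc" and y[simp]: "y \<in> Obj C"
  shows "is_coproduct C I (\<lambda>i. x i \<boxtimes> y) (X \<boxtimes> y) (\<lambda>i. inc i \<boxdot> Idt C y)"
  unfolding is_coproduct_def
proof (intro conjI ballI allI impI)
  note [simp] = coproduct_simps[OF X]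
  show "X \<boxtimes> y \<in> Obj C" by simp
  show "x i \<boxtimes> y \<in> Obj C" "inc i \<boxdot> Idt C y \<in> Hom C (x i \<boxtimes> y) (X \<boxtimes> y)" if "i \<in> I" for i
    using that by simp_all
  fix Y f assume Y[simp]: "Y \<in> Obj C" and f: "\<forall>i\<in>I. f i \<in> Hom C (x i \<boxtimes> y) Y"
  obtain h ev where h[simp]: "h \<in> Obj C" and ev: "ev \<in> Hom C (h \<boxtimes> y) Y"
    and univ: "\<And>w f. w \<in> Obj C \<Longrightarrow> f \<in> Hom C (w \<boxtimes> y) Y \<Longrightarrow>
        \<exists>!g. g \<in> Hom C w h \<and> ev \<cdot> (g \<boxdot> Idt C y) = f"
    using closed[OF y Y] by blast
  have ev'[simp]: "ev \<in> Arr C" "Dom C ev = h \<boxtimes> y" "Cod C ev = Y" using ev by simp_all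
  have "\<forall>i\<in>I. \<exists>g. g \<in> Hom C (x i) h \<and> ev \<cdot> (g \<boxdot> Idt C y) = f i"
    using univ f coproduct_simps(2)[OF X] by blast
  from bchoice[OF this] obtain g where g: "\<And>i. i \<in> I \<Longrightarrow> g i \<in> Hom C (x i) h"
    and gf: "\<And>i. i \<in> I \<Longrightarrow> ev \<cdot> (g i \<boxdot> Idt C y) = f i" by blast
  obtain k where k[simp]: "k \<in> Arr C" "Dom C k = X" "Cod C k = h" and kg: "\<And>i. i \<in> I \<Longrightarrow> k \<cdot> inc i = g i"
    using coproduct_desc[OF X, of h g] g by auto
  show "\<exists>!l. l \<in> Hom C (X \<boxtimes> y) Y \<and> (\<forall>i\<in>I. l \<cdot> (inc i \<boxdot> Idt C y) = f i)"
  proof (rule ex1I[of _ "ev \<cdot> (k \<boxdot> Idt C y)"])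
    show "ev \<cdot> (k \<boxdot> Idt C y) \<in> Hom C (X \<boxtimes> y) Y \<and> (\<forall>i\<in>I. (ev \<cdot> (k \<boxdot> Idt C y)) \<cdot> (inc i \<boxdot> Idt C y) = f i)"
      using gf kg by (simp add: Tenm_Tenm)
  next
    fix l assume l: "l \<in> Hom C (X \<boxtimes> y) Y \<and> (\<forall>i\<in>I. l \<cdot> (inc i \<boxdot> Idt C y) = f i)"
    then obtain m where m: "m \<in> Hom C X h" and ml: "ev \<cdot> (m \<boxdot> Idt C y) = l"
      using univ[of X l] by auto
    have m'[simp]: "m \<in> Arr C" "Dom C m = X" "Cod C m = h" using m by simp_all
    have "m = k"
    proof (rule coproduct_eqI[OF X])
      fix i assume i: "i \<in> I"
      have fi: "f i \<in> Hom C (x i \<boxtimes> y) Y" using f i by blast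
      have "l \<cdot> (inc i \<boxdot> Idt C y) = f i" using l i by blast
      then have "ev \<cdot> ((m \<cdot> inc i) \<boxdot> Idt C y) = f i"
        unfolding ml[symmetric] using i by (simp add: Tenm_Tenm)
      moreover have "ev \<cdot> ((k \<cdot> inc i) \<boxdot> Idt C y) = f i" using i kg gf by simp
      moreover have "m \<cdot> inc i \<in> Hom C (x i) h" "k \<cdot> inc i \<in> Hom C (x i) h" using i by simp_all
      ultimately show "m \<cdot> inc i = k \<cdot> inc i"
        using univ[OF coproduct_simps(2)[OF X i] fi] by blast
    qed simp_all
    then show "l = ev \<cdot> (k \<boxdot> Idt C y)" using ml by simp
  qed
qed

lemma cut_Ten:
  assumes X: "is_coproduct C I x X inc" and y[simp]: "y \<in> Obj C" and E: "cut I x X inc J E"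
  shows "cut I (\<lambda>i. x i \<boxtimes> y) (X \<boxtimes> y) (\<lambda>i. inc i \<boxdot> Idt C y) J (E \<boxdot> Idt C y)"
proof -
  note [simp] = coproduct_simps[OF X] cutD[OF E]
  have "(E \<boxdot> Idt C y) \<cdot> (inc i \<boxdot> Idt C y) = (if i \<in> J then Zer C (x i \<boxtimes> y) (X \<boxtimes> y) else inc i \<boxdot> Idt C y)"
    if "i \<in> I" for i
    using that by (simp add: Tenm_Tenm Tenm_Zer_left)
  then show ?thesis unfolding cut_def by simp
qed

lemma compact_object_TenE:
  assumes c: "compact_object U C c" and I: "I \<subseteq> U" "small U I" and X: "is_coproduct C I x X inc"
    and y[simp]: "y \<in> Obj C" and u: "u \<in> Arr C" "Dom C u = c" "Cod C u = X \<boxtimes> y"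
  obtains J E where "finite J" "J \<subseteq> I" "cut I x X inc J E" "zero_arr ((E \<boxdot> Idt C y) \<cdot> u)"
proof -
  note XY = coproduct_Ten[OF X y]
  obtain J E where J: "finite J" "J \<subseteq> I"
      and E: "cut I (\<lambda>i. x i \<boxtimes> y) (X \<boxtimes> y) (\<lambda>i. inc i \<boxdot> Idt C y) J E" and zE: "zero_arr (E \<cdot> u)"
    using compact_objectE[OF c I XY u] by auto
  obtain E' where E': "cut I x X inc J E'" using ex_cut[OF X] .
  have "E = E' \<boxdot> Idt C y" using cut_unique[OF XY E cut_Ten[OF X y E']] .
  then show ?thesis using that[OF J E'] zE by simp
qed

text \<open>Arrows from \<open>x\<close> to X embed into arrows from the unit to X
  \<open>\<boxtimes>\<close> \<open>y\<close>, compatibly with cuts, so compactness of the unit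
  passes to \<open>x\<close>.\<close>

lemma half_dual_compact:
  assumes d: "half_dual x y coev ev" and unit: "compact_object U C (Unt C)"
  shows "compact_object U C x"
proof (rule compact_objectI)
  note [simp] = half_dualD(1-8)[OF d]
  show "x \<in> Obj C" by simp
  fix I a X inc u
  assume I: "I \<subseteq> U" "small U I" and X: "is_coproduct C I a X inc"
    and u[simp]: "u \<in> Arr C" "Dom C u = x" "Cod C u = X"
  obtain J E where J: "finite J" "J \<subseteq> I" and E: "cut I a X inc J E"
    and z: "zero_arr ((E \<boxdot> Idt C y) \<cdot> ((u \<boxdot> Idt C y) \<cdot> coev))"
    using compact_object_TenE[OF unit I X half_dualD(2)[OF d], of "(u \<boxdot> Idt C y) \<cdot> coev"] by auto
  note [simp] = cutD(1-3)[OF E]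
  have "((E \<cdot> u) \<boxdot> Idt C y) \<cdot> coev = (E \<boxdot> Idt C y) \<cdot> ((u \<boxdot> Idt C y) \<cdot> coev)"
    by (simp add: Ten_right_Cmp)
  then have "zero_arr (E \<cdot> u)"
    using half_dual_zero_arr[OF d, of "E \<cdot> u"] z by simp
  then show "\<exists>J E. finite J \<and> J \<subseteq> I \<and> cut I a X inc J E \<and> zero_arr (E \<cdot> u)"
    using J E by blast
qed

lemma half_dual_compact':
  assumes d: "half_dual x y coev ev" and unit: "compact_object U C (Unt C)"
    and k: "is_iso C ((ev \<boxdot> Idt C y) \<cdot> (inv_arr C (Asc C y x y) \<cdot> (Idt C y \<boxdot> coev)))"
  shows "compact_object U C y"
proof (rule compact_objectI)
  note [simp] = half_dualD(1-8)[OF d]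
  show "y \<in> Obj C" by simp
  fix I a X inc u
  assume I: "I \<subseteq> U" "small U I" and X: "is_coproduct C I a X inc"
    and u[simp]: "u \<in> Arr C" "Dom C u = y" "Cod C u = X"
  note [simp] = coproduct_simps(1)[OF X]
  obtain J E where J: "finite J" "J \<subseteq> I" and E: "cut I a X inc J E"
    and z: "zero_arr ((E \<boxdot> Idt C x) \<cdot> ((u \<boxdot> Idt C x) \<cdot> (Sym C x y \<cdot> coev)))"
    using compact_object_TenE[OF unit I X half_dualD(1)[OF d], of "(u \<boxdot> Idt C x) \<cdot> (Sym C x y \<cdot> coev)"] by auto
  note [simp] = cutD(1-3)[OF E]
  have s: "Sym C x X \<cdot> (Idt C x \<boxdot> (E \<cdot> u)) = ((E \<cdot> u) \<boxdot> Idt C x) \<cdot> Sym C x y"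
    by (rule Sym_natural) simp_all
  have "Sym C x X \<cdot> ((Idt C x \<boxdot> (E \<cdot> u)) \<cdot> coev) = ((E \<cdot> u) \<boxdot> Idt C x) \<cdot> (Sym C x y \<cdot> coev)"
    by (simp add: Cmp_eq_Cmp[OF s])
  also have "\<dots> = (E \<boxdot> Idt C x) \<cdot> ((u \<boxdot> Idt C x) \<cdot> (Sym C x y \<cdot> coev))"
    by (simp add: Ten_right_Cmp)
  finally have "zero_arr (Sym C x X \<cdot> ((Idt C x \<boxdot> (E \<cdot> u)) \<cdot> coev))" using z by simp
  then have "zero_arr ((Idt C x \<boxdot> (E \<cdot> u)) \<cdot> coev)"
    by (subst (asm) zero_arr_iso_left) simp_all
  then have "zero_arr (E \<cdot> u)"
    using half_dual_zero_arr'[OF d k, of "E \<cdot> u"] by simp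
  then show "\<exists>J E. finite J \<and> J \<subseteq> I \<and> cut I a X inc J E \<and> zero_arr (E \<cdot> u)"
    using J E by blast
qed

lemma half_dual_compact_Ten:
  assumes d: "half_dual x y coev ev" and c: "compact_object U C c"
  shows "compact_object U C (c \<boxtimes> x)"
proof (rule compact_objectI)
  note [simp] = half_dualD(1-8)[OF d] compact_object_Obj[OF c]
  note [simp] = inv_simps[of "Asc C c x y"] inv_simps[of "Run C c"] is_iso_inv[of "Run C c"]
  show "c \<boxtimes> x \<in> Obj C" by simp
  fix I a X inc u
  assume I: "I \<subseteq> U" "small U I" and X: "is_coproduct C I a X inc"
    and u[simp]: "u \<in> Arr C" "Dom C u = c \<boxtimes> x" "Cod C u = X"
  let ?Z = "inv_arr C (Asc C c x y) \<cdot> (Idt C c \<boxdot> coev)"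
  obtain J E where J: "finite J" "J \<subseteq> I" and E: "cut I a X inc J E"
    and z: "zero_arr ((E \<boxdot> Idt C y) \<cdot> ((u \<boxdot> Idt C y) \<cdot> (?Z \<cdot> inv_arr C (Run C c))))"
    using compact_object_TenE[OF c I X half_dualD(2)[OF d], of "(u \<boxdot> Idt C y) \<cdot> (?Z \<cdot> inv_arr C (Run C c))"] by auto
  note [simp] = cutD(1-3)[OF E]
  have "(((E \<cdot> u) \<boxdot> Idt C y) \<cdot> ?Z) \<cdot> inv_arr C (Run C c) =
      (E \<boxdot> Idt C y) \<cdot> ((u \<boxdot> Idt C y) \<cdot> (?Z \<cdot> inv_arr C (Run C c)))"
    by (simp add: Ten_right_Cmp)
  then have "zero_arr ((((E \<cdot> u) \<boxdot> Idt C y) \<cdot> ?Z) \<cdot> inv_arr C (Run C c))" using z by simp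
  then have "zero_arr (((E \<cdot> u) \<boxdot> Idt C y) \<cdot> ?Z)"
    by (rule zero_arr_iso_right[THEN iffD1, rotated 3]) simp_all
  then have "zero_arr (E \<cdot> u)"
    using half_dual_Ten_zero_arr[OF d, of c "E \<cdot> u"] by simp
  then show "\<exists>J E. finite J \<and> J \<subseteq> I \<and> cut I a X inc J E \<and> zero_arr (E \<cdot> u)"
    using J E by blast
qed

end

context rigidly_compactly_generated
begin

lemma compact_Unt: "compact_object U C (Unt C)"
  using dualizable_Unt compact_iff_dualizable by blast

text \<open>Cones, suspensions and sums are handled by compactness. For a tensor product one factor
  is used as a compact object and the other as a dualizable one; duals exist by dualizability and
  are compact because the unit is.\<close>

lemma rigid_compacts: "rigid_tt_category C (compacts U C)"
proof
  show "compacts U C \<subseteq> Obj C" using compact_object_Obj by (auto simp: compacts_def)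
  show "Unt C \<in> compacts U C" using compact_Unt by (simp add: compacts_def)
  show "a \<boxtimes> b \<in> compacts U C" if "a \<in> compacts U C" "b \<in> compacts U C" for a b
    using that dualizable_half_dual[of b] half_dual_compact_Ten compact_iff_dualizable
    unfolding compacts_def mem_Collect_eq by metis
  show sh: "Sh C a \<in> compacts U C \<longleftrightarrow> a \<in> compacts U C" if "a \<in> Obj C" for a
    using compact_object_Sh_iff[OF that] by (simp add: compacts_def)
  show "Dom C h \<in> compacts U C" if "(f, g, h) \<in> Tri C" "Dom C f \<in> compacts U C" "Dom C g \<in> compacts U C" for f g h
    using compact_object_cone[OF that(1)] that(2,3) sh[of "Dom C f"] Tri_simps[OF that(1)]
    by (simp add: compacts_def)
  show "z \<in> compacts U C" if "zero_object C z" for z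
    using compact_object_zero that by (simp add: compacts_def)
  show "X \<in> compacts U C" if "is_direct_sum C a b X" "a \<in> compacts U C" "b \<in> compacts U C" for a b X
    using compact_object_sum that by (simp add: compacts_def)
  show "\<exists>y\<in>compacts U C. \<exists>coev ev. coev \<in> Hom C (Unt C) (d \<boxtimes> y) \<and>
      ev \<in> Hom C (y \<boxtimes> d) (Unt C) \<and> split_mono (coev \<boxdot> Idt C d) \<and> split_epi (Idt C d \<boxdot> ev)"
    if d: "d \<in> compacts U C" for d
  proof -
    obtain y coev ev where y: "half_dual d y coev ev"
      "is_iso C ((ev \<boxdot> Idt C y) \<cdot> (inv_arr C (Asc C y d y) \<cdot> (Idt C y \<boxdot> coev)))"
      using dualizable_half_dual[of d] d compact_iff_dualizable unfolding compacts_def by blast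
    have "y \<in> compacts U C" using half_dual_compact'[OF y(1) compact_Unt y(2)] by (simp add: compacts_def)
    then show ?thesis using half_dual_split[OF y(1)] half_dualD[OF y(1)] by auto
  qed
qed

end

section \<open>Thick tensor ideals in rigid categories\<close>

lemma (in triangulated_category) Tri_iso_zero:
  assumes f: "is_iso C f" and z: "zero_object C z"
  shows "(f, Zer C (Cod C f) z, Zer C z (Sh C (Dom C f))) \<in> Tri C"
proof -
  note [simp] = is_iso_Arr[OF f]
  have zo[simp]: "z \<in> Obj C" using z zero_object_iff by blast
  show ?thesis
    by (rule Tri_iso[OF TR1_Idt[OF _ z], of "Dom C f" _ _ _ "Idt C (Dom C f)" f "Idt C z"])
      (use f in \<open>auto simp: candidate_def is_iso_Idt Shm_Idt\<close>)
qed

lemma (in category) coproduct_bool_desc: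
  assumes X: "is_coproduct C (UNIV :: bool set) (\<lambda>i. if i then a else b) X inc"
    and f: "f \<in> Arr C" "Dom C f = a" and g: "g \<in> Arr C" "Dom C g = b" "Cod C g = Cod C f"
  obtains h where "h \<in> Arr C" "Dom C h = X" "Cod C h = Cod C f" "h \<cdot> inc True = f" "h \<cdot> inc False = g"
proof -
  obtain h where h: "h \<in> Arr C" "Dom C h = X" "Cod C h = Cod C f"
    and hh: "\<And>i. i \<in> UNIV \<Longrightarrow> h \<cdot> inc i = (if i then f else g)"
    by (rule coproduct_desc[OF X, of "Cod C f" "\<lambda>i. if i then f else g"]) (use f g in auto)
  have "h \<cdot> inc True = f" "h \<cdot> inc False = g" using hh[of True] hh[of False] by simp_all
  then show ?thesis using that h by blast
qed

section \<open>Closure properties and generation of thick tensor ideals\<close>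

context rigid_tt_category
begin

abbreviation ideal :: "'o set \<Rightarrow> bool" where
  "ideal \<equiv> thick_tensor_ideal C K"

lemma Obj_if_K [simp]: "a \<in> K \<Longrightarrow> a \<in> Obj C"
  using K_Obj by blast

lemma mid_K:
  assumes tri: "(f, g, h) \<in> Tri C" and "Dom C f \<in> K" "Dom C h \<in> K"
  shows "Dom C g \<in> K"
proof -
  note [simp] = Tri_simps[OF tri]
  have "Sh C (Dom C g) \<in> K"
    using cone_K[OF Tri_rotate[OF Tri_rotate[OF tri]]] assms Sh_K[of "Dom C f"] by simp
  then show ?thesis using Sh_K by simp
qed

lemma fiber_K:
  assumes tri: "(f, g, h) \<in> Tri C" and "Dom C g \<in> K" "Dom C h \<in> K"
  shows "Dom C f \<in> K"
  using cone_K[OF Tri_rotate[OF tri]] Tri_simps[OF tri] assms Sh_K[of "Dom C f"] by simp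

lemma iso_K:
  assumes "isomorphic a b" "a \<in> K"
  shows "b \<in> K"
proof -
  obtain f where f: "is_iso C f" "Dom C f = a" "Cod C f = b" using assms unfolding isomorphic_def by blast
  obtain z where z: "zero_object C z" using ex_zero_object by blast
  have zo: "z \<in> Obj C" using z zero_object_iff by blast
  show ?thesis
    using mid_K[OF Tri_iso_zero[OF f(1) z]] f assms(2) zero_K[OF z] zo is_iso_Arr[OF f(1)] by auto
qed

lemma thick_cone:
  assumes P: "thick_subcategory C K P" and tri: "(f, g, h) \<in> Tri C" "Dom C f \<in> P" "Dom C g \<in> P"
  shows "Dom C h \<in> P"
proof -
  have "P \<subseteq> K" using P by (simp add: thick_subcategory_def)
  then have "{Dom C f, Dom C g, Dom C h} \<subseteq> K" using cone_K[OF tri(1)] tri(2,3) by blast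
  then show ?thesis using P tri unfolding thick_subcategory_def by blast
qed

lemma thick_mid:
  assumes P: "thick_subcategory C K P" and tri: "(f, g, h) \<in> Tri C" "Dom C f \<in> P" "Dom C h \<in> P"
  shows "Dom C g \<in> P"
proof -
  have "P \<subseteq> K" using P by (simp add: thick_subcategory_def)
  then have "{Dom C f, Dom C g, Dom C h} \<subseteq> K" using mid_K[OF tri(1)] tri(2,3) by blast
  then show ?thesis using P tri unfolding thick_subcategory_def by blast
qed

lemma ideal_thick: "ideal P \<Longrightarrow> thick_subcategory C K P"
  by (simp add: thick_tensor_ideal_def)

lemmas ideal_cone = thick_cone[OF ideal_thick]
lemmas ideal_mid = thick_mid[OF ideal_thick]
lemma ideal_K: "ideal P \<Longrightarrow> a \<in> P \<Longrightarrow> a \<in> K"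
  by (auto simp: thick_tensor_ideal_def thick_subcategory_def)

lemma ideal_Sh: "ideal P \<Longrightarrow> a \<in> K \<Longrightarrow> Sh C a \<in> P \<longleftrightarrow> a \<in> P"
  by (auto simp: thick_tensor_ideal_def thick_subcategory_def)

lemma ideal_Ten: "ideal P \<Longrightarrow> a \<in> K \<Longrightarrow> b \<in> P \<Longrightarrow> a \<boxtimes> b \<in> P"
  by (auto simp: thick_tensor_ideal_def)

lemma ideal_zero:
  assumes P: "ideal P" and z: "zero_object C z"
  shows "z \<in> P"
proof -
  obtain p where p: "p \<in> P" using P by (auto simp: thick_tensor_ideal_def thick_subcategory_def)
  have [simp]: "p \<in> Obj C" "z \<in> Obj C" using ideal_K[OF P p] z zero_object_iff by auto
  show ?thesis using ideal_cone[OF P TR1_Idt[OF _ z], of p] p by simp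
qed

text \<open>The retract is completed to a direct sum by the cone of its inclusion, and this cone
  lies in \<open>K\<close>, as the definition of thickness demands.\<close>

lemma ideal_retract:
  assumes P: "ideal P" and r: "is_retract a b" and b: "b \<in> P" and a: "a \<in> K"
  shows "a \<in> P"
proof -
  obtain i p where i: "i \<in> Arr C" "p \<in> Arr C" "Dom C i = a" "Cod C i = b"
      "Dom C p = b" "Cod C p = a" "p \<cdot> i = Idt C a"
    using r unfolding is_retract_def by blast
  obtain g h where tri: "(i, g, h) \<in> Tri C" using ex_cone[OF i(1)] .
  have "is_direct_sum C a (Dom C h) b"
    using Tri_split_complement[OF tri, of p] i by simp
  moreover have "Dom C h \<in> K"
    using cone_K[OF tri] Tri_simps[OF tri] i a ideal_K[OF P b] by simp
  ultimately show ?thesis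
    using P a b unfolding thick_tensor_ideal_def thick_subcategory_def by blast
qed

lemma ideal_iso:
  assumes P: "ideal P" and i: "isomorphic a b"
  shows "a \<in> P \<longleftrightarrow> b \<in> P"
proof -
  have "b \<in> P" if "isomorphic a b" "a \<in> P" for a b
    using ideal_retract[OF P isomorphic_retract[OF isomorphic_sym[OF that(1)]] that(2)]
      iso_K[OF that(1) ideal_K[OF P that(2)]] .
  then show ?thesis using i isomorphic_sym[OF i] by blast
qed

lemma ideal_Ten':
  assumes P: "ideal P" and "a \<in> P" "b \<in> K"
  shows "a \<boxtimes> b \<in> P"
  using ideal_iso[OF P isomorphic_Sym[of b a]] ideal_Ten[OF P assms(3,2)] ideal_K[OF P] assms by simp

text \<open>The cone of the inclusion of \<open>a\<close> is compared with \<open>b\<close> only up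
  to a retract: composing its section with the decomposition of the identity leaves the component
  through \<open>b\<close>. For ideals, closed under retracts, this comparison is enough.\<close>

lemma direct_sum_complement:
  assumes X: "is_direct_sum C a b X"
  obtains i g h where "(i, g, h) \<in> Tri C" "Dom C i = a" "Dom C g = X" "is_retract (Dom C h) b"
proof -
  obtain inc where inc: "is_coproduct C (UNIV :: bool set) (\<lambda>i. if i then a else b) X inc"
    using X by (auto simp: is_direct_sum_def)
  let ?i = "inc True" and ?j = "inc False"
  have o[simp]: "X \<in> Obj C" "a \<in> Obj C" "b \<in> Obj C" "?i \<in> Arr C" "Dom C ?i = a" "Cod C ?i = X"
    "?j \<in> Arr C" "Dom C ?j = b" "Cod C ?j = X"
    using coproduct_simps[OF inc] coproduct_simps(2)[OF inc, of True] coproduct_simps(2)[OF inc, of False] by auto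
  obtain p where p[simp]: "p \<in> Arr C" "Dom C p = X" "Cod C p = a"
    and pi: "p \<cdot> ?i = Idt C a" and pj: "p \<cdot> ?j = Zer C b a"
    by (rule coproduct_bool_desc[OF inc, of "Idt C a" "Zer C b a"]) simp_all
  obtain q where q[simp]: "q \<in> Arr C" "Dom C q = X" "Cod C q = b"
    and qi: "q \<cdot> ?i = Zer C a b" and qj: "q \<cdot> ?j = Idt C b"
    by (rule coproduct_bool_desc[OF inc, of "Zer C a b" "Idt C b"]) simp_all
  have dec: "(?i \<cdot> p) \<boxplus> (?j \<cdot> q) = Idt C X"
  proof (rule coproduct_eqI[OF inc])
    fix c :: bool
    show "((?i \<cdot> p) \<boxplus> (?j \<cdot> q)) \<cdot> inc c = Idt C X \<cdot> inc c"
      by (cases c) (simp_all add: pi pj qi qj)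
  qed simp_all
  obtain g h where tri: "(?i, g, h) \<in> Tri C" using ex_cone[OF o(4)] .
  note [simp] = Tri_simps(2,3)[OF tri] Tri_simps(5)[OF tri]
  have g[simp]: "Dom C g = X" using Tri_simps(4)[OF tri] by simp
  obtain s where s[simp]: "s \<in> Arr C" "Dom C s = Dom C h" "Cod C s = X" and gs: "g \<cdot> s = Idt C (Dom C h)"
    using Tri_split_section[OF tri, of p] pi by auto
  have gi: "g \<cdot> ?i = Zer C a (Dom C h)"
    using zero_arrD[OF Tri_Cmp_zero[OF tri]] by simp
  have "g \<cdot> (((?i \<cdot> p) \<boxplus> (?j \<cdot> q)) \<cdot> s) = g \<cdot> (?j \<cdot> (q \<cdot> s))"
    by (simp add: Cmp_eq_Cmp[OF gi])
  then have "(g \<cdot> ?j) \<cdot> (q \<cdot> s) = Idt C (Dom C h)"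
    unfolding dec using gs by simp
  then have "is_retract (Dom C h) b"
    unfolding is_retract_def by (intro bexI[of _ "q \<cdot> s"] bexI[of _ "g \<cdot> ?j"]) simp_all
  then show ?thesis using that[OF tri] by simp
qed

lemma ideal_sum:
  assumes P: "ideal P" and X: "is_direct_sum C a b X" and ab: "a \<in> K" "b \<in> K"
  shows "X \<in> P \<longleftrightarrow> a \<in> P \<and> b \<in> P"
proof
  assume "X \<in> P"
  then show "a \<in> P \<and> b \<in> P" using direct_sum_retracts[OF X] ideal_retract[OF P] ab by blast
next
  assume a: "a \<in> P \<and> b \<in> P"
  obtain i g h where tri: "(i, g, h) \<in> Tri C" "Dom C i = a" "Dom C g = X" "is_retract (Dom C h) b"
    using direct_sum_complement[OF X] .
  have "Dom C h \<in> K" using cone_K[OF tri(1)] sum_K[OF X] ab tri by simp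
  then have "Dom C h \<in> P" using ideal_retract[OF P tri(4)] a by blast
  then show "X \<in> P" using ideal_mid[OF P tri(1)] tri a by simp
qed

text \<open>Closure under suspension and desuspension comes from tensoring with the suspension and a
  desuspension of the unit, and then the remaining two sides of a triangle follow from the middle
  one by rotation.\<close>

lemma idealI:
  assumes sub: "P \<subseteq> K" and ne: "P \<noteq> {}"
    and mid: "\<And>f g h. (f, g, h) \<in> Tri C \<Longrightarrow> Dom C f \<in> P \<Longrightarrow> Dom C h \<in> P \<Longrightarrow> Dom C g \<in> K \<Longrightarrow> Dom C g \<in> P"
    and ret: "\<And>a b. is_retract a b \<Longrightarrow> b \<in> P \<Longrightarrow> a \<in> K \<Longrightarrow> a \<in> P"
    and ten: "\<And>a b. a \<in> K \<Longrightarrow> b \<in> P \<Longrightarrow> a \<boxtimes> b \<in> P"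
  shows "ideal P"
proof -
  have iso: "b \<in> P" if "isomorphic a b" "a \<in> P" for a b
  proof -
    have "a \<in> K" using that sub by blast
    then show ?thesis
      using ret[OF isomorphic_retract[OF isomorphic_sym[OF that(1)]] that(2)] iso_K[OF that(1)] by blast
  qed
  obtain s where s: "s \<in> Obj C" "isomorphic (Sh C s) (Unt C)" using ex_desuspended_unit .
  have "s \<in> K" using iso_K[OF isomorphic_sym[OF s(2)] Unt_K] Sh_K[OF s(1)] by blast
  then have Sh: "Sh C a \<in> P \<longleftrightarrow> a \<in> P" if a: "a \<in> K" for a
    using ten[of s "Sh C a"] ten[of "Sh C (Unt C)" a] Sh_K[of "Unt C"] Unt_K a
      iso[OF isomorphic_desuspended_unit[OF s], of a] iso[OF isomorphic_Sh_Unt, of a] by auto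
  have cone: "Dom C h \<in> P" if tri: "(f, g, h) \<in> Tri C" and "Dom C f \<in> P" "Dom C g \<in> P" for f g h
    using mid[OF Tri_rotate[OF tri]] Tri_simps[OF tri] Sh[of "Dom C f"] cone_K[OF tri] that(2,3) sub
    by auto
  have fiber: "Dom C f \<in> P" if tri: "(f, g, h) \<in> Tri C" and "Dom C g \<in> P" "Dom C h \<in> P" for f g h
  proof -
    have k: "Dom C g \<in> K" "Dom C h \<in> K" "Dom C f \<in> K" using that fiber_K[OF tri] sub by auto
    have "Sh C (Dom C f) \<in> P"
      using mid[OF Tri_rotate[OF Tri_rotate[OF tri]]] Tri_simps[OF tri] Sh[of "Dom C g"] that k
        Sh_K[of "Dom C f"] by simp
    then show ?thesis using Sh k by blast
  qed
  have S: "a \<in> P \<and> b \<in> P" if "a \<in> K" "b \<in> K" "X \<in> P" "is_direct_sum C a b X" for a b X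
    using ret[OF direct_sum_retracts(1)[OF that(4)]] ret[OF direct_sum_retracts(2)[OF that(4)]] that by blast
  have T: "(Dom C f \<in> P \<and> Dom C g \<in> P \<longrightarrow> Dom C h \<in> P) \<and>
        (Dom C g \<in> P \<and> Dom C h \<in> P \<longrightarrow> Dom C f \<in> P) \<and>
        (Dom C f \<in> P \<and> Dom C h \<in> P \<longrightarrow> Dom C g \<in> P)"
    if "(f, g, h) \<in> Tri C \<and> {Dom C f, Dom C g, Dom C h} \<subseteq> K" for f g h
    using cone[of f g h] fiber[of f g h] mid[of f g h] that by simp
  have "thick_subcategory C K P"
    unfolding thick_subcategory_def
  proof (intro conjI)
    show "P \<subseteq> K" "P \<noteq> {}" by (fact sub ne)+
    show "\<forall>a\<in>K. (Sh C a \<in> P) = (a \<in> P)" using Sh by blast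
    show "\<forall>f g h. (f, g, h) \<in> Tri C \<and> {Dom C f, Dom C g, Dom C h} \<subseteq> K \<longrightarrow>
        (Dom C f \<in> P \<and> Dom C g \<in> P \<longrightarrow> Dom C h \<in> P) \<and>
        (Dom C g \<in> P \<and> Dom C h \<in> P \<longrightarrow> Dom C f \<in> P) \<and>
        (Dom C f \<in> P \<and> Dom C h \<in> P \<longrightarrow> Dom C g \<in> P)"
      by (intro allI) (rule impI, rule T)
    show "\<forall>a\<in>K. \<forall>b\<in>K. \<forall>X\<in>P. is_direct_sum C a b X \<longrightarrow> a \<in> P \<and> b \<in> P"
      by (intro ballI impI) (rule S)
  qed
  then show ?thesis unfolding thick_tensor_ideal_def using ten by simp
qed

definition gen :: "'o set \<Rightarrow> 'o set" where
  "gen A = {x \<in> K. \<forall>P. ideal P \<and> A \<subseteq> P \<longrightarrow> x \<in> P}"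

lemma ideal_gen: "ideal (gen A)"
proof (rule idealI)
  obtain z where z: "zero_object C z" using ex_zero_object by blast
  then have "z \<in> gen A" using ideal_zero zero_K by (simp add: gen_def)
  then show "gen A \<noteq> {}" by blast
  show "a \<in> gen A" if "is_retract a b" "b \<in> gen A" "a \<in> K" for a b
    using that ideal_retract by (auto simp: gen_def)
  show "a \<boxtimes> b \<in> gen A" if "a \<in> K" "b \<in> gen A" for a b
    using that ideal_Ten Ten_K by (auto simp: gen_def)
  show "Dom C g \<in> gen A" if "(f, g, h) \<in> Tri C" "Dom C f \<in> gen A" "Dom C h \<in> gen A" "Dom C g \<in> K" for f g h
    using that ideal_mid by (auto simp: gen_def)
qed (auto simp: gen_def)

lemma gen_superset: "A \<subseteq> K \<Longrightarrow> A \<subseteq> gen A"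
  by (auto simp: gen_def)

lemma gen_least: "ideal P \<Longrightarrow> A \<subseteq> P \<Longrightarrow> gen A \<subseteq> P"
  by (auto simp: gen_def)

lemma gen_mono: "A \<subseteq> B \<Longrightarrow> gen A \<subseteq> gen B"
  by (auto simp: gen_def)

text \<open>The directed union of the ideals generated by finite subsets of \<open>A\<close> is
  itself an ideal.\<close>

lemma gen_finite:
  assumes A: "A \<subseteq> K" and x: "x \<in> gen A"
  shows "\<exists>A0. finite A0 \<and> A0 \<subseteq> A \<and> x \<in> gen A0"
proof -
  let ?G = "\<Union>{gen A0 |A0. finite A0 \<and> A0 \<subseteq> A}"
  have "ideal ?G"
  proof (rule idealI)
    show "?G \<subseteq> K" by (auto simp: gen_def)
    obtain z where "zero_object C z" using ex_zero_object by blast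
    then have "z \<in> gen {}" using ideal_zero[OF ideal_gen] by blast
    then show "?G \<noteq> {}" by blast
    show "a \<in> ?G" if "is_retract a b" "b \<in> ?G" "a \<in> K" for a b
      using that ideal_retract[OF ideal_gen] by blast
    show "a \<boxtimes> b \<in> ?G" if "a \<in> K" "b \<in> ?G" for a b
      using that ideal_Ten[OF ideal_gen] by blast
    fix f g h assume tri: "(f, g, h) \<in> Tri C" and "Dom C f \<in> ?G" "Dom C h \<in> ?G"
    then obtain A1 A2 where A: "finite A1" "A1 \<subseteq> A" "Dom C f \<in> gen A1" "finite A2" "A2 \<subseteq> A" "Dom C h \<in> gen A2"
      by blast
    then have "Dom C f \<in> gen (A1 \<union> A2)" "Dom C h \<in> gen (A1 \<union> A2)"
      using gen_mono[of A1 "A1 \<union> A2"] gen_mono[of A2 "A1 \<union> A2"] by auto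
    then have "Dom C g \<in> gen (A1 \<union> A2)" using ideal_mid[OF ideal_gen tri] by blast
    then show "Dom C g \<in> ?G" using A by (intro UnionI[of "gen (A1 \<union> A2)"]) auto
  qed
  moreover have "A \<subseteq> ?G"
  proof
    fix a assume "a \<in> A"
    then have "a \<in> gen {a}" "finite {a}" "{a} \<subseteq> A" using gen_superset[of "{a}"] A by auto
    then show "a \<in> ?G" by blast
  qed
  ultimately show ?thesis using gen_least[of ?G A] x by blast
qed

text \<open>The colon ideal of P by b. A statement about products with b that holds on generators
  extends through it to the generated ideal.\<close>

lemma ideal_transporter:
  assumes P: "ideal P" and b: "b \<in> K"
  shows "ideal {x \<in> K. x \<boxtimes> b \<in> P}"
proof (rule idealI)
  obtain z where z: "zero_object C z" using ex_zero_object by blast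
  then have "z \<boxtimes> b \<in> P" using ideal_Ten'[OF P ideal_zero[OF P z] b] by blast
  then show "{x \<in> K. x \<boxtimes> b \<in> P} \<noteq> {}" using zero_K[OF z] by blast
next
  fix f g h assume tri: "(f, g, h) \<in> Tri C" and a: "Dom C f \<in> {x \<in> K. x \<boxtimes> b \<in> P}"
    "Dom C h \<in> {x \<in> K. x \<boxtimes> b \<in> P}" and k: "Dom C g \<in> K"
  obtain h' where h': "(f \<boxdot> Idt C b, g \<boxdot> Idt C b, h') \<in> Tri C" "Dom C h' = Dom C h \<boxtimes> b"
    using Tri_Ten_right[OF tri, of b] b by auto
  show "Dom C g \<in> {x \<in> K. x \<boxtimes> b \<in> P}"
    using ideal_mid[OF P h'(1)] h'(2) a k b Tri_simps[OF tri] by simp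
next
  fix x y assume r: "is_retract x y" and y: "y \<in> {x \<in> K. x \<boxtimes> b \<in> P}" and x: "x \<in> K"
  obtain i p where i: "i \<in> Arr C" "p \<in> Arr C" "Dom C i = x" "Cod C i = y"
      "Dom C p = y" "Cod C p = x" "p \<cdot> i = Idt C x"
    using r unfolding is_retract_def by blast
  have "(p \<boxdot> Idt C b) \<cdot> (i \<boxdot> Idt C b) = Idt C (x \<boxtimes> b)"
    using i b x by (simp add: Tenm_Tenm)
  then have "is_retract (x \<boxtimes> b) (y \<boxtimes> b)"
    unfolding is_retract_def using i b x y by (intro bexI[of _ "i \<boxdot> Idt C b"] bexI[of _ "p \<boxdot> Idt C b"]) simp_all
  then show "x \<in> {x \<in> K. x \<boxtimes> b \<in> P}"
    using ideal_retract[OF P] x y Ten_K[OF x b] by blast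
next
  fix a x assume a: "a \<in> K" and x: "x \<in> {x \<in> K. x \<boxtimes> b \<in> P}"
  then have "a \<boxtimes> (x \<boxtimes> b) \<in> P" using ideal_Ten[OF P] by blast
  then show "a \<boxtimes> x \<in> {x \<in> K. x \<boxtimes> b \<in> P}"
    using ideal_iso[OF P isomorphic_Asc[of a x b]] a b x Ten_K by simp
qed auto

text \<open>For arrows between objects of \<open>K\<close> and an ideal \<open>B\<close>: vanishing
  in the Verdier quotient by \<open>B\<close>.\<close>

definition null :: "'o set \<Rightarrow> 'm \<Rightarrow> bool" where
  "null B m \<longleftrightarrow> m \<in> Arr C \<and> (\<exists>h1\<in>Arr C. \<exists>h2\<in>Arr C. Dom C h1 = Dom C m \<and> Cod C h1 = Dom C h2 \<and>
     Cod C h2 = Cod C m \<and> Dom C h2 \<in> B \<and> m = h2 \<cdot> h1)"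

text \<open>Invertibility in the Verdier quotient by \<open>B\<close>; such arrows serve as the
  denominators of fractions.\<close>

definition biso :: "'o set \<Rightarrow> 'm \<Rightarrow> bool" where
  "biso B m \<longleftrightarrow> Dom C m \<in> K \<and> Cod C m \<in> K \<and> (\<exists>g h. (m, g, h) \<in> Tri C \<and> Dom C h \<in> B)"

lemma nullE:
  assumes "null B m"
  obtains h1 h2 where "h1 \<in> Arr C" "h2 \<in> Arr C" "Dom C h1 = Dom C m" "Cod C h1 = Dom C h2"
    "Cod C h2 = Cod C m" "Dom C h2 \<in> B" "m = h2 \<cdot> h1" "m \<in> Arr C"
  using assms unfolding null_def by blast

lemma null_factor: "h1 \<in> Arr C \<Longrightarrow> h2 \<in> Arr C \<Longrightarrow> Cod C h1 = Dom C h2 \<Longrightarrow> Dom C h2 \<in> B \<Longrightarrow> null B (h2 \<cdot> h1)"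
  unfolding null_def by (intro conjI bexI[of _ h1] bexI[of _ h2]) simp_all

lemma null_Arr: "null B m \<Longrightarrow> m \<in> Arr C"
  by (simp add: null_def)

lemma null_Cmp_left:
  assumes "null B f" "g \<in> Arr C" "Cod C f = Dom C g"
  shows "null B (g \<cdot> f)"
  using assms(1)
proof (rule nullE)
  fix h1 h2 assume h: "h1 \<in> Arr C" "h2 \<in> Arr C" "Dom C h1 = Dom C f" "Cod C h1 = Dom C h2"
    "Cod C h2 = Cod C f" "Dom C h2 \<in> B" "f = h2 \<cdot> h1" "f \<in> Arr C"
  have "null B ((g \<cdot> h2) \<cdot> h1)" by (rule null_factor) (use h(1-6,8) assms(2,3) in simp_all)
  then show ?thesis unfolding h(7) using h(1-6,8) assms(2,3) by simp
qed

lemma null_Cmp_right: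
  assumes "null B g" "f \<in> Arr C" "Cod C f = Dom C g"
  shows "null B (g \<cdot> f)"
  using assms(1)
proof (rule nullE)
  fix h1 h2 assume h: "h1 \<in> Arr C" "h2 \<in> Arr C" "Dom C h1 = Dom C g" "Cod C h1 = Dom C h2"
    "Cod C h2 = Cod C g" "Dom C h2 \<in> B" "g = h2 \<cdot> h1" "g \<in> Arr C"
  have "null B (h2 \<cdot> (h1 \<cdot> f))" by (rule null_factor) (use h(1-6,8) assms(2,3) in simp_all)
  then show ?thesis unfolding h(7) using h(1-6,8) assms(2,3) by simp
qed

lemma null_Dom: "m \<in> Arr C \<Longrightarrow> Dom C m \<in> B \<Longrightarrow> null B m"
  using null_factor[of "Idt C (Dom C m)" m B] by simp

lemma null_Cod: "m \<in> Arr C \<Longrightarrow> Cod C m \<in> B \<Longrightarrow> null B m"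
  using null_factor[of m "Idt C (Cod C m)" B] by simp

lemma null_zero:
  assumes B: "ideal B" and m: "m \<in> Arr C" "zero_arr m"
  shows "null B m"
proof -
  obtain z where z: "zero_object C z" using ex_zero_object by blast
  have [simp]: "z \<in> Obj C" using z zero_object_iff by blast
  have "null B (Zer C z (Cod C m) \<cdot> Zer C (Dom C m) z)"
    by (rule null_factor) (use m ideal_zero[OF B z] in simp_all)
  then show ?thesis using m zero_arrD[OF m(2)] by simp
qed

lemma null_arr_iso:
  assumes "arr_iso f g" "null B f"
  shows "null B g"
proof -
  from assms(1) obtain i j where a: "is_iso C i" "is_iso C j" "Dom C i = Dom C f" "Cod C i = Dom C g"
    "Dom C j = Cod C f" "Cod C j = Cod C g" "g \<cdot> i = j \<cdot> f" "f \<in> Arr C" "g \<in> Arr C"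
    "i \<in> Arr C" "j \<in> Arr C" by (rule arr_isoE)
  note [simp] = a(3-6,8-11) inv_simps[OF a(1)]
  have "null B ((j \<cdot> f) \<cdot> inv_arr C i)"
    by (intro null_Cmp_right null_Cmp_left assms(2)) simp_all
  moreover have "(j \<cdot> f) \<cdot> inv_arr C i = g" unfolding a(7)[symmetric] by simp
  ultimately show ?thesis by simp
qed

lemma null_Ten:
  assumes B: "ideal B" and m: "null B m" and x: "x \<in> K"
  shows "null B (m \<boxdot> Idt C x)" "null B (Idt C x \<boxdot> m)"
proof -
  from m show 1: "null B (m \<boxdot> Idt C x)"
  proof (rule nullE)
    fix h1 h2 assume h: "h1 \<in> Arr C" "h2 \<in> Arr C" "Dom C h1 = Dom C m" "Cod C h1 = Dom C h2"
      "Cod C h2 = Cod C m" "Dom C h2 \<in> B" "m = h2 \<cdot> h1" "m \<in> Arr C"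
    have "null B ((h2 \<boxdot> Idt C x) \<cdot> (h1 \<boxdot> Idt C x))"
      by (rule null_factor) (use h(1-6,8) x ideal_Ten'[OF B] in simp_all)
    then show ?thesis unfolding h(7) using h(1-6,8) x by (simp add: Ten_right_Cmp)
  qed
  show "null B (Idt C x \<boxdot> m)"
    by (rule null_arr_iso[OF arr_iso_Sym 1]) (use m x null_Arr in simp_all)
qed

lemma bisoE:
  assumes "biso B m"
  obtains g h where "(m, g, h) \<in> Tri C" "Dom C h \<in> B" "m \<in> Arr C" "Dom C m \<in> K" "Cod C m \<in> K"
  using assms Tri_simps(1) unfolding biso_def by blast

lemma biso_Arr: "biso B m \<Longrightarrow> m \<in> Arr C" "biso B m \<Longrightarrow> Dom C m \<in> K" "biso B m \<Longrightarrow> Cod C m \<in> K"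
  by (auto elim: bisoE)

text \<open>The octahedral axiom for \<open>m\<close> followed by an identity places any two cones
  of \<open>m\<close> in a triangle whose third object is zero.\<close>

lemma biso_cone:
  assumes B: "ideal B" and m: "biso B m" and tri: "(m, g, h) \<in> Tri C"
  shows "Dom C h \<in> B"
proof -
  obtain p1 d1 where t1: "(m, p1, d1) \<in> Tri C" "Dom C d1 \<in> B" using m by (rule bisoE)
  obtain z where z: "zero_object C z" using ex_zero_object by blast
  have [simp]: "z \<in> Obj C" using z zero_object_iff by blast
  note [simp] = Tri_simps[OF tri]
  have t3: "(Idt C (Cod C m), Zer C (Cod C m) z, Zer C z (Sh C (Cod C m))) \<in> Tri C"
    using TR1_Idt[OF _ z, of "Cod C m"] by simp
  obtain u v where uv: "(u, v, Shm C p1 \<cdot> Zer C z (Sh C (Cod C m))) \<in> Tri C"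
    "u \<in> Hom C (Dom C d1) (Dom C h)" "v \<in> Hom C (Dom C h) (Dom C (Zer C z (Sh C (Cod C m))))"
    using TR4[OF _ _ t1(1) _ t3, of "Dom C m" "Cod C m" "Cod C m" g h] tri by auto
  have "Dom C v \<in> B"
    using uv ideal_zero[OF B z] t1(2) Tri_simps[OF t1(1)]
    by (intro ideal_mid[OF B uv(1)]) simp_all
  then show ?thesis using uv by simp
qed

text \<open>By the octahedral axiom the cone of the composite is an extension of the two
  cones.\<close>

lemma biso_Cmp:
  assumes B: "ideal B" and f: "biso B f" and g: "biso B g" and fg: "Cod C f = Dom C g"
  shows "biso B (g \<cdot> f)"
proof -
  obtain p1 d1 where t1: "(f, p1, d1) \<in> Tri C" "Dom C d1 \<in> B" using f by (rule bisoE)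
  obtain p3 d3 where t3: "(g, p3, d3) \<in> Tri C" "Dom C d3 \<in> B" using g by (rule bisoE)
  note [simp] = biso_Arr[OF f] biso_Arr[OF g] fg
  obtain p2 d2 where t2: "(g \<cdot> f, p2, d2) \<in> Tri C" using ex_cone[of "g \<cdot> f"] by auto
  obtain u v where uv: "(u, v, Shm C p1 \<cdot> d3) \<in> Tri C"
    "u \<in> Hom C (Dom C d1) (Dom C d2)" "v \<in> Hom C (Dom C d2) (Dom C d3)"
    using TR4[OF _ _ t1(1) t2 t3(1), of "Dom C f" "Dom C g" "Cod C g"] by auto
  have "Dom C v \<in> B"
    using uv t1 t3 Tri_simps[OF t1(1)] Tri_simps[OF t3(1)] by (intro ideal_mid[OF B uv(1)]) simp_all
  then show ?thesis unfolding biso_def using uv t2 biso_Arr[OF f] biso_Arr[OF g] by auto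
qed

lemma biso_iso:
  assumes B: "ideal B" and f: "is_iso C f" "Dom C f \<in> K"
  shows "biso B f"
proof -
  obtain z where z: "zero_object C z" using ex_zero_object by blast
  have [simp]: "z \<in> Obj C" using z zero_object_iff by blast
  have "Cod C f \<in> K" using iso_K[OF isomorphicI[OF f(1)] f(2)] .
  then show ?thesis
    unfolding biso_def using f Tri_iso_zero[OF f(1) z] ideal_zero[OF B z] is_iso_Arr[OF f(1)]
    by (metis Zer_simps(2) Sh_simps(1) Obj_Dom \<open>z \<in> Obj C\<close>)
qed

lemma biso_if_fiber:
  assumes B: "ideal B" and tri: "(k, m, h) \<in> Tri C" and k: "Dom C k \<in> B" and m: "Dom C m \<in> K" "Cod C m \<in> K"
  shows "biso B m"
proof -
  have "Sh C (Dom C k) \<in> B" using ideal_Sh[OF B] ideal_K[OF B] k by blast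
  then show ?thesis
    unfolding biso_def using Tri_rotate[OF tri] m Tri_simps[OF tri]
    by (intro conjI exI[of _ h] exI[of _ "Neg C (Shm C k)"]) simp_all
qed

lemma biso_fiber:
  assumes B: "ideal B" and m: "biso B m"
  obtains k h where "(k, m, h) \<in> Tri C" "Dom C k \<in> B"
proof -
  obtain k h where tri: "(k, m, h) \<in> Tri C" using ex_fiber biso_Arr(1)[OF m] by blast
  have k: "Dom C k \<in> K" using fiber_K[OF tri] biso_Arr[OF m] Tri_simps[OF tri] by simp
  have "Sh C (Dom C k) \<in> B"
    using biso_cone[OF B m Tri_rotate[OF tri]] Tri_simps[OF tri] by simp
  then have "Dom C k \<in> B" using ideal_Sh[OF B k] by blast
  then show ?thesis using that tri by blast
qed

text \<open>The fiber of the arrow into the object of \<open>B\<close> is a denominator, and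
  \<open>m\<close> vanishes on it.\<close>

lemma null_preE:
  assumes B: "ideal B" and m: "null B m" and K: "Dom C m \<in> K"
  obtains t where "biso B t" "Cod C t = Dom C m" "zero_arr (m \<cdot> t)"
  using m
proof (rule nullE)
  fix h1 h2 assume h: "h1 \<in> Arr C" "h2 \<in> Arr C" "Dom C h1 = Dom C m" "Cod C h1 = Dom C h2"
    "Cod C h2 = Cod C m" "Dom C h2 \<in> B" "m = h2 \<cdot> h1" "m \<in> Arr C"
  obtain t k where tri: "(t, h1, k) \<in> Tri C" using ex_fiber[OF h(1)] .
  note T = Tri_simps[OF tri]
  note h = h(1-6,8) and mh = h(7)
  have kB: "Dom C k \<in> B" using T h by simp
  have t: "Cod C t = Dom C m" "Dom C t \<in> K" using T h fiber_K[OF tri] K ideal_K[OF B kB] by simp_all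
  then have "biso B t" unfolding biso_def using tri kB K by auto
  moreover have "zero_arr (m \<cdot> t)"
    unfolding mh using zero_arr_Cmp_left[OF Tri_Cmp_zero[OF tri], of h2] h T by simp
  ultimately show ?thesis using that t by blast
qed

text \<open>Denominators can be cancelled on the right: after refining \<open>t\<close> the
  composite is zero on the nose, and \<open>m\<close> factors through the cone of the refined
  denominator. The dual is \<open>null_post\<close>.\<close>

lemma null_pre:
  assumes B: "ideal B" and t: "biso B t" "Cod C t = Dom C m" and m: "m \<in> Arr C" and n: "null B (m \<cdot> t)"
  shows "null B m"
proof -
  note [simp] = biso_Arr[OF t(1)] t(2) m
  obtain t2 where t2: "biso B t2" "Cod C t2 = Dom C t" "zero_arr ((m \<cdot> t) \<cdot> t2)"
    using null_preE[OF B n] by auto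
  note [simp] = biso_Arr[OF t2(1)] t2(2)
  have b: "biso B (t \<cdot> t2)" using biso_Cmp[OF B t2(1) t(1)] by simp
  then obtain g h where tri: "(t \<cdot> t2, g, h) \<in> Tri C" "Dom C h \<in> B" by (rule bisoE)
  note T = Tri_simps[OF tri(1)]
  have "zero_arr (m \<cdot> (t \<cdot> t2))" using t2(3) by simp
  then obtain k where k: "k \<in> Arr C" "Dom C k = Dom C h" "Cod C k = Cod C m" "k \<cdot> g = m"
    by (rule Tri_factor[OF tri(1), rotated 2]) (use T in simp_all)
  then show ?thesis using null_factor[of g k B] T tri(2) by simp
qed

lemma null_postE:
  assumes B: "ideal B" and m: "null B m" and K: "Cod C m \<in> K"
  obtains s where "biso B s" "Dom C s = Cod C m" "zero_arr (s \<cdot> m)"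
  using m
proof (rule nullE)
  fix h1 h2 assume h: "h1 \<in> Arr C" "h2 \<in> Arr C" "Dom C h1 = Dom C m" "Cod C h1 = Dom C h2"
    "Cod C h2 = Cod C m" "Dom C h2 \<in> B" "m = h2 \<cdot> h1" "m \<in> Arr C"
  obtain s k where tri: "(h2, s, k) \<in> Tri C" using ex_cone[OF h(2)] .
  note T = Tri_simps[OF tri]
  have "biso B s"
    by (rule biso_if_fiber[OF B tri h(6)]) (use T h(1-6,8) K cone_K[OF tri] ideal_K[OF B h(6)] in simp_all)
  moreover have "zero_arr (s \<cdot> m)"
    unfolding h(7) using zero_arr_Cmp_right[OF Tri_Cmp_zero[OF tri], of h1] h(1-6,8) T by simp
  moreover have "Dom C s = Cod C m" using T h(1-6,8) by simp
  ultimately show ?thesis using that by blast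
qed

lemma null_post:
  assumes B: "ideal B" and s: "biso B s" "Dom C s = Cod C m" and m: "m \<in> Arr C" and n: "null B (s \<cdot> m)"
  shows "null B m"
proof -
  note [simp] = biso_Arr[OF s(1)] s(2) m
  obtain s2 where s2: "biso B s2" "Dom C s2 = Cod C s" "zero_arr (s2 \<cdot> (s \<cdot> m))"
    using null_postE[OF B n] by auto
  note [simp] = biso_Arr[OF s2(1)] s2(2)
  have b: "biso B (s2 \<cdot> s)" using biso_Cmp[OF B s(1) s2(1)] by simp
  then obtain k h where tri: "(k, s2 \<cdot> s, h) \<in> Tri C" "Dom C k \<in> B" using biso_fiber[OF B] by blast
  note T = Tri_simps[OF tri(1)]
  have "zero_arr ((s2 \<cdot> s) \<cdot> m)" using s2(3) by simp
  then obtain l where l: "l \<in> Arr C" "Dom C l = Dom C m" "Cod C l = Dom C k" "k \<cdot> l = m"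
    by (rule Tri_lift[OF tri(1), rotated 2]) (use T in simp_all)
  then show ?thesis using null_factor[of l k B] T tri(2) by simp
qed

lemma biso_Ten:
  assumes B: "ideal B" and m: "biso B m" and x: "x \<in> K"
  shows "biso B (m \<boxdot> Idt C x)" "biso B (Idt C x \<boxdot> m)"
proof -
  obtain g h where tri: "(m, g, h) \<in> Tri C" "Dom C h \<in> B" using m by (rule bisoE)
  obtain h' where h': "(m \<boxdot> Idt C x, g \<boxdot> Idt C x, h') \<in> Tri C" "Dom C h' = Dom C h \<boxtimes> x"
    using Tri_Ten_right[OF tri(1), of x] x by auto
  show "biso B (m \<boxdot> Idt C x)"
    unfolding biso_def using h' ideal_Ten'[OF B tri(2) x] biso_Arr[OF m] x Ten_K
    by (intro conjI exI[of _ "g \<boxdot> Idt C x"] exI[of _ h']) simp_all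
  obtain h'' where h'': "(Idt C x \<boxdot> m, Idt C x \<boxdot> g, h'') \<in> Tri C" "Dom C h'' = x \<boxtimes> Dom C h"
    using Tri_Ten_left[OF tri(1), of x] x by auto
  show "biso B (Idt C x \<boxdot> m)"
    unfolding biso_def using h'' ideal_Ten[OF B x tri(2)] biso_Arr[OF m] x Ten_K
    by (intro conjI exI[of _ "Idt C x \<boxdot> g"] exI[of _ h'']) simp_all
qed

text \<open>Choose a denominator \<open>t\<close> on which \<open>m\<close> vanishes. Then
  \<open>m \<cdot> t\<close> is zero and has its fiber in \<open>B\<close>, so the source of
  \<open>t\<close> is a retract of that fiber; together with the cone of \<open>t\<close> this puts
  the source of \<open>m\<close> into \<open>B\<close>.\<close>

lemma null_biso_Dom:
  assumes B: "ideal B" and m: "biso B m" "null B m"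
  shows "Dom C m \<in> B"
proof -
  note [simp] = biso_Arr[OF m(1)]
  obtain t where t: "biso B t" "Cod C t = Dom C m" "zero_arr (m \<cdot> t)"
    using null_preE[OF B m(2)] by auto
  note [simp] = biso_Arr[OF t(1)] t(2)
  have b: "biso B (m \<cdot> t)" using biso_Cmp[OF B t(1) m(1)] by simp
  obtain k h where tri: "(k, m \<cdot> t, h) \<in> Tri C" "Dom C k \<in> B" using biso_fiber[OF B b] .
  note T = Tri_simps[OF tri(1)]
  have "zero_arr ((m \<cdot> t) \<cdot> Idt C (Dom C t))" using t(3) by simp
  then obtain l where l: "l \<in> Arr C" "Dom C l = Dom C t" "Cod C l = Dom C k" "k \<cdot> l = Idt C (Dom C t)"
    by (rule Tri_lift[OF tri(1), rotated 2]) (use T in simp_all)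
  then have "is_retract (Dom C t) (Dom C k)"
    unfolding is_retract_def using T by (intro bexI[of _ l] bexI[of _ k]) simp_all
  then have "Dom C t \<in> B" using ideal_retract[OF B _ tri(2)] by simp
  moreover obtain g h' where "(t, g, h') \<in> Tri C" "Dom C h' \<in> B" using t(1) by (rule bisoE)
  ultimately show ?thesis using ideal_mid[OF B] Tri_simps(4) t(2) by metis
qed

lemma biso_act:
  assumes B: "ideal B" and \<theta>: "biso B \<theta>" "Dom C \<theta> = Unt C" and y: "y \<in> K"
  shows "biso B (act \<theta> y)"
  unfolding act_def
  by (rule biso_Cmp[OF B biso_iso[OF B] biso_Ten(1)[OF B \<theta>(1) y]])
    (use y \<theta> biso_Arr[OF \<theta>(1)] in simp_all)

text \<open>Here \<kappa> is an evaluation of \<open>t\<close>, \<theta> its cone and \<sigma> a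
  coevaluation. So \<kappa> and \<sigma> pass through objects generated by \<open>t\<close>,
  \<sigma> is split injective on \<open>t\<close>, and \<theta> is invertible modulo
  \<open>t\<close> while annihilating \<open>t\<close>.\<close>

lemma rigid_approximation:
  assumes t: "t \<in> K"
  obtains \<kappa> \<theta> h \<sigma> where "(\<kappa>, \<theta>, h) \<in> Tri C" "Dom C \<kappa> \<in> gen {t}" "Dom C \<theta> = Unt C" "Cod C \<theta> \<in> K"
    "zero_arr (\<theta> \<boxdot> Idt C t)" "biso (gen {t}) \<theta>"
    "\<sigma> \<in> Arr C" "Dom C \<sigma> = Unt C" "Cod C \<sigma> \<in> gen {t}" "split_mono (\<sigma> \<boxdot> Idt C t)"
proof -
  obtain y coev ev where y: "y \<in> K" and c: "coev \<in> Hom C (Unt C) (t \<boxtimes> y)" and e: "ev \<in> Hom C (y \<boxtimes> t) (Unt C)"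
    and s: "split_mono (coev \<boxdot> Idt C t)" "split_epi (Idt C t \<boxdot> ev)"
    using dual_K[OF t] by blast
  have tg: "t \<in> gen {t}" using gen_superset[of "{t}"] t by blast
  have u: "y \<boxtimes> t \<in> gen {t}" "t \<boxtimes> y \<in> gen {t}"
    using ideal_Ten[OF ideal_gen y tg] ideal_Ten'[OF ideal_gen tg y] by auto
  note [simp] = c[simplified] e[simplified] y t
  obtain \<theta> h where tri: "(ev, \<theta>, h) \<in> Tri C" using ex_cone[of ev] by auto
  note T = Tri_simps[OF tri]
  have [simp]: "\<theta> \<in> Arr C" "Dom C \<theta> = Unt C" using T by simp_all
  have v: "Cod C \<theta> \<in> K" using cone_K[OF tri] T Ten_K[OF y t] Unt_K by simp
  \<comment> \<open>Tensored with \<open>t\<close> the evaluation is a split epimorphism, so what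
    annihilates it is zero.\<close>
  have "(Idt C t \<boxdot> \<theta>) \<cdot> (Idt C t \<boxdot> ev) = Idt C t \<boxdot> (\<theta> \<cdot> ev)" by (simp add: Ten_left_Cmp)
  then have "zero_arr ((Idt C t \<boxdot> \<theta>) \<cdot> (Idt C t \<boxdot> ev))"
    using zero_arr_Tenm_right[OF Tri_Cmp_zero[OF tri], of "Idt C t"] by simp
  then have "zero_arr (Idt C t \<boxdot> \<theta>)" by (rule zero_arr_Cmp_split_epi[OF _ s(2)]) simp_all
  then have z: "zero_arr (\<theta> \<boxdot> Idt C t)" using zero_arr_arr_iso[OF arr_iso_Sym[of "Idt C t" \<theta>]] by simp
  have "biso (gen {t}) \<theta>"
    by (rule biso_if_fiber[OF ideal_gen tri]) (use u v Unt_K in simp_all)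
  then show ?thesis
    using that[OF tri _ _ v z, of coev] u s by simp
qed

lemma retract_Ten_self:
  assumes y: "y \<in> K"
  obtains w where "w \<in> K" "is_retract y (y \<boxtimes> (w \<boxtimes> y))"
proof -
  obtain w coev ev where w: "w \<in> K" and e: "ev \<in> Hom C (w \<boxtimes> y) (Unt C)" and s: "split_epi (Idt C y \<boxdot> ev)"
    using dual_K[OF y] by blast
  note [simp] = e[simplified] w y
  obtain p where p: "p \<in> Arr C" "Dom C p = y \<boxtimes> Unt C" "Cod C p = y \<boxtimes> (w \<boxtimes> y)"
     "(Idt C y \<boxdot> ev) \<cdot> p = Idt C (y \<boxtimes> Unt C)"
    using s unfolding split_epi_def by auto
  have "is_retract (y \<boxtimes> Unt C) (y \<boxtimes> (w \<boxtimes> y))"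
    unfolding is_retract_def using p by (intro bexI[of _ p] bexI[of _ "Idt C y \<boxdot> ev"]) simp_all
  moreover have "isomorphic y (y \<boxtimes> Unt C)"
    using isomorphic_sym[OF isomorphicI[of "Run C y"]] by simp
  ultimately show ?thesis using that w is_retract_trans isomorphic_retract by blast
qed

end

section \<open>Prime ideals\<close>

context rigid_tt_category
begin

abbreviation prime :: "'o set \<Rightarrow> bool" where
  "prime \<equiv> prime_ideal C K"

lemma prime_is_ideal: "prime P \<Longrightarrow> ideal P"
  by (simp add: prime_ideal_def)

lemma ideal_eq_K: "ideal P \<Longrightarrow> Unt C \<in> P \<Longrightarrow> P = K"
proof -
  assume P: "ideal P" and u: "Unt C \<in> P"
  have "a \<in> P" if a: "a \<in> K" for a
    using ideal_Ten'[OF P u a] ideal_iso[OF P isomorphic_Lun[of a]] a by simp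
  then show ?thesis using ideal_K[OF P] by blast
qed

lemma prime_iff:
  "prime P \<longleftrightarrow> ideal P \<and> Unt C \<notin> P \<and> (\<forall>a\<in>K. \<forall>b\<in>K. a \<boxtimes> b \<in> P \<longrightarrow> a \<in> P \<or> b \<in> P)"
  using ideal_eq_K Unt_K by (auto simp: prime_ideal_def)

lemma prime_Ten_iff: "prime P \<Longrightarrow> a \<in> K \<Longrightarrow> b \<in> K \<Longrightarrow> a \<boxtimes> b \<in> P \<longleftrightarrow> a \<in> P \<or> b \<in> P"
  using ideal_Ten ideal_Ten' unfolding prime_iff by blast

text \<open>As for commutative rings: an ideal maximal among those containing \<open>I\<close> and
  disjoint from the multiplicative set \<open>M\<close> is prime.\<close>

lemma ex_prime:
  assumes I: "ideal I" and M: "M \<subseteq> K" "M \<noteq> {}" "\<And>x y. x \<in> M \<Longrightarrow> y \<in> M \<Longrightarrow> x \<boxtimes> y \<in> M"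
    and disj: "I \<inter> M = {}"
  obtains Q where "prime Q" "I \<subseteq> Q" "Q \<inter> M = {}"
proof -
  let ?S = "{J. ideal J \<and> I \<subseteq> J \<and> J \<inter> M = {}}"
  have "\<exists>Q\<in>?S. \<forall>X\<in>?S. Q \<subseteq> X \<longrightarrow> X = Q"
  proof (rule subset_Zorn_nonempty)
    show "?S \<noteq> {}" using I disj by blast
    fix \<C> assume ne: "\<C> \<noteq> {}" and ch: "subset.chain ?S \<C>"
    have S: "\<And>J. J \<in> \<C> \<Longrightarrow> ideal J \<and> I \<subseteq> J \<and> J \<inter> M = {}" using ch by (auto simp: subset.chain_def)
    have lin: "\<And>J J'. J \<in> \<C> \<Longrightarrow> J' \<in> \<C> \<Longrightarrow> J \<subseteq> J' \<or> J' \<subseteq> J" using ch by (auto simp: subset_chain_def)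
    have "ideal (\<Union>\<C>)"
    proof (rule idealI)
      show "\<Union>\<C> \<subseteq> K" using S ideal_K by blast
      obtain J where J: "J \<in> \<C>" using ne by blast
      obtain z where "zero_object C z" using ex_zero_object by blast
      then show "\<Union>\<C> \<noteq> {}" using ideal_zero S J by blast
      show "a \<in> \<Union>\<C>" if "is_retract a b" "b \<in> \<Union>\<C>" "a \<in> K" for a b
        using that ideal_retract S by blast
      show "a \<boxtimes> b \<in> \<Union>\<C>" if "a \<in> K" "b \<in> \<Union>\<C>" for a b
        using that ideal_Ten S by blast
      fix f g h assume tri: "(f, g, h) \<in> Tri C" and "Dom C f \<in> \<Union>\<C>" "Dom C h \<in> \<Union>\<C>"
      then obtain J1 J2 where "J1 \<in> \<C>" "J2 \<in> \<C>" "Dom C f \<in> J1" "Dom C h \<in> J2" by blast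
      then obtain J where "J \<in> \<C>" "Dom C f \<in> J" "Dom C h \<in> J" using lin by blast
      then show "Dom C g \<in> \<Union>\<C>" using ideal_mid[OF _ tri] S by blast
    qed
    then show "\<Union>\<C> \<in> ?S" using S ne by blast
  qed
  then obtain Q where Q: "ideal Q" "I \<subseteq> Q" "Q \<inter> M = {}"
    and max: "\<And>J. ideal J \<Longrightarrow> Q \<subseteq> J \<Longrightarrow> J \<inter> M = {} \<Longrightarrow> J = Q" by auto
  have "prime Q"
    unfolding prime_ideal_def
  proof (intro conjI ballI impI)
    show "Q \<noteq> K" using Q(3) M by blast
    fix a b assume a: "a \<in> K" and b: "b \<in> K" and ab: "a \<boxtimes> b \<in> Q"
    show "a \<in> Q \<or> b \<in> Q"
    proof (rule ccontr)
      assume n: "\<not> (a \<in> Q \<or> b \<in> Q)"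
      have meet: "\<exists>m\<in>M. m \<in> gen (insert c Q)" if "c \<in> K" "c \<notin> Q" for c
      proof (rule ccontr)
        assume "\<not> (\<exists>m\<in>M. m \<in> gen (insert c Q))"
        moreover have sup: "insert c Q \<subseteq> gen (insert c Q)" using gen_superset that ideal_K[OF Q(1)] by blast
        ultimately have "gen (insert c Q) = Q" using max[OF ideal_gen, of "insert c Q"] by blast
        then show False using sup that by blast
      qed
      obtain m where m: "m \<in> M" "m \<in> gen (insert a Q)" using meet a n by blast
      obtain m' where m': "m' \<in> M" "m' \<in> gen (insert b Q)" using meet b n by blast
      have mK: "m \<in> K" "m' \<in> K" using m m' M by auto
      \<comment> \<open>Two colon ideals in succession replace the product of generators
        \<open>a\<close> and \<open>b\<close> by the product of the elements \<open>m\<close> and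
        \<open>m'\<close> of \<open>M\<close>.\<close>
      have "insert a Q \<subseteq> {x \<in> K. x \<boxtimes> b \<in> Q}" using a ab ideal_Ten'[OF Q(1) _ b] ideal_K[OF Q(1)] by blast
      then have "m \<boxtimes> b \<in> Q" using gen_least[OF ideal_transporter[OF Q(1) b]] m by blast
      then have "b \<boxtimes> m \<in> Q" using ideal_iso[OF Q(1) isomorphic_Sym[of m b]] mK b by simp
      then have "insert b Q \<subseteq> {x \<in> K. x \<boxtimes> m \<in> Q}" using b ideal_Ten'[OF Q(1) _ mK(1)] ideal_K[OF Q(1)] by blast
      then have "m' \<boxtimes> m \<in> Q" using gen_least[OF ideal_transporter[OF Q(1) mK(1)]] m' by blast
      then show False using M(3)[OF m'(1) m(1)] Q(3) by blast
    qed
  qed (fact Q(1))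
  then show ?thesis using that Q by blast
qed

inductive_set tens :: "'o set \<Rightarrow> 'o set" for B where
  tens_Unt: "Unt C \<in> tens B"
| tens_base: "b \<in> B \<Longrightarrow> b \<in> tens B"
| tens_Ten: "x \<in> tens B \<Longrightarrow> y \<in> tens B \<Longrightarrow> x \<boxtimes> y \<in> tens B"

lemma tens_K: "m \<in> tens B \<Longrightarrow> B \<subseteq> K \<Longrightarrow> m \<in> K"
  by (induction rule: tens.induct) (auto simp: Unt_K Ten_K)

lemma ex_prime_avoiding:
  assumes I: "ideal I" and B: "B \<subseteq> K" and disj: "I \<inter> tens B = {}"
  obtains Q where "prime Q" "I \<subseteq> Q" "Q \<inter> B = {}"
proof -
  have "tens B \<subseteq> K" using tens_K[OF _ B] by blast
  moreover have "tens B \<noteq> {}" using tens_Unt by blast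
  ultimately obtain Q where Q: "prime Q" "I \<subseteq> Q" "Q \<inter> tens B = {}"
    using ex_prime[OF I _ _ _ disj] tens_Ten by metis
  moreover have "B \<subseteq> tens B" using tens_base by blast
  ultimately show ?thesis using that by blast
qed

lemma tens_prime:
  assumes "m \<in> tens B" "B \<subseteq> K"
  shows "\<exists>B0. finite B0 \<and> B0 \<subseteq> B \<and> (\<forall>P. prime P \<and> m \<in> P \<longrightarrow> P \<inter> B0 \<noteq> {})"
  using assms
proof (induction rule: tens.induct)
  case tens_Unt
  then show ?case by (intro exI[of _ "{}"]) (auto simp: prime_iff)
next
  case (tens_base b)
  then show ?case by (intro exI[of _ "{b}"]) auto
next
  case (tens_Ten x y)
  then obtain B1 B2 where "finite B1" "B1 \<subseteq> B" "\<forall>P. prime P \<and> x \<in> P \<longrightarrow> P \<inter> B1 \<noteq> {}"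
    "finite B2" "B2 \<subseteq> B" "\<forall>P. prime P \<and> y \<in> P \<longrightarrow> P \<inter> B2 \<noteq> {}" by (elim meta_impE exE conjE)
  note B12 = this
  have xy: "x \<in> K" "y \<in> K" using tens_K tens_Ten.hyps tens_Ten.prems by blast+
  have "P \<inter> (B1 \<union> B2) \<noteq> {}" if "prime P \<and> x \<boxtimes> y \<in> P" for P
    using prime_Ten_iff[of P x y] xy that B12(3,6) by blast
  then show ?case using B12(1,2,4,5) by (intro exI[of _ "B1 \<union> B2"]) simp
qed

text \<open>Compactness of the spectrum in the constructible topology. The ideal generated by
  \<open>A\<close> must meet the multiplicative set generated by \<open>B\<close>, since otherwise
  some prime separates them; an object common to both involves finitely many members of
  each.\<close>

lemma prime_patch_compact:
  assumes A: "A \<subseteq> K" and B: "B \<subseteq> K" and meet: "\<And>P. prime P \<Longrightarrow> A \<subseteq> P \<Longrightarrow> P \<inter> B \<noteq> {}"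
  obtains A0 B0 where "finite A0" "A0 \<subseteq> A" "finite B0" "B0 \<subseteq> B"
    "\<And>P. prime P \<Longrightarrow> A0 \<subseteq> P \<Longrightarrow> P \<inter> B0 \<noteq> {}"
proof -
  have "gen A \<inter> tens B \<noteq> {}"
  proof
    assume "gen A \<inter> tens B = {}"
    then obtain Q where Q: "prime Q" "gen A \<subseteq> Q" "Q \<inter> B = {}"
      using ex_prime_avoiding[OF ideal_gen B] by metis
    then have "A \<subseteq> Q" using gen_superset[OF A] by blast
    then show False using meet Q by blast
  qed
  then obtain m where m: "m \<in> gen A" "m \<in> tens B" by blast
  obtain A0 where A0: "finite A0" "A0 \<subseteq> A" "m \<in> gen A0" using gen_finite[OF A m(1)] by blast
  obtain B0 where B0: "finite B0" "B0 \<subseteq> B" "\<forall>P. prime P \<and> m \<in> P \<longrightarrow> P \<inter> B0 \<noteq> {}"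
    using tens_prime[OF m(2) B] by (elim exE conjE)
  have "P \<inter> B0 \<noteq> {}" if "prime P" "A0 \<subseteq> P" for P
  proof -
    have "m \<in> P" using gen_least[OF prime_is_ideal[OF that(1)] that(2)] A0(3) by (rule subsetD)
    then show ?thesis using B0(3) that(1) by simp
  qed
  then show ?thesis by (rule that[OF A0(1,2) B0(1,2)])
qed

text \<open>Containing finitely many given objects is thus a single membership condition; for
  primes, so is containing at least one of them (\<open>ex_product_of_set\<close>).\<close>

lemma ex_sum_of_set:
  assumes "finite A0" "A0 \<subseteq> K"
  obtains a where "a \<in> K" "\<And>P. ideal P \<Longrightarrow> a \<in> P \<longleftrightarrow> A0 \<subseteq> P"
proof -
  have "\<exists>a\<in>K. \<forall>P. ideal P \<longrightarrow> (a \<in> P \<longleftrightarrow> A0 \<subseteq> P)"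
    using assms
  proof (induction A0)
    case empty
    obtain z where "zero_object C z" using ex_zero_object by blast
    then show ?case using ideal_zero zero_K by blast
  next
    case (insert x A0)
    then obtain a where a: "a \<in> K" "\<forall>P. ideal P \<longrightarrow> (a \<in> P \<longleftrightarrow> A0 \<subseteq> P)" by blast
    obtain X where X: "is_direct_sum C x a X" using ex_direct_sum[of x a] insert a by auto
    have "X \<in> P \<longleftrightarrow> insert x A0 \<subseteq> P" if "ideal P" for P
      using ideal_sum[OF that X] a that insert.prems by simp
    then show ?case using sum_K[OF X] a insert.prems by blast
  qed
  then show ?thesis using that by blast
qed

lemma ex_product_of_set:
  assumes "finite B0" "B0 \<subseteq> K"
  obtains b where "b \<in> K" "\<And>P. prime P \<Longrightarrow> b \<in> P \<longleftrightarrow> P \<inter> B0 \<noteq> {}"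
proof -
  have "\<exists>b\<in>K. \<forall>P. prime P \<longrightarrow> (b \<in> P \<longleftrightarrow> P \<inter> B0 \<noteq> {})"
    using assms
  proof (induction B0)
    case empty
    show ?case using Unt_K by (auto simp: prime_iff)
  next
    case (insert x B0)
    then obtain b where b: "b \<in> K" "\<forall>P. prime P \<longrightarrow> (b \<in> P \<longleftrightarrow> P \<inter> B0 \<noteq> {})" by blast
    have "x \<boxtimes> b \<in> P \<longleftrightarrow> P \<inter> insert x B0 \<noteq> {}" if "prime P" for P
      using prime_Ten_iff[OF that, of x b] b that insert.prems by auto
    then show ?case using Ten_K[of x b] b insert.prems by blast
  qed
  then show ?thesis using that by blast
qed

text \<open>By rigidity \<open>y\<close> is a retract of \<open>y \<boxtimes> (w \<boxtimes> y)\<close>, so every thick tensor ideal is radical.\<close>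

lemma ideal_square:
  assumes J: "ideal J" and y: "y \<in> K" and yy: "y \<boxtimes> y \<in> J"
  shows "y \<in> J"
proof -
  obtain w where w: "w \<in> K" "is_retract y (y \<boxtimes> (w \<boxtimes> y))" using retract_Ten_self[OF y] .
  have "isomorphic (y \<boxtimes> (w \<boxtimes> y)) ((w \<boxtimes> y) \<boxtimes> y)" using w y by (simp add: isomorphic_Sym)
  moreover have "isomorphic ((w \<boxtimes> y) \<boxtimes> y) (w \<boxtimes> (y \<boxtimes> y))" using w y by (simp add: isomorphic_Asc)
  ultimately have "y \<boxtimes> (w \<boxtimes> y) \<in> J"
    using ideal_Ten[OF J w(1) yy] ideal_iso[OF J] by blast
  then show ?thesis using ideal_retract[OF J w(2)] y by blast
qed

text \<open>The extra factor \<open>z\<close> makes the induction work: it absorbs one tensor factor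
  while the other is treated. This leaves y \<open>\<boxtimes>\<close> y, which is reduced to y by
  applying \<open>ideal_square\<close> to the colon ideal of \<open>z\<close>.\<close>

lemma tens_singleton:
  assumes J: "ideal J" and y: "y \<in> K" and m: "m \<in> tens {y}"
  shows "\<forall>z\<in>K. m \<boxtimes> z \<in> J \<longrightarrow> y \<boxtimes> z \<in> J"
  using m
proof (induction rule: tens.induct)
  case tens_Unt
  show ?case using ideal_iso[OF J isomorphic_Lun] ideal_Ten[OF J y] by auto
next
  case (tens_base b)
  then show ?case by auto
next
  case (tens_Ten a b)
  have ab: "a \<in> K" "b \<in> K" using tens_K tens_Ten.hyps y by auto
  show ?case
  proof (intro ballI impI)
    fix z assume z: "z \<in> K" and *: "(a \<boxtimes> b) \<boxtimes> z \<in> J"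
    have "a \<boxtimes> (b \<boxtimes> z) \<in> J" using * ideal_iso[OF J isomorphic_Asc[of a b z]] ab z by simp
    then have 1: "y \<boxtimes> (b \<boxtimes> z) \<in> J" using tens_Ten.IH(1) Ten_K ab z by blast
    have "isomorphic (y \<boxtimes> (b \<boxtimes> z)) ((y \<boxtimes> b) \<boxtimes> z)" "isomorphic ((y \<boxtimes> b) \<boxtimes> z) ((b \<boxtimes> y) \<boxtimes> z)"
      "isomorphic ((b \<boxtimes> y) \<boxtimes> z) (b \<boxtimes> (y \<boxtimes> z))"
      using y ab z by (simp_all add: isomorphic_Asc isomorphic_sym isomorphic_Ten isomorphic_Sym isomorphic_refl)
    then have "b \<boxtimes> (y \<boxtimes> z) \<in> J" using 1 ideal_iso[OF J] by blast
    then have "y \<boxtimes> (y \<boxtimes> z) \<in> J" using tens_Ten.IH(2) Ten_K y z by blast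
    then have "(y \<boxtimes> y) \<boxtimes> z \<in> J" using ideal_iso[OF J isomorphic_Asc[of y y z]] y z by simp
    then show "y \<boxtimes> z \<in> J" using ideal_square[OF ideal_transporter[OF J z] y] Ten_K y by blast
  qed
qed

text \<open>If \<open>J\<close> contained no tensor power of \<open>y\<close>, a prime over
  \<open>J\<close> would avoid \<open>y\<close>; and a tensor power in \<open>J\<close> forces
  \<open>y\<close> itself into \<open>J\<close>.\<close>

lemma ideal_if_in_primes:
  assumes J: "ideal J" and y: "y \<in> K" and Q: "\<And>Q. prime Q \<Longrightarrow> J \<subseteq> Q \<Longrightarrow> y \<in> Q"
  shows "y \<in> J"
proof -
  have "J \<inter> tens {y} \<noteq> {}"
  proof
    assume "J \<inter> tens {y} = {}"
    then obtain Q where "prime Q" "J \<subseteq> Q" "Q \<inter> {y} = {}"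
      using ex_prime_avoiding[OF J, of "{y}"] y by auto
    then show False using Q by blast
  qed
  then obtain m where m: "m \<in> J" "m \<in> tens {y}" by blast
  have "m \<boxtimes> Unt C \<in> J" using ideal_Ten'[OF J m(1) Unt_K] .
  then have "y \<boxtimes> Unt C \<in> J" using tens_singleton[OF J y m(2)] Unt_K by blast
  then show ?thesis using ideal_iso[OF J isomorphicI[of "Run C y"]] y by simp
qed

end

section \<open>The spectrum\<close>

context rigid_tt_category
begin

text \<open>For a single object this is a basic open set: in contrast to the Zariski topology,
  openness means containing an object. For arbitrary \<open>A\<close> it is an intersection of basic
  open sets, that is, the complement of a Thomason subset.\<close>

definition prs :: "'o set \<Rightarrow> 'o set set" where
  "prs A = {P. prime P \<and> A \<subseteq> P}"

lemma Spc_basis_eq: "primes C K - supp C K a = prs {a}"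
  by (auto simp: primes_def supp_def prs_def)

lemma Spc_eq: "Spc C K = topology_generated_by {prs {a} | a. a \<in> K}"
  by (simp add: Spc_def Spc_basis_eq)

lemma openin_Spc:
  "openin (Spc C K) V \<longleftrightarrow> V \<subseteq> prs {} \<and> (\<forall>P\<in>V. \<exists>a\<in>P. prs {a} \<subseteq> V)"
proof
  assume "openin (Spc C K) V"
  then have "generate_topology_on {prs {a} | a. a \<in> K} V"
    by (simp add: Spc_eq openin_topology_generated_by_iff)
  then show "V \<subseteq> prs {} \<and> (\<forall>P\<in>V. \<exists>a\<in>P. prs {a} \<subseteq> V)"
  proof (induction rule: generate_topology_on.induct)
    case (Int V W)
    have "\<exists>c\<in>P. prs {c} \<subseteq> V \<inter> W" if P: "P \<in> V \<inter> W" for P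
    proof -
      have "\<exists>a\<in>P. prs {a} \<subseteq> V" "\<exists>b\<in>P. prs {b} \<subseteq> W" using Int.IH P by simp_all
      then obtain a b where ab: "a \<in> P" "prs {a} \<subseteq> V" "b \<in> P" "prs {b} \<subseteq> W" by (elim bexE)
      have "P \<in> prs {}" using Int.IH(1) P by (elim conjE IntE) (rule subsetD)
      then have pr: "prime P" by (simp add: prs_def)
      have k: "{a, b} \<subseteq> K" using ab ideal_K[OF prime_is_ideal[OF pr]] by blast
      obtain c where c: "c \<in> K" "\<And>P. ideal P \<Longrightarrow> c \<in> P \<longleftrightarrow> {a, b} \<subseteq> P"
        using ex_sum_of_set[OF _ k] by auto
      have "c \<in> P" using c(2)[OF prime_is_ideal[OF pr]] ab by blast
      moreover have "prs {c} \<subseteq> V \<inter> W"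
      proof
        fix Q assume "Q \<in> prs {c}"
        then have "prime Q" "a \<in> Q" "b \<in> Q" using c(2)[OF prime_is_ideal] by (auto simp: prs_def)
        then show "Q \<in> V \<inter> W" using ab by (auto simp: prs_def)
      qed
      ultimately show ?thesis by blast
    qed
    moreover have "V \<inter> W \<subseteq> prs {}" using Int.IH(1) by (elim conjE) (rule le_infI1)
    ultimately show ?case by simp
  next
    case (UN \<V>)
    show ?case
    proof (intro conjI ballI)
      show "\<Union>\<V> \<subseteq> prs {}" using UN.IH by (intro Union_least) simp
      fix P assume "P \<in> \<Union>\<V>"
      then obtain W where W: "W \<in> \<V>" "P \<in> W" by (rule UnionE)
      then have "\<exists>a\<in>P. prs {a} \<subseteq> W" using UN.IH by simp
      then show "\<exists>a\<in>P. prs {a} \<subseteq> \<Union>\<V>" using W(1) by (meson Union_upper order_trans)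
    qed
  next
    case (Basis V)
    then show ?case by (auto simp: prs_def)
  qed auto
next
  assume V: "V \<subseteq> prs {} \<and> (\<forall>P\<in>V. \<exists>a\<in>P. prs {a} \<subseteq> V)"
  have "openin (Spc C K) (\<Union>{prs {a} |a. a \<in> K \<and> prs {a} \<subseteq> V})"
    by (rule openin_Union) (auto simp: Spc_eq intro: topology_generated_by_Basis)
  moreover have "\<Union>{prs {a} |a. a \<in> K \<and> prs {a} \<subseteq> V} = V"
  proof
    show "V \<subseteq> \<Union>{prs {a} |a. a \<in> K \<and> prs {a} \<subseteq> V}"
    proof
      fix P assume P: "P \<in> V"
      then obtain a where a: "a \<in> P" "prs {a} \<subseteq> V" using V by blast
      have "prime P" using P V by (auto simp: prs_def)
      then have "P \<in> prs {a}" "a \<in> K" using a ideal_K[OF prime_is_ideal] by (auto simp: prs_def)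
      then show "P \<in> \<Union>{prs {a} |a. a \<in> K \<and> prs {a} \<subseteq> V}" using a by blast
    qed
  qed auto
  ultimately show "openin (Spc C K) V" by simp
qed

lemma topspace_Spc: "topspace (Spc C K) = prs {}"
proof -
  obtain z where z: "zero_object C z" using ex_zero_object by blast
  have "openin (Spc C K) (prs {})"
    unfolding openin_Spc
  proof (intro conjI ballI)
    fix P assume "P \<in> prs {}"
    then have "z \<in> P" using ideal_zero[OF prime_is_ideal z] by (auto simp: prs_def)
    then show "\<exists>a\<in>P. prs {a} \<subseteq> prs {}" by (auto simp: prs_def)
  qed simp
  then show ?thesis using openin_Spc[of "topspace (Spc C K)"] openin_subset by blast
qed

abbreviation Spc_over :: "'o set \<Rightarrow> 'o set topology" where
  "Spc_over A \<equiv> subtopology (Spc C K) (prs A)"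

lemma topspace_Spc_over: "topspace (Spc_over A) = prs A"
  by (auto simp: topspace_Spc prs_def)

lemma Spc_over_empty: "Spc_over {} = Spc C K"
  by (metis topspace_Spc subtopology_topspace)

lemma prs_D: "P \<in> prs A \<Longrightarrow> prime P" "P \<in> prs A \<Longrightarrow> a \<in> A \<Longrightarrow> a \<in> P" "P \<in> prs A \<Longrightarrow> a \<in> P \<Longrightarrow> a \<in> K"
  using ideal_K[OF prime_is_ideal] by (auto simp: prs_def)

lemma prs_Un: "prs (A \<union> B) = prs A \<inter> prs B"
  by (auto simp: prs_def)

lemma openin_Spc_over:
  "openin (Spc_over A) V \<longleftrightarrow> V \<subseteq> prs A \<and> (\<forall>P\<in>V. \<exists>a\<in>P. prs (insert a A) \<subseteq> V)"
proof
  assume "openin (Spc_over A) V"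
  then obtain W where W: "openin (Spc C K) W" "V = W \<inter> prs A" by (auto simp: openin_subtopology)
  show "V \<subseteq> prs A \<and> (\<forall>P\<in>V. \<exists>a\<in>P. prs (insert a A) \<subseteq> V)"
  proof (intro conjI ballI)
    fix P assume "P \<in> V"
    then obtain a where "a \<in> P" "prs {a} \<subseteq> W" using W openin_Spc by blast
    then show "\<exists>a\<in>P. prs (insert a A) \<subseteq> V" using W prs_Un[of "{a}" A] by auto
  qed (use W in blast)
next
  assume V: "V \<subseteq> prs A \<and> (\<forall>P\<in>V. \<exists>a\<in>P. prs (insert a A) \<subseteq> V)"
  let ?W = "\<Union>{prs {a} |a. a \<in> K \<and> prs (insert a A) \<subseteq> V}"
  have "openin (Spc C K) ?W"
    by (rule openin_Union) (auto simp: Spc_eq intro: topology_generated_by_Basis)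
  moreover have "V = ?W \<inter> prs A"
  proof
    show "V \<subseteq> ?W \<inter> prs A"
    proof
      fix P assume P: "P \<in> V"
      then obtain a where a: "a \<in> P" "prs (insert a A) \<subseteq> V" using V by blast
      have "P \<in> prs A" using P V by blast
      then have "P \<in> prs {a}" using a(1) by (simp add: prs_def)
      moreover have "a \<in> K" using prs_D(3)[OF \<open>P \<in> prs A\<close> a(1)] .
      ultimately show "P \<in> ?W \<inter> prs A" using a(2) \<open>P \<in> prs A\<close> by auto
    qed
    show "?W \<inter> prs A \<subseteq> V" by (auto simp: prs_def)
  qed
  ultimately show "openin (Spc_over A) V" by (auto simp: openin_subtopology)
qed

lemma openin_Spc_overE:
  assumes V: "openin (Spc_over A) V" and P: "P \<in> V"
  obtains a where "a \<in> K" "a \<in> P" "P \<in> prs A" "P \<in> prs (insert a A)" "prs (insert a A) \<subseteq> V"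
proof -
  have VA: "V \<subseteq> prs A" and *: "\<forall>P\<in>V. \<exists>a\<in>P. prs (insert a A) \<subseteq> V"
    using iffD1[OF openin_Spc_over V] by (rule conjunct1, rule conjunct2)
  have PA: "P \<in> prs A" using VA P by (rule subsetD)
  obtain a where a: "a \<in> P" "prs (insert a A) \<subseteq> V" using bspec[OF * P] by (rule bexE)
  have "P \<in> prs (insert a A)" using PA a(1) by (simp add: prs_def)
  then show ?thesis using that a PA prs_D(3)[OF PA a(1)] by simp
qed

lemma openin_Spc_over_basic: "openin (Spc_over A) (prs (insert a A))"
  unfolding openin_Spc_over
  by (auto simp: prs_def)

text \<open>A cover says that every prime containing \<open>a\<close> and \<open>A\<close> contains
  some b whose basic open set fits into a member of the cover. This is the hypothesis of
  \<open>prime_patch_compact\<close>, which leaves finitely many such b.\<close>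

lemma compactin_Spc_over_basic:
  assumes a: "a \<in> K" and A: "A \<subseteq> K"
  shows "compactin (Spc_over A) (prs (insert a A))"
  unfolding compactin_def
proof (intro conjI allI impI)
  show "prs (insert a A) \<subseteq> topspace (Spc_over A)" by (auto simp: prs_def topspace_Spc)
  fix \<U> assume U: "Ball \<U> (openin (Spc_over A)) \<and> prs (insert a A) \<subseteq> \<Union>\<U>"
  let ?B = "{b \<in> K. \<exists>W\<in>\<U>. prs (insert b A) \<subseteq> W}"
  obtain A0 B0 where A0: "finite A0" "A0 \<subseteq> insert a A" and B0: "finite B0" "B0 \<subseteq> ?B"
    and meet: "\<And>P. prime P \<Longrightarrow> A0 \<subseteq> P \<Longrightarrow> P \<inter> B0 \<noteq> {}"
  proof (rule prime_patch_compact[of "insert a A" ?B])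
    fix P assume P: "prime P" "insert a A \<subseteq> P"
    then have "P \<in> prs (insert a A)" by (simp add: prs_def)
    moreover have "prs (insert a A) \<subseteq> \<Union>\<U>" using U by simp
    ultimately have "P \<in> \<Union>\<U>" by (rule rev_subsetD)
    then obtain W where W: "W \<in> \<U>" "P \<in> W" by (rule UnionE)
    have "openin (Spc_over A) W" using U W(1) by simp
    from openin_Spc_overE[OF this W(2)]
    obtain b where "b \<in> K" "b \<in> P" "prs (insert b A) \<subseteq> W" .
    then show "P \<inter> ?B \<noteq> {}" using W(1) by auto
  qed (use a A in auto)
  have "\<forall>b\<in>B0. \<exists>W. W \<in> \<U> \<and> prs (insert b A) \<subseteq> W" using B0 by blast
  from bchoice[OF this] obtain W where W: "\<forall>b\<in>B0. W b \<in> \<U> \<and> prs (insert b A) \<subseteq> W b" by blast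
  have "prs (insert a A) \<subseteq> \<Union>(W ` B0)"
  proof
    fix P assume P: "P \<in> prs (insert a A)"
    then have "P \<inter> B0 \<noteq> {}" using meet[of P] A0 by (auto simp: prs_def)
    then obtain b where "b \<in> P" "b \<in> B0" by blast
    then show "P \<in> \<Union>(W ` B0)" using W P by (auto simp: prs_def)
  qed
  then show "\<exists>\<F>. finite \<F> \<and> \<F> \<subseteq> \<U> \<and> prs (insert a A) \<subseteq> \<Union>\<F>"
    using W B0 by (intro exI[of _ "W ` B0"]) auto
qed

text \<open>A quasi-compact open set is a finite union of basic ones, and the tensor product of the
  objects involved makes that union basic.\<close>

lemma qc_open_Spc_over:
  assumes A: "A \<subseteq> K"
  shows "qc_open (Spc_over A) V \<longleftrightarrow> (\<exists>a\<in>K. V = prs (insert a A))"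
proof
  assume "\<exists>a\<in>K. V = prs (insert a A)"
  then show "qc_open (Spc_over A) V"
    using openin_Spc_over_basic compactin_Spc_over_basic A unfolding qc_open_def by blast
next
  assume V: "qc_open (Spc_over A) V"
  let ?\<U> = "{prs (insert a A) |a. a \<in> K \<and> prs (insert a A) \<subseteq> V}"
  have "V \<subseteq> \<Union>?\<U>"
  proof
    fix P assume P: "P \<in> V"
    have "openin (Spc_over A) V" using V by (simp add: qc_open_def)
    from openin_Spc_overE[OF this P]
    obtain a where "a \<in> K" "P \<in> prs (insert a A)" "prs (insert a A) \<subseteq> V" .
    then show "P \<in> \<Union>?\<U>" by auto
  qed
  moreover have "Ball ?\<U> (openin (Spc_over A))" using openin_Spc_over_basic by blast
  ultimately obtain \<F> where F: "finite \<F>" "\<F> \<subseteq> ?\<U>" "V \<subseteq> \<Union>\<F>"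
    using V unfolding qc_open_def compactin_def by meson
  have "\<forall>W\<in>\<F>. \<exists>a. a \<in> K \<and> W = prs (insert a A) \<and> W \<subseteq> V" using F(2) by blast
  from bchoice[OF this] obtain g where G: "\<forall>W\<in>\<F>. g W \<in> K \<and> W = prs (insert (g W) A) \<and> W \<subseteq> V" ..
  have g: "g W \<in> K" "W = prs (insert (g W) A)" "W \<subseteq> V" if "W \<in> \<F>" for W
    using bspec[OF G that] by metis+
  obtain b where b: "b \<in> K" "\<And>P. prime P \<Longrightarrow> b \<in> P \<longleftrightarrow> P \<inter> g ` \<F> \<noteq> {}"
    using ex_product_of_set[of "g ` \<F>"] F(1) g(1) by blast
  have "V = prs (insert b A)"
  proof
    show "V \<subseteq> prs (insert b A)"
    proof
      fix P assume "P \<in> V"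
      then obtain W where W: "W \<in> \<F>" "P \<in> W" using F by blast
      then have P: "P \<in> prs (insert (g W) A)" using g(2) by blast
      then have "b \<in> P" using b(2)[of P] W by (auto simp: prs_def)
      then show "P \<in> prs (insert b A)" using P by (auto simp: prs_def)
    qed
    show "prs (insert b A) \<subseteq> V"
    proof
      fix P assume P: "P \<in> prs (insert b A)"
      then obtain W where W: "W \<in> \<F>" "g W \<in> P" using b(2)[of P] by (auto simp: prs_def)
      then have "P \<in> prs (insert (g W) A)" using P by (auto simp: prs_def)
      then show "P \<in> V" using g(2,3) W by blast
    qed
  qed
  then show "\<exists>a\<in>K. V = prs (insert a A)" using b by blast
qed

lemma closure_of_prime:
  assumes P: "P \<in> prs A"
  shows "Spc_over A closure_of {P} = {Q \<in> prs A. Q \<subseteq> P}"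
proof (rule subset_antisym; rule subsetI)
  fix Q assume Q: "Q \<in> Spc_over A closure_of {P}"
  then have QA: "Q \<in> prs A" unfolding in_closure_of by simp
  have "Q \<subseteq> P"
  proof
    fix a assume "a \<in> Q"
    then have "Q \<in> prs (insert a A)" using QA by (auto simp: prs_def)
    then have "P \<in> prs (insert a A)" using Q openin_Spc_over_basic unfolding in_closure_of by blast
    then show "a \<in> P" by (auto simp: prs_def)
  qed
  then show "Q \<in> {Q \<in> prs A. Q \<subseteq> P}" using QA by blast
next
  fix Q assume Q: "Q \<in> {Q \<in> prs A. Q \<subseteq> P}"
  show "Q \<in> Spc_over A closure_of {P}"
    unfolding in_closure_of
  proof (intro conjI allI impI)
    show "Q \<in> topspace (Spc_over A)" unfolding topspace_Spc_over using Q by simp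
    fix W assume W: "Q \<in> W \<and> openin (Spc_over A) W"
    obtain a where a: "a \<in> Q" "prs (insert a A) \<subseteq> W"
      using openin_Spc_overE[of A W Q] W by auto
    moreover have "P \<in> prs (insert a A)" using a(1) Q P by (auto simp: prs_def)
    ultimately show "\<exists>y. y \<in> {P} \<and> y \<in> W" by blast
  qed
qed

text \<open>Closures consist of smaller primes, so the union of \<open>Z\<close> is the only
  candidate. Irreducibility enters through \<open>common\<close>: any two elements of the union lie
  in one member of \<open>Z\<close>, which yields closure under extensions.\<close>

lemma irreducible_closed_generic_point:
  assumes A: "A \<subseteq> K" and Z: "irreducible_closed (Spc_over A) Z"
  obtains P where "P \<in> prs A" "Spc_over A closure_of {P} = Z"
proof -
  have cl: "closedin (Spc_over A) Z" and ne: "Z \<noteq> {}"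
    and irr: "\<And>B B'. closedin (Spc_over A) B \<Longrightarrow> closedin (Spc_over A) B' \<Longrightarrow> Z = B \<union> B' \<Longrightarrow> Z = B \<or> Z = B'"
    using Z unfolding irreducible_closed_def by auto
  have ZA: "Z \<subseteq> prs A" using closedin_subset[OF cl] by simp
  let ?P = "\<Union>Z"
  have common: "\<exists>Q\<in>Z. a \<in> Q \<and> b \<in> Q" if "a \<in> ?P" "b \<in> ?P" for a b
  proof (rule ccontr)
    assume n: "\<not> (\<exists>Q\<in>Z. a \<in> Q \<and> b \<in> Q)"
    have "closedin (Spc_over A) (Z - prs (insert c A))" for c
      by (rule closedin_diff[OF cl openin_Spc_over_basic])
    moreover have "Z = (Z - prs (insert a A)) \<union> (Z - prs (insert b A))"
      using n by (auto simp: prs_def)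
    ultimately have "Z = Z - prs (insert a A) \<or> Z = Z - prs (insert b A)" using irr by blast
    then have "Z \<inter> prs (insert a A) = {} \<or> Z \<inter> prs (insert b A) = {}" by (elim disjE) blast+
    moreover have "Z \<inter> prs (insert c A) \<noteq> {}" if c: "c \<in> ?P" for c
    proof -
      obtain Q where Q: "Q \<in> Z" "c \<in> Q" using c by (rule UnionE)
      have "Q \<in> prs A" using ZA Q(1) by (rule subsetD)
      then have "Q \<in> prs (insert c A)" using Q(2) by (simp add: prs_def)
      then show ?thesis using Q(1) by blast
    qed
    ultimately show False using that by simp
  qed
  have idl: "ideal ?P"
  proof (rule idealI)
    show "?P \<subseteq> K" using ZA prs_D by blast
    obtain z where "zero_object C z" using ex_zero_object by blast
    then show "?P \<noteq> {}" using ne ideal_zero[OF prime_is_ideal] ZA prs_D by blast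
    show "a \<in> ?P" if "is_retract a b" "b \<in> ?P" "a \<in> K" for a b
      using that ideal_retract[OF prime_is_ideal] ZA prs_D by blast
    show "a \<boxtimes> b \<in> ?P" if "a \<in> K" "b \<in> ?P" for a b
      using that ideal_Ten[OF prime_is_ideal] ZA prs_D by blast
    show "Dom C g \<in> ?P" if tri: "(f, g, h) \<in> Tri C" and "Dom C f \<in> ?P" "Dom C h \<in> ?P" for f g h
      using common[OF that(2,3)] ideal_mid[OF prime_is_ideal tri] ZA prs_D by blast
  qed
  have "prime ?P"
    unfolding prime_iff
  proof (intro conjI idl)
    show "Unt C \<notin> ?P" using ZA prs_D(1) prime_iff by blast
    show "\<forall>a\<in>K. \<forall>b\<in>K. a \<boxtimes> b \<in> ?P \<longrightarrow> a \<in> ?P \<or> b \<in> ?P"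
      using ZA prs_D(1) prime_iff by blast
  qed
  moreover have "A \<subseteq> ?P" using ne ZA by (auto simp: prs_def)
  ultimately have P: "?P \<in> prs A" by (simp add: prs_def)
  \<comment> \<open>An object of the union already belongs to a member of \<open>Z\<close>, so every
    basic neighbourhood of the union meets the closed set \<open>Z\<close>.\<close>
  have "?P \<in> Z"
  proof (rule ccontr)
    assume "?P \<notin> Z"
    then have PZ: "?P \<in> prs A - Z" using P by (intro DiffI)
    have "openin (Spc_over A) (prs A - Z)" using cl unfolding closedin_def topspace_Spc_over by simp
    from openin_Spc_overE[OF this PZ]
    obtain a where a: "a \<in> ?P" "prs (insert a A) \<subseteq> prs A - Z" .
    obtain Q where Q: "Q \<in> Z" "a \<in> Q" using a(1) by (rule UnionE)
    then have "Q \<in> prs (insert a A)" using ZA by (auto simp: prs_def)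
    then show False using a(2) Q(1) by blast
  qed
  then have "Spc_over A closure_of {?P} \<subseteq> Z" using closure_of_minimal[OF _ cl] by blast
  moreover have "Z \<subseteq> Spc_over A closure_of {?P}" unfolding closure_of_prime[OF P] using ZA by blast
  ultimately show ?thesis using that P by blast
qed

lemma spectral_space_Spc_over:
  assumes A: "A \<subseteq> K"
  shows "spectral_space (Spc_over A)"
  unfolding spectral_space_def
proof (intro conjI allI impI)
  obtain z where z: "zero_object C z" using ex_zero_object by blast
  have "prs (insert z A) = prs A" using ideal_zero[OF prime_is_ideal z] by (auto simp: prs_def)
  then show "compact_space (Spc_over A)"
    using compactin_Spc_over_basic[OF zero_K[OF z] A] unfolding compact_space_def topspace_Spc_over by metis
next
  fix V P assume "openin (Spc_over A) V \<and> P \<in> V"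
  then obtain a where "a \<in> K" "P \<in> prs (insert a A)" "prs (insert a A) \<subseteq> V"
    using openin_Spc_overE[of A V P] by auto
  then show "\<exists>B. qc_open (Spc_over A) B \<and> P \<in> B \<and> B \<subseteq> V" using qc_open_Spc_over[OF A] by auto
next
  fix V W assume "qc_open (Spc_over A) V \<and> qc_open (Spc_over A) W"
  then obtain a b where ab: "a \<in> K" "b \<in> K" and V: "V = prs (insert a A)" "W = prs (insert b A)"
    using qc_open_Spc_over[OF A] by auto
  obtain c where c: "c \<in> K" "\<And>P. ideal P \<Longrightarrow> c \<in> P \<longleftrightarrow> {a, b} \<subseteq> P"
    using ex_sum_of_set[of "{a, b}"] ab by auto
  have "V \<inter> W = prs (insert c A)" unfolding V using c(2)[OF prime_is_ideal] by (auto simp: prs_def)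
  then show "qc_open (Spc_over A) (V \<inter> W)" using c qc_open_Spc_over[OF A] by blast
next
  fix Z assume "irreducible_closed (Spc_over A) Z"
  then obtain P where P: "P \<in> prs A" "Spc_over A closure_of {P} = Z"
    using irreducible_closed_generic_point[OF A] by blast
  show "\<exists>!x. x \<in> topspace (Spc_over A) \<and> Spc_over A closure_of {x} = Z"
    unfolding topspace_Spc_over
  proof (rule ex1I[of _ P])
    show "P \<in> prs A \<and> Spc_over A closure_of {P} = Z" using P by simp
    fix Q assume "Q \<in> prs A \<and> Spc_over A closure_of {Q} = Z"
    then have Q: "Q \<in> prs A" "{R \<in> prs A. R \<subseteq> Q} = {R \<in> prs A. R \<subseteq> P}"
      using closure_of_prime P by auto
    then show "Q = P" using P(1) by blast
  qed
qed

text \<open>Each closed set in the Thomason union has a quasi-compact open complement, which is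
  basic; the objects defining these complements make up \<open>A\<close>.\<close>

lemma thomason_complement:
  assumes V: "V \<subseteq> prs {}" and th: "thomason (Spc C K) (prs {} - V)"
  obtains A where "A \<subseteq> K" "V = prs A"
proof -
  obtain \<Z> where Z0: "\<forall>Z\<in>\<Z>. closedin (Spc C K) Z \<and> compactin (Spc C K) (prs {} - Z)"
    and U: "prs {} - V = \<Union>\<Z>"
    using th unfolding thomason_def topspace_Spc by (elim exE conjE)
  note Z = bspec[OF Z0]
  have "\<forall>Z\<in>\<Z>. \<exists>a. a \<in> K \<and> prs {} - Z = prs {a}"
  proof
    fix Y assume "Y \<in> \<Z>"
    then have "qc_open (Spc_over {}) (prs {} - Y)"
      using Z[of Y] unfolding qc_open_def Spc_over_empty closedin_def topspace_Spc by blast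
    then show "\<exists>a. a \<in> K \<and> prs {} - Y = prs {a}" using qc_open_Spc_over[of "{}"] by auto
  qed
  from bchoice[OF this] obtain g where G: "\<forall>Z\<in>\<Z>. g Z \<in> K \<and> prs {} - Z = prs {g Z}" ..
  have g: "g Z \<in> K" "prs {} - Z = prs {g Z}" if "Z \<in> \<Z>" for Z
    using bspec[OF G that] by metis+
  have "V = prs (g ` \<Z>)"
  proof
    show "V \<subseteq> prs (g ` \<Z>)"
    proof
      fix P assume P: "P \<in> V"
      have "g Z \<in> P" if "Z \<in> \<Z>" for Z
      proof -
        have "P \<in> prs {} - Z" using P V U that by blast
        then show ?thesis using g(2)[OF that] by (auto simp: prs_def)
      qed
      then show "P \<in> prs (g ` \<Z>)" using P V by (auto simp: prs_def)
    qed
    show "prs (g ` \<Z>) \<subseteq> V"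
    proof
      fix P assume P: "P \<in> prs (g ` \<Z>)"
      have "P \<notin> Z" if "Z \<in> \<Z>" for Z
      proof -
        have "P \<in> prs {g Z}" using P that by (auto simp: prs_def)
        then show ?thesis using g(2)[OF that] by blast
      qed
      then show "P \<in> V" using U P by (auto simp: prs_def)
    qed
  qed
  then show ?thesis using that g(1) by blast
qed

end

section \<open>Tensor-triangulated functors\<close>

context exact_functor
begin

lemma F_simps [simp]:
  "a \<in> Obj T \<Longrightarrow> Fob F a \<in> Obj S"
  "f \<in> Arr T \<Longrightarrow> Far F f \<in> Arr S"
  "f \<in> Arr T \<Longrightarrow> Dom S (Far F f) = Fob F (Dom T f)"
  "f \<in> Arr T \<Longrightarrow> Cod S (Far F f) = Fob F (Cod T f)"
  "a \<in> Obj T \<Longrightarrow> Far F (Idt T a) = Idt S (Fob F a)"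
  using Fob_Obj Far_Hom[of f "Dom T f" "Cod T f"] Far_Idt by simp_all

lemma Far_Cmp':
  "f \<in> Arr T \<Longrightarrow> g \<in> Arr T \<Longrightarrow> Cod T f = Dom T g \<Longrightarrow> Far F (g \<cdot>\<^bsub>T\<^esub> f) = Far F g \<cdot>\<^bsub>S\<^esub> Far F f"
  by (rule Far_Cmp) auto

lemma Far_Zer: "a \<in> Obj T \<Longrightarrow> b \<in> Obj T \<Longrightarrow> Far F (Zer T a b) = Zer S (Fob F a) (Fob F b)"
  using Far_Add[of "Zer T a b" a b "Zer T a b"] S.Add_cancel[of "Far F (Zer T a b)" "Far F (Zer T a b)"] by simp

lemma zero_arr_Far: "T.zero_arr f \<Longrightarrow> f \<in> Arr T \<Longrightarrow> S.zero_arr (Far F f)"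
  using Far_Zer[of "Dom T f" "Cod T f"] T.zero_arrD[of f "Dom T f" "Cod T f"]
  by (metis S.zero_arr_Zer F_simps(1) T.Obj_Cod T.Obj_Dom)

lemma inverses_Far:
  assumes "T.inverses f g"
  shows "S.inverses (Far F f) (Far F g)"
proof -
  note [simp] = T.inverses_simps[OF assms]
  show ?thesis
    unfolding S.inverses_def using Far_Cmp'[of f g, symmetric] Far_Cmp'[of g f, symmetric] by simp
qed

lemma is_iso_Far: "is_iso T f \<Longrightarrow> is_iso S (Far F f)"
  using inverses_Far T.is_iso_iff S.is_iso_iff by metis

lemma is_retract_Far:
  assumes "T.is_retract a b"
  shows "S.is_retract (Fob F a) (Fob F b)"
proof -
  obtain i p where i: "i \<in> Arr T" "p \<in> Arr T" "Dom T i = a" "Cod T i = b"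
      "Dom T p = b" "Cod T p = a" "p \<cdot>\<^bsub>T\<^esub> i = Idt T a"
    using assms unfolding T.is_retract_def by blast
  have "a \<in> Obj T" using i by auto
  then have "Far F p \<cdot>\<^bsub>S\<^esub> Far F i = Idt S (Fob F a)" using Far_Cmp'[of i p] i by simp
  then show ?thesis
    unfolding S.is_retract_def using i by (intro bexI[of _ "Far F i"] bexI[of _ "Far F p"]) simp_all
qed

lemma zero_object_Far:
  assumes z: "zero_object T z"
  shows "zero_object S (Fob F z)"
proof -
  have "z \<in> Obj T" "T.zero_arr (Idt T z)" using z T.zero_object_iff by blast+
  then have "S.zero_arr (Idt S (Fob F z))" using zero_arr_Far[of "Idt T z"] by simp
  then show ?thesis using S.zero_object_iff \<open>z \<in> Obj T\<close> by simp
qed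

lemma Far_TriE:
  assumes tri: "(f, g, h) \<in> Tri T"
  obtains h' where "(Far F f, Far F g, h') \<in> Tri S" "Dom S h' = Fob F (Dom T h)"
proof -
  note [simp] = T.Tri_simps[OF tri]
  have "Fsh F (Dom T f) \<in> Hom S (Fob F (Sh T (Dom T f))) (Sh S (Fob F (Dom T f)))"
    by (rule Fsh_Hom) simp
  then have "Dom S (Fsh F (Dom T f) \<cdot>\<^bsub>S\<^esub> Far F h) = Fob F (Dom T h)" by simp
  then show ?thesis using that Far_Tri[OF tri] by blast
qed

end

section \<open>Compatibility of the functor with unit actions and duality\<close>

context tt_functor
begin

lemma Ften_simps [simp]:
  assumes "x \<in> Obj T" "y \<in> Obj T"
  shows "Ften F x y \<in> Arr S" "Dom S (Ften F x y) = Fob F x \<boxtimes>\<^bsub>S\<^esub> Fob F y"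
    "Cod S (Ften F x y) = Fob F (x \<boxtimes>\<^bsub>T\<^esub> y)" "is_iso S (Ften F x y)"
  using Ften_Hom[OF assms] Ften_iso[OF assms] by simp_all

lemma Funt_simps [simp]:
  "Funt F \<in> Arr S" "Dom S (Funt F) = Unt S" "Cod S (Funt F) = Fob F (Unt T)" "is_iso S (Funt F)"
  using Funt_Hom Funt_iso by simp_all

lemma isomorphic_Ften: "x \<in> Obj T \<Longrightarrow> y \<in> Obj T \<Longrightarrow> S.isomorphic (Fob F x \<boxtimes>\<^bsub>S\<^esub> Fob F y) (Fob F (x \<boxtimes>\<^bsub>T\<^esub> y))"
  using S.isomorphicI[of "Ften F x y"] by simp

lemma arr_iso_Ften: "f \<in> Arr T \<Longrightarrow> g \<in> Arr T \<Longrightarrow> S.arr_iso (Far F f \<boxdot>\<^bsub>S\<^esub> Far F g) (Far F (f \<boxdot>\<^bsub>T\<^esub> g))"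
  by (rule S.arr_isoI[of _ "Ften F (Dom T f) (Dom T g)" "Ften F (Cod T f) (Cod T g)"])
    (auto simp: Ften_natural[of f "Dom T f" "Cod T f" g "Dom T g" "Cod T g"])

definition hat :: "'m \<Rightarrow> 'n" where
  "hat \<theta> = Far F \<theta> \<cdot>\<^bsub>S\<^esub> Funt F"

definition cohat :: "'m \<Rightarrow> 'n" where
  "cohat \<kappa> = inv_arr S (Funt F) \<cdot>\<^bsub>S\<^esub> Far F \<kappa>"

lemma hat_simps [simp]:
  assumes "\<theta> \<in> Arr T" "Dom T \<theta> = Unt T"
  shows "hat \<theta> \<in> Arr S" "Dom S (hat \<theta>) = Unt S" "Cod S (hat \<theta>) = Fob F (Cod T \<theta>)"
  using assms by (simp_all add: hat_def)

lemma cohat_simps [simp]: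
  assumes "\<kappa> \<in> Arr T" "Cod T \<kappa> = Unt T"
  shows "cohat \<kappa> \<in> Arr S" "Cod S (cohat \<kappa>) = Unt S" "Dom S (cohat \<kappa>) = Fob F (Dom T \<kappa>)"
  using assms S.inv_simps[of "Funt F"] by (simp_all add: cohat_def)

lemma arr_iso_hat:
  assumes "\<theta> \<in> Arr T" "Dom T \<theta> = Unt T" "y \<in> Obj S"
  shows "S.arr_iso (Far F \<theta> \<boxdot>\<^bsub>S\<^esub> Idt S y) (S.act (hat \<theta>) y)"
proof -
  have "S.arr_iso (hat \<theta>) (Far F \<theta>)"
    unfolding hat_def by (rule S.arr_iso_Cmp_iso_right) (use assms in simp_all)
  then have "S.arr_iso (hat \<theta> \<boxdot>\<^bsub>S\<^esub> Idt S y) (Far F \<theta> \<boxdot>\<^bsub>S\<^esub> Idt S y)"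
    by (rule S.arr_iso_Tenm) (use assms S.arr_iso_refl in simp_all)
  moreover have "S.arr_iso (S.act (hat \<theta>) y) (hat \<theta> \<boxdot>\<^bsub>S\<^esub> Idt S y)"
    by (rule S.arr_iso_act) (use assms in simp_all)
  ultimately show ?thesis using S.arr_iso_sym S.arr_iso_trans by blast
qed

lemma Ften_Funt:
  assumes [simp]: "a \<in> Obj T"
  shows "Ften F (Unt T) a \<cdot>\<^bsub>S\<^esub> (Funt F \<boxdot>\<^bsub>S\<^esub> Idt S (Fob F a)) =
    Far F (inv_arr T (Lun T a)) \<cdot>\<^bsub>S\<^esub> Lun S (Fob F a)"
proof -
  let ?G = "Ften F (Unt T) a \<cdot>\<^bsub>S\<^esub> (Funt F \<boxdot>\<^bsub>S\<^esub> Idt S (Fob F a))"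
  have "Far F (Lun T a) \<cdot>\<^bsub>S\<^esub> ?G = Lun S (Fob F a)" using Ften_Lun[of a] by simp
  then have "Far F (inv_arr T (Lun T a)) \<cdot>\<^bsub>S\<^esub> (Far F (Lun T a) \<cdot>\<^bsub>S\<^esub> ?G) =
      Far F (inv_arr T (Lun T a)) \<cdot>\<^bsub>S\<^esub> Lun S (Fob F a)" by simp
  moreover have i: "Far F (inv_arr T (Lun T a)) \<cdot>\<^bsub>S\<^esub> Far F (Lun T a) = Idt S (Fob F (Unt T \<boxtimes>\<^bsub>T\<^esub> a))"
    by (subst Far_Cmp'[symmetric]) simp_all
  ultimately show ?thesis by (simp add: S.Cmp_eq_Cmp[OF i])
qed

lemma Far_act:
  assumes [simp]: "\<theta> \<in> Arr T" "Dom T \<theta> = Unt T" "a \<in> Obj T"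
  shows "Far F (T.act \<theta> a) = Ften F (Cod T \<theta>) a \<cdot>\<^bsub>S\<^esub> S.act (hat \<theta>) (Fob F a)"
proof -
  have n: "Ften F (Cod T \<theta>) a \<cdot>\<^bsub>S\<^esub> (Far F \<theta> \<boxdot>\<^bsub>S\<^esub> Idt S (Fob F a)) =
      Far F (\<theta> \<boxdot>\<^bsub>T\<^esub> Idt T a) \<cdot>\<^bsub>S\<^esub> Ften F (Unt T) a"
    using Ften_natural[of \<theta> "Unt T" "Cod T \<theta>" "Idt T a" a a] by simp
  have "Ften F (Cod T \<theta>) a \<cdot>\<^bsub>S\<^esub> S.act (hat \<theta>) (Fob F a) =
      Far F (\<theta> \<boxdot>\<^bsub>T\<^esub> Idt T a) \<cdot>\<^bsub>S\<^esub> ((Ften F (Unt T) a \<cdot>\<^bsub>S\<^esub> (Funt F \<boxdot>\<^bsub>S\<^esub> Idt S (Fob F a))) \<cdot>\<^bsub>S\<^esub> inv_arr S (Lun S (Fob F a)))"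
    by (simp add: S.act_def hat_def S.Ten_right_Cmp S.Cmp_eq_Cmp[OF n])
  also have "\<dots> = Far F (\<theta> \<boxdot>\<^bsub>T\<^esub> Idt T a) \<cdot>\<^bsub>S\<^esub> Far F (inv_arr T (Lun T a))"
    unfolding Ften_Funt[OF assms(3)] by simp
  also have "\<dots> = Far F (T.act \<theta> a)"
    unfolding T.act_def by (rule Far_Cmp'[symmetric]) simp_all
  finally show ?thesis ..
qed

lemma Far_coact:
  assumes [simp]: "\<kappa> \<in> Arr T" "Cod T \<kappa> = Unt T" "a \<in> Obj T"
  shows "Far F (T.coact \<kappa> a) \<cdot>\<^bsub>S\<^esub> Ften F (Dom T \<kappa>) a = S.coact (cohat \<kappa>) (Fob F a)"
proof -
  note [simp] = S.inv_simps[of "Funt F"]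
  have n: "Ften F (Unt T) a \<cdot>\<^bsub>S\<^esub> (Far F \<kappa> \<boxdot>\<^bsub>S\<^esub> Idt S (Fob F a)) =
      Far F (\<kappa> \<boxdot>\<^bsub>T\<^esub> Idt T a) \<cdot>\<^bsub>S\<^esub> Ften F (Dom T \<kappa>) a"
    using Ften_natural[of \<kappa> "Dom T \<kappa>" "Unt T" "Idt T a" a a] by simp
  have "S.coact (cohat \<kappa>) (Fob F a) = Far F (Lun T a) \<cdot>\<^bsub>S\<^esub> (Ften F (Unt T) a \<cdot>\<^bsub>S\<^esub>
      ((Funt F \<boxdot>\<^bsub>S\<^esub> Idt S (Fob F a)) \<cdot>\<^bsub>S\<^esub> (cohat \<kappa> \<boxdot>\<^bsub>S\<^esub> Idt S (Fob F a))))"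
    unfolding S.coact_def Ften_Lun[OF assms(3), symmetric] by simp
  also have "(Funt F \<boxdot>\<^bsub>S\<^esub> Idt S (Fob F a)) \<cdot>\<^bsub>S\<^esub> (cohat \<kappa> \<boxdot>\<^bsub>S\<^esub> Idt S (Fob F a)) = Far F \<kappa> \<boxdot>\<^bsub>S\<^esub> Idt S (Fob F a)"
    by (simp add: S.Tenm_Tenm) (simp add: cohat_def)
  also have "Far F (Lun T a) \<cdot>\<^bsub>S\<^esub> (Ften F (Unt T) a \<cdot>\<^bsub>S\<^esub> (Far F \<kappa> \<boxdot>\<^bsub>S\<^esub> Idt S (Fob F a))) =
      (Far F (Lun T a) \<cdot>\<^bsub>S\<^esub> Far F (\<kappa> \<boxdot>\<^bsub>T\<^esub> Idt T a)) \<cdot>\<^bsub>S\<^esub> Ften F (Dom T \<kappa>) a"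
    unfolding n by simp
  also have "Far F (Lun T a) \<cdot>\<^bsub>S\<^esub> Far F (\<kappa> \<boxdot>\<^bsub>T\<^esub> Idt T a) = Far F (T.coact \<kappa> a)"
    unfolding T.coact_def by (rule Far_Cmp'[symmetric]) simp_all
  finally show ?thesis ..
qed

lemma Tri_hat:
  assumes tri: "(\<kappa>, \<theta>, h) \<in> Tri T" and d: "Dom T \<theta> = Unt T"
  obtains h' where "(cohat \<kappa>, hat \<theta>, h') \<in> Tri S"
proof -
  note [simp] = T.Tri_simps[OF tri] d S.inv_simps[of "Funt F"]
  have [simp]: "Cod T \<kappa> = Unt T" using T.Tri_simps(4)[OF tri] d by simp
  obtain h1 where h1: "(Far F \<kappa>, Far F \<theta>, h1) \<in> Tri S" "Dom S h1 = Fob F (Dom T h)"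
    using Far_TriE[OF tri] .
  note [simp] = S.Tri_simps(3)[OF h1(1)]
  have c: "Cod S h1 = Sh S (Fob F (Dom T \<kappa>))" using S.Tri_simps(6)[OF h1(1)] by simp
  have "(cohat \<kappa>, hat \<theta>, h1) \<in> Tri S"
    by (rule S.Tri_iso[OF h1(1), of _ _ _ "Idt S (Fob F (Dom T \<kappa>))" "inv_arr S (Funt F)" "Idt S (Fob F (Dom T h))"])
      (simp_all add: candidate_def h1(2) c S.Shm_Idt cohat_def hat_def S.is_iso_inv)
  then show ?thesis using that by blast
qed

text \<open>The image of the zigzag is the zigzag of the images, conjugated by structure
  isomorphisms. The facts \<open>n1\<close> to \<open>n6\<close> move these across one tensor factor
  at a time until the unitors remain.\<close>

lemma half_dual_Far:
  assumes x: "dualizable T x"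
  obtains y coev ev where "S.half_dual (Fob F x) y coev ev"
proof -
  obtain y coev ev where y[simp]: "x \<in> Obj T" "y \<in> Obj T" and ce: "coev \<in> Hom T (Unt T) (x \<boxtimes>\<^bsub>T\<^esub> y)"
     "ev \<in> Hom T (y \<boxtimes>\<^bsub>T\<^esub> x) (Unt T)"
     and 1: "Run T x \<cdot>\<^bsub>T\<^esub> (Idt T x \<boxdot>\<^bsub>T\<^esub> ev) \<cdot>\<^bsub>T\<^esub> Asc T x y x \<cdot>\<^bsub>T\<^esub> (coev \<boxdot>\<^bsub>T\<^esub> Idt T x) = Lun T x"
    using x unfolding dualizable_def by blast
  have [simp]: "coev \<in> Arr T" "Dom T coev = Unt T" "Cod T coev = x \<boxtimes>\<^bsub>T\<^esub> y"
    "ev \<in> Arr T" "Dom T ev = y \<boxtimes>\<^bsub>T\<^esub> x" "Cod T ev = Unt T" using ce by simp_all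
  let ?x = "Fob F x" and ?y = "Fob F y"
  note [simp] = S.inv_simps[of "Funt F"] S.inv_simps[of "Ften F x y"]
  let ?coev = "inv_arr S (Ften F x y) \<cdot>\<^bsub>S\<^esub> hat coev"
  let ?ev = "cohat ev \<cdot>\<^bsub>S\<^esub> Ften F y x"
  let ?k = "(Idt S ?x \<boxdot>\<^bsub>S\<^esub> ?ev) \<cdot>\<^bsub>S\<^esub> (Asc S ?x ?y ?x \<cdot>\<^bsub>S\<^esub> (?coev \<boxdot>\<^bsub>S\<^esub> Idt S ?x))"
  let ?c = "Far F coev \<boxdot>\<^bsub>S\<^esub> Idt S ?x" and ?u = "Funt F \<boxdot>\<^bsub>S\<^esub> Idt S ?x" and ?cc = "?coev \<boxdot>\<^bsub>S\<^esub> Idt S ?x"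
  have L: "Far F (Lun T x) \<cdot>\<^bsub>S\<^esub> (Ften F (Unt T) x \<cdot>\<^bsub>S\<^esub> ?u) = Lun S ?x"
    using Ften_Lun[of x] by simp
  have F1: "Far F (Lun T x) = Far F (Run T x) \<cdot>\<^bsub>S\<^esub> (Far F (Idt T x \<boxdot>\<^bsub>T\<^esub> ev) \<cdot>\<^bsub>S\<^esub>
      (Far F (Asc T x y x) \<cdot>\<^bsub>S\<^esub> Far F (coev \<boxdot>\<^bsub>T\<^esub> Idt T x)))"
    unfolding 1[symmetric] by (simp add: Far_Cmp')
  have n1: "Far F (coev \<boxdot>\<^bsub>T\<^esub> Idt T x) \<cdot>\<^bsub>S\<^esub> Ften F (Unt T) x = Ften F (x \<boxtimes>\<^bsub>T\<^esub> y) x \<cdot>\<^bsub>S\<^esub> ?c"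
    using Ften_natural[of coev "Unt T" "x \<boxtimes>\<^bsub>T\<^esub> y" "Idt T x" x x] by simp
  have n2: "?c \<cdot>\<^bsub>S\<^esub> ?u = (Ften F x y \<boxdot>\<^bsub>S\<^esub> Idt S ?x) \<cdot>\<^bsub>S\<^esub> ?cc"
    by (simp add: S.Tenm_Tenm) (simp add: hat_def)
  have n3: "Far F (Asc T x y x) \<cdot>\<^bsub>S\<^esub> (Ften F (x \<boxtimes>\<^bsub>T\<^esub> y) x \<cdot>\<^bsub>S\<^esub> (Ften F x y \<boxdot>\<^bsub>S\<^esub> Idt S ?x)) =
      Ften F x (y \<boxtimes>\<^bsub>T\<^esub> x) \<cdot>\<^bsub>S\<^esub> ((Idt S ?x \<boxdot>\<^bsub>S\<^esub> Ften F y x) \<cdot>\<^bsub>S\<^esub> Asc S ?x ?y ?x)"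
    using Ften_Asc[of x y x] by simp
  have n4: "Far F (Idt T x \<boxdot>\<^bsub>T\<^esub> ev) \<cdot>\<^bsub>S\<^esub> Ften F x (y \<boxtimes>\<^bsub>T\<^esub> x) = Ften F x (Unt T) \<cdot>\<^bsub>S\<^esub> (Idt S ?x \<boxdot>\<^bsub>S\<^esub> Far F ev)"
    using Ften_natural[of "Idt T x" x x ev "y \<boxtimes>\<^bsub>T\<^esub> x" "Unt T"] by simp
  have n5: "(Idt S ?x \<boxdot>\<^bsub>S\<^esub> Far F ev) \<cdot>\<^bsub>S\<^esub> (Idt S ?x \<boxdot>\<^bsub>S\<^esub> Ften F y x) = (Idt S ?x \<boxdot>\<^bsub>S\<^esub> Funt F) \<cdot>\<^bsub>S\<^esub> (Idt S ?x \<boxdot>\<^bsub>S\<^esub> ?ev)"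
    by (simp add: S.Tenm_Tenm) (simp add: cohat_def)
  have n6: "Far F (Run T x) \<cdot>\<^bsub>S\<^esub> (Ften F x (Unt T) \<cdot>\<^bsub>S\<^esub> (Idt S ?x \<boxdot>\<^bsub>S\<^esub> Funt F)) = Run S ?x"
    using Ften_Run[of x] by simp
  have "Lun S ?x = Far F (Run T x) \<cdot>\<^bsub>S\<^esub> (Far F (Idt T x \<boxdot>\<^bsub>T\<^esub> ev) \<cdot>\<^bsub>S\<^esub>
      (Far F (Asc T x y x) \<cdot>\<^bsub>S\<^esub> ((Far F (coev \<boxdot>\<^bsub>T\<^esub> Idt T x) \<cdot>\<^bsub>S\<^esub> Ften F (Unt T) x) \<cdot>\<^bsub>S\<^esub> ?u)))"
    unfolding L[symmetric] F1 by simp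
  also have "\<dots> = Far F (Run T x) \<cdot>\<^bsub>S\<^esub> (Far F (Idt T x \<boxdot>\<^bsub>T\<^esub> ev) \<cdot>\<^bsub>S\<^esub>
      (Far F (Asc T x y x) \<cdot>\<^bsub>S\<^esub> (Ften F (x \<boxtimes>\<^bsub>T\<^esub> y) x \<cdot>\<^bsub>S\<^esub> (?c \<cdot>\<^bsub>S\<^esub> ?u))))"
    unfolding n1 by simp
  also have "\<dots> = Far F (Run T x) \<cdot>\<^bsub>S\<^esub> (Far F (Idt T x \<boxdot>\<^bsub>T\<^esub> ev) \<cdot>\<^bsub>S\<^esub>
      ((Far F (Asc T x y x) \<cdot>\<^bsub>S\<^esub> (Ften F (x \<boxtimes>\<^bsub>T\<^esub> y) x \<cdot>\<^bsub>S\<^esub> (Ften F x y \<boxdot>\<^bsub>S\<^esub> Idt S ?x))) \<cdot>\<^bsub>S\<^esub> ?cc))"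
    unfolding n2 by simp
  also have "\<dots> = Far F (Run T x) \<cdot>\<^bsub>S\<^esub> ((Far F (Idt T x \<boxdot>\<^bsub>T\<^esub> ev) \<cdot>\<^bsub>S\<^esub> Ften F x (y \<boxtimes>\<^bsub>T\<^esub> x)) \<cdot>\<^bsub>S\<^esub>
      ((Idt S ?x \<boxdot>\<^bsub>S\<^esub> Ften F y x) \<cdot>\<^bsub>S\<^esub> (Asc S ?x ?y ?x \<cdot>\<^bsub>S\<^esub> ?cc)))"
    unfolding n3 by simp
  also have "\<dots> = Far F (Run T x) \<cdot>\<^bsub>S\<^esub> (Ften F x (Unt T) \<cdot>\<^bsub>S\<^esub>
      (((Idt S ?x \<boxdot>\<^bsub>S\<^esub> Far F ev) \<cdot>\<^bsub>S\<^esub> (Idt S ?x \<boxdot>\<^bsub>S\<^esub> Ften F y x)) \<cdot>\<^bsub>S\<^esub> (Asc S ?x ?y ?x \<cdot>\<^bsub>S\<^esub> ?cc)))"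
    unfolding n4 by simp
  also have "\<dots> = (Far F (Run T x) \<cdot>\<^bsub>S\<^esub> (Ften F x (Unt T) \<cdot>\<^bsub>S\<^esub> (Idt S ?x \<boxdot>\<^bsub>S\<^esub> Funt F))) \<cdot>\<^bsub>S\<^esub> ?k"
    unfolding n5 by simp
  finally have e: "Lun S ?x = Run S ?x \<cdot>\<^bsub>S\<^esub> ?k" unfolding n6 .
  have "?k = inv_arr S (Run S ?x) \<cdot>\<^bsub>S\<^esub> Lun S ?x"
    unfolding e using S.inv_simps[of "Run S ?x"] by simp
  moreover have "is_iso S (inv_arr S (Run S ?x) \<cdot>\<^bsub>S\<^esub> Lun S ?x)"
    using S.inv_simps[of "Run S ?x"] by (intro S.is_iso_Cmp S.is_iso_inv) simp_all
  ultimately have "is_iso S ?k" by (rule ssubst)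
  then have "S.half_dual ?x ?y ?coev ?ev" unfolding S.half_dual_def by simp
  then show ?thesis using that by blast
qed

end

text \<open>Compact objects of \<open>T\<close> are dualizable, duality data survive the functor,
  and in \<open>S\<close> they imply compactness.\<close>

lemma (in geometric_functor) Fob_compact:
  assumes "x \<in> compacts U T"
  shows "Fob F x \<in> compacts U S"
proof -
  have "dualizable T x" using assms T.compact_iff_dualizable by (simp add: compacts_def)
  then obtain y coev ev where "S.half_dual (Fob F x) y coev ev" by (rule half_dual_Far)
  then show ?thesis using S.half_dual_compact S.compact_Unt by (auto simp: compacts_def)
qed

section \<open>Faithfulness modulo ideals\<close>

context rigid_tt_category
begin

text \<open>With this ideal, vanishing becomes an instance of \<open>null\<close>, so that results
  modulo an ideal also cover the absolute case.\<close>

lemma zero_objects_ideal: "ideal {z. zero_object C z}"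
proof (rule idealI)
  show "{z. zero_object C z} \<subseteq> K" using zero_K by blast
  show "{z. zero_object C z} \<noteq> {}" using ex_zero_object by blast
next
  fix f g h assume tri: "(f, g, h) \<in> Tri C" and z: "Dom C f \<in> {z. zero_object C z}" "Dom C h \<in> {z. zero_object C z}"
  note [simp] = Tri_simps[OF tri]
  have "zero_arr (g \<cdot> Idt C (Dom C g))" using zero_object_arr(2)[of "Dom C h" g] z by simp
  then obtain k where "k \<in> Arr C" "Dom C k = Dom C g" "Cod C k = Dom C f" "f \<cdot> k = Idt C (Dom C g)"
    by (rule Tri_lift[OF tri, rotated 2]) simp_all
  then have "zero_arr (Idt C (Dom C g))"
    using zero_object_arr(1)[of "Dom C f" f] zero_arr_Cmp_right[of f k] z by simp
  then show "Dom C g \<in> {z. zero_object C z}" using zero_object_iff by simp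
next
  fix a b assume r: "is_retract a b" and b: "b \<in> {z. zero_object C z}" and a: "a \<in> K"
  obtain i p where i: "i \<in> Arr C" "p \<in> Arr C" "Dom C i = a" "Cod C i = b"
      "Dom C p = b" "Cod C p = a" "p \<cdot> i = Idt C a"
    using r unfolding is_retract_def by blast
  have "zero_arr (p \<cdot> i)" using zero_object_arr(2)[of b i] zero_arr_Cmp_left[of i p] i b by simp
  then show "a \<in> {z. zero_object C z}" using i(7) a zero_object_iff by simp
next
  fix a b assume a: "a \<in> K" and b: "b \<in> {z. zero_object C z}"
  then have bo: "b \<in> Obj C" "zero_arr (Idt C b)" using zero_object_iff by auto
  then have "zero_arr (Idt C (a \<boxtimes> b))" using zero_arr_Tenm_right[of "Idt C b" "Idt C a"] a by simp
  then show "a \<boxtimes> b \<in> {z. zero_object C z}" using a bo zero_object_iff by simp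
qed

lemma zero_arr_if_null_zero_objects:
  assumes "null {z. zero_object C z} m"
  shows "zero_arr m"
  using assms
proof (rule nullE)
  fix h1 h2 assume h: "h1 \<in> Arr C" "h2 \<in> Arr C" "Dom C h1 = Dom C m" "Cod C h1 = Dom C h2"
    "Cod C h2 = Cod C m" "Dom C h2 \<in> {z. zero_object C z}" "m = h2 \<cdot> h1" "m \<in> Arr C"
  have "zero_arr h2" using zero_object_arr(1)[of "Dom C h2" h2] h(2,6) by simp
  then show ?thesis unfolding h(7) using zero_arr_Cmp_right[of h2 h1] h(1,2,4) by simp
qed

text \<open>The Ore condition: \<open>h\<close> followed by the cone arrow of \<open>t\<close> ends
  in \<open>B\<close>, hence vanishes on a denominator, and there \<open>h\<close> lifts along
  \<open>t\<close>.\<close>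

lemma biso_pullback:
  assumes B: "ideal B" and t: "biso B t" and h: "h \<in> Arr C" "Cod C h = Cod C t" "Dom C h \<in> K"
  obtains t' h' where "biso B t'" "Cod C t' = Dom C h" "h' \<in> Arr C" "Dom C h' = Dom C t'"
    "Cod C h' = Dom C t" "t \<cdot> h' = h \<cdot> t'"
proof -
  obtain c c' where tri: "(t, c, c') \<in> Tri C" "Dom C c' \<in> B" using t by (rule bisoE)
  note [simp] = Tri_simps(2,3)[OF tri(1)] Tri_simps(4)[OF tri(1), symmetric] Tri_simps(5)[OF tri(1)] h(1,2)
  have "null B (c \<cdot> h)"
    by (rule null_Cod) (use tri(2) in simp_all)
  then obtain t' where t': "biso B t'" "Cod C t' = Dom C h" "zero_arr ((c \<cdot> h) \<cdot> t')"
    using null_preE[OF B, of "c \<cdot> h"] h(3) by auto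
  note [simp] = biso_Arr(1)[OF t'(1)] t'(2)
  have "zero_arr (c \<cdot> (h \<cdot> t'))" using t'(3) by simp
  then obtain h' where "h' \<in> Arr C" "Dom C h' = Dom C (h \<cdot> t')" "Cod C h' = Dom C t" "t \<cdot> h' = h \<cdot> t'"
    by (rule Tri_lift[OF tri(1), rotated 2]) simp_all
  then show ?thesis using that t' by simp
qed

lemma split_mono_retract:
  assumes r: "is_retract a b" and \<sigma>[simp]: "\<sigma> \<in> Arr C" "Dom C \<sigma> = w" and s: "split_mono (\<sigma> \<boxdot> Idt C b)"
  shows "split_mono (\<sigma> \<boxdot> Idt C a)"
proof -
  obtain i p where i: "i \<in> Arr C" "p \<in> Arr C" "Dom C i = a" "Cod C i = b"
      "Dom C p = b" "Cod C p = a" and pi: "p \<cdot> i = Idt C a"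
    using r unfolding is_retract_def by blast
  note [simp] = i
  have [simp]: "a \<in> Obj C" "b \<in> Obj C" "w \<in> Obj C"
    using Obj_Dom[of i] Obj_Cod[of i] Obj_Dom[of \<sigma>] by simp_all
  obtain q where q[simp]: "q \<in> Arr C" "Dom C q = Cod C \<sigma> \<boxtimes> b" "Cod C q = w \<boxtimes> b"
    and qs: "q \<cdot> (\<sigma> \<boxdot> Idt C b) = Idt C (w \<boxtimes> b)"
    using s unfolding split_mono_def by auto
  have n: "(Idt C (Cod C \<sigma>) \<boxdot> i) \<cdot> (\<sigma> \<boxdot> Idt C a) = (\<sigma> \<boxdot> Idt C b) \<cdot> (Idt C w \<boxdot> i)"
    by (simp add: Tenm_Tenm)
  have "((Idt C w \<boxdot> p) \<cdot> (q \<cdot> (Idt C (Cod C \<sigma>) \<boxdot> i))) \<cdot> (\<sigma> \<boxdot> Idt C a) = (Idt C w \<boxdot> p) \<cdot> (Idt C w \<boxdot> i)"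
    by (simp add: n Cmp_eq_Cmp[OF qs])
  also have "\<dots> = Idt C (w \<boxtimes> a)" by (simp add: Tenm_Tenm pi)
  finally show ?thesis
    unfolding split_mono_def by (intro conjI bexI[of _ "(Idt C w \<boxdot> p) \<cdot> (q \<cdot> (Idt C (Cod C \<sigma>) \<boxdot> i))"]) simp_all
qed

lemma null_split_mono:
  assumes "null B (i \<cdot> f)" "split_mono i" "f \<in> Arr C" "Cod C f = Dom C i"
  shows "null B f"
proof -
  obtain p where p: "i \<in> Arr C" "p \<in> Arr C" "Dom C p = Cod C i" "Cod C p = Dom C i" "p \<cdot> i = Idt C (Dom C i)"
    using assms(2) unfolding split_mono_def by blast
  have "null B (p \<cdot> (i \<cdot> f))" by (rule null_Cmp_left[OF assms(1)]) (use p assms in simp_all)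
  then show ?thesis using p assms by (simp add: Cmp_eq_Cmp[OF p(5)])
qed

lemma split_mono_act:
  assumes "split_mono (\<sigma> \<boxdot> Idt C y)" "\<sigma> \<in> Arr C" "Dom C \<sigma> = Unt C" "y \<in> Obj C"
  shows "split_mono (act \<sigma> y)"
  using split_mono_arr_iso[OF arr_iso_sym[OF arr_iso_act]] assms by blast

end

text \<open>Faithfulness is recorded as the detection of zero arrows, an equivalent condition for an
  additive functor.\<close>

locale rigid_tt_functor = T: rigid_tt_category T K + S: rigid_tt_category S L + tt_functor T S F
  for T :: "('o, 'm, 'x) ttcat_scheme" and K :: "'o set"
    and S :: "('p, 'n, 'y) ttcat_scheme" and L :: "'p set"
    and F :: "('o, 'm, 'p, 'n, 'z) ttfun_scheme" +
  assumes Fob_K: "a \<in> K \<Longrightarrow> Fob F a \<in> L"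
    and zero_arr_if_Far: "f \<in> Arr T \<Longrightarrow> S.zero_arr (Far F f) \<Longrightarrow> T.zero_arr f"
begin

lemma ideal_vimage:
  assumes Q: "S.ideal Q"
  shows "T.ideal {a \<in> K. Fob F a \<in> Q}"
proof (rule T.idealI)
  obtain z where z: "zero_object T z" using T.ex_zero_object by blast
  then show "{a \<in> K. Fob F a \<in> Q} \<noteq> {}" using T.zero_K S.ideal_zero[OF Q zero_object_Far] by blast
next
  fix f g h assume tri: "(f, g, h) \<in> Tri T" and d: "Dom T f \<in> {a \<in> K. Fob F a \<in> Q}" "Dom T h \<in> {a \<in> K. Fob F a \<in> Q}"
    and k: "Dom T g \<in> K"
  note [simp] = T.Tri_simps[OF tri]
  obtain h' where "(Far F f, Far F g, h') \<in> Tri S" "Dom S h' = Fob F (Dom T h)"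
    using Far_TriE[OF tri] .
  then show "Dom T g \<in> {a \<in> K. Fob F a \<in> Q}" using S.ideal_mid[OF Q, of "Far F f" "Far F g" h'] d k by simp
next
  fix a b assume "T.is_retract a b" "b \<in> {a \<in> K. Fob F a \<in> Q}" "a \<in> K"
  then show "a \<in> {a \<in> K. Fob F a \<in> Q}" using S.ideal_retract[OF Q is_retract_Far] Fob_K by blast
next
  fix a b assume a: "a \<in> K" and b: "b \<in> {a \<in> K. Fob F a \<in> Q}"
  then have "Fob F a \<boxtimes>\<^bsub>S\<^esub> Fob F b \<in> Q" using S.ideal_Ten[OF Q] Fob_K by blast
  then show "a \<boxtimes>\<^bsub>T\<^esub> b \<in> {a \<in> K. Fob F a \<in> Q}"
    using S.ideal_iso[OF Q isomorphic_Ften[of a b]] a b T.Ten_K by simp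
qed blast

lemma hat_act_Ten:
  assumes [simp]: "\<theta> \<in> Arr T" "Dom T \<theta> = Unt T" "v \<in> Obj T" "y \<in> Obj S"
  shows "S.arr_iso ((Far F \<theta> \<boxdot>\<^bsub>S\<^esub> Idt S y) \<boxdot>\<^bsub>S\<^esub> Idt S (Fob F v)) (Far F (T.act \<theta> v) \<boxdot>\<^bsub>S\<^esub> Idt S y)"
proof -
  have "S.arr_iso (Far F (T.act \<theta> v)) (Far F (\<theta> \<boxdot>\<^bsub>T\<^esub> Idt T v))"
    unfolding T.act_def by (subst Far_Cmp') (simp_all add: S.arr_iso_Cmp_iso_right is_iso_Far)
  moreover have "S.arr_iso (Far F \<theta> \<boxdot>\<^bsub>S\<^esub> Idt S (Fob F v)) (Far F (\<theta> \<boxdot>\<^bsub>T\<^esub> Idt T v))"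
    using arr_iso_Ften[of \<theta> "Idt T v"] by simp
  ultimately have "S.arr_iso (Far F \<theta> \<boxdot>\<^bsub>S\<^esub> Idt S (Fob F v)) (Far F (T.act \<theta> v))"
    using S.arr_iso_sym S.arr_iso_trans by blast
  then have "S.arr_iso ((Far F \<theta> \<boxdot>\<^bsub>S\<^esub> Idt S (Fob F v)) \<boxdot>\<^bsub>S\<^esub> Idt S y) (Far F (T.act \<theta> v) \<boxdot>\<^bsub>S\<^esub> Idt S y)"
    by (rule S.arr_iso_Tenm) (simp add: S.arr_iso_refl)
  moreover have "S.arr_iso ((Far F \<theta> \<boxdot>\<^bsub>S\<^esub> Idt S y) \<boxdot>\<^bsub>S\<^esub> Idt S (Fob F v))
      ((Far F \<theta> \<boxdot>\<^bsub>S\<^esub> Idt S (Fob F v)) \<boxdot>\<^bsub>S\<^esub> Idt S y)"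
    by (rule S.arr_iso_Ten_mid) simp_all
  ultimately show ?thesis using S.arr_iso_trans by blast
qed

text \<open>Exchanges membership in an ideal of \<open>S\<close> for an arrow of \<open>T\<close>:
  one \<theta> out of the unit, invertible modulo \<open>I\<close>, whose image annihilates
  \<open>y\<close> modulo \<open>B\<close>.\<close>

definition killed :: "'o set \<Rightarrow> 'p set \<Rightarrow> 'p set" where
  "killed I B = {y \<in> L. \<exists>\<theta>. Dom T \<theta> = Unt T \<and> T.biso I \<theta> \<and> S.null B (Far F \<theta> \<boxdot>\<^bsub>S\<^esub> Idt S y)}"

lemma killedI:
  "y \<in> L \<Longrightarrow> Dom T \<theta> = Unt T \<Longrightarrow> T.biso I \<theta> \<Longrightarrow> S.null B (Far F \<theta> \<boxdot>\<^bsub>S\<^esub> Idt S y) \<Longrightarrow> y \<in> killed I B"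
  unfolding killed_def by (intro CollectI conjI exI)

text \<open>The point is closure under extensions. If \<theta> annihilates the third object of a
  triangle and \<theta>' the first, then \<theta> followed by the action of \<theta>' annihilates
  the middle one, and it is again invertible modulo \<open>I\<close>.\<close>

lemma ideal_killed:
  assumes I: "T.ideal I" and B: "S.ideal B"
  shows "S.ideal (killed I B)"
proof (rule S.idealI)
  have id: "T.biso I (Idt T (Unt T))" by (rule T.biso_iso[OF I]) (simp_all add: T.Unt_K)
  obtain z where z: "zero_object S z" using S.ex_zero_object by blast
  have [simp]: "z \<in> Obj S" using z S.zero_object_iff by blast
  have "S.null B (Far F (Idt T (Unt T)) \<boxdot>\<^bsub>S\<^esub> Idt S z)"
  proof (rule S.null_zero[OF B])
    have "S.zero_arr (Idt S z)" using z S.zero_object_iff by blast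
    then show "S.zero_arr (Far F (Idt T (Unt T)) \<boxdot>\<^bsub>S\<^esub> Idt S z)" by (rule S.zero_arr_Tenm_right) simp_all
  qed simp
  then have "z \<in> killed I B" by (rule killedI[OF S.zero_K[OF z] _ id, rotated]) simp
  then show "killed I B \<noteq> {}" by auto
next
  fix a b assume r: "S.is_retract a b" and b: "b \<in> killed I B" and a: "a \<in> L"
  obtain i p where i[simp]: "i \<in> Arr S" "p \<in> Arr S" "Dom S i = a" "Cod S i = b"
      "Dom S p = b" "Cod S p = a" and pi: "p \<cdot>\<^bsub>S\<^esub> i = Idt S a"
    using r unfolding S.is_retract_def by blast
  obtain \<theta> where \<theta>: "Dom T \<theta> = Unt T" "T.biso I \<theta>" "S.null B (Far F \<theta> \<boxdot>\<^bsub>S\<^esub> Idt S b)" and bL: "b \<in> L"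
    using b unfolding killed_def by blast
  note [simp] = T.biso_Arr(1)[OF \<theta>(2)]
  have "S.null B ((Idt S (Cod S (Far F \<theta>)) \<boxdot>\<^bsub>S\<^esub> p) \<cdot>\<^bsub>S\<^esub> ((Far F \<theta> \<boxdot>\<^bsub>S\<^esub> Idt S b) \<cdot>\<^bsub>S\<^esub> (Idt S (Dom S (Far F \<theta>)) \<boxdot>\<^bsub>S\<^esub> i)))"
    by (intro S.null_Cmp_left S.null_Cmp_right \<theta>(3)) (use bL in simp_all)
  then have "S.null B (Far F \<theta> \<boxdot>\<^bsub>S\<^esub> Idt S a)"
    using bL a by (simp add: S.Tenm_Tenm pi)
  then show "a \<in> killed I B" by (rule killedI[OF a \<theta>(1,2)])
next
  fix a y assume a: "a \<in> L" and y: "y \<in> killed I B"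
  obtain \<theta> where \<theta>: "Dom T \<theta> = Unt T" "T.biso I \<theta>" "S.null B (Far F \<theta> \<boxdot>\<^bsub>S\<^esub> Idt S y)" and yL: "y \<in> L"
    using y unfolding killed_def by blast
  have "S.null B (Far F \<theta> \<boxdot>\<^bsub>S\<^esub> Idt S (a \<boxtimes>\<^bsub>S\<^esub> y))"
    by (rule S.null_arr_iso[OF S.arr_iso_Ten_left S.null_Ten(1)[OF B \<theta>(3) a]])
      (use a yL T.biso_Arr(1)[OF \<theta>(2)] in simp_all)
  then show "a \<boxtimes>\<^bsub>S\<^esub> y \<in> killed I B" by (rule killedI[OF S.Ten_K[OF a yL] \<theta>(1,2)])
next
  fix f g h assume tri: "(f, g, h) \<in> Tri S" and k: "Dom S f \<in> killed I B" "Dom S h \<in> killed I B" and gL: "Dom S g \<in> L"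
  note [simp] = S.Tri_simps[OF tri]
  let ?y = "Dom S f" and ?y' = "Dom S g" and ?y'' = "Dom S h"
  obtain \<theta> where \<theta>: "Dom T \<theta> = Unt T" "T.biso I \<theta>" and n: "S.null B (Far F \<theta> \<boxdot>\<^bsub>S\<^esub> Idt S ?y'')" and y'': "?y'' \<in> L"
    using k(2) unfolding killed_def by blast
  obtain \<theta>' where \<theta>': "Dom T \<theta>' = Unt T" "T.biso I \<theta>'" and n': "S.null B (Far F \<theta>' \<boxdot>\<^bsub>S\<^esub> Idt S ?y)" and y: "?y \<in> L"
    using k(1) unfolding killed_def by blast
  note [simp] = T.biso_Arr[OF \<theta>(2)] T.biso_Arr[OF \<theta>'(2)] \<theta>(1) \<theta>'(1)
  let ?v = "Cod T \<theta>"
  let ?Fv = "Fob F ?v" and ?F1 = "Fob F (Unt T)"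
  let ?n = "Far F \<theta> \<boxdot>\<^bsub>S\<^esub> Idt S ?y'" and ?m = "Far F (T.act \<theta>' ?v)"
  have e1: "(Idt S ?Fv \<boxdot>\<^bsub>S\<^esub> g) \<cdot>\<^bsub>S\<^esub> ?n = (Far F \<theta> \<boxdot>\<^bsub>S\<^esub> Idt S ?y'') \<cdot>\<^bsub>S\<^esub> (Idt S ?F1 \<boxdot>\<^bsub>S\<^esub> g)"
    by (simp add: S.Tenm_Tenm)
  have "S.null B ((Idt S ?Fv \<boxdot>\<^bsub>S\<^esub> g) \<cdot>\<^bsub>S\<^esub> ?n)"
    unfolding e1 by (rule S.null_Cmp_right[OF n]) simp_all
  then obtain t where t: "S.biso B t" "Cod S t = ?F1 \<boxtimes>\<^bsub>S\<^esub> ?y'"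
      "S.zero_arr (((Idt S ?Fv \<boxdot>\<^bsub>S\<^esub> g) \<cdot>\<^bsub>S\<^esub> ?n) \<cdot>\<^bsub>S\<^esub> t)"
    using S.null_preE[OF B, of "(Idt S ?Fv \<boxdot>\<^bsub>S\<^esub> g) \<cdot>\<^bsub>S\<^esub> ?n"] S.Ten_K[OF Fob_K[OF T.Unt_K] gL] by auto
  note [simp] = S.biso_Arr(1)[OF t(1)] t(2)
  obtain h' where tri': "(Idt S ?Fv \<boxdot>\<^bsub>S\<^esub> f, Idt S ?Fv \<boxdot>\<^bsub>S\<^esub> g, h') \<in> Tri S"
    using S.Tri_Ten_left[OF tri, of ?Fv] by auto
  have "S.zero_arr ((Idt S ?Fv \<boxdot>\<^bsub>S\<^esub> g) \<cdot>\<^bsub>S\<^esub> (?n \<cdot>\<^bsub>S\<^esub> t))" using t(3) by simp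
  \<comment> \<open>On the denominator \<open>t\<close> the action of \<theta> on the middle object
    comes from the first object, where \<theta>' takes over.\<close>
  then obtain l where l[simp]: "l \<in> Arr S" "Dom S l = Dom S t" "Cod S l = ?Fv \<boxtimes>\<^bsub>S\<^esub> ?y"
      and lt: "(Idt S ?Fv \<boxdot>\<^bsub>S\<^esub> f) \<cdot>\<^bsub>S\<^esub> l = ?n \<cdot>\<^bsub>S\<^esub> t"
    using S.Tri_lift[OF tri', of "?n \<cdot>\<^bsub>S\<^esub> t"] by auto
  have nm: "S.null B (?m \<boxdot>\<^bsub>S\<^esub> Idt S ?y)"
    by (rule S.null_arr_iso[OF hat_act_Ten S.null_Ten(1)[OF B n' Fob_K]]) simp_all
  have e2: "(?m \<boxdot>\<^bsub>S\<^esub> Idt S ?y') \<cdot>\<^bsub>S\<^esub> (Idt S ?Fv \<boxdot>\<^bsub>S\<^esub> f) = (Idt S (Cod S ?m) \<boxdot>\<^bsub>S\<^esub> f) \<cdot>\<^bsub>S\<^esub> (?m \<boxdot>\<^bsub>S\<^esub> Idt S ?y)"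
    by (simp add: S.Tenm_Tenm)
  have "((?m \<boxdot>\<^bsub>S\<^esub> Idt S ?y') \<cdot>\<^bsub>S\<^esub> ?n) \<cdot>\<^bsub>S\<^esub> t = (?m \<boxdot>\<^bsub>S\<^esub> Idt S ?y') \<cdot>\<^bsub>S\<^esub> ((Idt S ?Fv \<boxdot>\<^bsub>S\<^esub> f) \<cdot>\<^bsub>S\<^esub> l)"
    unfolding lt by simp
  also have "\<dots> = (Idt S (Cod S ?m) \<boxdot>\<^bsub>S\<^esub> f) \<cdot>\<^bsub>S\<^esub> ((?m \<boxdot>\<^bsub>S\<^esub> Idt S ?y) \<cdot>\<^bsub>S\<^esub> l)"
    by (simp add: S.Cmp_eq_Cmp[OF e2])
  finally have "S.null B (((?m \<boxdot>\<^bsub>S\<^esub> Idt S ?y') \<cdot>\<^bsub>S\<^esub> ?n) \<cdot>\<^bsub>S\<^esub> t)"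
    using S.null_Cmp_left[OF S.null_Cmp_right[OF nm, of l], of "Idt S (Cod S ?m) \<boxdot>\<^bsub>S\<^esub> f"] by simp
  then have "S.null B ((?m \<boxdot>\<^bsub>S\<^esub> Idt S ?y') \<cdot>\<^bsub>S\<^esub> ?n)"
    by (rule S.null_pre[OF B t(1), rotated 2]) simp_all
  then have n'': "S.null B (Far F (T.act \<theta>' ?v \<cdot>\<^bsub>T\<^esub> \<theta>) \<boxdot>\<^bsub>S\<^esub> Idt S ?y')"
    by (simp add: Far_Cmp' S.Tenm_Tenm)
  have b'': "T.biso I (T.act \<theta>' ?v \<cdot>\<^bsub>T\<^esub> \<theta>)"
    by (rule T.biso_Cmp[OF I \<theta>(2) T.biso_act[OF I \<theta>'(2)]]) simp_all
  show "?y' \<in> killed I B" by (rule killedI[OF gL _ b'' n'']) simp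
qed (auto simp: killed_def)

text \<open>An object of \<open>I\<close> is annihilated by the cone of its evaluation, an object of
  \<open>B\<close> by the identity of the unit modulo \<open>B\<close>; being an ideal,
  \<open>killed I B\<close> contains whatever these generate.\<close>

lemma gen_killed:
  assumes I: "T.ideal I" and B: "S.ideal B" and y: "y \<in> S.gen (Fob F ` I \<union> B)"
  shows "y \<in> killed I B"
proof -
  have "Fob F ` I \<subseteq> killed I B"
  proof (rule image_subsetI)
    fix c assume c: "c \<in> I"
    then have cK: "c \<in> K" using T.ideal_K[OF I] by blast
    obtain \<theta> where \<theta>: "Dom T \<theta> = Unt T" "T.zero_arr (\<theta> \<boxdot>\<^bsub>T\<^esub> Idt T c)" "T.biso (T.gen {c}) \<theta>"
      using T.rigid_approximation[OF cK] by metis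
    note [simp] = T.biso_Arr[OF \<theta>(3)] \<theta>(1)
    have "T.biso I \<theta>"
      using \<theta>(3) T.gen_least[OF I, of "{c}"] c unfolding T.biso_def by blast
    moreover have "S.zero_arr (Far F \<theta> \<boxdot>\<^bsub>S\<^esub> Idt S (Fob F c))"
      using zero_arr_Far[OF \<theta>(2)] S.zero_arr_arr_iso[OF arr_iso_Ften[of \<theta> "Idt T c"]] cK by simp
    then have "S.null B (Far F \<theta> \<boxdot>\<^bsub>S\<^esub> Idt S (Fob F c))"
      by (rule S.null_zero[OF B, rotated]) (use cK in simp)
    ultimately show "Fob F c \<in> killed I B" by (intro killedI[OF Fob_K[OF cK] \<theta>(1)])
  qed
  moreover have "B \<subseteq> killed I B"
  proof
    fix y assume y: "y \<in> B"
    then have yL: "y \<in> L" using S.ideal_K[OF B] by blast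
    have id: "T.biso I (Idt T (Unt T))" by (rule T.biso_iso[OF I]) (simp_all add: T.Unt_K)
    have "S.null B (Far F (Idt T (Unt T)) \<boxdot>\<^bsub>S\<^esub> Idt S y)"
      by (rule S.null_Dom) (use yL S.ideal_Ten[OF B Fob_K[OF T.Unt_K] y] in simp_all)
    then show "y \<in> killed I B" by (rule killedI[OF yL _ id, rotated]) simp
  qed
  ultimately have "Fob F ` I \<union> B \<subseteq> killed I B" by (rule Un_least)
  from S.gen_least[OF ideal_killed[OF I B] this] show ?thesis using y by (rule subsetD)
qed

text \<open>The induced functor between the Verdier quotients by \<open>P\<close> and by the ideal generated by its
  image is again faithful.\<close>

lemma null_if_Far_null:
  assumes P: "T.ideal P" and m: "m \<in> Arr T" "Cod T m \<in> K"
    and n: "S.null (S.gen (Fob F ` P)) (Far F m)"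
  shows "T.null P m"
  using n
proof (rule S.nullE)
  let ?Z = "{z. zero_object S z}"
  fix h1 h2 assume h: "h1 \<in> Arr S" "h2 \<in> Arr S" "Dom S h1 = Dom S (Far F m)" "Cod S h1 = Dom S h2"
    "Cod S h2 = Cod S (Far F m)" "Dom S h2 \<in> S.gen (Fob F ` P)" "Far F m = h2 \<cdot>\<^bsub>S\<^esub> h1" "Far F m \<in> Arr S"
  note [simp] = h(1,2,4) m
  have d[simp]: "Dom S h1 = Fob F (Dom T m)" "Cod S h2 = Fob F (Cod T m)" using h(3,5) by simp_all
  let ?y = "Dom S h2"
  \<comment> \<open>With the zero objects as second ideal, the annihilation obtained is honest
    vanishing.\<close>
  have "?y \<in> killed P ?Z"
    using gen_killed[OF P S.zero_objects_ideal] S.gen_mono[of "Fob F ` P" "Fob F ` P \<union> ?Z"] h(6) by blast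
  then obtain \<theta> where \<theta>: "Dom T \<theta> = Unt T" "T.biso P \<theta>" "S.null ?Z (Far F \<theta> \<boxdot>\<^bsub>S\<^esub> Idt S ?y)"
    unfolding killed_def by blast
  note [simp] = T.biso_Arr[OF \<theta>(2)] \<theta>(1)
  have "S.zero_arr (Far F \<theta> \<boxdot>\<^bsub>S\<^esub> Idt S ?y)" using S.zero_arr_if_null_zero_objects[OF \<theta>(3)] .
  then have z: "S.zero_arr (S.act (hat \<theta>) ?y)"
    using S.zero_arr_arr_iso[OF arr_iso_hat[of \<theta> ?y]] by simp
  have na: "S.act (hat \<theta>) (Fob F (Cod T m)) \<cdot>\<^bsub>S\<^esub> h2 = (Idt S (Fob F (Cod T \<theta>)) \<boxdot>\<^bsub>S\<^esub> h2) \<cdot>\<^bsub>S\<^esub> S.act (hat \<theta>) ?y"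
    by (rule S.act_natural) simp_all
  \<comment> \<open>By naturality the action of \<theta> on the target of \<open>m\<close> can be
    moved past \<open>h2\<close> to \<open>?y\<close>, where it is zero. So an arrow of
    \<open>T\<close> is sent to zero.\<close>
  have "Far F (T.act \<theta> (Cod T m) \<cdot>\<^bsub>T\<^esub> m) =
      Ften F (Cod T \<theta>) (Cod T m) \<cdot>\<^bsub>S\<^esub> (S.act (hat \<theta>) (Fob F (Cod T m)) \<cdot>\<^bsub>S\<^esub> (h2 \<cdot>\<^bsub>S\<^esub> h1))"
    unfolding h(7)[symmetric] by (simp add: Far_Cmp' Far_act)
  also have "\<dots> = (Ften F (Cod T \<theta>) (Cod T m) \<cdot>\<^bsub>S\<^esub> (Idt S (Fob F (Cod T \<theta>)) \<boxdot>\<^bsub>S\<^esub> h2)) \<cdot>\<^bsub>S\<^esub> (S.act (hat \<theta>) ?y \<cdot>\<^bsub>S\<^esub> h1)"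
    by (simp add: S.Cmp_eq_Cmp[OF na])
  finally have "S.zero_arr (Far F (T.act \<theta> (Cod T m) \<cdot>\<^bsub>T\<^esub> m))"
    using S.zero_arr_Cmp_left[OF S.zero_arr_Cmp_right[OF z, of h1],
        of "Ften F (Cod T \<theta>) (Cod T m) \<cdot>\<^bsub>S\<^esub> (Idt S (Fob F (Cod T \<theta>)) \<boxdot>\<^bsub>S\<^esub> h2)"] by simp
  then have "T.zero_arr (T.act \<theta> (Cod T m) \<cdot>\<^bsub>T\<^esub> m)" by (rule zero_arr_if_Far[rotated]) simp
  then have "T.null P (T.act \<theta> (Cod T m) \<cdot>\<^bsub>T\<^esub> m)" by (rule T.null_zero[OF P, rotated]) simp
  \<comment> \<open>The action of \<theta> is a denominator modulo \<open>P\<close> and is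
    cancelled.\<close>
  then show ?thesis
    by (rule T.null_post[OF P T.biso_act[OF P \<theta>(2)], rotated 4]) simp_all
qed

text \<open>Membership in an ideal is the vanishing of the identity modulo that ideal. This is the
  source of surjectivity on spectra.\<close>

lemma mem_if_Fob_mem_gen:
  assumes P: "T.ideal P" and s: "s \<in> K" and Fs: "Fob F s \<in> S.gen (Fob F ` P)"
  shows "s \<in> P"
proof -
  have "S.null (S.gen (Fob F ` P)) (Far F (Idt T s))" by (rule S.null_Dom) (use s Fs in simp_all)
  then have "T.null P (Idt T s)" by (rule null_if_Far_null[OF P, rotated 2]) (use s in simp_all)
  then show ?thesis using T.null_biso_Dom[OF P T.biso_iso[OF P, of "Idt T s"]] s by simp
qed

end

section \<open>Splitting modulo a prime\<close>

context rigid_tt_functor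
begin

text \<open>Modulo \<open>J\<close> the object \<open>Fob F a\<close> is the sum of a part supported where \<open>d\<close> vanishes, on which
  \<open>\<theta>\<close> is invertible, and a part supported on \<open>d\<close>, which \<open>\<theta>\<close> kills.  So an arrow \<open>x\<close> that
  vanishes on both parts (hypotheses \<open>\<sigma>x\<close> and \<open>h1x\<close>) vanishes.\<close>

lemma null_if_null_on_parts:
  assumes J: "S.ideal J" and tri: "(\<kappa>, \<theta>, h) \<in> Tri S" and \<theta>1: "Dom S \<theta> = Unt S" and \<theta>L: "Cod S \<theta> \<in> L"
    and \<alpha>: "\<alpha> \<in> L"
    and h1: "h1 \<in> Arr S" "Dom S h1 = \<alpha>" "Cod S h1 = y" and h2: "h2 \<in> Arr S" "Dom S h2 = y"
      "Cod S h2 = Cod S \<theta> \<boxtimes>\<^bsub>S\<^esub> \<alpha>" and y: "y \<in> L"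
    and fac: "S.act \<theta> \<alpha> = h2 \<cdot>\<^bsub>S\<^esub> h1"
    and \<sigma>: "\<sigma> \<in> Arr S" "Dom S \<sigma> = Unt S" "Cod S \<sigma> \<in> L" and \<sigma>y: "Cod S \<sigma> \<boxtimes>\<^bsub>S\<^esub> y \<in> J"
    and \<sigma>u: "S.split_mono (\<sigma> \<boxdot>\<^bsub>S\<^esub> Idt S (Dom S \<kappa>))"
    and x: "x \<in> Arr S" "Cod S x = \<alpha>" "Dom S x \<in> L"
    and \<sigma>x: "S.zero_arr (S.act \<sigma> \<alpha> \<cdot>\<^bsub>S\<^esub> x)" and h1x: "S.null J (h1 \<cdot>\<^bsub>S\<^esub> x)"
  shows "S.null J x"
proof -
  let ?u = "Dom S \<kappa>" and ?v = "Cod S \<theta>" and ?s = "Cod S \<sigma>"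
  let ?N = "Sh S (?u \<boxtimes>\<^bsub>S\<^esub> \<alpha>)"
  note Tr = S.Tri_simps[OF tri]
  have \<kappa>[simp]: "\<kappa> \<in> Arr S" "Cod S \<kappa> = Unt S" "\<theta> \<in> Arr S" using Tr \<theta>1 by simp_all
  note [simp] = \<theta>1 \<theta>L \<alpha> h1 h2 y \<sigma> x
  \<comment> \<open>Split injectivity of \<sigma> passes from \<open>?u\<close> to its tensor
    multiples, and a suspension is a multiple by the suspended unit.\<close>
  have sm: "S.split_mono (\<sigma> \<boxdot>\<^bsub>S\<^esub> Idt S (?u \<boxtimes>\<^bsub>S\<^esub> \<alpha>))" "S.split_mono (\<sigma> \<boxdot>\<^bsub>S\<^esub> Idt S ?N)"
  proof -
    have ten: "S.split_mono (\<sigma> \<boxdot>\<^bsub>S\<^esub> Idt S (a \<boxtimes>\<^bsub>S\<^esub> b))" "S.split_mono (\<sigma> \<boxdot>\<^bsub>S\<^esub> Idt S (b \<boxtimes>\<^bsub>S\<^esub> a))"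
      if sa: "S.split_mono (\<sigma> \<boxdot>\<^bsub>S\<^esub> Idt S a)" and [simp]: "a \<in> Obj S" "b \<in> Obj S" for a b
    proof -
      let ?f = "\<sigma> \<boxdot>\<^bsub>S\<^esub> Idt S a"
      obtain p where "p \<in> Arr S" "Dom S p = Cod S ?f" "Cod S p = Dom S ?f" "p \<cdot>\<^bsub>S\<^esub> ?f = Idt S (Dom S ?f)"
        using sa unfolding S.split_mono_def by blast
      then have p: "p \<in> Arr S" "Dom S p = ?s \<boxtimes>\<^bsub>S\<^esub> a" "Cod S p = Unt S \<boxtimes>\<^bsub>S\<^esub> a"
        "p \<cdot>\<^bsub>S\<^esub> ?f = Idt S (Unt S \<boxtimes>\<^bsub>S\<^esub> a)"
        by simp_all
      have "(p \<boxdot>\<^bsub>S\<^esub> Idt S b) \<cdot>\<^bsub>S\<^esub> ((\<sigma> \<boxdot>\<^bsub>S\<^esub> Idt S a) \<boxdot>\<^bsub>S\<^esub> Idt S b) = Idt S ((Unt S \<boxtimes>\<^bsub>S\<^esub> a) \<boxtimes>\<^bsub>S\<^esub> b)"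
        using p by (simp add: S.Tenm_Tenm)
      then have "S.split_mono ((\<sigma> \<boxdot>\<^bsub>S\<^esub> Idt S a) \<boxdot>\<^bsub>S\<^esub> Idt S b)"
        unfolding S.split_mono_def using p by (intro conjI bexI[of _ "p \<boxdot>\<^bsub>S\<^esub> Idt S b"]) simp_all
      then show "S.split_mono (\<sigma> \<boxdot>\<^bsub>S\<^esub> Idt S (a \<boxtimes>\<^bsub>S\<^esub> b))" "S.split_mono (\<sigma> \<boxdot>\<^bsub>S\<^esub> Idt S (b \<boxtimes>\<^bsub>S\<^esub> a))"
        using S.split_mono_arr_iso[OF S.arr_iso_Ten_right] S.split_mono_arr_iso[OF S.arr_iso_Ten_left]
        by simp_all
    qed
    show 1: "S.split_mono (\<sigma> \<boxdot>\<^bsub>S\<^esub> Idt S (?u \<boxtimes>\<^bsub>S\<^esub> \<alpha>))" by (rule ten(1)[OF \<sigma>u]) simp_all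
    have r: "S.is_retract ?N (Sh S (Unt S) \<boxtimes>\<^bsub>S\<^esub> (?u \<boxtimes>\<^bsub>S\<^esub> \<alpha>))"
      by (rule S.isomorphic_retract[OF S.isomorphic_sym[OF S.isomorphic_Sh_Unt]]) simp
    have "S.split_mono (\<sigma> \<boxdot>\<^bsub>S\<^esub> Idt S (Sh S (Unt S) \<boxtimes>\<^bsub>S\<^esub> (?u \<boxtimes>\<^bsub>S\<^esub> \<alpha>)))"
      by (rule ten(2)[OF 1]) simp_all
    then show "S.split_mono (\<sigma> \<boxdot>\<^bsub>S\<^esub> Idt S ?N)" by (rule S.split_mono_retract[OF r, rotated 2]) simp_all
  qed
  let ?\<theta>\<alpha> = "S.act \<theta> \<alpha>" and ?\<kappa>\<alpha> = "S.coact \<kappa> \<alpha>"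
  obtain \<delta> where triA: "(?\<kappa>\<alpha>, ?\<theta>\<alpha>, \<delta>) \<in> Tri S" and \<delta>d: "Dom S \<delta> = ?v \<boxtimes>\<^bsub>S\<^esub> \<alpha>"
    by (rule S.Tri_act[OF tri \<theta>1 S.Obj_if_K[OF \<alpha>]])
  have \<delta>[simp]: "\<delta> \<in> Arr S" "Dom S \<delta> = ?v \<boxtimes>\<^bsub>S\<^esub> \<alpha>" "Cod S \<delta> = ?N"
    using S.Tri_simps(3,6)[OF triA] \<delta>d by simp_all
  have "S.null J (S.act \<sigma> ?N \<cdot>\<^bsub>S\<^esub> (\<delta> \<cdot>\<^bsub>S\<^esub> h2))"
  proof -
    have e: "S.act \<sigma> ?N \<cdot>\<^bsub>S\<^esub> (\<delta> \<cdot>\<^bsub>S\<^esub> h2) = (Idt S ?s \<boxdot>\<^bsub>S\<^esub> (\<delta> \<cdot>\<^bsub>S\<^esub> h2)) \<cdot>\<^bsub>S\<^esub> S.act \<sigma> y"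
      by (rule S.act_natural) simp_all
    show ?thesis unfolding e by (rule S.null_factor) (use \<sigma>y in simp_all)
  qed
  then have "S.null J (\<delta> \<cdot>\<^bsub>S\<^esub> h2)"
    by (rule S.null_split_mono[OF _ S.split_mono_act[OF sm(2)]]) simp_all
  then obtain t1 where t1: "S.biso J t1" "Cod S t1 = y" and z1: "S.zero_arr ((\<delta> \<cdot>\<^bsub>S\<^esub> h2) \<cdot>\<^bsub>S\<^esub> t1)"
    by (rule S.null_preE[OF J]) simp_all
  note [simp] = S.biso_Arr[OF t1(1)] t1(2)
  have "S.zero_arr (\<delta> \<cdot>\<^bsub>S\<^esub> (h2 \<cdot>\<^bsub>S\<^esub> t1))" using z1 by simp
  \<comment> \<open>Consequently \<open>h2\<close> lifts along the action of \<theta>, over the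
    denominator \<open>t1\<close>.\<close>
  then obtain g where g[simp]: "g \<in> Arr S" "Dom S g = Dom S t1" "Cod S g = \<alpha>" and \<theta>g: "?\<theta>\<alpha> \<cdot>\<^bsub>S\<^esub> g = h2 \<cdot>\<^bsub>S\<^esub> t1"
    by (rule S.Tri_lift[OF S.Tri_rotate[OF triA], rotated 2]) simp_all
  obtain t2 h1' where t2: "S.biso J t2" "Cod S t2 = \<alpha>" and h1'[simp]: "h1' \<in> Arr S" "Dom S h1' = Dom S t2" "Cod S h1' = Dom S t1"
    and ore1: "t1 \<cdot>\<^bsub>S\<^esub> h1' = h1 \<cdot>\<^bsub>S\<^esub> t2"
    by (rule S.biso_pullback[OF J t1(1), of h1]) simp_all
  note [simp] = S.biso_Arr[OF t2(1)] t2(2)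
  let ?e = "g \<cdot>\<^bsub>S\<^esub> h1'"
  have \<theta>e: "?\<theta>\<alpha> \<cdot>\<^bsub>S\<^esub> t2 = ?\<theta>\<alpha> \<cdot>\<^bsub>S\<^esub> ?e"
  proof -
    have "?\<theta>\<alpha> \<cdot>\<^bsub>S\<^esub> ?e = h2 \<cdot>\<^bsub>S\<^esub> (t1 \<cdot>\<^bsub>S\<^esub> h1')" by (simp add: S.Cmp_eq_Cmp[OF \<theta>g])
    also have "\<dots> = (h2 \<cdot>\<^bsub>S\<^esub> h1) \<cdot>\<^bsub>S\<^esub> t2" unfolding ore1 by simp
    finally show ?thesis unfolding fac ..
  qed
  obtain k where k[simp]: "k \<in> Arr S" "Dom S k = Dom S t2" "Cod S k = \<alpha>" and t2k: "t2 = ?e \<boxplus>\<^bsub>S\<^esub> k"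
    using S.ex_difference[of t2 ?e] by auto
  have "S.zero_arr (?\<theta>\<alpha> \<cdot>\<^bsub>S\<^esub> k)"
    by (rule S.zero_arr_difference[OF \<theta>e t2k]) simp_all
  then obtain e2 where e2[simp]: "e2 \<in> Arr S" "Dom S e2 = Dom S t2" "Cod S e2 = ?u \<boxtimes>\<^bsub>S\<^esub> \<alpha>" and \<kappa>e2: "?\<kappa>\<alpha> \<cdot>\<^bsub>S\<^esub> e2 = k"
    by (rule S.Tri_lift[OF triA, rotated 2]) simp_all
  obtain t3 x1 where t3: "S.biso J t3" "Cod S t3 = Dom S x" and x1[simp]: "x1 \<in> Arr S" "Dom S x1 = Dom S t3" "Cod S x1 = Dom S t2"
    and ore2: "t2 \<cdot>\<^bsub>S\<^esub> x1 = x \<cdot>\<^bsub>S\<^esub> t3"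
    by (rule S.biso_pullback[OF J t2(1), of x]) simp_all
  note [simp] = S.biso_Arr[OF t3(1)] t3(2)
  have n1: "S.null J (S.act \<sigma> (Dom S t2) \<cdot>\<^bsub>S\<^esub> x1)"
  proof (rule S.null_post[OF J S.biso_Ten(2)[OF J t2(1) \<sigma>(3)]])
    have n: "S.act \<sigma> \<alpha> \<cdot>\<^bsub>S\<^esub> t2 = (Idt S ?s \<boxdot>\<^bsub>S\<^esub> t2) \<cdot>\<^bsub>S\<^esub> S.act \<sigma> (Dom S t2)"
      by (rule S.act_natural) simp_all
    have "(Idt S ?s \<boxdot>\<^bsub>S\<^esub> t2) \<cdot>\<^bsub>S\<^esub> (S.act \<sigma> (Dom S t2) \<cdot>\<^bsub>S\<^esub> x1) = S.act \<sigma> \<alpha> \<cdot>\<^bsub>S\<^esub> (t2 \<cdot>\<^bsub>S\<^esub> x1)"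
      by (simp add: S.Cmp_eq_Cmp[OF n])
    also have "\<dots> = (S.act \<sigma> \<alpha> \<cdot>\<^bsub>S\<^esub> x) \<cdot>\<^bsub>S\<^esub> t3" unfolding ore2 by simp
    finally show "S.null J ((Idt S ?s \<boxdot>\<^bsub>S\<^esub> t2) \<cdot>\<^bsub>S\<^esub> (S.act \<sigma> (Dom S t2) \<cdot>\<^bsub>S\<^esub> x1))"
      using S.null_Cmp_right[OF S.null_zero[OF J _ \<sigma>x], of t3] by simp
  qed simp_all
  \<comment> \<open>On a multiple of \<open>?u\<close> the action of \<sigma> is split injective,
    while by naturality it annihilates this composite together with \<open>x\<close>.\<close>
  have n2: "S.null J (e2 \<cdot>\<^bsub>S\<^esub> x1)"
  proof (rule S.null_split_mono[OF _ S.split_mono_act[OF sm(1)]])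
    have n: "S.act \<sigma> (?u \<boxtimes>\<^bsub>S\<^esub> \<alpha>) \<cdot>\<^bsub>S\<^esub> e2 = (Idt S ?s \<boxdot>\<^bsub>S\<^esub> e2) \<cdot>\<^bsub>S\<^esub> S.act \<sigma> (Dom S t2)"
      by (rule S.act_natural) simp_all
    have "S.act \<sigma> (?u \<boxtimes>\<^bsub>S\<^esub> \<alpha>) \<cdot>\<^bsub>S\<^esub> (e2 \<cdot>\<^bsub>S\<^esub> x1) = (Idt S ?s \<boxdot>\<^bsub>S\<^esub> e2) \<cdot>\<^bsub>S\<^esub> (S.act \<sigma> (Dom S t2) \<cdot>\<^bsub>S\<^esub> x1)"
      by (simp add: S.Cmp_eq_Cmp[OF n])
    then show "S.null J (S.act \<sigma> (?u \<boxtimes>\<^bsub>S\<^esub> \<alpha>) \<cdot>\<^bsub>S\<^esub> (e2 \<cdot>\<^bsub>S\<^esub> x1))"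
      using S.null_Cmp_left[OF n1, of "Idt S ?s \<boxdot>\<^bsub>S\<^esub> e2"] by simp
  qed simp_all
  have n3: "S.null J (h1' \<cdot>\<^bsub>S\<^esub> x1)"
  proof (rule S.null_post[OF J t1(1)])
    have "t1 \<cdot>\<^bsub>S\<^esub> (h1' \<cdot>\<^bsub>S\<^esub> x1) = h1 \<cdot>\<^bsub>S\<^esub> (t2 \<cdot>\<^bsub>S\<^esub> x1)" by (simp add: S.Cmp_eq_Cmp[OF ore1])
    also have "\<dots> = (h1 \<cdot>\<^bsub>S\<^esub> x) \<cdot>\<^bsub>S\<^esub> t3" unfolding ore2 by simp
    finally show "S.null J (t1 \<cdot>\<^bsub>S\<^esub> (h1' \<cdot>\<^bsub>S\<^esub> x1))" using S.null_Cmp_right[OF h1x, of t3] by simp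
  qed simp_all
  obtain t4 where t4: "S.biso J t4" "Cod S t4 = Dom S t3" and z4: "S.zero_arr ((h1' \<cdot>\<^bsub>S\<^esub> x1) \<cdot>\<^bsub>S\<^esub> t4)"
    by (rule S.null_preE[OF J n3]) simp_all
  note [simp] = S.biso_Arr[OF t4(1)] t4(2)
  have "(x \<cdot>\<^bsub>S\<^esub> t3) \<cdot>\<^bsub>S\<^esub> t4 = (?e \<boxplus>\<^bsub>S\<^esub> k) \<cdot>\<^bsub>S\<^esub> (x1 \<cdot>\<^bsub>S\<^esub> t4)"
    unfolding t2k[symmetric] ore2[symmetric] by simp
  also have "\<dots> = (g \<cdot>\<^bsub>S\<^esub> ((h1' \<cdot>\<^bsub>S\<^esub> x1) \<cdot>\<^bsub>S\<^esub> t4)) \<boxplus>\<^bsub>S\<^esub> (?\<kappa>\<alpha> \<cdot>\<^bsub>S\<^esub> ((e2 \<cdot>\<^bsub>S\<^esub> x1) \<cdot>\<^bsub>S\<^esub> t4))"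
    unfolding \<kappa>e2[symmetric] by simp
  also have "g \<cdot>\<^bsub>S\<^esub> ((h1' \<cdot>\<^bsub>S\<^esub> x1) \<cdot>\<^bsub>S\<^esub> t4) = Zer S (Dom S t4) \<alpha>"
    by (rule S.zero_arrD[OF S.zero_arr_Cmp_left[OF z4]]) simp_all
  finally have "(x \<cdot>\<^bsub>S\<^esub> t3) \<cdot>\<^bsub>S\<^esub> t4 = ?\<kappa>\<alpha> \<cdot>\<^bsub>S\<^esub> ((e2 \<cdot>\<^bsub>S\<^esub> x1) \<cdot>\<^bsub>S\<^esub> t4)" by simp
  moreover have "S.null J (?\<kappa>\<alpha> \<cdot>\<^bsub>S\<^esub> ((e2 \<cdot>\<^bsub>S\<^esub> x1) \<cdot>\<^bsub>S\<^esub> t4))"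
    by (intro S.null_Cmp_left S.null_Cmp_right n2) simp_all
  ultimately have "S.null J ((x \<cdot>\<^bsub>S\<^esub> t3) \<cdot>\<^bsub>S\<^esub> t4)" by (rule ssubst)
  then have "S.null J (x \<cdot>\<^bsub>S\<^esub> t3)" by (rule S.null_pre[OF J t4(1), rotated 2]) simp_all
  then show ?thesis by (rule S.null_pre[OF J t3(1), rotated 2]) simp_all
qed

text \<open>The splitting descends in the form of an arrow \<open>q0\<close> with
  \<open>q0 \<cdot> \<sigma> \<cdot> \<kappa>0\<close> equal to \<open>\<kappa>0\<close> on
  \<open>a\<close> modulo \<open>P\<close>. From it arises an arrow \<open>?q\<close> out of
  \<open>a\<close> that is invertible modulo \<open>P\<close>, hence modulo \<open>R\<close>, and
  yet factors through an object of \<open>R\<close>.\<close>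

lemma mem_if_decomposes:
  assumes P: "T.prime P" and R: "T.prime R" and PR: "P \<subseteq> R" and d: "d \<in> R" "d \<notin> P" and a: "a \<in> K"
    and y0: "y0 \<in> L" "y0 \<boxtimes>\<^bsub>S\<^esub> Fob F d \<in> S.gen (Fob F ` P)"
    and mem: "Fob F a \<in> S.gen (insert (Fob F d) (insert y0 (Fob F ` P)))"
  shows "a \<in> R"
proof -
  note Pi = T.prime_is_ideal[OF P] and Ri = T.prime_is_ideal[OF R]
  have dK: "d \<in> K" using T.ideal_K[OF Ri d(1)] .
  define J where "J = S.gen (Fob F ` P)"
  have J: "S.ideal J" unfolding J_def by (rule S.ideal_gen)
  \<comment> \<open>The objects supported, modulo \<open>J\<close>, where d vanishes.\<close>
  define B where "B = {y \<in> L. y \<boxtimes>\<^bsub>S\<^esub> Fob F d \<in> J}"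
  have B: "S.ideal B" unfolding B_def by (rule S.ideal_transporter[OF J Fob_K[OF dK]])
  define I where "I = T.gen (insert d P)"
  have I: "T.ideal I" unfolding I_def by (rule T.ideal_gen)
  have "insert d P \<subseteq> K" using dK T.ideal_K[OF Pi] by blast
  then have PI: "insert d P \<subseteq> I" unfolding I_def by (rule T.gen_superset)
  have IR: "I \<subseteq> R" unfolding I_def using T.gen_least[OF Ri] PR d(1) by blast
  have FPJ: "Fob F ` P \<subseteq> J" unfolding J_def using S.gen_superset T.ideal_K[OF Pi] Fob_K by blast
  have BJ: "y \<boxtimes>\<^bsub>S\<^esub> Fob F c \<in> J" "Fob F c \<boxtimes>\<^bsub>S\<^esub> y \<in> J" if y: "y \<in> B" and c: "c \<in> I" for y c
  proof -
    have yL: "y \<in> L" using y S.ideal_K[OF B] by blast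
    have "T.ideal {a \<in> K. Fob F a \<in> {x \<in> L. x \<boxtimes>\<^bsub>S\<^esub> y \<in> J}}"
      by (rule ideal_vimage[OF S.ideal_transporter[OF J yL]])
    moreover have "insert d P \<subseteq> {a \<in> K. Fob F a \<in> {x \<in> L. x \<boxtimes>\<^bsub>S\<^esub> y \<in> J}}"
    proof
      fix p assume p: "p \<in> insert d P"
      have pK: "p \<in> K" using p dK T.ideal_K[OF Pi] by blast
      have "Fob F p \<boxtimes>\<^bsub>S\<^esub> y \<in> J"
      proof (cases "p = d")
        case True
        then show ?thesis using y S.ideal_iso[OF J S.isomorphic_Sym[of y "Fob F d"]] yL Fob_K[OF dK]
          by (simp add: B_def)
      next
        case False
        then have "Fob F p \<in> J" using p FPJ by blast
        then show ?thesis by (rule S.ideal_Ten'[OF J _ yL])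
      qed
      then show "p \<in> {a \<in> K. Fob F a \<in> {x \<in> L. x \<boxtimes>\<^bsub>S\<^esub> y \<in> J}}" using pK Fob_K by simp
    qed
    ultimately have "I \<subseteq> {a \<in> K. Fob F a \<in> {x \<in> L. x \<boxtimes>\<^bsub>S\<^esub> y \<in> J}}" unfolding I_def by (rule T.gen_least)
    then show 1: "Fob F c \<boxtimes>\<^bsub>S\<^esub> y \<in> J" using c by blast
    have "Fob F c \<in> L" using c T.ideal_K[OF I] Fob_K by blast
    then show "y \<boxtimes>\<^bsub>S\<^esub> Fob F c \<in> J"
      using 1 S.ideal_iso[OF J S.isomorphic_Sym[of "Fob F c" y]] yL by simp
  qed
  have "insert (Fob F d) (insert y0 (Fob F ` P)) \<subseteq> Fob F ` I \<union> B"
    using PI y0 by (auto simp: B_def J_def)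
  \<comment> \<open>So some \<theta>, invertible modulo the ideal \<open>I\<close> of
    \<open>d\<close> and \<open>P\<close>, acts on \<open>Fob F a\<close> through an object of
    \<open>B\<close>.\<close>
  then have "Fob F a \<in> killed I B" using gen_killed[OF I B] S.gen_mono mem by blast
  then obtain \<theta> where \<theta>: "Dom T \<theta> = Unt T" "T.biso I \<theta>" and n: "S.null B (Far F \<theta> \<boxdot>\<^bsub>S\<^esub> Idt S (Fob F a))"
    unfolding killed_def by blast
  obtain \<kappa> h where tri: "(\<kappa>, \<theta>, h) \<in> Tri T" and u: "Dom T \<kappa> \<in> I" using T.biso_fiber[OF I \<theta>(2)] by blast
  note [simp] = T.biso_Arr[OF \<theta>(2)] \<theta>(1) a Fob_K
  have \<kappa>[simp]: "\<kappa> \<in> Arr T" "Cod T \<kappa> = Unt T" using T.Tri_simps[OF tri] by simp_all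
  let ?u = "Dom T \<kappa>" and ?\<alpha> = "Fob F a"
  have uK: "?u \<in> K" using T.ideal_K[OF I u] .
  \<comment> \<open>Both summands matter: \<open>?u\<close> makes \<sigma> split injective on the
    fiber of \<theta>, and \<open>d\<close> keeps \<open>t\<close> out of \<open>P\<close>, so that
    primality can cancel it.\<close>
  obtain t where t: "is_direct_sum T ?u d t" using T.ex_direct_sum[of ?u d] uK dK by auto
  have tK: "t \<in> K" using T.sum_K[OF t uK dK] .
  have tI: "t \<in> I" using T.ideal_sum[OF I t uK dK] u PI by blast
  have tP: "t \<notin> P" using T.ideal_sum[OF Pi t uK dK] d(2) by blast
  obtain \<kappa>0 \<theta>0 h0 \<sigma> where tri0: "(\<kappa>0, \<theta>0, h0) \<in> Tri T" and u0: "Dom T \<kappa>0 \<in> T.gen {t}"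
    and \<theta>0: "Dom T \<theta>0 = Unt T" "Cod T \<theta>0 \<in> K" "T.zero_arr (\<theta>0 \<boxdot>\<^bsub>T\<^esub> Idt T t)"
    and \<sigma>: "\<sigma> \<in> Arr T" "Dom T \<sigma> = Unt T" "Cod T \<sigma> \<in> T.gen {t}" "T.split_mono (\<sigma> \<boxdot>\<^bsub>T\<^esub> Idt T t)"
    using T.rigid_approximation[OF tK] by metis
  have tgen: "T.gen {t} \<subseteq> I" using T.gen_least[OF I] tI by blast
  have \<kappa>0[simp]: "\<kappa>0 \<in> Arr T" "Cod T \<kappa>0 = Unt T" "\<theta>0 \<in> Arr T" using T.Tri_simps[OF tri0] \<theta>0 by simp_all
  let ?w = "Dom T \<kappa>0" and ?s = "Cod T \<sigma>"
  have K0: "?w \<in> K" "?s \<in> K" using u0 \<sigma>(3) tgen T.ideal_K[OF I] by blast+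
  note [simp] = \<theta>0(1,2) \<sigma>(1,2) K0 tK
  have "S.null B (S.act (hat \<theta>) ?\<alpha>)"
    by (rule S.null_arr_iso[OF arr_iso_hat n]) simp_all
  then obtain h1 h2 where hh: "h1 \<in> Arr S" "h2 \<in> Arr S" "Dom S h1 = Dom S (S.act (hat \<theta>) ?\<alpha>)" "Cod S h1 = Dom S h2"
    "Cod S h2 = Cod S (S.act (hat \<theta>) ?\<alpha>)" "Dom S h2 \<in> B" "S.act (hat \<theta>) ?\<alpha> = h2 \<cdot>\<^bsub>S\<^esub> h1"
    by (rule S.nullE) blast
  let ?y = "Dom S h2"
  have yL: "?y \<in> L" using hh(6) S.ideal_K[OF B] by blast
  let ?c = "T.coact \<kappa>0 a" and ?sa = "T.act \<sigma> a"
  obtain j jh where triW: "(j, ?sa \<cdot>\<^bsub>T\<^esub> ?c, jh) \<in> Tri T" using T.ex_fiber[of "?sa \<cdot>\<^bsub>T\<^esub> ?c"] by auto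
  have j[simp]: "j \<in> Arr T" "Cod T j = ?w \<boxtimes>\<^bsub>T\<^esub> a" "Dom T jh = ?s \<boxtimes>\<^bsub>T\<^esub> a"
    using T.Tri_simps[OF triW] by simp_all
  have jK: "Dom T j \<in> K" using T.fiber_K[OF triW] T.Ten_K by simp
  let ?x = "?c \<cdot>\<^bsub>T\<^esub> j"
  have zx: "T.zero_arr (?sa \<cdot>\<^bsub>T\<^esub> ?x)" using T.Tri_Cmp_zero[OF triW] by simp
  obtain h' where trih: "(cohat \<kappa>, hat \<theta>, h') \<in> Tri S" using Tri_hat[OF tri \<theta>(1)] .
  have "S.null J (Far F ?x)"
  proof (rule null_if_null_on_parts[OF J trih, of ?\<alpha> h1 ?y h2 "hat \<sigma>"])
    show "Cod S h2 = Cod S (hat \<theta>) \<boxtimes>\<^bsub>S\<^esub> ?\<alpha>" "Dom S h1 = ?\<alpha>" using hh(3,5) by simp_all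
    show "Cod S (hat \<sigma>) \<boxtimes>\<^bsub>S\<^esub> ?y \<in> J" using BJ(2)[OF hh(6)] \<sigma>(3) tgen by auto
    show "S.split_mono (hat \<sigma> \<boxdot>\<^bsub>S\<^esub> Idt S (Dom S (cohat \<kappa>)))"
    proof -
      have "T.split_mono (\<sigma> \<boxdot>\<^bsub>T\<^esub> Idt T ?u)"
        using T.split_mono_retract[OF T.direct_sum_retracts(1)[OF t] _ _ \<sigma>(4)] by simp
      then obtain p where p: "p \<in> Arr T" "Dom T p = ?s \<boxtimes>\<^bsub>T\<^esub> ?u" "Cod T p = Unt T \<boxtimes>\<^bsub>T\<^esub> ?u"
        "p \<cdot>\<^bsub>T\<^esub> (\<sigma> \<boxdot>\<^bsub>T\<^esub> Idt T ?u) = Idt T (Unt T \<boxtimes>\<^bsub>T\<^esub> ?u)"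
        unfolding T.split_mono_def by auto
      have "Far F p \<cdot>\<^bsub>S\<^esub> Far F (\<sigma> \<boxdot>\<^bsub>T\<^esub> Idt T ?u) = Idt S (Fob F (Unt T \<boxtimes>\<^bsub>T\<^esub> ?u))"
        using p Far_Cmp'[of "\<sigma> \<boxdot>\<^bsub>T\<^esub> Idt T ?u" p] by simp
      then have "S.split_mono (Far F (\<sigma> \<boxdot>\<^bsub>T\<^esub> Idt T ?u))"
        unfolding S.split_mono_def using p by (intro conjI bexI[of _ "Far F p"]) simp_all
      moreover have "S.arr_iso (Far F (\<sigma> \<boxdot>\<^bsub>T\<^esub> Idt T ?u)) (Far F \<sigma> \<boxdot>\<^bsub>S\<^esub> Idt S (Fob F ?u))"
        using S.arr_iso_sym[OF arr_iso_Ften[of \<sigma> "Idt T ?u"]] by simp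
      moreover have "S.arr_iso (Far F \<sigma> \<boxdot>\<^bsub>S\<^esub> Idt S (Fob F ?u)) (hat \<sigma> \<boxdot>\<^bsub>S\<^esub> Idt S (Fob F ?u))"
        by (rule S.arr_iso_trans[OF arr_iso_hat S.arr_iso_act]) simp_all
      ultimately show ?thesis using S.split_mono_arr_iso S.arr_iso_trans by (metis \<kappa> cohat_simps(3))
    qed
    show "S.zero_arr (S.act (hat \<sigma>) ?\<alpha> \<cdot>\<^bsub>S\<^esub> Far F ?x)"
    proof -
      have "S.zero_arr (Far F (?sa \<cdot>\<^bsub>T\<^esub> ?x))" by (rule zero_arr_Far[OF zx]) simp
      also have "Far F (?sa \<cdot>\<^bsub>T\<^esub> ?x) = Ften F ?s a \<cdot>\<^bsub>S\<^esub> (S.act (hat \<sigma>) ?\<alpha> \<cdot>\<^bsub>S\<^esub> Far F ?x)"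
        by (subst Far_Cmp') (simp_all add: Far_act)
      finally show ?thesis by (rule S.zero_arr_iso_left[THEN iffD1, rotated 3]) simp_all
    qed
    show "S.null J (h1 \<cdot>\<^bsub>S\<^esub> Far F ?x)"
    proof -
      note [simp] = S.inv_simps[of "Ften F ?w a"]
      have h1d: "Dom S h1 = ?\<alpha>" using hh(3) by simp
      have na: "h1 \<cdot>\<^bsub>S\<^esub> S.coact (cohat \<kappa>0) ?\<alpha> = S.coact (cohat \<kappa>0) ?y \<cdot>\<^bsub>S\<^esub> (Idt S (Fob F ?w) \<boxdot>\<^bsub>S\<^esub> h1)"
        by (rule S.coact_natural) (use hh h1d in simp_all)
      have "Far F ?c = (Far F ?c \<cdot>\<^bsub>S\<^esub> Ften F ?w a) \<cdot>\<^bsub>S\<^esub> inv_arr S (Ften F ?w a)" by simp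
      then have c: "Far F ?c = S.coact (cohat \<kappa>0) ?\<alpha> \<cdot>\<^bsub>S\<^esub> inv_arr S (Ften F ?w a)"
        unfolding Far_coact[OF \<kappa>0(1,2) T.Obj_if_K[OF a]] .
      have "h1 \<cdot>\<^bsub>S\<^esub> Far F ?x = h1 \<cdot>\<^bsub>S\<^esub> (S.coact (cohat \<kappa>0) ?\<alpha> \<cdot>\<^bsub>S\<^esub> (inv_arr S (Ften F ?w a) \<cdot>\<^bsub>S\<^esub> Far F j))"
        using h1d hh(1) by (simp add: Far_Cmp' c)
      also have "\<dots> = S.coact (cohat \<kappa>0) ?y \<cdot>\<^bsub>S\<^esub> ((Idt S (Fob F ?w) \<boxdot>\<^bsub>S\<^esub> h1) \<cdot>\<^bsub>S\<^esub> (inv_arr S (Ften F ?w a) \<cdot>\<^bsub>S\<^esub> Far F j))"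
        using h1d hh(1,4) yL by (simp add: S.Cmp_eq_Cmp[OF na])
      finally have e: "h1 \<cdot>\<^bsub>S\<^esub> Far F ?x = S.coact (cohat \<kappa>0) ?y \<cdot>\<^bsub>S\<^esub>
          ((Idt S (Fob F ?w) \<boxdot>\<^bsub>S\<^esub> h1) \<cdot>\<^bsub>S\<^esub> (inv_arr S (Ften F ?w a) \<cdot>\<^bsub>S\<^esub> Far F j))" .
      have "Fob F ?w \<boxtimes>\<^bsub>S\<^esub> ?y \<in> J" using BJ(2)[OF hh(6)] u0 tgen by blast
      then show ?thesis unfolding e
        using h1d hh(1,4) yL by (intro S.null_factor) simp_all
    qed
  qed (use hh yL jK in simp_all)
  then have "T.null P ?x" unfolding J_def by (rule null_if_Far_null[OF Pi, rotated 2]) simp_all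
  then obtain s0 where s0: "T.biso P s0" "Dom T s0 = a" "T.zero_arr (s0 \<cdot>\<^bsub>T\<^esub> ?x)"
    using T.null_postE[OF Pi, of ?x] by auto
  note [simp] = T.biso_Arr[OF s0(1)] s0(2)
  have "T.zero_arr ((s0 \<cdot>\<^bsub>T\<^esub> ?c) \<cdot>\<^bsub>T\<^esub> j)" using s0(3) by simp
  then obtain q0 where q0[simp]: "q0 \<in> Arr T" "Dom T q0 = ?s \<boxtimes>\<^bsub>T\<^esub> a" "Cod T q0 = Cod T s0"
    and q0e: "q0 \<cdot>\<^bsub>T\<^esub> (?sa \<cdot>\<^bsub>T\<^esub> ?c) = s0 \<cdot>\<^bsub>T\<^esub> ?c"
    by (rule T.Tri_factor[OF triW, rotated 2]) simp_all
  let ?q = "q0 \<cdot>\<^bsub>T\<^esub> ?sa"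
  \<comment> \<open>The defect \<open>k\<close> vanishes on \<kappa>0, so it factors through the
    action of \<theta>0, which annihilates \<open>t\<close>. Hence \<open>s0\<close> and
    \<open>?q\<close> agree after tensoring with \<open>t\<close>.\<close>
  obtain k where k[simp]: "k \<in> Arr T" "Dom T k = a" "Cod T k = Cod T s0" and s0k: "s0 = ?q \<boxplus>\<^bsub>T\<^esub> k"
    using T.ex_difference[of s0 ?q] by auto
  have "T.zero_arr (k \<cdot>\<^bsub>T\<^esub> ?c)"
    by (rule T.zero_arr_difference'[OF _ s0k]) (simp_all add: q0e)
  moreover obtain \<delta>0 where tri0a: "(?c, T.act \<theta>0 a, \<delta>0) \<in> Tri T"
    by (rule T.Tri_act[OF tri0 \<theta>0(1) T.Obj_if_K[OF a]])
  ultimately obtain l where l[simp]: "l \<in> Arr T" "Dom T l = Cod T \<theta>0 \<boxtimes>\<^bsub>T\<^esub> a" "Cod T l = Cod T s0"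
    and lk: "l \<cdot>\<^bsub>T\<^esub> T.act \<theta>0 a = k"
    using T.Tri_factor[OF tri0a, of k] T.Tri_simps(5)[OF tri0a] by auto
  have "T.zero_arr ((\<theta>0 \<boxdot>\<^bsub>T\<^esub> Idt T a) \<boxdot>\<^bsub>T\<^esub> Idt T t)"
    using T.zero_arr_Tenm_left[OF \<theta>0(3), of "Idt T a"] T.zero_arr_arr_iso[OF T.arr_iso_Ten_mid[of \<theta>0 t a]] by simp
  moreover have "T.arr_iso (T.act \<theta>0 a \<boxdot>\<^bsub>T\<^esub> Idt T t) ((\<theta>0 \<boxdot>\<^bsub>T\<^esub> Idt T a) \<boxdot>\<^bsub>T\<^esub> Idt T t)"
    by (rule T.arr_iso_Tenm[OF T.arr_iso_act T.arr_iso_refl]) simp_all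
  ultimately have "T.zero_arr (T.act \<theta>0 a \<boxdot>\<^bsub>T\<^esub> Idt T t)" using T.zero_arr_arr_iso by blast
  then have "T.zero_arr ((l \<boxdot>\<^bsub>T\<^esub> Idt T t) \<cdot>\<^bsub>T\<^esub> (T.act \<theta>0 a \<boxdot>\<^bsub>T\<^esub> Idt T t))" by (rule T.zero_arr_Cmp_left) simp_all
  then have kt: "T.zero_arr (k \<boxdot>\<^bsub>T\<^esub> Idt T t)" by (simp add: T.Tenm_Tenm lk)
  have "s0 \<boxdot>\<^bsub>T\<^esub> Idt T t = (?q \<boxdot>\<^bsub>T\<^esub> Idt T t) \<boxplus>\<^bsub>T\<^esub> (k \<boxdot>\<^bsub>T\<^esub> Idt T t)"
    unfolding s0k by (rule T.Tenm_Add) auto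
  then have "s0 \<boxdot>\<^bsub>T\<^esub> Idt T t = ?q \<boxdot>\<^bsub>T\<^esub> Idt T t"
    by (rule T.eq_if_zero_difference[OF _ kt]) simp_all
  then have bqt: "T.biso P (?q \<boxdot>\<^bsub>T\<^esub> Idt T t)" using T.biso_Ten(1)[OF Pi s0(1) tK] by simp
  obtain g gh where triq: "(?q, g, gh) \<in> Tri T" using T.ex_cone[of ?q] by auto
  obtain g' where triqt: "(?q \<boxdot>\<^bsub>T\<^esub> Idt T t, g \<boxdot>\<^bsub>T\<^esub> Idt T t, g') \<in> Tri T" and g'd: "Dom T g' = Dom T gh \<boxtimes>\<^bsub>T\<^esub> t"
    by (rule T.Tri_Ten_right[OF triq T.Obj_if_K[OF tK]])
  have "Dom T gh \<boxtimes>\<^bsub>T\<^esub> t \<in> P" using T.biso_cone[OF Pi bqt triqt] g'd by simp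
  moreover have "Dom T gh \<in> K" using T.cone_K[OF triq] T.Tri_simps(4)[OF triq, symmetric] by simp
  ultimately have "Dom T gh \<in> P" using T.prime_Ten_iff[OF P _ tK] tP by blast
  then have "T.biso R ?q" unfolding T.biso_def using triq PR by auto
  moreover have "T.null R ?q"
    by (rule T.null_factor) (use T.ideal_Ten'[OF Ri _ a] \<sigma>(3) tgen IR in auto)
  ultimately have "Dom T ?q \<in> R" by (rule T.null_biso_Dom[OF Ri])
  then show ?thesis by simp
qed

end

section \<open>The spectral quotient property\<close>

context rigid_tt_functor
begin

abbreviation spec :: "'p set \<Rightarrow> 'o set" where
  "spec \<equiv> Spc_map F K"

lemma mem_spec: "a \<in> K \<Longrightarrow> a \<in> spec Q \<longleftrightarrow> Fob F a \<in> Q"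
  by (simp add: Spc_map_def)

lemma subset_spec: "A \<subseteq> K \<Longrightarrow> A \<subseteq> spec Q \<longleftrightarrow> Fob F ` A \<subseteq> Q"
  by (auto simp: Spc_map_def)

lemma prime_spec:
  assumes Q: "S.prime Q"
  shows "T.prime (spec Q)"
  unfolding T.prime_iff
proof (intro conjI ballI impI)
  note Qi = S.prime_is_ideal[OF Q]
  show "T.ideal (spec Q)" using ideal_vimage[OF Qi] by (simp add: Spc_map_def)
  have "Unt S \<notin> Q" using Q S.prime_iff by blast
  then show "Unt T \<notin> spec Q"
    using S.ideal_iso[OF Qi S.isomorphicI[of "Funt F"]] by (simp add: mem_spec T.Unt_K)
  fix a b assume a: "a \<in> K" and b: "b \<in> K" and "a \<boxtimes>\<^bsub>T\<^esub> b \<in> spec Q"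
  then have "Fob F a \<boxtimes>\<^bsub>S\<^esub> Fob F b \<in> Q"
    using S.ideal_iso[OF Qi isomorphic_Ften[of a b]] by (simp add: Spc_map_def)
  then show "a \<in> spec Q \<or> b \<in> spec Q"
    using S.prime_Ten_iff[OF Q] a b Fob_K by (simp add: mem_spec)
qed

text \<open>Up to isomorphism the image of the complement of a prime is already
  multiplicative.\<close>

lemma tens_image:
  assumes P: "T.prime P" and m: "m \<in> S.tens (Fob F ` (K - P))"
  shows "\<exists>s\<in>K - P. S.isomorphic (Fob F s) m"
  using m
proof (induction rule: S.tens.induct)
  case tens_Unt
  have "Unt T \<in> K - P" using P T.prime_iff T.Unt_K by blast
  then show ?case using S.isomorphic_sym[OF S.isomorphicI[of "Funt F"]] by auto
next
  case (tens_base b)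
  then obtain s where s: "s \<in> K - P" "b = Fob F s" by blast
  then have "S.isomorphic (Fob F s) b" by (simp add: S.isomorphic_refl)
  then show ?case using s(1) by blast
next
  case (tens_Ten x y)
  then obtain s s' where s: "s \<in> K - P" "S.isomorphic (Fob F s) x" "s' \<in> K - P" "S.isomorphic (Fob F s') y"
    by blast
  have "s \<boxtimes>\<^bsub>T\<^esub> s' \<in> K - P" using s T.Ten_K T.prime_Ten_iff[OF P] by blast
  moreover have "S.isomorphic (Fob F (s \<boxtimes>\<^bsub>T\<^esub> s')) (x \<boxtimes>\<^bsub>S\<^esub> y)"
    using S.isomorphic_trans[OF S.isomorphic_sym[OF isomorphic_Ften] S.isomorphic_Ten[OF s(2,4)]] s(1,3) by simp
  ultimately show ?case by blast
qed

text \<open>Since the functor detects membership in \<open>P\<close>, the ideal generated by the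
  image of \<open>P\<close> is disjoint from the multiplicative set generated by the image of the
  complement; a prime separating the two restricts to \<open>P\<close>.\<close>

lemma ex_prime_over:
  assumes P: "T.prime P"
  obtains Q where "S.prime Q" "spec Q = P"
proof -
  note Pi = T.prime_is_ideal[OF P]
  have PK: "P \<subseteq> K" using T.ideal_K[OF Pi] by blast
  have "S.gen (Fob F ` P) \<inter> S.tens (Fob F ` (K - P)) = {}"
  proof (rule ccontr)
    assume "\<not> ?thesis"
    then obtain m where m: "m \<in> S.gen (Fob F ` P)" "m \<in> S.tens (Fob F ` (K - P))" by blast
    obtain s where s: "s \<in> K - P" "S.isomorphic (Fob F s) m" using tens_image[OF P m(2)] by blast
    have "Fob F s \<in> S.gen (Fob F ` P)" using S.ideal_iso[OF S.ideal_gen s(2)] m(1) by blast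
    then show False using mem_if_Fob_mem_gen[OF Pi] s(1) by blast
  qed
  moreover have "Fob F ` (K - P) \<subseteq> L" using Fob_K by blast
  ultimately obtain Q where Q: "S.prime Q" "S.gen (Fob F ` P) \<subseteq> Q" "Q \<inter> Fob F ` (K - P) = {}"
    by (metis S.ex_prime_avoiding S.ideal_gen)
  have "Fob F ` P \<subseteq> S.gen (Fob F ` P)" by (rule S.gen_superset) (use PK Fob_K in blast)
  then have "spec Q = P" using Q(2,3) PK unfolding Spc_map_def by blast
  then show ?thesis using that Q(1) by blast
qed

lemma Fob_K_image: "A \<subseteq> K \<Longrightarrow> Fob F ` A \<subseteq> L"
  using Fob_K by blast

lemma prime_K: "T.prime P \<Longrightarrow> P \<subseteq> K"
  using T.ideal_K[OF T.prime_is_ideal] by blast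

lemma finite_subset_insert_image:
  assumes "finite X" "X \<subseteq> Z \<union> f ` A"
  obtains A0 where "finite A0" "A0 \<subseteq> A" "X \<subseteq> Z \<union> f ` A0"
proof -
  have "finite (X - Z)" "X - Z \<subseteq> f ` A" using assms by auto
  then obtain A0 where "A0 \<subseteq> A" "finite A0" "X - Z = f ` A0" by (meson finite_subset_image)
  then show ?thesis using that by blast
qed

section \<open>Subsets of the target whose preimage is a basic open set\<close>

context
  fixes A C b
  assumes A: "A \<subseteq> K" and CA: "C \<subseteq> T.prs A" and b: "b \<in> L"
    and C_iff: "\<And>Q. S.prime Q \<Longrightarrow> A \<subseteq> spec Q \<Longrightarrow> spec Q \<in> C \<longleftrightarrow> b \<in> Q"
begin

text \<open>Zorn's lemma applied to complements. What has to be checked is that the intersection of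
  a chain of primes outside \<open>C\<close> is again a prime outside \<open>C\<close>.\<close>

lemma ex_minimal_outside:
  assumes P: "P \<in> T.prs A" and R: "T.prime R" "P \<subseteq> R" "R \<notin> C"
  obtains R0 where "T.prime R0" "P \<subseteq> R0" "R0 \<notin> C"
    "\<And>R'. T.prime R' \<Longrightarrow> P \<subseteq> R' \<Longrightarrow> R' \<notin> C \<Longrightarrow> R' \<subseteq> R0 \<Longrightarrow> R' = R0"
proof -
  let ?D = "{R. T.prime R \<and> P \<subseteq> R \<and> R \<notin> C}"
  let ?E = "(\<lambda>R. K - R) ` ?D"
  have AP: "A \<subseteq> P" using P T.prs_D(2) by blast
  have "\<exists>M\<in>?E. \<forall>X\<in>?E. M \<subseteq> X \<longrightarrow> X = M"
  proof (rule subset_Zorn_nonempty)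
    show "?E \<noteq> {}" using R by blast
    fix \<C> assume ne: "\<C> \<noteq> {}" and ch: "subset.chain ?E \<C>"
    have CE: "\<C> \<subseteq> ?E" using ch by (simp add: subset.chain_def)
    let ?I = "K - \<Union>\<C>"
    have PI: "P \<subseteq> ?I"
    proof
      fix p assume p: "p \<in> P"
      have "p \<notin> E" if "E \<in> \<C>" for E using CE that p by blast
      then show "p \<in> ?I" using p P prime_K T.prs_D(1) by blast
    qed
    \<comment> \<open>The intersection \<open>?I\<close> is realized as the restriction of a prime
      that avoids \<open>b\<close>. By constructible compactness an obstruction would be finite,
      hence visible at one member of the chain, where surjectivity supplies a prime without
      it.\<close>
    have "\<exists>Q. S.prime Q \<and> Fob F ` ?I \<subseteq> Q \<and> Q \<inter> ({b} \<union> Fob F ` \<Union>\<C>) = {}"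
    proof (rule ccontr)
      assume n: "\<not> ?thesis"
      have UK: "\<Union>\<C> \<subseteq> K" using CE by blast
      obtain A0 B0 where A0: "finite A0" "A0 \<subseteq> Fob F ` ?I" and B0: "finite B0" "B0 \<subseteq> {b} \<union> Fob F ` \<Union>\<C>"
        and meet: "\<And>Q. S.prime Q \<Longrightarrow> A0 \<subseteq> Q \<Longrightarrow> Q \<inter> B0 \<noteq> {}"
      proof (rule S.prime_patch_compact)
        show "Fob F ` ?I \<subseteq> L" by (rule Fob_K_image) blast
        show "{b} \<union> Fob F ` \<Union>\<C> \<subseteq> L" using b Fob_K_image[OF UK] by simp
        show "Q \<inter> ({b} \<union> Fob F ` \<Union>\<C>) \<noteq> {}" if "S.prime Q" "Fob F ` ?I \<subseteq> Q" for Q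
          using n that by meson
      qed auto
      obtain E0 where E0: "finite E0" "E0 \<subseteq> \<Union>\<C>" "B0 \<subseteq> {b} \<union> Fob F ` E0"
        using finite_subset_insert_image[OF B0] by blast
      obtain E where E: "E \<in> \<C>" "E0 \<subseteq> E"
        using finite_subset_Union_chain[OF E0(1,2) ne ch] by blast
      obtain R' where R': "T.prime R'" "P \<subseteq> R'" "R' \<notin> C" "E = K - R'" using CE E(1) by blast
      obtain Q where Q: "S.prime Q" "spec Q = R'" using ex_prime_over[OF R'(1)] .
      have "?I \<subseteq> spec Q" using E(1) R'(4) Q(2) by blast
      then have "A0 \<subseteq> Q" using subset_spec[of ?I Q] A0(2) by blast
      then obtain c where c: "c \<in> Q" "c \<in> B0" using meet Q(1) by blast
      have "b \<notin> Q" using C_iff[OF Q(1)] Q(2) R'(2,3) AP by blast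
      then obtain e where e: "e \<in> E0" "c = Fob F e" using c E0(3) by blast
      then have "e \<in> K" "e \<notin> R'" using E(2) R'(4) by blast+
      then show False using mem_spec[of e Q] c(1) e(2) Q(2) by simp
    qed
    then obtain Q where Q: "S.prime Q" "Fob F ` ?I \<subseteq> Q" "Q \<inter> ({b} \<union> Fob F ` \<Union>\<C>) = {}" by blast
    have UK: "\<Union>\<C> \<subseteq> K" using CE by blast
    have sQ: "spec Q = ?I" using Q(2,3) UK unfolding Spc_map_def by blast
    have "spec Q \<notin> C" using C_iff[OF Q(1)] Q(3) sQ AP PI by blast
    then have "spec Q \<in> ?D" using prime_spec[OF Q(1)] sQ PI by simp
    moreover have "\<Union>\<C> = K - spec Q" using sQ UK by blast
    ultimately show "\<Union>\<C> \<in> ?E" by (rule rev_image_eqI)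
  qed
  then obtain M where M: "M \<in> ?E" and max: "\<forall>X\<in>?E. M \<subseteq> X \<longrightarrow> X = M" by (rule bexE)
  from M obtain R0 where R0: "M = K - R0" "R0 \<in> ?D" by (rule imageE)
  show ?thesis
  proof (rule that)
    show "T.prime R0" "P \<subseteq> R0" "R0 \<notin> C" using R0(2) by simp_all
    fix R' assume R': "T.prime R'" "P \<subseteq> R'" "R' \<notin> C" "R' \<subseteq> R0"
    have "K - R' \<in> ?E" using R' by (intro imageI) simp
    note e = bspec[OF max this, THEN mp]
    have "M \<subseteq> K - R'" unfolding R0(1) using R'(4) by (rule Diff_mono[OF subset_refl])
    from e[OF this] have "K - R' = K - R0" unfolding R0(1) .
    moreover have "R' \<subseteq> K" "R0 \<subseteq> K" using prime_K R'(1) R0(2) by simp_all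
    ultimately show "R' = R0" by (metis double_diff subset_refl)
  qed
qed

lemma generalization_closed:
  assumes P: "P \<in> C" and R: "T.prime R" "P \<subseteq> R"
  shows "R \<in> C"
proof (rule ccontr)
  assume "R \<notin> C"
  moreover have PA: "P \<in> T.prs A" using P CA by blast
  ultimately obtain R0 where R0: "T.prime R0" "P \<subseteq> R0" "R0 \<notin> C"
    and min: "\<And>R'. T.prime R' \<Longrightarrow> P \<subseteq> R' \<Longrightarrow> R' \<notin> C \<Longrightarrow> R' \<subseteq> R0 \<Longrightarrow> R' = R0"
    using ex_minimal_outside[OF PA R] by metis
  have Pp: "T.prime P" and AP: "A \<subseteq> P" using PA by (auto simp: T.prs_def)
  note PK = prime_K[OF Pp] and RK = prime_K[OF R0(1)]
  have KR: "K - R0 \<subseteq> K" by blast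
  \<comment> \<open>Since \<open>R0\<close> is outside \<open>C\<close>, no prime over it contains
    \<open>b\<close>. Compactness spreads this to nearby primes: \<open>d\<close> is assembled from
    finitely many objects of \<open>R0\<close>, \<open>a1\<close> from finitely many objects outside
    it.\<close>
  obtain A0 B0 where A0: "finite A0" "A0 \<subseteq> {b} \<union> Fob F ` R0" and B0: "finite B0" "B0 \<subseteq> {} \<union> Fob F ` (K - R0)"
    and meet1: "\<And>Q. S.prime Q \<Longrightarrow> A0 \<subseteq> Q \<Longrightarrow> Q \<inter> B0 \<noteq> {}"
  proof (rule S.prime_patch_compact)
    show "{b} \<union> Fob F ` R0 \<subseteq> L" using b Fob_K_image[OF RK] by simp
    show "{} \<union> Fob F ` (K - R0) \<subseteq> L" using Fob_K_image[OF KR] by simp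
    show "Q \<inter> ({} \<union> Fob F ` (K - R0)) \<noteq> {}" if Q: "S.prime Q" "{b} \<union> Fob F ` R0 \<subseteq> Q" for Q
    proof
      assume "Q \<inter> ({} \<union> Fob F ` (K - R0)) = {}"
      then have "spec Q = R0" using Q(2) RK unfolding Spc_map_def by blast
      then show False using C_iff[OF Q(1)] Q(2) R0(2,3) AP by blast
    qed
  qed auto
  obtain D0 where D0: "finite D0" "D0 \<subseteq> R0" "A0 \<subseteq> {b} \<union> Fob F ` D0"
    using finite_subset_insert_image[OF A0] by blast
  obtain S0 where S0: "finite S0" "S0 \<subseteq> K - R0" "B0 \<subseteq> {} \<union> Fob F ` S0"
    using finite_subset_insert_image[OF B0] by blast
  have D0K: "D0 \<subseteq> K" and S0K: "S0 \<subseteq> K" using D0(2) S0(2) RK by blast+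
  obtain d where d: "d \<in> K" "\<And>P. T.ideal P \<Longrightarrow> d \<in> P \<longleftrightarrow> D0 \<subseteq> P"
    using T.ex_sum_of_set[OF D0(1) D0K] by metis
  obtain a1 where a1: "a1 \<in> K" "\<And>P. T.prime P \<Longrightarrow> a1 \<in> P \<longleftrightarrow> P \<inter> S0 \<noteq> {}"
    using T.ex_product_of_set[OF S0(1) S0K] by metis
  have dR: "d \<in> R0" using d(2)[OF T.prime_is_ideal[OF R0(1)]] D0(2) by blast
  have a1R: "a1 \<notin> R0" using a1(2)[OF R0(1)] S0(2) by blast
  have c1: "a1 \<in> spec Q" if Q: "S.prime Q" "d \<in> spec Q" "b \<in> Q" for Q
  proof -
    note Qp = prime_spec[OF Q(1)]
    have "D0 \<subseteq> spec Q" using d(2)[OF T.prime_is_ideal[OF Qp]] Q(2) by blast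
    then have "A0 \<subseteq> Q" using subset_spec[OF D0K] D0(3) Q(3) by blast
    then obtain c where "c \<in> Q" "c \<in> B0" using meet1 Q(1) by blast
    then obtain s where s: "s \<in> S0" "Fob F s \<in> Q" using S0(3) by blast
    then have "s \<in> spec Q" using mem_spec[of s Q] S0K by blast
    then show ?thesis using a1(2)[OF Qp] s(1) by blast
  qed
  \<comment> \<open>Minimality of \<open>R0\<close> enters here: a prime over the image of
    \<open>P\<close> that avoids \<open>b\<close> and restricts into \<open>R0\<close> lies over a
    prime outside \<open>C\<close>, hence over \<open>R0\<close> itself, and so contains the image
    of \<open>d\<close>.\<close>
  obtain A1 B1 where A1: "finite A1" "A1 \<subseteq> Fob F ` P" and B1: "finite B1" "B1 \<subseteq> {b, Fob F d} \<union> Fob F ` (K - R0)"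
    and meet2: "\<And>Q. S.prime Q \<Longrightarrow> A1 \<subseteq> Q \<Longrightarrow> Q \<inter> B1 \<noteq> {}"
  proof (rule S.prime_patch_compact)
    show "Fob F ` P \<subseteq> L" using Fob_K_image[OF PK] .
    show "{b, Fob F d} \<union> Fob F ` (K - R0) \<subseteq> L" using b Fob_K[OF d(1)] Fob_K_image[OF KR] by simp
    show "Q \<inter> ({b, Fob F d} \<union> Fob F ` (K - R0)) \<noteq> {}" if Q: "S.prime Q" "Fob F ` P \<subseteq> Q" for Q
    proof
      assume e: "Q \<inter> ({b, Fob F d} \<union> Fob F ` (K - R0)) = {}"
      then have sR: "spec Q \<subseteq> R0" unfolding Spc_map_def by blast
      have Ps: "P \<subseteq> spec Q" using subset_spec[OF PK] Q(2) by blast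
      have "spec Q \<notin> C" using C_iff[OF Q(1)] e Ps AP by blast
      then have "spec Q = R0" using min[OF prime_spec[OF Q(1)] Ps _ sR] by blast
      then have "Fob F d \<in> Q" using dR mem_spec[OF d(1)] by blast
      then show False using e by blast
    qed
  qed auto
  obtain S1 where S1: "finite S1" "S1 \<subseteq> K - R0" "B1 \<subseteq> {b, Fob F d} \<union> Fob F ` S1"
    using finite_subset_insert_image[OF B1] by blast
  have S1K: "S1 \<subseteq> K" using S1(2) by blast
  obtain a2 where a2: "a2 \<in> K" "\<And>P. T.prime P \<Longrightarrow> a2 \<in> P \<longleftrightarrow> P \<inter> S1 \<noteq> {}"
    using T.ex_product_of_set[OF S1(1) S1K] by metis
  have a2R: "a2 \<notin> R0" using a2(2)[OF R0(1)] S1(2) by blast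
  have c2: "b \<in> Q \<or> d \<in> spec Q \<or> a2 \<in> spec Q" if Q: "S.prime Q" "Fob F ` P \<subseteq> Q" for Q
  proof -
    have "A1 \<subseteq> Q" using A1(2) Q(2) by blast
    then obtain c where "c \<in> Q" "c \<in> B1" using meet2 Q(1) by blast
    then consider "b \<in> Q" | "Fob F d \<in> Q" | s where "s \<in> S1" "Fob F s \<in> Q" using S1(3) by blast
    then show ?thesis
    proof cases
      case 3
      then have "s \<in> spec Q" using mem_spec[of s Q] S1K by blast
      then show ?thesis using a2(2)[OF prime_spec[OF Q(1)]] 3(1) by blast
    qed (use mem_spec[OF d(1)] in blast)+
  qed
  define a where "a = a1 \<boxtimes>\<^bsub>T\<^esub> a2"
  have a: "a \<in> K" unfolding a_def by (rule T.Ten_K[OF a1(1) a2(1)])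
  have a_iff: "a \<in> P \<longleftrightarrow> a1 \<in> P \<or> a2 \<in> P" if "T.prime P" for P
    unfolding a_def by (rule T.prime_Ten_iff[OF that a1(1) a2(1)])
  have aR: "a \<notin> R0" using a_iff[OF R0(1)] a1R a2R by blast
  \<comment> \<open>As \<open>P\<close> is in \<open>C\<close>, a prime over it contains
    \<open>b\<close>; with \<open>d\<close> in \<open>P\<close> the relation \<open>c1\<close> would
    put \<open>a1\<close> into \<open>P\<close>, hence into \<open>R0\<close>.\<close>
  have dP: "d \<notin> P"
  proof
    assume dP: "d \<in> P"
    obtain Q where Q: "S.prime Q" "spec Q = P" using ex_prime_over[OF Pp] .
    have "b \<in> Q" using C_iff[OF Q(1)] Q(2) P AP by blast
    then have "a1 \<in> P" using c1[OF Q(1)] Q(2) dP by blast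
    then show False using R0(2) a1R by blast
  qed
  have FL: "Fob F a \<in> L" "Fob F d \<in> L" using Fob_K a d(1) by blast+
  \<comment> \<open>Over the primes that contain \<open>A\<close>, the support of \<open>y0\<close>
    is the part of the support of \<open>Fob F a\<close> lying outside the preimage of
    \<open>C\<close>. Over \<open>P\<close> it is disjoint from the support of
    \<open>Fob F d\<close>, and together the two cover that of \<open>Fob F a\<close>.\<close>
  define y0 where "y0 = Fob F a \<boxtimes>\<^bsub>S\<^esub> b"
  have y0L: "y0 \<in> L" unfolding y0_def by (rule S.Ten_K[OF FL(1) b])
  have y0_iff: "y0 \<in> Q \<longleftrightarrow> Fob F a \<in> Q \<or> b \<in> Q" if "S.prime Q" for Q
    unfolding y0_def by (rule S.prime_Ten_iff[OF that FL(1) b])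
  have FP: "Fob F ` P \<subseteq> L" by (rule Fob_K_image[OF PK])
  have y0d: "y0 \<boxtimes>\<^bsub>S\<^esub> Fob F d \<in> S.gen (Fob F ` P)"
  proof (rule S.ideal_if_in_primes[OF S.ideal_gen S.Ten_K[OF y0L FL(2)]])
    fix Q assume Q: "S.prime Q" "S.gen (Fob F ` P) \<subseteq> Q"
    have "Fob F ` P \<subseteq> Q" using S.gen_superset[OF FP] Q(2) by (rule subset_trans)
    then have "b \<in> Q \<or> d \<in> spec Q \<or> a \<in> spec Q" using c2[OF Q(1)] a_iff[OF prime_spec[OF Q(1)]] by blast
    then have "b \<in> Q \<or> Fob F d \<in> Q \<or> Fob F a \<in> Q" using mem_spec[OF d(1)] mem_spec[OF a] by blast
    then show "y0 \<boxtimes>\<^bsub>S\<^esub> Fob F d \<in> Q"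
      using S.prime_Ten_iff[OF Q(1) y0L FL(2)] y0_iff[OF Q(1)] by blast
  qed
  let ?G = "insert (Fob F d) (insert y0 (Fob F ` P))"
  have GL: "?G \<subseteq> L" using FP FL(2) y0L by simp
  have "Fob F a \<in> S.gen ?G"
  proof (rule S.ideal_if_in_primes[OF S.ideal_gen FL(1)])
    fix Q assume Q: "S.prime Q" "S.gen ?G \<subseteq> Q"
    have "?G \<subseteq> Q" using S.gen_superset[OF GL] Q(2) by (rule subset_trans)
    then have *: "d \<in> spec Q" "Fob F a \<in> Q \<or> b \<in> Q" using mem_spec[OF d(1)] y0_iff[OF Q(1)] by blast+
    have "b \<in> Q \<Longrightarrow> a \<in> spec Q" using c1[OF Q(1) *(1)] a_iff[OF prime_spec[OF Q(1)]] by blast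
    then show "Fob F a \<in> Q" using *(2) mem_spec[OF a] by blast
  qed
  then have "a \<in> R0"
    using mem_if_decomposes[OF Pp R0(1,2) dR dP a y0L y0d] by blast
  then show False using aR by blast
qed

text \<open>Every prime containing the image of \<open>P\<close> contains \<open>b\<close>, because
  it restricts to a prime above \<open>P\<close>. Compactness makes finitely many objects of
  \<open>P\<close> responsible for this, their direct sum defines a basic neighbourhood of
  \<open>P\<close>, and surjectivity shows that it lies in \<open>C\<close>.\<close>

lemma openin_if_basic_preimage: "openin (T.Spc_over A) C"
  unfolding T.openin_Spc_over
proof (intro conjI ballI CA)
  fix P assume P: "P \<in> C"
  then have Pp: "T.prime P" and AP: "A \<subseteq> P" using CA by (auto simp: T.prs_def)
  note PK = prime_K[OF Pp]
  obtain A0 B0 where A0: "finite A0" "A0 \<subseteq> {} \<union> Fob F ` P" and B0: "finite B0" "B0 \<subseteq> {b}"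
    and meet: "\<And>Q. S.prime Q \<Longrightarrow> A0 \<subseteq> Q \<Longrightarrow> Q \<inter> B0 \<noteq> {}"
  proof (rule S.prime_patch_compact)
    show "{} \<union> Fob F ` P \<subseteq> L" using Fob_K_image[OF PK] by simp
    show "{b} \<subseteq> L" using b by simp
    show "Q \<inter> {b} \<noteq> {}" if Q: "S.prime Q" "{} \<union> Fob F ` P \<subseteq> Q" for Q
    proof -
      have Ps: "P \<subseteq> spec Q" using subset_spec[OF PK] Q(2) by blast
      have "spec Q \<in> C" by (rule generalization_closed[OF P prime_spec[OF Q(1)] Ps])
      then show ?thesis using C_iff[OF Q(1)] Ps AP by blast
    qed
  qed auto
  obtain D0 where D0: "finite D0" "D0 \<subseteq> P" "A0 \<subseteq> {} \<union> Fob F ` D0"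
    using finite_subset_insert_image[OF A0] by blast
  have D0K: "D0 \<subseteq> K" using D0(2) PK by blast
  obtain d where d: "d \<in> K" "\<And>P. T.ideal P \<Longrightarrow> d \<in> P \<longleftrightarrow> D0 \<subseteq> P"
    using T.ex_sum_of_set[OF D0(1) D0K] by metis
  have "T.prs (insert d A) \<subseteq> C"
  proof
    fix P' assume "P' \<in> T.prs (insert d A)"
    then have P': "T.prime P'" "d \<in> P'" "A \<subseteq> P'" by (auto simp: T.prs_def)
    obtain Q where Q: "S.prime Q" "spec Q = P'" using ex_prime_over[OF P'(1)] .
    have "D0 \<subseteq> spec Q" using d(2)[OF T.prime_is_ideal[OF P'(1)]] P'(2) Q(2) by blast
    then have "A0 \<subseteq> Q" using subset_spec[OF D0K] D0(3) by blast
    then have "b \<in> Q" using meet[OF Q(1)] B0(2) by blast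
    then show "P' \<in> C" using C_iff[OF Q(1)] Q(2) P'(3) by blast
  qed
  moreover have "d \<in> P" using d(2)[OF T.prime_is_ideal[OF Pp]] D0(2) by blast
  ultimately show "\<exists>a\<in>P. T.prs (insert a A) \<subseteq> C" by blast
qed

end

section \<open>The induced map over the primes containing a given set of objects\<close>

lemma preimage_prs:
  assumes "B \<subseteq> K"
  shows "{Q \<in> S.prs (Fob F ` A). spec Q \<in> T.prs B} = S.prs (Fob F ` (A \<union> B))"
  using prime_spec subset_spec[OF assms] by (auto simp: T.prs_def S.prs_def image_Un)

lemma spec_mem_prs: "A \<subseteq> K \<Longrightarrow> Q \<in> S.prs (Fob F ` A) \<Longrightarrow> spec Q \<in> T.prs A"
  using prime_spec subset_spec[of A Q] by (simp add: T.prs_def S.prs_def)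

lemma spec_image:
  assumes A: "A \<subseteq> K"
  shows "spec ` S.prs (Fob F ` A) = T.prs A"
proof
  show "spec ` S.prs (Fob F ` A) \<subseteq> T.prs A" using spec_mem_prs[OF A] by blast
  show "T.prs A \<subseteq> spec ` S.prs (Fob F ` A)"
  proof
    fix P assume P: "P \<in> T.prs A"
    obtain Q where Q: "S.prime Q" "spec Q = P" using ex_prime_over[OF T.prs_D(1)[OF P]] .
    have "A \<subseteq> spec Q" using P Q(2) by (simp add: T.prs_def)
    then have "Q \<in> S.prs (Fob F ` A)" using subset_spec[OF A] Q(1) by (simp add: S.prs_def)
    then show "P \<in> spec ` S.prs (Fob F ` A)" using Q(2) by blast
  qed
qed

lemma spectral_map_Spc_over:
  assumes A: "A \<subseteq> K"
  shows "spectral_map (S.Spc_over (Fob F ` A)) (T.Spc_over A) spec"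
proof -
  note FA = Fob_K_image[OF A]
  have pre: "{Q \<in> S.prs (Fob F ` A). spec Q \<in> T.prs (insert a A)} = S.prs (insert (Fob F a) (Fob F ` A))"
    if "a \<in> K" for a
    using preimage_prs[of "insert a A" A] A that by (simp add: insert_absorb)
  have "openin (S.Spc_over (Fob F ` A)) {Q \<in> S.prs (Fob F ` A). spec Q \<in> V}" if V: "openin (T.Spc_over A) V" for V
    unfolding S.openin_Spc_over
  proof (intro conjI ballI)
    fix Q assume Q: "Q \<in> {Q \<in> S.prs (Fob F ` A). spec Q \<in> V}"
    then have "spec Q \<in> V" by blast
    from T.openin_Spc_overE[OF V this]
    obtain a where a: "a \<in> K" "a \<in> spec Q" "T.prs (insert a A) \<subseteq> V" .
    have "S.prs (insert (Fob F a) (Fob F ` A)) \<subseteq> {Q \<in> S.prs (Fob F ` A). spec Q \<in> V}"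
      unfolding pre[OF a(1), symmetric] using a(3) by blast
    moreover have "Fob F a \<in> Q" using mem_spec[OF a(1)] a(2) by blast
    ultimately show "\<exists>c\<in>Q. S.prs (insert c (Fob F ` A)) \<subseteq> {Q \<in> S.prs (Fob F ` A). spec Q \<in> V}" by blast
  qed blast
  then have cont: "continuous_map (S.Spc_over (Fob F ` A)) (T.Spc_over A) spec"
    unfolding continuous_map_def S.topspace_Spc_over T.topspace_Spc_over
    using spec_mem_prs[OF A] by blast
  show ?thesis
    unfolding spectral_map_def
  proof (intro conjI allI impI cont S.spectral_space_Spc_over[OF FA] T.spectral_space_Spc_over[OF A])
    fix V assume "qc_open (T.Spc_over A) V"
    then obtain a where a: "a \<in> K" "V = T.prs (insert a A)" using T.qc_open_Spc_over[OF A] by blast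
    show "qc_open (S.Spc_over (Fob F ` A)) (preimage_in (S.Spc_over (Fob F ` A)) spec V)"
      unfolding preimage_in_def S.topspace_Spc_over a(2) pre[OF a(1)]
      using S.qc_open_Spc_over[OF FA] Fob_K[OF a(1)] by blast
  qed
qed

text \<open>Openness of \<open>C\<close> is the substance; quasi-compactness follows since
  \<open>C\<close> is, by surjectivity, the continuous image of its quasi-compact preimage.\<close>

lemma spectral_quotient_map_Spc_over:
  assumes A: "A \<subseteq> K"
  shows "spectral_quotient_map (S.Spc_over (Fob F ` A)) (T.Spc_over A) spec"
  unfolding spectral_quotient_map_def
proof (intro conjI allI impI)
  note FA = Fob_K_image[OF A]
  show sm: "spectral_map (S.Spc_over (Fob F ` A)) (T.Spc_over A) spec"
    by (rule spectral_map_Spc_over[OF A])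
  show "spec ` topspace (S.Spc_over (Fob F ` A)) = topspace (T.Spc_over A)"
    unfolding S.topspace_Spc_over T.topspace_Spc_over by (rule spec_image[OF A])
  fix C assume "C \<subseteq> topspace (T.Spc_over A)"
  then have CA: "C \<subseteq> T.prs A" unfolding T.topspace_Spc_over .
  let ?W = "preimage_in (S.Spc_over (Fob F ` A)) spec C"
  assume qc: "qc_open (S.Spc_over (Fob F ` A)) ?W"
  have W: "?W = {Q \<in> S.prs (Fob F ` A). spec Q \<in> C}"
    unfolding preimage_in_def S.topspace_Spc_over ..
  obtain b where b: "b \<in> L" "?W = S.prs (insert b (Fob F ` A))" using qc S.qc_open_Spc_over[OF FA] by blast
  have C_iff: "spec Q \<in> C \<longleftrightarrow> b \<in> Q" if "S.prime Q" "A \<subseteq> spec Q" for Q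
  proof -
    have "Q \<in> S.prs (Fob F ` A)" using that subset_spec[OF A] by (simp add: S.prs_def)
    then have "spec Q \<in> C \<longleftrightarrow> Q \<in> S.prs (insert b (Fob F ` A))" unfolding b(2)[symmetric] W by blast
    also have "\<dots> \<longleftrightarrow> b \<in> Q" using \<open>Q \<in> S.prs (Fob F ` A)\<close> by (simp add: S.prs_def)
    finally show ?thesis .
  qed
  have "openin (T.Spc_over A) C" by (rule openin_if_basic_preimage[OF A CA b(1) C_iff])
  moreover have "spec ` ?W = C"
    unfolding W
  proof (intro subset_antisym subsetI)
    fix P assume P: "P \<in> C"
    then have "P \<in> spec ` S.prs (Fob F ` A)" unfolding spec_image[OF A] using CA by (rule rev_subsetD)
    then obtain Q where "P = spec Q" "Q \<in> S.prs (Fob F ` A)" by (rule imageE)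
    then show "P \<in> spec ` {Q \<in> S.prs (Fob F ` A). spec Q \<in> C}" using P by (intro image_eqI[of _ _ Q]) simp_all
  qed (elim imageE, simp)
  then have "compactin (T.Spc_over A) C"
    using image_compactin[of "S.Spc_over (Fob F ` A)" ?W "T.Spc_over A" spec] qc sm
    unfolding qc_open_def spectral_map_def by metis
  ultimately show "qc_open (T.Spc_over A) C" by (simp add: qc_open_def)
qed

lemma strong_spectral_quotient_map_spec:
  "strong_spectral_quotient_map (Spc S L) (Spc T K) spec"
  unfolding strong_spectral_quotient_map_def
proof (intro conjI allI impI)
  show "spectral_map (Spc S L) (Spc T K) spec"
    using spectral_map_Spc_over[of "{}"] by (simp add: T.Spc_over_empty S.Spc_over_empty)
  fix V assume "V \<subseteq> topspace (Spc T K)" "thomason (Spc T K) (topspace (Spc T K) - V)"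
  then obtain A where A: "A \<subseteq> K" and V: "V = T.prs A"
    using T.thomason_complement[of V] unfolding T.topspace_Spc by metis
  have "preimage_in (Spc S L) spec V = S.prs (Fob F ` A)"
    unfolding preimage_in_def V S.topspace_Spc using preimage_prs[OF A, of "{}"] by simp
  then show "spectral_quotient_map (subtopology (Spc S L) (preimage_in (Spc S L) spec V)) (subtopology (Spc T K) V) spec"
    using spectral_quotient_map_Spc_over[OF A] V by simp
qed

end

theorem theorem4p1:
  fixes U :: "'u set"
    and T :: "('o, 'm) ttcat" and S :: "('p, 'n) ttcat"
    and F :: "('o, 'm, 'p, 'n) ttfun"
  assumes "rigidly_compactly_generated U T"
    and "rigidly_compactly_generated U S"
    and "geometric_functor U T S F"
    and "faithful T F"
  shows "strong_spectral_quotient_map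
           (Spc S (compacts U S)) (Spc T (compacts U T)) (Spc_map F (compacts U T))"
proof -
  interpret G: geometric_functor U T S F by fact
  have "G.T.zero_arr f" if f: "f \<in> Arr T" and z: "G.S.zero_arr (Far F f)" for f
  proof -
    have "Far F f = Far F (Zer T (Dom T f) (Cod T f))"
      using G.S.zero_arrD[OF z] f by (simp add: G.Far_Zer)
    moreover have "inj_on (Far F) (Hom T (Dom T f) (Cod T f))"
      using \<open>faithful T F\<close> f unfolding faithful_def by simp
    ultimately have "f = Zer T (Dom T f) (Cod T f)"
      using f by (auto dest: inj_onD)
    then show ?thesis by (simp add: G.T.zero_arr_def)
  qed
  then interpret rigid_tt_functor T "compacts U T" S "compacts U S" F
    by (intro rigid_tt_functor.intro G.T.rigid_compacts G.S.rigid_compacts G.tt_functor_axioms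
        rigid_tt_functor_axioms.intro G.Fob_compact)
  show ?thesis by (rule strong_spectral_quotient_map_spec)
qed

end
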